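(* Let $N\ge2$, $0<\alpha<1$, let $\Omega\subset\mathbb{R}^N$ be a bounded domain with connected boundary $\Gamma$ of class $C^{2,\alpha}$ whose mean curvature satisfies $H>0$ on $\Gamma$. Let $u$ be the solution of $\Delta u=N$ in $\Omega$, $u=0$ on $\Gamma$, and $M=\max_{\overline\Omega}|\nabla u|$. There exist constants $k_N,\alpha_N>0$ depending only on $N$ and a point $z\in\Omega$ such that, with $\rho_i=\min_{x\in\Gamma}|x-z|$, $\rho_e=\max_{x\in\Gamma}|x-z|$ and $\mu_0(\Omega)$ computed with respect to $x_0=z$: (i) if $N=2$ or $3$, $\rho_e-\rho_i\le C\|u_\nu-1/H\|_{L^1(\Gamma)}^{1/2}$ with $C=k_N\,c\,\frac{d_\Omega^\gamma}{|\Omega|^{1/N}}\frac{1+\mu_0(\Omega)}{\mu_0(\Omega)}\sqrt{\frac{M}{r_i}}$; (ii) if $N\ge4$, $\rho_e-\rho_i\le C\|u_\nu-1/H\|_{L^1(\Gamma)}^{1/(N+2)}$ whenever $\|u_\nu-1/H\|_{L^1(\Gamma)}<\varepsilon$, with $C=k_N\frac{M^{(N+1)/(N+2)}}{\mu_0(\Omega)^{2/(N+2)}|\Omega|^{1/N}r_i^{1/(N+2)}}$ and $\varepsilon=\alpha_N\,\mu_0(\Omega)^2M\,r_i^{N+3}$.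
   Context: $u_\nu$ is the outward normal derivative of $u$. $|\Omega|$ volume, $d_\Omega$ diameter. $H=\frac1{N-1}\mathrm{div}\,\nu$ with $\nu$ the outward normal (sphere of radius $\rho$ has $H=1/\rho$). $r_i>0$ is a radius of the uniform interior sphere condition (for every $p\in\Gamma$ a ball of radius $r_i$ in $\Omega$ has closure meeting $\Gamma$ only at $p$). For $x_0\in\Omega$, $\mu_0(\Omega)=\inf\{\int_\Omega|\nabla v|^2:\ v\in W^{1,2}(\Omega),\ \Delta v=0,\ \int_\Omega v^2=1,\ v(x_0)=0\}>0$. For $N=2$, $\gamma\in(0,1)$ is fixed; for $N=3$, $\gamma=1/2$; $c$ satisfies $|v(x)-v(y)|\le c\|v\|_{W^{2,2}(\Omega)}|x-y|^\gamma$ for all $v\in W^{2,2}(\Omega)$, $x,y\in\overline\Omega$. *)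

theory Defs
  imports "HOL-Analysis.Analysis"
begin

definition pd :: "(real^'n \<Rightarrow> real) \<Rightarrow> 'n \<Rightarrow> real^'n \<Rightarrow> real" where
  "pd f i x = deriv (\<lambda>t. f (x + t *\<^sub>R axis i 1)) 0"

definition pd_exists :: "(real^'n \<Rightarrow> real) \<Rightarrow> 'n \<Rightarrow> real^'n \<Rightarrow> bool" where
  "pd_exists f i x \<longleftrightarrow> (\<lambda>t. f (x + t *\<^sub>R axis i 1)) field_differentiable (at 0)"

definition C2_on :: "(real^'n) set \<Rightarrow> (real^'n \<Rightarrow> real) \<Rightarrow> bool" where
  "C2_on U f \<longleftrightarrow> (\<forall>x\<in>U. \<forall>i j. pd_exists f i x \<and> pd_exists (pd f i) j x)
     \<and> (\<forall>i. continuous_on U (pd f i)) \<and> (\<forall>i j. continuous_on U (pd (pd f i) j))"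

definition grad :: "(real^'n \<Rightarrow> real) \<Rightarrow> real^'n \<Rightarrow> real^'n" where
  "grad f x = (\<chi> i. pd f i x)"

definition lap :: "(real^'n \<Rightarrow> real) \<Rightarrow> real^'n \<Rightarrow> real" where
  "lap f x = (\<Sum>i\<in>UNIV. pd (pd f i) i x)"

definition C2alpha_boundary :: "real \<Rightarrow> (real^'n) set \<Rightarrow> bool" where
  "C2alpha_boundary \<alpha> \<Omega> \<longleftrightarrow> (\<forall>p\<in>frontier \<Omega>. \<exists>r>0. \<exists>\<psi> L.
      C2_on (ball p r) \<psi> \<and> (\<forall>x\<in>ball p r. grad \<psi> x \<noteq> 0)
      \<and> (\<forall>i j. \<forall>x\<in>ball p r. \<forall>y\<in>ball p r.
            \<bar>pd (pd \<psi> i) j x - pd (pd \<psi> i) j y\<bar> \<le> L * dist x y powr \<alpha>)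
      \<and> \<Omega> \<inter> ball p r = {x\<in>ball p r. \<psi> x < 0})"

text \<open>Signed distance to the boundary (negative inside); outward normal is its gradient on the
  boundary and H = (1/(N-1)) div nu is (1/(N-1)) times its Laplacian on the boundary.\<close>
definition sdist :: "(real^'n) set \<Rightarrow> real^'n \<Rightarrow> real" where
  "sdist \<Omega> x = (if x \<in> \<Omega> then - setdist {x} (frontier \<Omega>) else setdist {x} (frontier \<Omega>))"

definition outer_normal :: "(real^'n) set \<Rightarrow> real^'n \<Rightarrow> real^'n" where
  "outer_normal \<Omega> p = grad (sdist \<Omega>) p"

definition mean_curv :: "(real^'n) set \<Rightarrow> real^'n \<Rightarrow> real" where
  "mean_curv \<Omega> p = lap (sdist \<Omega>) p / (real CARD('n) - 1)"

definition hausdorff :: "real \<Rightarrow> (real^'n) set \<Rightarrow> ennreal" where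
  "hausdorff s A = (SUP \<delta>\<in>{0<..}. INF C\<in>{C :: nat \<Rightarrow> (real^'n) set.
       A \<subseteq> (\<Union>n. C n) \<and> (\<forall>n. bounded (C n) \<and> diameter (C n) \<le> \<delta>)}.
       (\<Sum>n. ennreal (pi powr (s/2) / Gamma (s/2 + 1) * (diameter (C n) / 2) powr s)))"

text \<open>L^1 norm on the boundary w.r.t. surface measure H^{N-1} (layer-cake formula).\<close>
definition L1_bdry :: "(real^'n) set \<Rightarrow> (real^'n \<Rightarrow> real) \<Rightarrow> real" where
  "L1_bdry \<Omega> g = enn2real (\<integral>\<^sup>+ t\<in>{0<..}.
      hausdorff (real CARD('n) - 1) {x\<in>frontier \<Omega>. \<bar>g x\<bar> > t} \<partial>lborel)"

definition interior_sphere :: "(real^'n) set \<Rightarrow> real \<Rightarrow> bool" where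
  "interior_sphere \<Omega> r \<longleftrightarrow> r > 0 \<and>
     (\<forall>p\<in>frontier \<Omega>. \<exists>c. ball c r \<subseteq> \<Omega> \<and> cball c r \<inter> frontier \<Omega> = {p})"

text \<open>mu_0: harmonic functions in W^{1,2} are exactly C^2 harmonic functions with finite
  Dirichlet integral; infinite values do not affect the infimum.\<close>
definition mu0 :: "(real^'n) set \<Rightarrow> real^'n \<Rightarrow> real" where
  "mu0 \<Omega> x0 = enn2real (INF v\<in>{v. C2_on \<Omega> v \<and> (\<forall>x\<in>\<Omega>. lap v x = 0)
        \<and> (\<integral>\<^sup>+ x\<in>\<Omega>. ennreal ((v x)\<^sup>2) \<partial>lebesgue) = 1 \<and> v x0 = 0}.
        (\<integral>\<^sup>+ x\<in>\<Omega>. ennreal ((norm (grad v x))\<^sup>2) \<partial>lebesgue))"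

definition W22_norm :: "(real^'n) set \<Rightarrow> (real^'n \<Rightarrow> real) \<Rightarrow> real" where
  "W22_norm \<Omega> v = sqrt (enn2real (\<integral>\<^sup>+ x\<in>\<Omega>. ennreal ((v x)\<^sup>2 + (\<Sum>i\<in>UNIV. (pd v i x)\<^sup>2)
        + (\<Sum>i\<in>UNIV. \<Sum>j\<in>UNIV. (pd (pd v i) j x)\<^sup>2)) \<partial>lebesgue))"

text \<open>c is a constant for the embedding W^{2,2} into C^{0,gamma}; stated on functions C^2 up to the
  boundary (dense in W^{2,2}; the inequality passes to limits).\<close>
definition sobolev_holder_const :: "(real^'n) set \<Rightarrow> real \<Rightarrow> real \<Rightarrow> bool" where
  "sobolev_holder_const \<Omega> \<gamma> c \<longleftrightarrow> (\<forall>v U. open U \<and> closure \<Omega> \<subseteq> U \<and> C2_on U v \<longrightarrow>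
     (\<forall>x\<in>closure \<Omega>. \<forall>y\<in>closure \<Omega>. \<bar>v x - v y\<bar> \<le> c * W22_norm \<Omega> v * dist x y powr \<gamma>))"

definition rho_i :: "(real^'n) set \<Rightarrow> real^'n \<Rightarrow> real" where
  "rho_i \<Omega> z = (INF x\<in>frontier \<Omega>. dist x z)"

definition rho_e :: "(real^'n) set \<Rightarrow> real^'n \<Rightarrow> real" where
  "rho_e \<Omega> z = (SUP x\<in>frontier \<Omega>. dist x z)"

end

theory Submission
  imports Defs
begin

text \<open>Let \<open>z\<close> be a minimum point of \<open>u\<close>. The function \<open>h = \<bar>x - z\<bar>\<^sup>2 / 2 - u\<close> is harmonic and equals \<open>\<bar>x - z\<bar>\<^sup>2 / 2\<close> on
  \<open>\<Gamma>\<close>, so its oscillation on \<open>\<Gamma>\<close> controls \<open>\<rho>\<^sub>e - \<rho>\<^sub>i\<close>. The Hessian of \<open>h\<close> satisfies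
  \<open>\<bar>D\<^sup>2h\<bar>\<^sup>2 = \<bar>D\<^sup>2u\<bar>\<^sup>2 - N\<close>; testing this identity with cut-offs that depend only on the signed distance, and using
  a Rellich-type identity in the boundary strip, bounds its integral by strip averages of a function
  that on \<open>\<Gamma>\<close> is at most \<open>(N - 1) * max 0 (1 / H - u\<^sub>\<nu>)\<close>. A covering argument compares strip averages with the
  Hausdorff measure, whence \<open>\<integral>\<bar>D\<^sup>2h\<bar>\<^sup>2 \<le> k\<^sub>N * D\<close> with \<open>D\<close> the boundary deficit. Because \<open>h - h z\<close> and all \<open>\<partial>\<^sub>i h\<close> are
  harmonic and vanish at \<open>z\<close>, two applications of the definition of \<open>\<mu>\<^sub>0\<close> bound the \<open>L\<^sup>2\<close> norms of
  \<open>grad h\<close> and \<open>h - h z\<close>. For \<open>N \<le> 3\<close> the Sobolev inequality turns this into a bound for the oscillation of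
  \<open>h\<close>. For \<open>N \<ge> 4\<close> one evaluates \<open>h\<close> at distance \<open>\<sigma>\<close> from the boundary by the mean value property and
  chooses \<open>\<sigma>\<close> optimally.\<close>

subsection \<open>Partial derivatives and gradients\<close>

text \<open>No boundary integral is ever formed. \<open>u\<close> is only C^2 in the open set, with
  \<open>G\<close> extending its gradient continuously, so every integration by parts is done
  against compactly supported functions and the boundary enters through limits of strips. The strip
  volume is compared with the Hausdorff measure from one side only; the dimensional factor lost
  there goes into \<open>defect_const\<close>, and thus into \<open>k\<close>. The point
  \<open>z\<close> is taken critical because the derivatives of \<open>h\<close> must vanish there
  before the inequality that defines \<open>mu0\<close> applies to them. Positivity of
  \<open>mu0\<close> has to be proved: for \<open>\<mu> = 0\<close> the quotient
  \<open>(1 + \<mu>) / \<mu>\<close> would be 0 and the bound in dimensions two and three would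
  assert far too much. The Sobolev constant is tested only on functions that are C^2 across the
  boundary, whereas \<open>h\<close> is known to be C^2 only inside; this forces the deformations
  into the domain. The comparison \<open>r \<le> 4 * M\<close> inserts the powers of
  \<open>M\<close> and \<open>r\<close> that the estimates themselves do not produce.\<close>

definition C1_on :: "(real^'n) set \<Rightarrow> (real^'n \<Rightarrow> real) \<Rightarrow> bool" where
  "C1_on U f \<longleftrightarrow> (\<forall>x\<in>U. \<forall>i. pd_exists f i x) \<and> (\<forall>i. continuous_on U (pd f i))"

lemma pd_exists_DERIV:
  "pd_exists f i x \<Longrightarrow> DERIV (\<lambda>t. f (x + t *\<^sub>R axis i 1)) 0 :> pd f i x"
  unfolding pd_exists_def pd_def using DERIV_deriv_iff_field_differentiable by blast

lemma pd_eqI: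
  assumes "DERIV (\<lambda>t. f (x + t *\<^sub>R axis i 1)) 0 :> D"
  shows "pd_exists f i x" "pd f i x = D"
  using assms unfolding pd_exists_def pd_def
  by (auto simp: field_differentiable_def DERIV_imp_deriv)

text \<open>Splitting off one order of differentiability lets facts on second derivatives follow by
  applying first-order facts twice.\<close>

lemma C2_on_iff: "C2_on U f \<longleftrightarrow> C1_on U f \<and> (\<forall>i. C1_on U (pd f i))"
  unfolding C2_on_def C1_on_def by blast

lemma GDERIV_has_derivative: "GDERIV f x :> D \<longleftrightarrow> (f has_derivative (\<lambda>h. D \<bullet> h)) (at x)"
  by (simp add: gderiv_def inner_commute)

lemma GDERIV_pd:
  fixes x :: "real^'n"
  assumes "GDERIV f x :> D"
  shows "pd_exists f i x" "pd f i x = D $ i" "grad f x = D"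
proof -
  have *: "pd_exists f i x \<and> pd f i x = D $ i" for i
  proof -
    have "((\<lambda>t. f (x + t *\<^sub>R axis i 1)) has_derivative (\<lambda>t. D \<bullet> (t *\<^sub>R axis i 1))) (at 0)"
    proof -
      have 1: "((\<lambda>t. x + t *\<^sub>R axis i 1) has_derivative (\<lambda>t. t *\<^sub>R axis i 1)) (at 0)"
        by (auto intro!: derivative_eq_intros)
      have 2: "(f has_derivative (\<bullet>) D) (at (x + 0 *\<^sub>R axis i 1))"
        using assms unfolding GDERIV_has_derivative by simp
      show ?thesis using has_derivative_compose[OF 1 2] by simp
    qed
    then have "DERIV (\<lambda>t. f (x + t *\<^sub>R axis i 1)) 0 :> D $ i"
      unfolding has_field_derivative_def by (simp add: inner_axis mult_commute_abs)
    from pd_eqI[OF this] show ?thesis by auto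
  qed
  show "pd_exists f i x" "pd f i x = D $ i" using * by auto
  show "grad f x = D" unfolding grad_def using * by (simp add: vec_eq_iff)
qed

lemma pd_eq_grad: "pd f i x = grad f x $ i"
  by (simp add: grad_def)

lemma pd_segment:
  fixes f :: "real^'n \<Rightarrow> real"
  assumes "pd_exists f j (y + (t * c) *\<^sub>R axis j 1)"
  shows "DERIV (\<lambda>t. f (y + (t * c) *\<^sub>R axis j 1)) t :> c * pd f j (y + (t * c) *\<^sub>R axis j 1)"
proof -
  have "DERIV (\<lambda>s. f ((y + (t * c) *\<^sub>R axis j 1) + s *\<^sub>R axis j 1)) ((t - t) * c) :> pd f j (y + (t * c) *\<^sub>R axis j 1)"
    using pd_exists_DERIV[OF assms] by simp
  moreover have "DERIV (\<lambda>\<tau>. (\<tau> - t) * c) t :> c"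
    by (auto intro!: derivative_eq_intros)
  ultimately have "DERIV (\<lambda>\<tau>. f ((y + (t * c) *\<^sub>R axis j 1) + ((\<tau> - t) * c) *\<^sub>R axis j 1)) t :> pd f j (y + (t * c) *\<^sub>R axis j 1) * c"
    by (rule DERIV_chain2)
  moreover have "(y + (t * c) *\<^sub>R axis j 1) + ((\<tau> - t) * c) *\<^sub>R axis j 1 = y + (\<tau> * c) *\<^sub>R axis j 1" for \<tau>
    by (simp add: left_diff_distrib scaleR_left_diff_distrib)
  ultimately show ?thesis by (simp only: mult.commute[of c])
qed

lemma norm_partial_sum_axis_le:
  fixes v :: "real^'n"
  shows "norm (\<Sum>i\<in>S. v $ i *\<^sub>R (axis i 1 :: real^'n)) \<le> norm v"
proof (rule norm_le_componentwise_cart)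
  fix k
  have "(\<Sum>i\<in>S. v $ i *\<^sub>R (axis i 1 :: real^'n)) $ k = (\<Sum>i\<in>S. v $ i * (axis i 1 :: real^'n) $ k)"
    by simp
  also have "\<dots> = (\<Sum>i\<in>S. if i = k then v $ i else 0)"
    by (rule sum.cong) (auto simp: axis_def)
  also have "\<dots> = (if k \<in> S then v $ k else 0)"
    using sum.delta'[of S k "\<lambda>i. v $ i"] by (simp add: eq_commute)
  finally have eq: "(\<Sum>i\<in>S. v $ i *\<^sub>R (axis i 1 :: real^'n)) $ k = (if k \<in> S then v $ k else 0)" .
  show "norm ((\<Sum>i\<in>S. v $ i *\<^sub>R (axis i 1 :: real^'n)) $ k) \<le> norm (v $ k)" unfolding eq by simp
qed

lemma sum_axis_eq:
  fixes v :: "real^'n"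
  shows "(\<Sum>i\<in>UNIV. v $ i *\<^sub>R axis i 1) = v"
  using basis_expansion[of v] by (simp add: scalar_mult_eq_scaleR)

text \<open>The increment \<open>v\<close> is built up one coordinate at a time, and the mean value
  theorem is applied on each coordinate segment. Continuity of the partial derivatives at
  \<open>x\<close> bounds the error of each segment by \<open>e' * norm v\<close>; hence the
  induction over sets of coordinates.\<close>

lemma C1_on_GDERIV:
  fixes f :: "real^'n \<Rightarrow> real"
  assumes "C1_on U f" "open U" "x \<in> U"
  shows "GDERIV f x :> grad f x"
proof -
  have ex: "\<And>y i. y \<in> U \<Longrightarrow> pd_exists f i y" and cont: "\<And>i. continuous_on U (pd f i)"
    using assms(1) unfolding C1_on_def by auto
  obtain r where r: "r > 0" "ball x r \<subseteq> U" using assms openE by blast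
  have *: "\<exists>d>0. \<forall>v. norm v < d \<longrightarrow> \<bar>f (x + v) - f x - grad f x \<bullet> v\<bar> \<le> e * norm v" if e: "e > 0" for e
  proof -
    define e' where "e' = e / real CARD('n)"
    have e': "e' > 0" using e by (simp add: e'_def)
    have "\<forall>i. \<exists>d>0. \<forall>y\<in>ball x d. \<bar>pd f i y - pd f i x\<bar> < e'"
    proof
      fix i
      have "isCont (pd f i) x" using cont assms continuous_on_eq_continuous_at by blast
      then show "\<exists>d>0. \<forall>y\<in>ball x d. \<bar>pd f i y - pd f i x\<bar> < e'"
        using e' unfolding continuous_at_eps_delta by (metis dist_commute dist_real_def mem_ball)
    qed
    then obtain d where d: "\<And>i. d i > 0" "\<And>i y. y \<in> ball x (d i) \<Longrightarrow> \<bar>pd f i y - pd f i x\<bar> < e'"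
      by metis
    define \<delta> where "\<delta> = min r (Min (range d))"
    have \<delta>: "\<delta> > 0" "\<delta> \<le> r" "\<And>i. \<delta> \<le> d i"
      using r d(1) by (auto simp: \<delta>_def min.coboundedI2)
    show ?thesis
    proof (intro exI conjI allI impI)
      show "\<delta> > 0" by fact
      fix v :: "real^'n" assume v: "norm v < \<delta>"
      define vs where "vs S = (\<Sum>i\<in>S. v $ i *\<^sub>R (axis i 1 :: real^'n))" for S
      have "\<bar>f (x + vs S) - f x - (\<Sum>i\<in>S. v $ i * pd f i x)\<bar> \<le> card S * (e' * norm v)" if "finite S" for S
        using that
      proof (induction S)
        case empty then show ?case by (simp add: vs_def)
      next
        case (insert j S)
        let ?p = "\<lambda>t. x + vs S + (t * v $ j) *\<^sub>R axis j 1"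
        have inb: "norm (vs S + (t * v $ j) *\<^sub>R axis j 1) \<le> norm v" if "0 \<le> t" "t \<le> 1" for t
        proof -
          \<comment> \<open>\<open>v'\<close> is \<open>v\<close> with its \<open>j\<close>-th
            coordinate scaled by \<open>t\<close>; as a partial sum of \<open>v'\<close> the
            intermediate increment is no longer than \<open>v\<close>, so the whole path stays in
            the ball.\<close>
          define v' where "v' = (\<chi> i. if i = j then t * v $ j else v $ i)"
          have "vs S + (t * v $ j) *\<^sub>R axis j 1 = (\<Sum>i\<in>insert j S. v' $ i *\<^sub>R axis i 1)"
            using insert.hyps by (auto simp: vs_def v'_def add.commute intro!: sum.cong)
          also have "norm \<dots> \<le> norm v'" by (rule norm_partial_sum_axis_le)
          also have "norm v' \<le> norm v"
            using that by (intro norm_le_componentwise_cart) (auto simp: v'_def abs_mult mult_left_le_one_le)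
          finally show ?thesis .
        qed
        have inb': "?p t \<in> ball x \<delta>" if "0 \<le> t" "t \<le> 1" for t
        proof -
          have "dist x (x + w) = norm w" for w :: "real^'n" by (simp add: dist_norm)
          then have "dist x (?p t) = norm (vs S + (t * v $ j) *\<^sub>R axis j 1)"
            by (simp only: add.assoc)
          then show ?thesis using inb[OF that] v by simp
        qed
        let ?g = "\<lambda>t. f (?p t) - t * (v $ j * pd f j x)"
        have D: "DERIV ?g t :> v $ j * pd f j (?p t) - v $ j * pd f j x" if "0 \<le> t" "t \<le> 1" for t
        proof -
          have "?p t \<in> U" using inb'[OF that] r \<delta> by auto
          note pd_segment[OF ex[OF this]]
          then show ?thesis by (auto intro!: derivative_eq_intros)
        qed
        obtain \<xi> where \<xi>: "0 < \<xi>" "\<xi> < 1" "?g 1 - ?g 0 = (1 - 0) * (v $ j * pd f j (?p \<xi>) - v $ j * pd f j x)"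
          using MVT2[OF zero_less_one, of ?g "\<lambda>t. v $ j * pd f j (?p t) - v $ j * pd f j x", OF D] by blast
        have "\<bar>pd f j (?p \<xi>) - pd f j x\<bar> < e'"
          using inb'[of \<xi>] \<xi> \<delta>(3)[of j] by (intro d) auto
        then have "\<bar>v $ j\<bar> * \<bar>pd f j (?p \<xi>) - pd f j x\<bar> \<le> norm v * e'"
          using component_le_norm_cart[of v j] e' by (intro mult_mono) auto
        then have "\<bar>?g 1 - ?g 0\<bar> \<le> norm v * e'"
          unfolding \<xi>(3) by (simp only: abs_mult right_diff_distrib[symmetric]) simp
        moreover have "vs (insert j S) = vs S + v $ j *\<^sub>R axis j 1"
          using insert.hyps by (simp add: vs_def add.commute)
        ultimately show ?case using insert
          by (simp add: algebra_simps)
      qed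
      from this[of UNIV] have "\<bar>f (x + v) - f x - (\<Sum>i\<in>UNIV. v $ i * pd f i x)\<bar> \<le> CARD('n) * (e' * norm v)"
        by (simp add: vs_def sum_axis_eq)
      then show "\<bar>f (x + v) - f x - grad f x \<bullet> v\<bar> \<le> e * norm v"
        by (simp add: e'_def grad_def inner_vec_def mult.commute)
    qed
  qed
  show ?thesis
    unfolding GDERIV_has_derivative has_derivative_at_alt
  proof (intro conjI allI impI)
    fix e :: real assume "e > 0"
    from *[OF this] obtain d where d: "d > 0" "\<And>v. norm v < d \<Longrightarrow> \<bar>f (x + v) - f x - grad f x \<bullet> v\<bar> \<le> e * norm v"
      by blast
    show "\<exists>d>0. \<forall>y. norm (y - x) < d \<longrightarrow> norm (f y - f x - grad f x \<bullet> (y - x)) \<le> e * norm (y - x)"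
      using d(1) d(2)[of "_ - x"] by auto
  qed (rule bounded_linear_inner_right)
qed

lemma C1_on_iff:
  fixes f :: "real^'n \<Rightarrow> real"
  assumes "open U"
  shows "C1_on U f \<longleftrightarrow> (\<forall>x\<in>U. GDERIV f x :> grad f x) \<and> continuous_on U (grad f)"
proof
  assume *: "C1_on U f"
  then show "(\<forall>x\<in>U. GDERIV f x :> grad f x) \<and> continuous_on U (grad f)"
    using C1_on_GDERIV[OF * assms] unfolding C1_on_def grad_def
    by (auto intro!: continuous_on_vec_lambda)
next
  assume *: "(\<forall>x\<in>U. GDERIV f x :> grad f x) \<and> continuous_on U (grad f)"
  have "continuous_on U (\<lambda>x. grad f x $ i)" for i
    using * by (intro continuous_intros) auto
  then have "continuous_on U (pd f i)" for i
    by (simp add: pd_eq_grad[abs_def])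
  then show "C1_on U f" unfolding C1_on_def using * GDERIV_pd(1) by blast
qed

lemma C1_onI:
  fixes f :: "real^'n \<Rightarrow> real"
  assumes "open U" "\<And>x. x \<in> U \<Longrightarrow> GDERIV f x :> D x" "continuous_on U D"
  shows "C1_on U f"
proof -
  have "grad f x = D x" if "x \<in> U" for x using GDERIV_pd(3) assms(2) that by blast
  then show ?thesis
    unfolding C1_on_iff[OF assms(1)] using assms
    by (metis (no_types, lifting) continuous_on_cong)
qed

lemma C1_on_continuous:
  assumes "C1_on U f" "open U" shows "continuous_on U f"
  using C1_on_GDERIV[OF assms] assms(2)
  by (meson GDERIV_has_derivative continuous_at_imp_continuous_on has_derivative_continuous)

lemma C1_on_pd_continuous: "C1_on U f \<Longrightarrow> continuous_on U (pd f i)"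
  by (simp add: C1_on_def)

lemma C1_on_grad_continuous: "C1_on U f \<Longrightarrow> continuous_on U (grad f)"
  unfolding C1_on_def grad_def by (auto intro!: continuous_on_vec_lambda)

lemma C1_on_subset: "C1_on U f \<Longrightarrow> V \<subseteq> U \<Longrightarrow> C1_on V f"
  unfolding C1_on_def by (meson continuous_on_subset subset_iff)

lemma C2_on_subset: "C2_on U f \<Longrightarrow> V \<subseteq> U \<Longrightarrow> C2_on V f"
  unfolding C2_on_iff by (meson C1_on_subset)

lemma pd_exists_cong:
  fixes f :: "real^'n \<Rightarrow> real"
  assumes "open U" "x \<in> U" "\<And>y. y \<in> U \<Longrightarrow> f y = g y" "pd_exists f i x"
  shows "pd_exists g i x \<and> pd g i x = pd f i x"
proof -
  let ?p = "\<lambda>t. x + t *\<^sub>R (axis i 1 :: real^'n)"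
  have "open (?p -` U)" by (rule continuous_open_vimage) (use assms in \<open>auto intro!: continuous_intros\<close>)
  moreover have "0 \<in> ?p -` U" using assms by simp
  moreover have "f (?p t) = g (?p t)" if "t \<in> ?p -` U" for t using assms(3) that by simp
  ultimately have "DERIV (\<lambda>t. g (?p t)) 0 :> pd f i x"
    using has_derivative_transform_within_open[OF pd_exists_DERIV[OF assms(4), unfolded has_field_derivative_def],
        of "?p -` U" "\<lambda>t. g (?p t)"]
    unfolding has_field_derivative_def by blast
  from pd_eqI[OF this] show ?thesis by auto
qed

lemma C1_on_cong_imp:
  assumes "open U" "C1_on U f" "\<And>y. y \<in> U \<Longrightarrow> f y = g y"
  shows "C1_on U g" "\<And>x i. x \<in> U \<Longrightarrow> pd g i x = pd f i x"
proof -
  have *: "pd_exists g i x \<and> pd g i x = pd f i x" if "x \<in> U" for x i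
    using assms(2) that unfolding C1_on_def by (intro pd_exists_cong[OF assms(1) that assms(3)]) auto
  then show "\<And>x i. x \<in> U \<Longrightarrow> pd g i x = pd f i x" by auto
  have "continuous_on U (pd g i)" for i
    using assms(2) * unfolding C1_on_def by (metis (no_types, lifting) continuous_on_cong)
  then show "C1_on U g" unfolding C1_on_def using * by auto
qed

lemma C2_on_cong_imp:
  assumes "open U" "C2_on U f" "\<And>y. y \<in> U \<Longrightarrow> f y = g y"
  shows "C2_on U g" "\<And>x i j. x \<in> U \<Longrightarrow> pd (pd g i) j x = pd (pd f i) j x"
proof -
  have 1: "C1_on U f" "\<And>i. C1_on U (pd f i)" using assms(2) by (auto simp: C2_on_iff)
  note g = C1_on_cong_imp[OF assms(1) 1(1) assms(3)]
  have g2: "C1_on U (pd g i)" "x \<in> U \<Longrightarrow> pd (pd g i) j x = pd (pd f i) j x" for i j x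
    using C1_on_cong_imp[OF assms(1) 1(2)[of i], of "pd g i"] g(2) by auto
  show "C2_on U g" "\<And>x i j. x \<in> U \<Longrightarrow> pd (pd g i) j x = pd (pd f i) j x"
    using g g2 by (auto simp: C2_on_iff)
qed

lemma C1_on_local:
  assumes "\<And>x. x \<in> U \<Longrightarrow> \<exists>V. open V \<and> x \<in> V \<and> C1_on V f"
  shows "C1_on U f"
  unfolding C1_on_def
proof (intro conjI ballI allI)
  fix x i assume "x \<in> U"
  with assms show "pd_exists f i x" unfolding C1_on_def by blast
next
  fix i
  show "continuous_on U (pd f i)"
    unfolding continuous_on_eq_continuous_within
  proof
    fix x assume "x \<in> U"
    then obtain V where "open V" "x \<in> V" "continuous_on V (pd f i)"
      using assms unfolding C1_on_def by blast
    then show "continuous (at x within U) (pd f i)"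
      using continuous_at_imp_continuous_within continuous_on_eq_continuous_at by blast
  qed
qed

lemma C2_on_local:
  assumes "\<And>x. x \<in> U \<Longrightarrow> \<exists>V. open V \<and> x \<in> V \<and> C2_on V f"
  shows "C2_on U f"
  using assms unfolding C2_on_iff
  by (intro conjI allI C1_on_local; blast)

lemma norm_grad_power2: "(norm (grad f x))\<^sup>2 = (\<Sum>i\<in>UNIV. (pd f i x)\<^sup>2)"
  unfolding power2_norm_eq_inner by (simp add: inner_vec_def grad_def power2_eq_square)

lemma C1_on_DERIV_line:
  fixes f :: "real^'n \<Rightarrow> real"
  assumes "C1_on U f" "open U" "x - t *\<^sub>R d \<in> U"
  shows "DERIV (\<lambda>t. f (x - t *\<^sub>R d)) t :> - (grad f (x - t *\<^sub>R d) \<bullet> d)"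
proof -
  have "((\<lambda>t. x - t *\<^sub>R d) has_derivative (\<lambda>h. - h *\<^sub>R d)) (at t)" by (auto intro!: derivative_eq_intros)
  then have "((\<lambda>t. f (x - t *\<^sub>R d)) has_derivative (\<lambda>h. grad f (x - t *\<^sub>R d) \<bullet> (- h *\<^sub>R d))) (at t)"
    by (rule has_derivative_compose) (rule C1_on_GDERIV[OF assms, unfolded GDERIV_has_derivative])
  then show ?thesis by (rule has_derivative_imp_has_field_derivative) simp
qed

lemma C1_on_const [intro, simp]:
  fixes U :: "(real^'n) set"
  shows "C1_on U (\<lambda>x. c)" "pd (\<lambda>x::real^'n. c) i x = 0"
proof -
  have *: "pd_exists (\<lambda>x. c) i x" "pd (\<lambda>x. c) i x = 0" for i and x :: "real^'n"
    using pd_eqI[of "\<lambda>x. c" x i 0] by auto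
  then show "pd (\<lambda>x::real^'n. c) i x = 0" by blast
  have "pd (\<lambda>x::real^'n. c) i = (\<lambda>x. 0)" for i using * by (rule_tac ext)
  then show "C1_on U (\<lambda>x. c)" unfolding C1_on_def using * by simp
qed

lemma C1_on_coord [intro, simp]:
  "C1_on U (\<lambda>x::real^'n. x $ k)" "pd (\<lambda>x::real^'n. x $ k) i x = (if i = k then 1 else 0)"
proof -
  have "pd_exists (\<lambda>x::real^'n. x $ k) i x \<and> pd (\<lambda>x::real^'n. x $ k) i x = (if i = k then 1 else 0)" for i x
  proof -
    have "DERIV (\<lambda>t. (x + t *\<^sub>R axis i 1) $ k) 0 :> (if i = k then 1 else 0)"
      by (auto intro!: derivative_eq_intros simp: axis_def)
    from pd_eqI[OF this] show ?thesis by auto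
  qed
  then show "C1_on U (\<lambda>x::real^'n. x $ k)" "pd (\<lambda>x::real^'n. x $ k) i x = (if i = k then 1 else 0)"
    unfolding C1_on_def by auto
qed

lemma pd_add:
  assumes "pd_exists f i x" "pd_exists g i x"
  shows "pd_exists (\<lambda>x. f x + g x) i x" "pd (\<lambda>x. f x + g x) i x = pd f i x + pd g i x"
  using pd_eqI[OF DERIV_add[OF assms[THEN pd_exists_DERIV]]] by auto

lemma pd_diff:
  assumes "pd_exists f i x" "pd_exists g i x"
  shows "pd_exists (\<lambda>x. f x - g x) i x" "pd (\<lambda>x. f x - g x) i x = pd f i x - pd g i x"
  using pd_eqI[OF DERIV_diff[OF assms[THEN pd_exists_DERIV]]] by auto

lemma pd_mult:
  assumes "pd_exists f i x" "pd_exists g i x"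
  shows "pd_exists (\<lambda>x. f x * g x) i x" "pd (\<lambda>x. f x * g x) i x = f x * pd g i x + pd f i x * g x"
  using pd_eqI[OF DERIV_mult'[OF assms[THEN pd_exists_DERIV]]] by auto

lemma pd_cmult:
  assumes "pd_exists f i x"
  shows "pd_exists (\<lambda>x. c * f x) i x" "pd (\<lambda>x. c * f x) i x = c * pd f i x"
  using pd_eqI[OF DERIV_cmult[OF assms[THEN pd_exists_DERIV]]] by auto

lemma pd_real_compose:
  assumes "pd_exists f i x" "DERIV \<phi> (f x) :> d"
  shows "pd_exists (\<lambda>x. \<phi> (f x)) i x" "pd (\<lambda>x. \<phi> (f x)) i x = d * pd f i x"
proof -
  have "DERIV \<phi> (f (x + 0 *\<^sub>R axis i 1)) :> d" using assms(2) by simp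
  from pd_eqI[OF DERIV_chain2[OF this pd_exists_DERIV[OF assms(1)]]]
  show "pd_exists (\<lambda>x. \<phi> (f x)) i x" "pd (\<lambda>x. \<phi> (f x)) i x = d * pd f i x" by auto
qed

lemma pd_sum:
  assumes "finite S" "\<And>k. k \<in> S \<Longrightarrow> pd_exists (f k) i x"
  shows "pd_exists (\<lambda>x. \<Sum>k\<in>S. f k x) i x \<and> pd (\<lambda>x. \<Sum>k\<in>S. f k x) i x = (\<Sum>k\<in>S. pd (f k) i x)"
proof -
  have "DERIV (\<lambda>t. \<Sum>k\<in>S. f k (x + t *\<^sub>R axis i 1)) 0 :> (\<Sum>k\<in>S. pd (f k) i x)"
    using assms(2) by (intro DERIV_sum pd_exists_DERIV)
  from pd_eqI[OF this] show ?thesis by auto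
qed

lemma C1_on_pd_exists: "C1_on U f \<Longrightarrow> x \<in> U \<Longrightarrow> pd_exists f i x"
  by (simp add: C1_on_def)

lemma C1_onI_pd:
  assumes "\<And>x i. x \<in> U \<Longrightarrow> pd_exists f i x" "\<And>x i. x \<in> U \<Longrightarrow> pd f i x = D i x" "\<And>i. continuous_on U (D i)"
  shows "C1_on U f"
  unfolding C1_on_def using assms by (metis (no_types, lifting) continuous_on_cong)

context
  fixes U :: "(real^'n) set" assumes U: "open U"
begin

lemma C1_on_add: "C1_on U f \<Longrightarrow> C1_on U g \<Longrightarrow> C1_on U (\<lambda>x. f x + g x)"
  by (rule C1_onI_pd[where D="\<lambda>i x. pd f i x + pd g i x"])
     (auto intro!: pd_add continuous_intros C1_on_pd_continuous dest: C1_on_pd_exists)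

lemma C1_on_diff: "C1_on U f \<Longrightarrow> C1_on U g \<Longrightarrow> C1_on U (\<lambda>x. f x - g x)"
  by (rule C1_onI_pd[where D="\<lambda>i x. pd f i x - pd g i x"])
     (auto intro!: pd_diff continuous_intros C1_on_pd_continuous dest: C1_on_pd_exists)

lemma C1_on_mult: "C1_on U f \<Longrightarrow> C1_on U g \<Longrightarrow> C1_on U (\<lambda>x. f x * g x)"
  by (rule C1_onI_pd[where D="\<lambda>i x. f x * pd g i x + pd f i x * g x"])
     (auto intro!: pd_mult continuous_on_add continuous_on_mult intro: C1_on_pd_continuous C1_on_continuous[OF _ U] dest: C1_on_pd_exists)

lemma C1_on_sum:
  assumes "finite S" "\<And>k. k \<in> S \<Longrightarrow> C1_on U (f k)" shows "C1_on U (\<lambda>x. \<Sum>k\<in>S. f k x)"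
proof (rule C1_onI_pd[where D="\<lambda>i x. \<Sum>k\<in>S. pd (f k) i x"])
  show "pd_exists (\<lambda>x. \<Sum>k\<in>S. f k x) i x" "pd (\<lambda>x. \<Sum>k\<in>S. f k x) i x = (\<Sum>k\<in>S. pd (f k) i x)" if "x \<in> U" for x i
    using pd_sum[OF assms(1)] C1_on_pd_exists[OF assms(2) that] by blast+
  show "continuous_on U (\<lambda>x. \<Sum>k\<in>S. pd (f k) i x)" for i
    using assms by (auto intro!: continuous_intros C1_on_pd_continuous)
qed

lemma C1_on_real_compose:
  assumes "C1_on U f" "\<And>t. t \<in> T \<Longrightarrow> DERIV \<phi> t :> \<phi>' t" "continuous_on T \<phi>'" "f ` U \<subseteq> T"
  shows "C1_on U (\<lambda>x. \<phi> (f x))"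
proof (rule C1_onI_pd[where D="\<lambda>i x. \<phi>' (f x) * pd f i x"])
  show "pd_exists (\<lambda>x. \<phi> (f x)) i x" "pd (\<lambda>x. \<phi> (f x)) i x = \<phi>' (f x) * pd f i x" if "x \<in> U" for x i
    using pd_real_compose[OF C1_on_pd_exists[OF assms(1) that] assms(2)] assms(4) that by blast+
  have "continuous_on U (\<lambda>x. \<phi>' (f x))"
    using continuous_on_compose2[OF assms(3) C1_on_continuous[OF assms(1) U] assms(4)] .
  then show "continuous_on U (\<lambda>x. \<phi>' (f x) * pd f i x)" for i
    using C1_on_pd_continuous[OF assms(1)] by (intro continuous_on_mult)
qed

lemma C2_on_intro:
  assumes "C1_on U f" "\<And>i. C1_on U (D i)" "\<And>i x. x \<in> U \<Longrightarrow> pd f i x = D i x"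
  shows "C2_on U f"
  unfolding C2_on_iff using assms C1_on_cong_imp(1)[OF U] by metis

lemma C2_on_const [simp]: "C2_on U (\<lambda>x. c)"
  by (rule C2_on_intro[where D="\<lambda>i x. 0"]) auto

lemma C2_on_coord [simp]: "C2_on U (\<lambda>x. x $ k)"
  by (rule C2_on_intro[where D="\<lambda>i x. if i = k then 1 else 0"]) auto

lemma C2_on_C1: "C2_on U f \<Longrightarrow> C1_on U f" "C2_on U f \<Longrightarrow> C1_on U (pd f i)"
  by (auto simp: C2_on_iff)

lemma C2_on_add:
  assumes "C2_on U f" "C2_on U g"
  shows "C2_on U (\<lambda>x. f x + g x)"
    "x \<in> U \<Longrightarrow> pd (\<lambda>x. f x + g x) i x = pd f i x + pd g i x"
    "x \<in> U \<Longrightarrow> pd (pd (\<lambda>x. f x + g x) i) j x = pd (pd f i) j x + pd (pd g i) j x"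
proof -
  note C = assms[THEN C2_on_C1(1)] assms[THEN C2_on_C1(2)]
  have p: "pd (\<lambda>x. f x + g x) i x = pd f i x + pd g i x" if "x \<in> U" for x i
    using C that by (intro pd_add C1_on_pd_exists)
  then show "x \<in> U \<Longrightarrow> pd (\<lambda>x. f x + g x) i x = pd f i x + pd g i x" .
  show "C2_on U (\<lambda>x. f x + g x)"
    using C p by (intro C2_on_intro[where D="\<lambda>i x. pd f i x + pd g i x"] C1_on_add) auto
  show "pd (pd (\<lambda>x. f x + g x) i) j x = pd (pd f i) j x + pd (pd g i) j x" if "x \<in> U"
    using C1_on_cong_imp(2)[OF U C1_on_add[OF C(3) C(4)] p[symmetric] that]
      pd_add(2)[OF C1_on_pd_exists[OF C(3) that] C1_on_pd_exists[OF C(4) that]] by simp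
qed

lemma C2_on_mult:
  assumes "C2_on U f" "C2_on U g"
  shows "C2_on U (\<lambda>x. f x * g x)"
    "x \<in> U \<Longrightarrow> pd (\<lambda>x. f x * g x) i x = f x * pd g i x + pd f i x * g x"
    "x \<in> U \<Longrightarrow> pd (pd (\<lambda>x. f x * g x) i) j x
       = f x * pd (pd g i) j x + pd f j x * pd g i x + pd f i x * pd g j x + pd (pd f i) j x * g x"
proof -
  note C = assms[THEN C2_on_C1(1)] assms[THEN C2_on_C1(2)]
  have p: "pd (\<lambda>x. f x * g x) i x = f x * pd g i x + pd f i x * g x" if "x \<in> U" for x i
    using C that by (intro pd_mult C1_on_pd_exists)
  then show "x \<in> U \<Longrightarrow> pd (\<lambda>x. f x * g x) i x = f x * pd g i x + pd f i x * g x" .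
  have c: "C1_on U (\<lambda>x. f x * pd g i x + pd f i x * g x)" for i
    using C by (intro C1_on_add C1_on_mult) auto
  show "C2_on U (\<lambda>x. f x * g x)"
    using C p c by (intro C2_on_intro[where D="\<lambda>i x. f x * pd g i x + pd f i x * g x"] C1_on_mult) auto
  show "pd (pd (\<lambda>x. f x * g x) i) j x
       = f x * pd (pd g i) j x + pd f j x * pd g i x + pd f i x * pd g j x + pd (pd f i) j x * g x" if "x \<in> U"
  proof -
    have e: "pd_exists f j x" "pd_exists g j x" "pd_exists (pd f i) j x" "pd_exists (pd g i) j x"
      using C that by (auto intro: C1_on_pd_exists)
    show ?thesis
      using C1_on_cong_imp(2)[OF U c p[symmetric] that, of i j]
        pd_add(2)[OF pd_mult(1)[OF e(1) e(4)] pd_mult(1)[OF e(3) e(2)]] pd_mult(2)[OF e(1) e(4)] pd_mult(2)[OF e(3) e(2)]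
      by simp
  qed
qed

lemma C2_on_cmult:
  assumes "C2_on U f"
  shows "C2_on U (\<lambda>x. c * f x)"
    "x \<in> U \<Longrightarrow> pd (\<lambda>x. c * f x) i x = c * pd f i x"
    "x \<in> U \<Longrightarrow> pd (pd (\<lambda>x. c * f x) i) j x = c * pd (pd f i) j x"
  using C2_on_mult[OF C2_on_const[of c] assms] by (simp_all add: C1_on_const(2)[abs_def])

lemma C2_on_shift:
  assumes "C2_on U f"
  shows "C2_on U (\<lambda>x. f x + c)" "x \<in> U \<Longrightarrow> pd (\<lambda>x. f x + c) i x = pd f i x"
    "x \<in> U \<Longrightarrow> pd (pd (\<lambda>x. f x + c) i) j x = pd (pd f i) j x"
  using C2_on_add[OF assms C2_on_const[of c]] by (simp_all add: C1_on_const(2)[abs_def])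

lemma C2_on_sum:
  assumes "finite S" "\<And>k. k \<in> S \<Longrightarrow> C2_on U (f k)"
  shows "C2_on U (\<lambda>x. \<Sum>k\<in>S. f k x) \<and> (\<forall>x\<in>U. \<forall>i j. pd (\<lambda>x. \<Sum>k\<in>S. f k x) i x = (\<Sum>k\<in>S. pd (f k) i x)
     \<and> pd (pd (\<lambda>x. \<Sum>k\<in>S. f k x) i) j x = (\<Sum>k\<in>S. pd (pd (f k) i) j x))"
  using assms
proof (induction S rule: finite_induct)
  case empty
  have "pd (\<lambda>x. 0) i = (\<lambda>x. 0)" for i :: 'n by (rule ext) simp
  then show ?case by simp
next
  case (insert k S)
  let ?g = "\<lambda>x. \<Sum>k\<in>S. f k x"
  have 1: "C2_on U (f k)" using insert.prems by simp
  have IH: "C2_on U ?g" "\<And>x i j. x \<in> U \<Longrightarrow> pd ?g i x = (\<Sum>k\<in>S. pd (f k) i x)"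
    "\<And>x i j. x \<in> U \<Longrightarrow> pd (pd ?g i) j x = (\<Sum>k\<in>S. pd (pd (f k) i) j x)"
    using insert.IH[OF insert.prems] by blast+
  have eq: "(\<lambda>x. \<Sum>k\<in>insert k S. f k x) = (\<lambda>x. f k x + ?g x)"
    using insert.hyps by (intro ext) (rule sum.insert)
  show ?case
    unfolding eq sum.insert[OF insert.hyps]
    by (intro conjI ballI allI; (rule C2_on_add(1)[OF 1 IH(1)])?; simp only: C2_on_add(2,3)[OF 1 IH(1)] IH(2,3))
qed

lemma C2_on_real_compose:
  assumes "C2_on U f" "\<And>t. t \<in> T \<Longrightarrow> DERIV \<phi> t :> \<phi>' t" "\<And>t. t \<in> T \<Longrightarrow> DERIV \<phi>' t :> \<phi>'' t"
    "continuous_on T \<phi>''" "f ` U \<subseteq> T"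
  shows "C2_on U (\<lambda>x. \<phi> (f x))"
    "x \<in> U \<Longrightarrow> pd (\<lambda>x. \<phi> (f x)) i x = \<phi>' (f x) * pd f i x"
    "x \<in> U \<Longrightarrow> pd (pd (\<lambda>x. \<phi> (f x)) i) j x = \<phi>'' (f x) * pd f j x * pd f i x + \<phi>' (f x) * pd (pd f i) j x"
proof -
  note C = assms(1)[THEN C2_on_C1(1)] assms(1)[THEN C2_on_C1(2)]
  have p: "pd (\<lambda>x. \<phi> (f x)) i x = \<phi>' (f x) * pd f i x" if "x \<in> U" for x i
    using pd_real_compose(2)[OF C1_on_pd_exists[OF C(1) that] assms(2)] assms(5) that by blast
  then show "x \<in> U \<Longrightarrow> pd (\<lambda>x. \<phi> (f x)) i x = \<phi>' (f x) * pd f i x" .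
  have ct: "continuous_on T \<phi>'"
    using assms(3) by (meson DERIV_continuous continuous_at_imp_continuous_on)
  have c: "C1_on U (\<lambda>x. \<phi>' (f x))" using C1_on_real_compose[OF C(1) assms(3,4,5)] .
  then have c': "C1_on U (\<lambda>x. \<phi>' (f x) * pd f i x)" for i
    using C by (intro C1_on_mult)
  show "C2_on U (\<lambda>x. \<phi> (f x))"
    using C1_on_real_compose[OF C(1) assms(2) ct assms(5)] c' p
    by (intro C2_on_intro[where D="\<lambda>i x. \<phi>' (f x) * pd f i x"]) auto
  show "pd (pd (\<lambda>x. \<phi> (f x)) i) j x = \<phi>'' (f x) * pd f j x * pd f i x + \<phi>' (f x) * pd (pd f i) j x" if "x \<in> U"
  proof -
    have e: "pd_exists f j x" "pd_exists (pd f i) j x" "pd_exists (\<lambda>x. \<phi>' (f x)) j x"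
      using C c that by (auto intro: C1_on_pd_exists)
    have "f x \<in> T" using assms(5) that by auto
    then show ?thesis
      using C1_on_cong_imp(2)[OF U c' p[symmetric] that, of i j] pd_mult(2)[OF e(3) e(2)]
        pd_real_compose(2)[OF e(1) assms(3)] by simp
  qed
qed

end

subsection \<open>Integration by parts\<close>

text \<open>The open sets \<open>U\<close> and \<open>- K\<close> cover the space, and
  \<open>f\<close> is zero on the second.\<close>

lemma C1_on_extend:
  fixes f :: "real^'n \<Rightarrow> real"
  assumes "open U" "closed K" "K \<subseteq> U" "C1_on U f" "\<And>x. x \<notin> K \<Longrightarrow> f x = 0"
  shows "C1_on UNIV f" "x \<notin> K \<Longrightarrow> pd f i x = 0"
proof -
  have o: "open (- K)" using assms by auto
  have 1: "C1_on (-K) f" "\<And>x i. x \<in> -K \<Longrightarrow> pd f i x = 0"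
    using C1_on_cong_imp[OF o, of "\<lambda>x. 0" f] assms(5) by auto
  show "C1_on UNIV f"
  proof (rule C1_on_local)
    fix x show "\<exists>V. open V \<and> x \<in> V \<and> C1_on V f"
      using assms 1 o by (cases "x \<in> K") blast+
  qed
  show "x \<notin> K \<Longrightarrow> pd f i x = 0" using 1 by simp
qed

lemma continuous_compact_support_integrable:
  fixes f :: "'a::euclidean_space \<Rightarrow> real"
  assumes "continuous_on K f" "compact K" "\<And>x. x \<notin> K \<Longrightarrow> f x = 0"
  shows "integrable lborel f"
proof -
  have "(\<lambda>x. indicator K x *\<^sub>R f x) = f" using assms(3) by (auto simp: indicator_def fun_eq_iff)
  then show ?thesis using borel_integrable_compact[OF assms(2,1)] by simp
qed

text \<open>Translates of \<open>g\<close> have the same integral, so every difference quotient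
  \<open>q n\<close> integrates to 0, and dominated convergence passes this on to the
  derivative.\<close>

lemma integral_pd_zero:
  fixes g :: "real^'n \<Rightarrow> real"
  assumes C: "C1_on UNIV g" and K: "compact K" and z: "\<And>x. x \<notin> K \<Longrightarrow> g x = 0"
  shows "integral\<^sup>L lborel (pd g i) = 0" "integrable lborel (pd g i)"
proof -
  obtain R where R: "R > 0" "K \<subseteq> cball 0 R" using compact_imp_bounded[OF K] unfolding bounded_pos by (metis mem_cball_0 subsetI)
  have cont: "continuous_on UNIV g" using C1_on_continuous[OF C] by simp
  have contp: "continuous_on UNIV (pd g i)" using C1_on_pd_continuous[OF C] .
  have zp: "pd g i x = 0" if "x \<notin> K" for x
    using C1_on_extend(2)[of UNIV K g] C K z that compact_imp_closed by blast
  show int: "integrable lborel (pd g i)"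
    using continuous_compact_support_integrable[OF _ K] zp contp continuous_on_subset by blast
  have intg: "integrable lborel g"
    using continuous_compact_support_integrable[OF _ K] z cont continuous_on_subset by blast
  have "compact (pd g i ` K)" using K contp compact_continuous_image continuous_on_subset by blast
  then obtain B0 where B0: "\<And>y. y \<in> K \<Longrightarrow> \<bar>pd g i y\<bar> \<le> B0"
    by (metis bounded_real compact_imp_bounded imageI)
  define B where "B = max B0 0"
  have B: "\<bar>pd g i y\<bar> \<le> B" for y
    using B0[of y] zp[of y] by (cases "y \<in> K") (auto simp: B_def)
  define e where "e = (axis i 1 :: real^'n)"
  define q where "q n x = real (Suc n) * (g (x + (1 / real (Suc n)) *\<^sub>R e) - g x)" for n x
  have norme: "norm e = 1" by (simp add: e_def)
  have transl: "integrable lborel (\<lambda>x. g (x + a))" "integral\<^sup>L lborel (\<lambda>x. g (x + a)) = integral\<^sup>L lborel g" for a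
  proof -
    have gm: "g \<in> borel_measurable borel" using cont by (rule borel_measurable_continuous_onI)
    have "integrable (distr lborel borel ((+) a)) g \<longleftrightarrow> integrable lborel (\<lambda>x. g (a + x))"
      by (rule integrable_distr_eq) (use gm in auto)
    then show "integrable lborel (\<lambda>x. g (x + a))"
      using intg by (simp add: lborel_distr_plus add.commute)
    have "integral\<^sup>L (distr lborel borel ((+) a)) g = integral\<^sup>L lborel (\<lambda>x. g (a + x))"
      by (rule integral_distr) (use gm in auto)
    then show "integral\<^sup>L lborel (\<lambda>x. g (x + a)) = integral\<^sup>L lborel g"
      by (simp add: lborel_distr_plus add.commute)
  qed
  have iq: "integral\<^sup>L lborel (q n) = 0" for n
    unfolding q_def using transl intg by simp
  have "(\<lambda>n. integral\<^sup>L lborel (q n)) \<longlonglongrightarrow> integral\<^sup>L lborel (pd g i)"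
  \<comment> \<open>The steps \<open>1 / Suc n\<close> are at most 1, so all quotients vanish
    outside the ball of radius \<open>R + 1\<close>; inside it the mean value theorem bounds them by
    \<open>B\<close>.\<close>
  proof (rule integral_dominated_convergence[where w="\<lambda>x. B * indicator (cball 0 (R+1)) x"])
    show "pd g i \<in> borel_measurable lborel" "\<And>n. q n \<in> borel_measurable lborel"
      unfolding q_def using contp cont
      by (auto intro!: borel_measurable_continuous_onI continuous_intros continuous_on_compose2[OF cont])
    show "integrable lborel (\<lambda>x. B * indicator (cball 0 (R+1)) x :: real)"
      by (intro integrable_mult_right integrable_real_indicator) (use emeasure_lborel_cball_finite in auto)
    show "AE x in lborel. (\<lambda>n. q n x) \<longlonglongrightarrow> pd g i x"
    proof (rule AE_I2)
      fix x
      have "DERIV (\<lambda>t. g (x + t *\<^sub>R e)) 0 :> pd g i x"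
        unfolding e_def by (rule pd_exists_DERIV) (use C in \<open>auto simp: C1_on_def\<close>)
      then have l: "((\<lambda>h. (g (x + h *\<^sub>R e) - g x) / h) \<longlongrightarrow> pd g i x) (at 0)"
        unfolding DERIV_def by simp
      have "filterlim (\<lambda>n. 1 / real (Suc n)) (at 0) sequentially"
        unfolding filterlim_at using LIMSEQ_inverse_real_of_nat by (auto simp: inverse_eq_divide)
      from filterlim_compose[OF l this]
      show "(\<lambda>n. q n x) \<longlonglongrightarrow> pd g i x" by (simp add: q_def mult.commute)
    qed
    show "AE x in lborel. norm (q n x) \<le> B * indicator (cball 0 (R+1)) x" for n
    proof (rule AE_I2)
      fix x
      let ?h = "1 / real (Suc n)"
      have h: "0 < ?h" "?h \<le> 1" by auto
      show "norm (q n x) \<le> B * indicator (cball 0 (R+1)) x"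
      proof (cases "x \<in> cball 0 (R+1)")
        case True
        have "DERIV (\<lambda>t. g (x + (t * 1) *\<^sub>R e)) t :> 1 * pd g i (x + (t * 1) *\<^sub>R e)" for t
          unfolding e_def by (rule pd_segment) (use C in \<open>auto simp: C1_on_def\<close>)
        then have D: "DERIV (\<lambda>t. g (x + t *\<^sub>R e)) t :> pd g i (x + t *\<^sub>R e)" for t by simp
        obtain \<xi> where "g (x + ?h *\<^sub>R e) - g (x + 0 *\<^sub>R e) = (?h - 0) * pd g i (x + \<xi> *\<^sub>R e)"
          using MVT2[OF h(1) D] by blast
        then have "q n x = pd g i (x + \<xi> *\<^sub>R e)" unfolding q_def by simp
        then show ?thesis using B True by simp
      next
        case False
        then have nx: "norm x > R + 1" by (simp add: dist_norm)
        have "norm (x + ?h *\<^sub>R e) \<ge> norm x - norm (?h *\<^sub>R e)"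
          by (metis add.commute add_diff_cancel_left' diff_add_cancel norm_diff_ineq)
        moreover have "norm (?h *\<^sub>R e) \<le> 1" using h norme by simp
        ultimately have "norm (x + ?h *\<^sub>R e) > R" using nx by linarith
        then have "g (x + ?h *\<^sub>R e) = 0" "g x = 0" using nx R by (auto intro!: z)
        then show ?thesis unfolding q_def using False by simp
      qed
    qed
  qed
  then show "integral\<^sup>L lborel (pd g i) = 0"
    unfolding iq by (simp add: LIMSEQ_const_iff)
qed

lemma integral_pd_zero_on:
  fixes f :: "real^'n \<Rightarrow> real"
  assumes "open U" "compact K" "K \<subseteq> U" "C1_on U f" "\<And>x. x \<notin> K \<Longrightarrow> f x = 0"
  shows "integral\<^sup>L lborel (pd f i) = 0" "integrable lborel (pd f i)"
  using integral_pd_zero[OF C1_on_extend(1)[OF assms(1) compact_imp_closed[OF assms(2)] assms(3,4,5)] assms(2,5)]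
  by auto

subsection \<open>Mollification by truncated polynomials\<close>

text \<open>Only the origin needs an argument: the exponent is at least two, so the difference
  quotient there is bounded by \<open>\<bar>h\<bar> ^ Suc m\<close>.\<close>

lemma DERIV_max0_power:
  fixes t :: real
  shows "DERIV (\<lambda>t. max 0 t ^ Suc (Suc m)) t :> real (Suc (Suc m)) * max 0 t ^ Suc m"
proof -
  consider "t > 0" | "t < 0" | "t = 0" by linarith
  then show ?thesis
  proof cases
    case 1
    have "DERIV (\<lambda>t. t ^ Suc (Suc m)) t :> real (Suc (Suc m)) * max 0 t ^ Suc m"
      using 1 DERIV_pow[of "Suc (Suc m)" t] by simp
    then show ?thesis
      unfolding has_field_derivative_def
      by (rule has_derivative_transform_within_open[where s="{0<..}"]) (use 1 in auto)
  next
    case 2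
    have "DERIV (\<lambda>t. 0) t :> real (Suc (Suc m)) * max 0 t ^ Suc m"
      using 2 by simp
    then show ?thesis
      unfolding has_field_derivative_def
      by (rule has_derivative_transform_within_open[where s="{..<0}"]) (use 2 in auto)
  next
    case 3
    have "((\<lambda>h. max 0 h ^ Suc (Suc m) / h) \<longlongrightarrow> 0) (at (0::real))"
    proof (rule Lim_null_comparison)
      have "norm (max 0 h ^ Suc (Suc m) / h) \<le> \<bar>h\<bar> ^ Suc m" for h :: real
      proof (cases "h > 0")
        case False
        then have "max 0 h = 0" by simp
        then show ?thesis by (simp del: power_Suc add: power_0_left)
      qed simp
      then show "\<forall>\<^sub>F h in at 0. norm (max 0 h ^ Suc (Suc m) / h) \<le> \<bar>h\<bar> ^ Suc m" for h :: real
        by (intro always_eventually) auto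
      show "((\<lambda>h::real. \<bar>h\<bar> ^ Suc m) \<longlongrightarrow> 0) (at 0)"
        by (rule tendsto_eq_intros | simp)+
    qed
    then show ?thesis unfolding DERIV_def using 3 by simp
  qed
qed

text \<open>A kernel of finite smoothness is preferred to a smooth one because the family is closed
  under differentiation: the gradient of one member is a multiple of \<open>y\<close> times the next
  lower member. It is not normalised; its mass is carried along as \<open>bump_mass\<close>.\<close>

definition bump :: "real \<Rightarrow> nat \<Rightarrow> real^'n \<Rightarrow> real" where
  "bump e m y = max 0 (e\<^sup>2 - y \<bullet> y) ^ m"

lemma bump_nonneg: "bump e m y \<ge> 0"
  by (simp add: bump_def)

lemma bump_zero: "m > 0 \<Longrightarrow> e \<ge> 0 \<Longrightarrow> norm y \<ge> e \<Longrightarrow> bump e m y = 0"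
  by (simp add: bump_def power2_norm_eq_inner[symmetric] max_def power_mono)

lemma bump_minus: "bump e m (- y) = bump e m y"
  by (simp add: bump_def)

lemma bump_scale: "e > 0 \<Longrightarrow> bump 1 m (y /\<^sub>R e) = bump e m y / e ^ (2 * m)"
proof -
  assume e: "e > 0"
  have "max 0 (1 - (y /\<^sub>R e) \<bullet> (y /\<^sub>R e)) = max 0 (e\<^sup>2 - y \<bullet> y) / e\<^sup>2"
    using e by (simp add: max_def field_simps power2_eq_square)
  then show ?thesis unfolding bump_def by (simp add: power_divide power_mult)
qed

lemma C1_on_bump:
  "C1_on (UNIV :: (real^'n) set) (bump e (Suc (Suc m)))"
  "pd (bump e (Suc (Suc m))) i = (\<lambda>y :: real^'n. - 2 * real (Suc (Suc m)) * y $ i * bump e (Suc m) y)"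
proof -
  have g: "C2_on UNIV (\<lambda>y::real^'n. y \<bullet> y) \<and>
     (\<forall>x\<in>UNIV :: (real^'n) set. \<forall>i j. pd (\<lambda>y. y \<bullet> y) i x = (\<Sum>k\<in>UNIV. pd (\<lambda>y. y $ k * y $ k) i x) \<and>
     pd (pd (\<lambda>y. y \<bullet> y) i) j x = (\<Sum>k\<in>UNIV. pd (pd (\<lambda>y. y $ k * y $ k) i) j x))"
    unfolding inner_vec_def inner_real_def
    using C2_on_sum[OF open_UNIV finite, of "UNIV :: 'n set" "\<lambda>k y::real^'n. y $ k * y $ k",
        OF C2_on_mult(1)[OF open_UNIV C2_on_coord[OF open_UNIV] C2_on_coord[OF open_UNIV]]] .
  have p: "pd (\<lambda>y::real^'n. y \<bullet> y) i x = 2 * x $ i" for x i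
  proof -
    have "pd (\<lambda>y::real^'n. y $ k * y $ k) i x = (if i = k then 2 * x $ k else 0)" for k
      using C2_on_mult(2)[of UNIV "\<lambda>y::real^'n. y $ k" "\<lambda>y. y $ k" x i] by simp
    then show ?thesis using g by simp
  qed
  have C: "C1_on UNIV (\<lambda>y::real^'n. e\<^sup>2 - y \<bullet> y)"
    using g by (intro C1_on_diff) (auto simp: C2_on_iff)
  have pC: "pd (\<lambda>y::real^'n. e\<^sup>2 - y \<bullet> y) i x = - 2 * x $ i" for x i
    using pd_diff(2)[OF C1_on_pd_exists[OF C1_on_const(1) UNIV_I], of "\<lambda>y::real^'n. y \<bullet> y" i x "e\<^sup>2"]
      C1_on_pd_exists[OF C2_on_C1(1)[OF open_UNIV conjunct1[OF g]]] p by simp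
  show "C1_on (UNIV :: (real^'n) set) (bump e (Suc (Suc m)))"
    unfolding bump_def[abs_def]
    by (rule C1_on_real_compose[OF open_UNIV C DERIV_max0_power, of UNIV m]) (intro continuous_intros, simp)
  show "pd (bump e (Suc (Suc m))) i = (\<lambda>y :: real^'n. - 2 * real (Suc (Suc m)) * y $ i * bump e (Suc m) y)"
  proof
    fix y :: "real^'n"
    have "pd_exists (\<lambda>y::real^'n. e\<^sup>2 - y \<bullet> y) i y" using C by (simp add: C1_on_def)
    from pd_real_compose(2)[OF this DERIV_max0_power[of m]] 
    show "pd (bump e (Suc (Suc m))) i y = - 2 * real (Suc (Suc m)) * y $ i * bump e (Suc m) y"
      unfolding bump_def[abs_def] pC by (simp add: algebra_simps)
  qed
qed

lemma pd_coord_mult: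
  assumes "C1_on UNIV f"
  shows "C1_on UNIV (\<lambda>y::real^'n. c * y $ k * f y)"
    "pd (\<lambda>y::real^'n. c * y $ k * f y) i = (\<lambda>y. (if i = k then c else 0) * f y + c * y $ k * pd f i y)"
proof -
  have 1: "C1_on UNIV (\<lambda>y::real^'n. c * y $ k)" by (intro C1_on_mult) auto
  have 2: "pd (\<lambda>y::real^'n. c * y $ k) i x = (if i = k then c else 0)" for i x
    using pd_cmult(2)[OF C1_on_pd_exists[OF C1_on_coord(1) UNIV_I], of c k i x] by simp
  show "C1_on UNIV (\<lambda>y::real^'n. c * y $ k * f y)" using 1 assms by (intro C1_on_mult) auto
  show "pd (\<lambda>y::real^'n. c * y $ k * f y) i = (\<lambda>y. (if i = k then c else 0) * f y + c * y $ k * pd f i y)"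
    by (rule ext) (simp add: pd_mult(2)[OF C1_on_pd_exists[OF 1 UNIV_I] C1_on_pd_exists[OF assms UNIV_I]] 2)
qed

text \<open>Exponent 5 leaves three continuous derivatives, enough to differentiate a convolution
  three times. With explicit formulas the symmetry of the mixed derivatives is a
  calculation.\<close>

lemma bump5_second:
  fixes e :: real
  defines "f \<equiv> bump e 5 :: real^'n \<Rightarrow> real"
  shows "pd f i = (\<lambda>y. -10 * y $ i * bump e 4 y)"
    "pd (pd f i) j = (\<lambda>y. (if j = i then -10 else 0) * bump e 4 y + 80 * y $ i * (y $ j * bump e 3 y))"
    "C1_on UNIV f" "C1_on UNIV (pd f i)" "C1_on UNIV (pd (pd f i) j)"
    "pd (pd f i) j = pd (pd f j) i"
    "pd (pd (pd f j) j) i = pd (pd (pd f i) j) j"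
proof -
  have b: "C1_on (UNIV::(real^'n) set) (bump e 5)" "C1_on (UNIV::(real^'n) set) (bump e 4)" "C1_on (UNIV::(real^'n) set) (bump e 3)"
    "pd (bump e 5) i = (\<lambda>y::real^'n. -10 * y $ i * bump e 4 y)"
    "pd (bump e 4) i = (\<lambda>y::real^'n. -8 * y $ i * bump e 3 y)"
    "pd (bump e 3) i = (\<lambda>y::real^'n. -6 * y $ i * bump e 2 y)" for i
    using C1_on_bump[of e 3] C1_on_bump[of e 2] C1_on_bump[of e 1] by (simp_all add: numeral_eq_Suc)
  show f1: "C1_on UNIV f" unfolding f_def by (rule b)
  have p1: "pd f i = (\<lambda>y. -10 * y $ i * bump e 4 y)" for i unfolding f_def by (rule b)
  then show "pd f i = (\<lambda>y. -10 * y $ i * bump e 4 y)" .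
  show f2: "C1_on UNIV (pd f i)" for i unfolding p1 by (rule pd_coord_mult) (rule b)
  have p2: "pd (pd f i) j = (\<lambda>y. (if j = i then -10 else 0) * bump e 4 y + 80 * y $ i * (y $ j * bump e 3 y))" for i j
    unfolding p1 pd_coord_mult(2)[OF b(2)] b(5) by (auto simp: fun_eq_iff)
  then show "pd (pd f i) j = (\<lambda>y. (if j = i then -10 else 0) * bump e 4 y + 80 * y $ i * (y $ j * bump e 3 y))" .
  show sym: "pd (pd f i) j = pd (pd f j) i" for i j unfolding p2 by (auto simp: fun_eq_iff)
  have c3: "C1_on UNIV (\<lambda>y::real^'n. y $ j * bump e 3 y)" for j using pd_coord_mult(1)[OF b(3), of 1 j] by simp
  have c4: "C1_on UNIV (\<lambda>y::real^'n. c * bump e 4 y)" for c by (intro C1_on_mult b) auto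
  show C3: "C1_on UNIV (pd (pd f i) j)" for i j
    unfolding p2 by (intro C1_on_add c4 pd_coord_mult(1) c3) auto
  have p3: "pd (pd (pd f i) j) k y = (if j = i then -10 else 0) * (-8 * y $ k * bump e 3 y)
     + (if k = i then 80 else 0) * (y $ j * bump e 3 y) 
     + 80 * y $ i * ((if k = j then 1 else 0) * bump e 3 y + y $ j * (-6 * y $ k * bump e 2 y))" for i j k y
  proof -
    have 1: "pd (\<lambda>y::real^'n. c * bump e 4 y) k y = c * (-8 * y $ k * bump e 3 y)" for c
      using pd_cmult(2)[of "bump e 4" k y c] b(2) b(5) by (simp add: C1_on_def)
    have 2: "pd (\<lambda>y::real^'n. y $ j * bump e 3 y) k = (\<lambda>y. (if k = j then 1 else 0) * bump e 3 y + y $ j * (-6 * y $ k * bump e 2 y))"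
      using pd_coord_mult(2)[OF b(3), of 1 j k] unfolding b(6) by simp
    have 3: "pd (\<lambda>y::real^'n. 80 * y $ i * (y $ j * bump e 3 y)) k y = 
       (if k = i then 80 else 0) * (y $ j * bump e 3 y) 
     + 80 * y $ i * ((if k = j then 1 else 0) * bump e 3 y + y $ j * (-6 * y $ k * bump e 2 y))"
      unfolding pd_coord_mult(2)[OF c3] 2 ..
    show ?thesis unfolding p2
      using pd_add(2)[of "\<lambda>y::real^'n. (if j = i then -10 else 0) * bump e 4 y" k y "\<lambda>y. 80 * y $ i * (y $ j * bump e 3 y)"]
        c4[of "if j = i then -10 else 0"] pd_coord_mult(1)[OF c3[of j], of 80 i] 1 3
      by (simp add: C1_on_def)
  qed
  show "pd (pd (pd f j) j) i = pd (pd (pd f i) j) j"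
    by (rule ext) (auto simp: p3 algebra_simps)
qed

subsection \<open>Convolution\<close>

lemma continuous_on_mult_extend:
  fixes v g :: "'a::topological_space \<Rightarrow> real"
  assumes "open U" "closed K" "K \<subseteq> U" "continuous_on U v" "continuous_on UNIV g" "\<And>x. x \<notin> K \<Longrightarrow> g x = 0"
  shows "continuous_on UNIV (\<lambda>x. v x * g x)"
proof -
  have "continuous_on U (\<lambda>x. v x * g x)" using assms continuous_on_subset by (intro continuous_intros) blast+
  moreover have "continuous_on (-K) (\<lambda>x. v x * g x)"
    by (subst continuous_on_cong[where g="\<lambda>x. 0"]) (use assms in auto)
  moreover have "U \<union> -K = UNIV" using assms by auto
  ultimately show ?thesis using continuous_on_open_Un[of U "-K"] assms by auto
qed

lemma integral_cbox_support:
  fixes f :: "'a::euclidean_space \<Rightarrow> real"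
  assumes "continuous_on UNIV f" "\<And>x. x \<notin> cbox a b \<Longrightarrow> f x = 0"
  shows "integral (cbox a b) f = integral\<^sup>L lborel f" "integrable lborel f"
proof -
  show i: "integrable lborel f"
    using continuous_compact_support_integrable[OF _ compact_cbox] assms continuous_on_subset by blast
  have "(\<lambda>x. if x \<in> cbox a b then f x else 0) = f" using assms(2) by auto
  then show "integral (cbox a b) f = integral\<^sup>L lborel f"
    using integral_lborel[OF i] Henstock_Kurzweil_Integration.integral_restrict_UNIV[of "cbox a b" f] by simp
qed

lemma integral_lborel_scale:
  fixes f :: "'a::euclidean_space \<Rightarrow> real"
  assumes "f \<in> borel_measurable borel" "e > 0"
  shows "integral\<^sup>L lborel f = e ^ DIM('a) * integral\<^sup>L lborel (\<lambda>y. f (x + e *\<^sub>R y))"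
proof -
  have "integral\<^sup>L lborel f = integral\<^sup>L (density (distr lborel borel (\<lambda>y. x + e *\<^sub>R y)) (\<lambda>_. e ^ DIM('a))) f"
    using lborel_affine[of e x] assms by simp
  also have "\<dots> = integral\<^sup>L (distr lborel borel (\<lambda>y. x + e *\<^sub>R y)) (\<lambda>y. e ^ DIM('a) *\<^sub>R f y)"
    using assms by (intro integral_density) auto
  also have "\<dots> = integral\<^sup>L lborel (\<lambda>y. e ^ DIM('a) *\<^sub>R f (x + e *\<^sub>R y))"
    using assms by (intro integral_distr) auto
  finally show ?thesis by simp
qed

text \<open>Differentiation under the integral sign puts every derivative on the kernel, so
  continuity of \<open>v\<close> on the box suffices.\<close>

lemma C1_on_convolution:
  fixes v k :: "real^'n \<Rightarrow> real"
  assumes v: "continuous_on (cbox a b) v" and k: "C1_on UNIV k"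
  shows "C1_on UNIV (\<lambda>x. integral (cbox a b) (\<lambda>y. v y * k (x - y)))"
    "pd (\<lambda>x. integral (cbox a b) (\<lambda>y. v y * k (x - y))) i = (\<lambda>x. integral (cbox a b) (\<lambda>y. v y * pd k i (x - y)))"
proof -
  have kc: "continuous_on UNIV k" "\<And>i. continuous_on UNIV (pd k i)"
    using C1_on_continuous[OF k] C1_on_pd_continuous[OF k] by auto
  have *: "pd_exists (\<lambda>x. integral (cbox a b) (\<lambda>y. v y * k (x - y))) i x \<and>
     pd (\<lambda>x. integral (cbox a b) (\<lambda>y. v y * k (x - y))) i x = integral (cbox a b) (\<lambda>y. v y * pd k i (x - y))" for i x
  proof -
    let ?e = "axis i 1 :: real^'n"
    have "((\<lambda>t. integral (cbox a b) (\<lambda>y. v y * k (x + t *\<^sub>R ?e - y))) has_field_derivative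
        integral (cbox a b) (\<lambda>y. v y * pd k i (x + 0 *\<^sub>R ?e - y))) (at 0 within UNIV)"
    proof (rule leibniz_rule_field_derivative[where fx="\<lambda>t y. v y * pd k i (x + t *\<^sub>R ?e - y)"])
      fix t y
      have "DERIV (\<lambda>t. k ((x - y) + (t * 1) *\<^sub>R ?e)) t :> 1 * pd k i ((x - y) + (t * 1) *\<^sub>R ?e)"
        by (rule pd_segment) (use k in \<open>auto simp: C1_on_def\<close>)
      then have "DERIV (\<lambda>t. k (x + t *\<^sub>R ?e - y)) t :> pd k i (x + t *\<^sub>R ?e - y)"
        by (simp add: algebra_simps)
      then show "DERIV (\<lambda>t. v y * k (x + t *\<^sub>R ?e - y)) t :> v y * pd k i (x + t *\<^sub>R ?e - y)"
        by (rule DERIV_cmult)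
    next
      fix t :: real
      show "(\<lambda>y. v y * k (x + t *\<^sub>R ?e - y)) integrable_on cbox a b"
        by (intro integrable_continuous continuous_intros v continuous_on_compose2[OF kc(1)]) auto
    next
      show "continuous_on (UNIV \<times> cbox a b) (\<lambda>(t, y). v y * pd k i (x + t *\<^sub>R ?e - y))"
        unfolding split_beta
        by (intro continuous_on_mult continuous_on_compose2[OF v] continuous_on_compose2[OF kc(2)] continuous_intros) auto
    qed auto
    from pd_eqI[OF this] show ?thesis by auto
  qed
  show "pd (\<lambda>x. integral (cbox a b) (\<lambda>y. v y * k (x - y))) i = (\<lambda>x. integral (cbox a b) (\<lambda>y. v y * pd k i (x - y)))"
    using * by blast
  show "C1_on UNIV (\<lambda>x. integral (cbox a b) (\<lambda>y. v y * k (x - y)))"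
  proof (rule C1_onI_pd[where D="\<lambda>i x. integral (cbox a b) (\<lambda>y. v y * pd k i (x - y))"])
    show "continuous_on UNIV (\<lambda>x. integral (cbox a b) (\<lambda>y. v y * pd k i (x - y)))" for i
      by (rule integral_continuous_on_param)
         (unfold split_beta, intro continuous_on_mult continuous_on_compose2[OF v] continuous_on_compose2[OF kc(2)] continuous_intros, auto)
  qed (use * in auto)
qed

subsection \<open>Harmonic functions\<close>

text \<open>This crude comparison of cube and ball is the source of the factor
  \<open>CARD('n)\<close> in hypotheses such as
  \<open>cball x (real CARD('n) * e) \<subseteq> U\<close>.\<close>

lemma norm_le_card:
  fixes y :: "real^'n"
  assumes "y \<in> cbox (-(\<chi> i. r)) (\<chi> i. r)"
  shows "norm y \<le> real CARD('n) * r"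
proof -
  have "norm y \<le> (\<Sum>i\<in>UNIV. \<bar>y $ i\<bar>)" by (rule norm_le_l1_cart)
  also have "\<dots> \<le> (\<Sum>i\<in>(UNIV::'n set). r)"
    using assms by (intro sum_mono) (auto simp: mem_box_cart abs_le_iff minus_le_iff)
  finally show ?thesis by simp
qed

lemma in_cube_norm:
  fixes y :: "real^'n"
  assumes "norm y \<le> r"
  shows "y \<in> cbox (-(\<chi> i. r)) (\<chi> i. r)"
proof -
  have "- r \<le> y $ i" "y $ i \<le> r" for i using component_le_norm_cart[of y i] assms by (auto simp: abs_le_iff)
  then show ?thesis by (simp add: mem_box_cart)
qed

definition cube :: "real \<Rightarrow> (real^'n) set" where
  "cube r = cbox (-(\<chi> i. r)) (\<chi> i. r)"

definition bump_mass :: "'n::finite itself \<Rightarrow> real" where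
  "bump_mass _ = integral\<^sup>L lborel (bump 1 5 :: real^'n \<Rightarrow> real)"

lemma continuous_bump: "continuous_on UNIV (bump e m :: real^'n \<Rightarrow> real)"
  unfolding bump_def[abs_def] by (intro continuous_intros)

lemma bump_mass_pos: "bump_mass TYPE('n::finite) > 0"
proof -
  have c: "continuous_on (cube 1) (bump 1 5 :: real^'n \<Rightarrow> real)"
    using continuous_bump continuous_on_subset by blast
  have "integral (cube 1) (bump 1 5 :: real^'n \<Rightarrow> real) \<noteq> 0"
  proof
    assume "integral (cube 1) (bump 1 5 :: real^'n \<Rightarrow> real) = 0"
    then have "(bump 1 5 has_integral 0) (cube 1 :: (real^'n) set)"
      using integrable_integral[OF integrable_continuous[OF c[unfolded cube_def]]] unfolding cube_def by simp
    then have "bump 1 5 (0::real^'n) = 0"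
      unfolding cube_def
      by (intro has_integral_0_cbox_imp_0[OF c[unfolded cube_def] bump_nonneg])
         (auto simp: mem_box_cart interval_ne_empty_cart)
    then show False by (simp add: bump_def)
  qed
  moreover have "integral (cube 1) (bump 1 5 :: real^'n \<Rightarrow> real) \<ge> 0"
    by (rule integral_nonneg) (use c bump_nonneg integrable_continuous in \<open>auto simp: cube_def\<close>)
  moreover have "integral (cube 1) (bump 1 5 :: real^'n \<Rightarrow> real) = bump_mass TYPE('n)"
    unfolding bump_mass_def cube_def
    by (rule integral_cbox_support(1)[OF continuous_bump])
       (metis bump_zero in_cube_norm linorder_le_cases zero_le_one zero_less_numeral)
  ultimately show ?thesis by simp
qed

lemma pd_affine:
  fixes v :: "real^'n \<Rightarrow> real"
  assumes "pd_exists v i (x + e *\<^sub>R y)"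
  shows "pd_exists (\<lambda>y. v (x + e *\<^sub>R y)) i y" "pd (\<lambda>y. v (x + e *\<^sub>R y)) i y = e * pd v i (x + e *\<^sub>R y)"
proof -
  have "DERIV (\<lambda>t. v ((x + e *\<^sub>R y) + (t * e) *\<^sub>R axis i 1)) 0 :> e * pd v i ((x + e *\<^sub>R y) + (0 * e) *\<^sub>R axis i 1)"
    by (rule pd_segment) (use assms in simp)
  then have "DERIV (\<lambda>t. v (x + e *\<^sub>R (y + t *\<^sub>R axis i 1))) 0 :> e * pd v i (x + e *\<^sub>R y)"
    by (simp add: algebra_simps)
  from pd_eqI[OF this]
  show "pd_exists (\<lambda>y. v (x + e *\<^sub>R y)) i y" "pd (\<lambda>y. v (x + e *\<^sub>R y)) i y = e * pd v i (x + e *\<^sub>R y)" by auto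
qed

lemma C1_on_affine:
  fixes v :: "real^'n \<Rightarrow> real"
  assumes "C1_on U v" "\<And>y. y \<in> V \<Longrightarrow> x + e *\<^sub>R y \<in> U"
  shows "C1_on V (\<lambda>y. v (x + e *\<^sub>R y))"
proof (rule C1_onI_pd[where D="\<lambda>i y. e * pd v i (x + e *\<^sub>R y)"])
  show "pd_exists (\<lambda>y. v (x + e *\<^sub>R y)) i y" "pd (\<lambda>y. v (x + e *\<^sub>R y)) i y = e * pd v i (x + e *\<^sub>R y)" if "y \<in> V" for y i
    using pd_affine assms that C1_on_pd_exists by blast+
  show "continuous_on V (\<lambda>y. e * pd v i (x + e *\<^sub>R y))" for i
    by (intro continuous_on_mult continuous_on_compose2[OF C1_on_pd_continuous[OF assms(1)]] continuous_intros)
       (use assms in auto)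
qed

text \<open>The derivative in \<open>e\<close> of the averages vanishes: \<open>y * bump 1 5 y\<close> is a gradient of a
  compactly supported function, and integrating by parts produces the Laplacian.\<close>

lemma harmonic_mean_value:
  fixes v :: "real^'n \<Rightarrow> real"
  assumes U: "open U" and C2: "C2_on U v" and harm: "\<And>x. x \<in> U \<Longrightarrow> lap v x = 0"
    and e: "e > 0" and ball: "cball x (real CARD('n) * e) \<subseteq> U"
  shows "integral\<^sup>L lborel (\<lambda>y. v (x + e *\<^sub>R y) * bump 1 5 y) = bump_mass TYPE('n) * v x"
proof -
  note C = C2_on_C1[OF U C2]
  let ?\<rho> = "bump 1 5 :: real^'n \<Rightarrow> real"
  have inU: "x + t *\<^sub>R y \<in> U" if "t \<in> {0..e}" "y \<in> cube 1" for t y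
  proof -
    have "norm y \<le> real CARD('n)" using norm_le_card[of y 1] that(2) by (simp add: cube_def)
    then have "norm (t *\<^sub>R y) \<le> real CARD('n) * e"
      using that(1) by (auto simp: mult.commute[of "real CARD('n)"] intro!: mult_mono)
    then show ?thesis using ball by (auto simp: dist_norm)
  qed
  have cont: "continuous_on UNIV ?\<rho>" by (rule continuous_bump)
  have z: "y \<notin> cube 1 \<Longrightarrow> ?\<rho> y = 0" for y :: "real^'n"
    unfolding cube_def by (metis bump_zero in_cube_norm linorder_le_cases zero_le_one zero_less_numeral)
  define I where "I t = integral (cube 1) (\<lambda>y. v (x + t *\<^sub>R y) * ?\<rho> y)" for t
  define I' where "I' t = integral (cube 1) (\<lambda>y. (\<Sum>i\<in>UNIV. pd v i (x + t *\<^sub>R y) * y $ i) * ?\<rho> y)" for t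
  have vc: "continuous_on U v" using C1_on_continuous[OF C(1) U] .
  have I_conv: "I t = integral\<^sup>L lborel (\<lambda>y. v (x + t *\<^sub>R y) * ?\<rho> y)" if t: "t \<in> {0..e}" for t
  proof -
    let ?V = "(\<lambda>y. x + t *\<^sub>R y) -` U"
    have "continuous_on UNIV (\<lambda>y. v (x + t *\<^sub>R y) * ?\<rho> y)"
    proof (rule continuous_on_mult_extend[where U="?V" and K="cube 1"])
      show "open ?V" by (rule continuous_open_vimage) (auto intro!: continuous_intros U)
      show "continuous_on ?V (\<lambda>y. v (x + t *\<^sub>R y))"
        by (rule continuous_on_compose2[OF vc]) (auto intro!: continuous_intros)
    qed (use inU[OF t] cont z in \<open>auto simp: cube_def closed_cbox\<close>)
    then show ?thesis unfolding I_def cube_def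
      by (rule integral_cbox_support) (use z in \<open>auto simp: cube_def\<close>)
  qed
  have "(I has_field_derivative I' t) (at t within {0..e})" if t: "t \<in> {0..e}" for t
    unfolding I_def[abs_def] I'_def cube_def
  proof (rule leibniz_rule_field_derivative[OF _ _ _ t])
    fix s :: real and y :: "real^'n" assume s: "s \<in> {0..e}" and y: "y \<in> cbox (- (\<chi> i. 1)) (\<chi> i. 1)"
    have "x + s *\<^sub>R y \<in> U" using inU s y by (simp add: cube_def)
    then have G: "(v has_derivative (\<lambda>h. grad v (x + s *\<^sub>R y) \<bullet> h)) (at (x + s *\<^sub>R y))"
      using C1_on_GDERIV[OF C(1) U] GDERIV_has_derivative by blast
    have "((\<lambda>s. x + s *\<^sub>R y) has_derivative (\<lambda>h. h *\<^sub>R y)) (at s within {0..e})"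
      by (auto intro!: derivative_eq_intros)
    from has_derivative_compose[OF this G]
    have "((\<lambda>s. v (x + s *\<^sub>R y)) has_field_derivative (grad v (x + s *\<^sub>R y) \<bullet> y)) (at s within {0..e})"
      unfolding has_field_derivative_def by (simp add: mult_commute_abs)
    then have "((\<lambda>s. v (x + s *\<^sub>R y) * ?\<rho> y) has_field_derivative (grad v (x + s *\<^sub>R y) \<bullet> y) * ?\<rho> y) (at s within {0..e})"
      by (rule DERIV_cmult_right)
    then show "((\<lambda>s. v (x + s *\<^sub>R y) * ?\<rho> y) has_field_derivative (\<Sum>i\<in>UNIV. pd v i (x + s *\<^sub>R y) * y $ i) * ?\<rho> y) (at s within {0..e})"
      by (simp add: inner_vec_def grad_def)
  next
    fix s :: real assume s: "s \<in> {0..e}"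
    show "(\<lambda>y. v (x + s *\<^sub>R y) * ?\<rho> y) integrable_on cbox (- (\<chi> i. 1)) (\<chi> i. 1)"
      by (intro integrable_continuous continuous_on_mult continuous_on_compose2[OF vc] continuous_intros continuous_on_subset[OF cont])
         (use inU[OF s] in \<open>auto simp: cube_def\<close>)
  next
    show "continuous_on ({0..e} \<times> cbox (- (\<chi> i. 1)) (\<chi> i. 1)) (\<lambda>(s, y). (\<Sum>i\<in>UNIV. pd v i (x + s *\<^sub>R y) * y $ i) * ?\<rho> y)"
      unfolding split_beta
      by (intro continuous_on_mult continuous_on_sum continuous_on_compose2[OF C1_on_pd_continuous[OF C(1)]]
           continuous_on_compose2[OF cont] continuous_intros)
         (use inU in \<open>auto simp: cube_def\<close>)
  qed auto
  moreover have "I' t = 0" if t: "t \<in> {0..e}" for t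
  proof -
    let ?V = "(\<lambda>y. x + t *\<^sub>R y) -` U"
    \<comment> \<open>The divisor is \<open>- 2 * 6\<close>, the factor that differentiating
      \<open>bump 1 6\<close> produces.\<close>
    let ?P = "\<lambda>y::real^'n. bump 1 6 y / (-12)"
    have oV: "open ?V" by (rule continuous_open_vimage) (auto intro!: continuous_intros U)
    have K: "cball 0 1 \<subseteq> ?V" using inU[OF t] in_cube_norm by (fastforce simp: cube_def)
    have P: "C1_on UNIV ?P" "pd ?P i y = y $ i * ?\<rho> y" for i y
    proof -
      have 1: "C1_on UNIV (bump 1 6 :: real^'n \<Rightarrow> real)" "pd (bump 1 6) i y = -12 * y $ i * ?\<rho> y"
        using C1_on_bump[of 1 4, where 'n='n] by (simp_all add: numeral_eq_Suc)
      show "C1_on UNIV ?P" using C1_on_mult[OF open_UNIV C1_on_const(1)[of _ "1 / (-12)"] 1(1)] by simp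
      show "pd ?P i y = y $ i * ?\<rho> y"
        using pd_cmult(2)[OF C1_on_pd_exists[OF 1(1)], of y "1 / (-12)" i] 1(2) by simp
    qed
    have P0: "y \<notin> cball 0 1 \<Longrightarrow> ?P y = 0" for y by (simp add: bump_zero)
    let ?f = "\<lambda>i y. pd v i (x + t *\<^sub>R y) * ?P y"
    have Cv: "C1_on ?V (\<lambda>y. pd v i (x + t *\<^sub>R y))" for i
      by (rule C1_on_affine[OF C(2)]) auto
    have Cf: "C1_on ?V (?f i)" for i
      by (intro C1_on_mult[OF oV] Cv C1_on_subset[OF P(1)]) auto
    have I0: "integral\<^sup>L lborel (pd (?f i) i) = 0" "integrable lborel (pd (?f i) i)" for i
      using integral_pd_zero_on[OF oV compact_cball K Cf, of i i] P0 by auto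
    have fz: "pd (?f i) i y = 0" if "y \<notin> cball 0 1" for i y
      using C1_on_extend(2)[OF oV closed_cball K Cf _ that, of i] P0 by auto
    have eq: "(\<Sum>i\<in>UNIV. pd (?f i) i y) = (\<Sum>i\<in>UNIV. pd v i (x + t *\<^sub>R y) * y $ i) * ?\<rho> y" for y
    proof (cases "y \<in> cball 0 1")
      case True
      then have y: "y \<in> ?V" using K by auto
      have "pd (?f i) i y = t * pd (pd v i) i (x + t *\<^sub>R y) * ?P y + pd v i (x + t *\<^sub>R y) * (y $ i * ?\<rho> y)" for i
        using pd_mult(2)[OF C1_on_pd_exists[OF Cv y] C1_on_pd_exists[OF P(1) UNIV_I]] P(2)
          pd_affine(2)[OF C1_on_pd_exists[OF C(2)], of x t y i i] y by simp
      then have "(\<Sum>i\<in>UNIV. pd (?f i) i y) = t * lap v (x + t *\<^sub>R y) * ?P y + (\<Sum>i\<in>UNIV. pd v i (x + t *\<^sub>R y) * (y $ i * ?\<rho> y))"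
        by (simp only: sum.distrib lap_def sum_distrib_left sum_distrib_right)
      then show ?thesis using harm y by (simp add: sum_distrib_right mult.assoc)
    next
      case False
      then have "?\<rho> y = 0" by (simp add: bump_zero)
      then show ?thesis using fz[OF False] by simp
    qed
    have sm: "integral\<^sup>L lborel (\<lambda>y. \<Sum>i\<in>UNIV. pd (?f i) i y) = 0"
      using I0 by simp
    have "continuous_on UNIV (\<lambda>y. \<Sum>i\<in>UNIV. pd (?f i) i y)"
      using C1_on_extend(1)[OF oV closed_cball K Cf] P0 by (intro continuous_on_sum C1_on_pd_continuous) auto
    then have "I' t = integral\<^sup>L lborel (\<lambda>y. \<Sum>i\<in>UNIV. pd (?f i) i y)"
      unfolding I'_def cube_def eq
      by (rule integral_cbox_support) (use z in \<open>auto simp: cube_def\<close>)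
    then show ?thesis using sm by simp
  qed
  ultimately have D: "(I has_field_derivative 0) (at t within {0..e})" if "t \<in> {0..e}" for t
    using that by metis
  \<comment> \<open>At parameter 0 the average is \<open>v x\<close> times the mass of the kernel,
    so constancy in the parameter is the mean value formula.\<close>
  have "I e = I 0"
    using has_field_derivative_zero_constant[OF convex_real_interval(5) D] e by fastforce
  moreover have "I 0 = bump_mass TYPE('n) * v x"
    using I_conv[of 0] e by (simp add: bump_mass_def)
  ultimately show ?thesis using I_conv[of e] e by simp
qed

lemma bump_scale': "e > 0 \<Longrightarrow> bump e m (e *\<^sub>R y) = e ^ (2 * m) * bump 1 m y"
  using bump_scale[of e m "e *\<^sub>R y"] by simp

text \<open>The mean value formula rewritten as a convolution: the substitution
  \<open>y = x + e *\<^sub>R w\<close> yields \<open>e ^ CARD('n)\<close>, and the scaling of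
  \<open>bump e 5\<close> yields \<open>e ^ 10\<close>.\<close>

lemma harmonic_representation:
  fixes v :: "real^'n \<Rightarrow> real"
  assumes U: "open U" and C2: "C2_on U v" and harm: "\<And>x. x \<in> U \<Longrightarrow> lap v x = 0"
    and e: "e > 0" and ball: "cball x (real CARD('n) * e) \<subseteq> U"
  shows "v x = (1 / (bump_mass TYPE('n) * e ^ CARD('n) * e ^ 10)) * integral\<^sup>L lborel (\<lambda>y. v y * bump e 5 (x - y))"
proof -
  note C = C2_on_C1[OF U C2]
  have K: "cball x e \<subseteq> U"
  proof -
    have "e \<le> real CARD('n) * e" using e by (simp add: mult_le_cancel_right1 Suc_leI)
    then show ?thesis using ball by (meson order_trans subset_cball)
  qed
  have "continuous_on UNIV (\<lambda>y. v y * bump e 5 (x - y))"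
    by (rule continuous_on_mult_extend[OF U closed_cball K C1_on_continuous[OF C(1) U]])
       (use e in \<open>auto intro!: continuous_on_compose2[OF continuous_bump] continuous_intros bump_zero simp: dist_norm\<close>)
  then have "integral\<^sup>L lborel (\<lambda>y. v y * bump e 5 (x - y))
      = e ^ CARD('n) * integral\<^sup>L lborel (\<lambda>y. v (x + e *\<^sub>R y) * bump e 5 (x - (x + e *\<^sub>R y)))"
    using integral_lborel_scale[OF borel_measurable_continuous_onI e, of "\<lambda>y. v y * bump e 5 (x - y)" x] by simp
  also have "(\<lambda>y. v (x + e *\<^sub>R y) * bump e 5 (x - (x + e *\<^sub>R y))) = (\<lambda>y. e ^ 10 * (v (x + e *\<^sub>R y) * bump 1 5 y))"
    using bump_scale'[OF e, of 5] by (auto simp add: bump_minus fun_eq_iff)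
  also have "integral\<^sup>L lborel \<dots> = e ^ 10 * (bump_mass TYPE('n) * v x)"
    using harmonic_mean_value[OF assms] by simp
  finally show ?thesis using e bump_mass_pos[where 'n='n] by simp
qed

text \<open>Only two derivatives are assumed. Near each point \<open>v\<close> equals its own
  average against \<open>bump e 5\<close>, and a convolution inherits the three derivatives of its
  kernel together with the symmetry of the mixed ones.\<close>

lemma harmonic_pd:
  fixes v :: "real^'n \<Rightarrow> real"
  assumes U: "open U" and C2: "C2_on U v" and harm: "\<And>x. x \<in> U \<Longrightarrow> lap v x = 0"
  shows "C2_on U (pd v i)" "\<And>x. x \<in> U \<Longrightarrow> lap (pd v i) x = 0"
    "\<And>x. x \<in> U \<Longrightarrow> pd (pd v i) j x = pd (pd v j) i x"
proof -
  have main: "\<exists>V. open V \<and> x0 \<in> V \<and> V \<subseteq> U \<and> (\<forall>i. C2_on V (pd v i) \<and> (\<forall>x\<in>V. lap (pd v i) x = 0) \<and>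
      (\<forall>j. \<forall>x\<in>V. pd (pd v i) j x = pd (pd v j) i x))" if x0: "x0 \<in> U" for x0
  proof -
    define N where "N = real CARD('n)"
    have N: "N \<ge> 1" by (simp add: N_def Suc_leI)
    obtain r where r: "r > 0" "cball x0 r \<subseteq> U" using U x0 open_contains_cball by blast
    \<comment> \<open>Two inclusions in the ball of radius \<open>r = 2 * N * e\<close> are served:
      that of the cube of half-side \<open>2 * e\<close> about \<open>x0\<close>, and that of the
      balls of radius \<open>N * e\<close> about points of \<open>ball x0 e\<close>.\<close>
    define e where "e = r / (2 * N)"
    have e: "e > 0" "2 * N * e = r" using r N by (auto simp: e_def)
    define a where "a = x0 - (\<chi> i. 2 * e)"
    define b where "b = x0 + (\<chi> i. 2 * e)"
    have Qin: "cbox a b \<subseteq> U"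
    proof
      fix y assume y: "y \<in> cbox a b"
      have "y - x0 \<in> cbox (-(\<chi> i. 2 * e)) (\<chi> i. 2 * e)"
        using y by (auto simp: a_def b_def mem_box_cart algebra_simps)
      from norm_le_card[OF this] have "norm (y - x0) \<le> r" using e by (simp add: N_def mult.commute mult.left_commute)
      then show "y \<in> U" using r by (auto simp: dist_norm norm_minus_commute)
    qed
    have ballQ: "y \<in> cbox a b" if "norm (y - x0) \<le> 2 * e" for y
      using in_cube_norm[OF that] by (auto simp: a_def b_def mem_box_cart algebra_simps)
    have vc: "continuous_on U v" using C2_on_C1(1)[OF U C2] C1_on_continuous U by blast
    then have vQ: "continuous_on (cbox a b) v" using Qin continuous_on_subset by blast
    define c where "c = 1 / (bump_mass TYPE('n) * e ^ CARD('n) * e ^ 10)"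
    define conv where "conv k x = integral (cbox a b) (\<lambda>y. v y * k (x - y))" for k :: "real^'n \<Rightarrow> real" and x
    have conv: "C1_on UNIV (conv k)" "pd (conv k) i = conv (pd k i)" if "C1_on UNIV k" for k i
      unfolding conv_def[abs_def] using C1_on_convolution[OF vQ that] by auto
    let ?k = "bump e 5 :: real^'n \<Rightarrow> real"
    note bk = bump5_second[of e, where 'n='n]
    \<comment> \<open>The domain of integration is the fixed box and does not move with
      \<open>x\<close>, so \<open>G\<close> is three times differentiable everywhere; it equals
      \<open>v\<close> on \<open>ball x0 e\<close> because the kernels centred there are supported
      in the box.\<close>
    define G where "G x = c * conv ?k x" for x
    have cm: "C1_on UNIV (\<lambda>x. c * f x)" "pd (\<lambda>x. c * f x) i = (\<lambda>x. c * pd f i x)" if "C1_on UNIV f" for f :: "real^'n \<Rightarrow> real" and i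
      using C1_on_mult[OF open_UNIV C1_on_const(1) that] pd_cmult(2)[OF C1_on_pd_exists[OF that UNIV_I]] by auto
    have G1: "C1_on UNIV G" "pd G i = (\<lambda>x. c * conv (pd ?k i) x)" for i
      unfolding G_def[abs_def] using cm[OF conv(1)[OF bk(3)]] conv(2)[OF bk(3)] by auto
    have G2: "C1_on UNIV (pd G i)" "pd (pd G i) j = (\<lambda>x. c * conv (pd (pd ?k i) j) x)" for i j
      unfolding G1 using cm[OF conv(1)[OF bk(4)]] conv(2)[OF bk(4)] by auto
    have G3: "C1_on UNIV (pd (pd G i) j)" "pd (pd (pd G i) j) l = (\<lambda>x. c * conv (pd (pd (pd ?k i) j) l) x)" for i j l
      unfolding G2 using cm[OF conv(1)[OF bk(5)]] conv(2)[OF bk(5)] by auto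
    have C2G: "C2_on UNIV G" "C2_on UNIV (pd G i)" for i using G1 G2 G3 by (auto simp: C2_on_iff)
    let ?V = "ball x0 e"
    have oV: "open ?V" by simp
    have VU: "?V \<subseteq> U"
    proof -
      have "e \<le> r" using mult_right_mono[of 1 "2 * N" e] N e by simp
      then show ?thesis using r by auto
    qed
    have eqv: "G x = v x" if x: "x \<in> ?V" for x
    proof -
      have "cball x (real CARD('n) * e) \<subseteq> U"
      proof -
        have "dist x0 y \<le> r" if "dist x y \<le> N * e" for y
        proof -
          have "dist x0 y \<le> e + N * e" using x that dist_triangle[of x0 y x] by simp
          also have "\<dots> \<le> N * e + N * e" using mult_right_mono[of 1 N e] N e by simp
          also have "\<dots> = r" using e by (simp add: algebra_simps)
          finally show ?thesis .
        qed
        then show ?thesis using r by (auto simp: N_def)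
      qed
      note rep = harmonic_representation[OF U C2 harm e(1) this]
      have K: "cball x e \<subseteq> cbox a b"
      proof
        fix y assume "y \<in> cball x e"
        then have "dist x0 y \<le> 2 * e" using x dist_triangle[of x0 y x] by simp
        then show "y \<in> cbox a b" by (intro ballQ) (simp add: dist_norm norm_minus_commute)
      qed
      have "continuous_on UNIV (\<lambda>y. v y * bump e 5 (x - y))"
        by (rule continuous_on_mult_extend[OF U closed_cball _ vc, of x e])
          (use e K Qin in \<open>auto intro!: continuous_on_compose2[OF continuous_bump] continuous_intros bump_zero simp: dist_norm\<close>)
      then have "conv ?k x = integral\<^sup>L lborel (\<lambda>y. v y * bump e 5 (x - y))"
        unfolding conv_def
      proof (rule integral_cbox_support)
        fix y assume "y \<notin> cbox a b"
        then have "y \<notin> cball x e" using K by blast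
        then show "v y * bump e 5 (x - y) = 0" using e by (simp add: bump_zero dist_norm)
      qed
      then show ?thesis using rep by (simp add: G_def c_def)
    qed
    have V1: "\<And>x i. x \<in> ?V \<Longrightarrow> pd v i x = pd G i x"
      using C1_on_cong_imp(2)[OF oV C1_on_subset[OF G1(1)] eqv] by simp
    have V2: "C2_on ?V (pd v i)" "\<And>x j. x \<in> ?V \<Longrightarrow> pd (pd v i) j x = pd (pd G i) j x"
       "\<And>x j l. x \<in> ?V \<Longrightarrow> pd (pd (pd v i) j) l x = pd (pd (pd G i) j) l x" for i
      using C2_on_cong_imp[OF oV C2_on_subset[OF C2G(2)] V1[symmetric]]
        C1_on_cong_imp(2)[OF oV C1_on_subset[OF G2(1)] V1[symmetric]] by auto
    have "lap (pd v i) x = 0" if x: "x \<in> ?V" for i x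
    proof -
      \<comment> \<open>Third derivatives of the kernel commute by their formulas, which turns the
        Laplacian of \<open>pd v i\<close> into a derivative of the Laplacian of \<open>G\<close>;
        the latter vanishes on the ball.\<close>
      have "lap (pd v i) x = (\<Sum>j\<in>UNIV. pd (pd (pd G j) j) i x)"
        unfolding lap_def V2(3)[OF x] G3 by (intro sum.cong refl) (rule arg_cong[OF bk(7)[symmetric], of "\<lambda>f. c * conv f x"])
      also have "\<dots> = pd (\<lambda>x. \<Sum>j\<in>UNIV. pd (pd G j) j x) i x"
        using pd_sum[of UNIV "\<lambda>j. pd (pd G j) j" i x] C1_on_pd_exists[OF G3(1) UNIV_I] by simp
      also have "\<dots> = pd (\<lambda>x. 0) i x"
      proof (rule C1_on_cong_imp(2)[OF oV _ _ x])
        show "C1_on ?V (\<lambda>x. 0)" by simp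
        fix y assume y: "y \<in> ?V"
        have "(\<Sum>j\<in>UNIV. pd (pd G j) j y) = lap v y" unfolding lap_def using V2(2)[OF y] by simp
        then show "0 = (\<Sum>j\<in>UNIV. pd (pd G j) j y)" using harm VU y by auto
      qed
      finally show ?thesis by simp
    qed
    moreover have "pd (pd v i) j x = pd (pd v j) i x" if x: "x \<in> ?V" for i j x
      unfolding V2(2)[OF x] G2(2) using bk(6) by simp
    ultimately show ?thesis using V2(1) e VU by (intro exI[of _ ?V]) auto
  qed
  show "C2_on U (pd v i)"
  proof (rule C2_on_local)
    fix x assume "x \<in> U"
    from main[OF this] show "\<exists>V. open V \<and> x \<in> V \<and> C2_on V (pd v i)" by blast
  qed
  show "\<And>x. x \<in> U \<Longrightarrow> lap (pd v i) x = 0" "\<And>x. x \<in> U \<Longrightarrow> pd (pd v i) j x = pd (pd v j) i x"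
    subgoal for x using main[of x] by blast
    subgoal for x using main[of x] by blast
    done
qed

lemma nn_integral_lebesgue_lborel: "(\<integral>\<^sup>+ x. f x \<partial>lebesgue) = (\<integral>\<^sup>+ x. f x \<partial>lborel)"
  by (rule nn_integral_completion)

text \<open>Jensen's inequality for the kernel average: in the nonnegative integral of
  \<open>(v - v x)\<^sup>2\<close> against the bump the mean value formula evaluates the cross term,
  and a bump bounded by 1 turns the weighted integral into one over a ball.\<close>

lemma harmonic_L2_bound:
  fixes v :: "real^'n \<Rightarrow> real"
  assumes U: "open U" and C2: "C2_on U v" and harm: "\<And>x. x \<in> U \<Longrightarrow> lap v x = 0"
    and e: "e > 0" and ball: "cball x (real CARD('n) * e) \<subseteq> U"
  shows "ennreal (bump_mass TYPE('n) * e ^ CARD('n) * (v x)\<^sup>2) \<le> (\<integral>\<^sup>+ y\<in>cball x e. ennreal ((v y)\<^sup>2) \<partial>lebesgue)"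
proof -
  let ?\<rho> = "bump 1 5 :: real^'n \<Rightarrow> real"
  note C = C2_on_C1[OF U C2]
  have vc: "continuous_on U v" using C(1) C1_on_continuous U by blast
  have K: "cball x e \<subseteq> U"
  proof -
    have "e \<le> real CARD('n) * e" using e by (simp add: mult_le_cancel_right1 Suc_leI)
    then show ?thesis using ball by (meson order_trans subset_cball)
  qed
  let ?V = "(\<lambda>y. x + e *\<^sub>R y) -` U"
  have oV: "open ?V" by (rule continuous_open_vimage) (auto intro!: continuous_intros U)
  have KV: "cball 0 1 \<subseteq> ?V"
  proof
    fix y :: "real^'n" assume "y \<in> cball 0 1"
    then have "norm (e *\<^sub>R y) \<le> e" using e by (simp add: mult_left_le)
    then show "y \<in> ?V" using K by (auto simp: dist_norm)
  qed
  have vV: "continuous_on ?V (\<lambda>y. v (x + e *\<^sub>R y))"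
    by (rule continuous_on_compose2[OF vc]) (auto intro!: continuous_intros)
  have int: "integrable lborel (\<lambda>y. w y * ?\<rho> y)" if w: "continuous_on ?V w" for w
  proof -
    have "continuous_on UNIV (\<lambda>y. w y * ?\<rho> y)"
      by (rule continuous_on_mult_extend[OF oV closed_cball KV w continuous_bump]) (simp add: bump_zero)
    then show ?thesis
      using continuous_compact_support_integrable[OF _ compact_cball[of 0 1]] continuous_on_subset
      by (metis (no_types, lifting) bump_zero linorder_le_cases mem_cball_0 mult_zero_right subset_UNIV zero_le_one zero_less_numeral)
  qed
  let ?m = "bump_mass TYPE('n)"
  let ?w = "\<lambda>y. v (x + e *\<^sub>R y)"
  have i1: "integrable lborel (\<lambda>y. ?w y * ?\<rho> y)" "integrable lborel (\<lambda>y. (?w y)\<^sup>2 * ?\<rho> y)" "integrable lborel ?\<rho>"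
    using int[OF vV] int[OF continuous_on_power[OF vV, of 2]] int[of "\<lambda>y. 1"] by auto
  have "0 \<le> integral\<^sup>L lborel (\<lambda>y. (?w y - v x)\<^sup>2 * ?\<rho> y)"
    by (intro integral_nonneg_AE AE_I2 mult_nonneg_nonneg bump_nonneg) auto
  also have "(\<lambda>y. (?w y - v x)\<^sup>2 * ?\<rho> y) = (\<lambda>y. (?w y)\<^sup>2 * ?\<rho> y - 2 * v x * (?w y * ?\<rho> y) + (v x)\<^sup>2 * ?\<rho> y)"
    by (auto simp: power2_eq_square algebra_simps)
  also have "integral\<^sup>L lborel \<dots> = integral\<^sup>L lborel (\<lambda>y. (?w y)\<^sup>2 * ?\<rho> y) - 2 * v x * (?m * v x) + (v x)\<^sup>2 * ?m"
    using i1 harmonic_mean_value[OF assms] by (simp add: bump_mass_def)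
  finally have 1: "?m * (v x)\<^sup>2 \<le> integral\<^sup>L lborel (\<lambda>y. (?w y)\<^sup>2 * ?\<rho> y)"
    by (simp add: power2_eq_square algebra_simps)
  have vball: "integrable lborel (\<lambda>y. indicator (cball x e) y *\<^sub>R (v y)\<^sup>2)"
    by (rule borel_integrable_compact) (use vc K in \<open>auto intro!: continuous_intros elim: continuous_on_subset\<close>)
  let ?f = "\<lambda>y. indicator (cball x e) y * (v y)\<^sup>2"
  have f: "integrable lborel ?f" using vball by simp
  then have mf: "?f \<in> borel_measurable borel" using borel_measurable_integrable by fastforce
  have fs: "integrable lborel (\<lambda>y. ?f (x + e *\<^sub>R y))"
  proof -
    have "integrable lborel (\<lambda>y. indicator (cball 0 1) y *\<^sub>R (?w y)\<^sup>2)"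
      by (rule borel_integrable_compact) (use vV KV in \<open>auto intro!: continuous_intros elim: continuous_on_subset\<close>)
    moreover have "indicator (cball x e) (x + e *\<^sub>R y) = (indicator (cball 0 1) y :: real)" for y
      using e by (auto simp: indicator_def dist_norm)
    ultimately show ?thesis by simp
  qed
  have "integral\<^sup>L lborel (\<lambda>y. (?w y)\<^sup>2 * ?\<rho> y) \<le> integral\<^sup>L lborel (\<lambda>y. ?f (x + e *\<^sub>R y))"
  proof (rule integral_mono[OF i1(2) fs])
    fix y :: "real^'n"
    show "(?w y)\<^sup>2 * ?\<rho> y \<le> ?f (x + e *\<^sub>R y)"
    proof (cases "norm y \<le> 1")
      case True
      have "?\<rho> y \<le> 1" unfolding bump_def by (rule power_le_one) auto
      moreover have "x + e *\<^sub>R y \<in> cball x e" using True e by (simp add: dist_norm)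
      ultimately show ?thesis by (simp add: mult_left_le)
    next
      case False
      then show ?thesis by (simp add: bump_zero)
    qed
  qed
  with 1 have "?m * (v x)\<^sup>2 \<le> integral\<^sup>L lborel (\<lambda>y. ?f (x + e *\<^sub>R y))" by simp
  then have "e ^ CARD('n) * (?m * (v x)\<^sup>2) \<le> integral\<^sup>L lborel ?f"
    using integral_lborel_scale[OF mf e, of x] e by simp
  then have "ennreal (?m * e ^ CARD('n) * (v x)\<^sup>2) \<le> ennreal (integral\<^sup>L lborel ?f)"
    by (intro ennreal_leI) (simp add: ac_simps)
  also have "\<dots> = (\<integral>\<^sup>+ y. ennreal (?f y) \<partial>lborel)"
    by (rule nn_integral_eq_integral[symmetric, OF f]) auto
  also have "\<dots> = (\<integral>\<^sup>+ y\<in>cball x e. ennreal ((v y)\<^sup>2) \<partial>lebesgue)"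
    unfolding nn_integral_lebesgue_lborel by (intro nn_integral_cong) (auto simp: indicator_def)
  finally show ?thesis .
qed

subsection \<open>The signed distance near the boundary\<close>

lemma C1_on_compose:
  fixes f :: "real^'n \<Rightarrow> real" and p :: "real^'m \<Rightarrow> real^'n"
  assumes "open U" "open W" "C1_on U f" "\<And>k. C1_on W (\<lambda>x. p x $ k)" "p ` W \<subseteq> U"
  shows "C1_on W (\<lambda>x. f (p x))"
    "x \<in> W \<Longrightarrow> pd (\<lambda>x. f (p x)) i x = (\<Sum>k\<in>UNIV. pd f k (p x) * pd (\<lambda>x. p x $ k) i x)"
proof -
  have G: "GDERIV (\<lambda>x. f (p x)) x :> (\<Sum>k\<in>UNIV. pd f k (p x) *\<^sub>R grad (\<lambda>x. p x $ k) x)" if x: "x \<in> W" for x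
  proof -
    have "((\<lambda>x. p x $ k) has_derivative (\<lambda>h. grad (\<lambda>x. p x $ k) x \<bullet> h)) (at x)" for k
      using C1_on_GDERIV[OF assms(4,2) x] unfolding GDERIV_has_derivative .
    then have 1: "(p has_derivative (\<lambda>h. \<chi> k. grad (\<lambda>x. p x $ k) x \<bullet> h)) (at x)"
      by (subst has_derivative_componentwise_within) (auto simp: Basis_vec_def inner_axis)
    have "p x \<in> U" using assms(5) x by auto
    then have 2: "(f has_derivative (\<lambda>h. grad f (p x) \<bullet> h)) (at (p x))"
      using C1_on_GDERIV[OF assms(3,1)] unfolding GDERIV_has_derivative by blast
    have "grad f (p x) \<bullet> (\<chi> k. grad (\<lambda>x. p x $ k) x \<bullet> h) = (\<Sum>k\<in>UNIV. pd f k (p x) *\<^sub>R grad (\<lambda>x. p x $ k) x) \<bullet> h" for h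
    proof -
      have "grad f (p x) \<bullet> (\<chi> k. c k) = (\<Sum>k\<in>UNIV. pd f k (p x) * c k)" for c
        by (simp add: inner_vec_def grad_def)
      then show ?thesis by (simp add: inner_sum_left)
    qed
    then show ?thesis using has_derivative_compose[OF 1 2] unfolding GDERIV_has_derivative by simp
  qed
  have "continuous_on W p"
    using continuous_on_vec_lambda[of W "\<lambda>k x. p x $ k"] C1_on_continuous[OF assms(4,2)] by simp
  then have "continuous_on W (\<lambda>x. \<Sum>k\<in>UNIV. pd f k (p x) *\<^sub>R grad (\<lambda>x. p x $ k) x)"
    by (intro continuous_on_sum continuous_on_scaleR continuous_on_compose2[OF C1_on_pd_continuous[OF assms(3)]]
      C1_on_grad_continuous assms(4,5))
  then show "C1_on W (\<lambda>x. f (p x))" using G assms(2) by (intro C1_onI[OF _ G]) auto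
  show "x \<in> W \<Longrightarrow> pd (\<lambda>x. f (p x)) i x = (\<Sum>k\<in>UNIV. pd f k (p x) * pd (\<lambda>x. p x $ k) i x)"
    using GDERIV_pd(2)[OF G, of x i] by (simp add: pd_eq_grad)
qed

lemma GDERIV_line:
  assumes "GDERIV f x :> g"
  shows "DERIV (\<lambda>t. f (x + t *\<^sub>R d)) 0 :> g \<bullet> d"
proof -
  have 1: "((\<lambda>t. x + t *\<^sub>R d) has_derivative (\<lambda>t. t *\<^sub>R d)) (at 0)"
    by (auto intro!: derivative_eq_intros)
  have 2: "(f has_derivative (\<lambda>h. g \<bullet> h)) (at (x + 0 *\<^sub>R d))"
    using assms unfolding GDERIV_has_derivative by simp
  show ?thesis using has_derivative_compose[OF 1 2]
    unfolding has_field_derivative_def by (simp add: mult_commute_abs)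
qed

text \<open>The inverse function theorem gives the derivative of the inverse pointwise as an
  \<open>inv\<close>; this supplies its continuity. For the solutions of
  \<open>A y (u y) = w\<close> one has \<open>A y0 (u y - u y0) = (A y0 - A y) (u y)\<close>, and
  \<open>A y0\<close> is bounded below by some \<open>B > 0\<close>.\<close>

lemma continuous_on_inv_blinfun:
  fixes A :: "'b::topological_space \<Rightarrow> ('a::euclidean_space \<Rightarrow>\<^sub>L 'a)"
  assumes cont: "continuous_on V A" and bij: "\<And>y. y \<in> V \<Longrightarrow> bij (blinfun_apply (A y))"
  shows "continuous_on V (\<lambda>y. inv (blinfun_apply (A y)) w)"
  unfolding continuous_on_def
proof (intro ballI tendstoI)
  fix y0 and e :: real assume y0: "y0 \<in> V" and e: "e > 0"
  let ?u = "\<lambda>y. inv (blinfun_apply (A y)) w"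
  have Au: "blinfun_apply (A y) (?u y) = w" if "y \<in> V" for y
    using bij[OF that] by (simp add: bij_is_surj surj_f_inv_f)
  obtain B where B: "B > 0" "\<And>x. B * norm x \<le> norm (blinfun_apply (A y0) x)"
    using linear_inj_bounded_below_pos[of "blinfun_apply (A y0)"] bij[OF y0]
    by (metis bij_is_inj blinfun.bounded_linear_right bounded_linear.linear)
  \<comment> \<open>The first bound keeps \<open>norm (?u y)\<close> below
    \<open>2 * norm (?u y0)\<close>; the second then makes \<open>d\<close> times that quantity
    smaller than \<open>B * e\<close>.\<close>
  define d where "d = min (B / 2) (e * B / (4 * (norm (?u y0) + 1)))"
  have d: "d > 0" using B e by (simp add: d_def add_nonneg_pos)
  have "\<forall>\<^sub>F y in at y0 within V. dist (A y) (A y0) < d"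
    using cont y0 d unfolding continuous_on_def by (blast intro: tendstoD)
  moreover have "\<forall>\<^sub>F y in at y0 within V. y \<in> V" by (simp add: eventually_at_topological) blast
  ultimately show "\<forall>\<^sub>F y in at y0 within V. dist (?u y) (?u y0) < e"
  proof eventually_elim
    case (elim y)
    have "B * norm (?u y - ?u y0) \<le> norm (blinfun_apply (A y0) (?u y - ?u y0))" by (rule B)
    also have "blinfun_apply (A y0) (?u y - ?u y0) = blinfun_apply (A y0 - A y) (?u y)"
      using Au[OF y0] Au[OF elim(2)] by (simp add: blinfun.diff_left blinfun.diff_right)
    also have "norm \<dots> \<le> norm (A y0 - A y) * norm (?u y)" by (rule norm_blinfun)
    also have "\<dots> \<le> d * norm (?u y)" using elim(1) by (intro mult_right_mono) (auto simp: dist_norm norm_minus_commute)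
    finally have 1: "B * norm (?u y - ?u y0) \<le> d * norm (?u y)" .
    have "d \<le> B / 2" unfolding d_def by (rule min.cobounded1)
    then have "d * norm (?u y) \<le> B / 2 * norm (?u y)" by (intro mult_right_mono) auto
    moreover have "norm (?u y) \<le> norm (?u y - ?u y0) + norm (?u y0)" by (metis diff_add_cancel norm_triangle_ineq)
    then have "B * norm (?u y) \<le> B * (norm (?u y - ?u y0) + norm (?u y0))" using B by simp
    ultimately have "B * norm (?u y) \<le> B * (2 * norm (?u y0))" using 1 by (simp add: algebra_simps)
    then have "norm (?u y) \<le> 2 * norm (?u y0)" using B by simp
    then have "d * norm (?u y) \<le> d * (2 * norm (?u y0))" using d by simp
    moreover have "d \<le> e * B / (4 * (norm (?u y0) + 1))" unfolding d_def by (rule min.cobounded2)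
    then have "d * (4 * (norm (?u y0) + 1)) \<le> e * B"
      by (subst (asm) pos_le_divide_eq) (simp_all add: add_nonneg_pos)
    then have "2 * (d * (2 * norm (?u y0))) + 4 * d \<le> B * e" by (simp add: algebra_simps)
    ultimately have "d * norm (?u y) < B * e" using d B e mult_pos_pos[OF B(1) e] by linarith
    then have "B * norm (?u y - ?u y0) < B * e" using 1 by linarith
    then show ?case using B by (simp add: dist_norm)
  qed
qed

locale C2_domain =
  fixes \<Omega> :: "(real^'n) set"
  assumes open_dom: "open \<Omega>" and bounded_dom: "bounded \<Omega>" and nonempty_dom: "\<Omega> \<noteq> {}"
    and chart: "\<And>p. p \<in> frontier \<Omega> \<Longrightarrow> \<exists>r>0. \<exists>\<psi>. C2_on (ball p r) \<psi> \<and> (\<forall>x\<in>ball p r. grad \<psi> x \<noteq> 0)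
      \<and> \<Omega> \<inter> ball p r = {x\<in>ball p r. \<psi> x < 0}"
begin

abbreviation "s \<equiv> sdist \<Omega>"
abbreviation "\<Gamma> \<equiv> frontier \<Omega>"

lemma compact_bdry: "compact \<Gamma>"
  using bounded_dom by (simp add: compact_frontier_bounded)

lemma compact_clos: "compact (closure \<Omega>)"
  using bounded_dom by (simp add: compact_closure)

lemma clos_eq: "closure \<Omega> = \<Omega> \<union> \<Gamma>" "\<Omega> \<inter> \<Gamma> = {}"
  using open_dom by (auto simp: frontier_def interior_open closure_def)

lemma bdry_nonempty: "\<Gamma> \<noteq> {}"
  using nonempty_dom bounded_dom frontier_eq_empty not_bounded_UNIV by metis

lemma abs_sdist: "\<bar>s x\<bar> = setdist {x} \<Gamma>"
  by (simp add: sdist_def setdist_pos_le)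

lemma sdist_neg_iff: "s x < 0 \<longleftrightarrow> x \<in> \<Omega>"
proof
  assume neg: "s x < 0"
  show "x \<in> \<Omega>"
  proof (rule ccontr)
    assume "x \<notin> \<Omega>"
    then have "s x = setdist {x} \<Gamma>" by (simp add: sdist_def)
    then show False using neg setdist_pos_le[of "{x}" \<Gamma>] by linarith
  qed
next
  assume x: "x \<in> \<Omega>"
  then have "x \<notin> \<Gamma>" using clos_eq by auto
  then have "setdist {x} \<Gamma> \<noteq> 0"
    using setdist_eq_0_sing_1[of x \<Gamma>] bdry_nonempty by (simp add: closure_closed)
  then have "setdist {x} \<Gamma> > 0" using setdist_pos_le[of "{x}" \<Gamma>] by linarith
  then show "s x < 0" using x unfolding sdist_def by simp
qed

lemma sdist_zero_iff: "s x = 0 \<longleftrightarrow> x \<in> \<Gamma>"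
proof -
  have "setdist {x} \<Gamma> = 0 \<longleftrightarrow> x \<in> \<Gamma>"
    using setdist_eq_0_sing_1[of x \<Gamma>] bdry_nonempty by (simp add: closure_closed)
  then show ?thesis using abs_sdist[of x] by (metis abs_eq_0)
qed

lemma nearest_exists: "\<exists>q\<in>\<Gamma>. dist x q = \<bar>s x\<bar>"
  using setdist_closed_compact[OF closed_singleton[of x] compact_bdry] bdry_nonempty by (auto simp: abs_sdist)

lemma abs_sdist_le: "q \<in> \<Gamma> \<Longrightarrow> \<bar>s x\<bar> \<le> dist x q"
  unfolding abs_sdist by (rule setdist_le_dist) auto

text \<open>The segment meets the boundary in some \<open>q\<close>, and each distance is at most
  the part of the segment on its side of \<open>q\<close>. The sum on the left is what makes the
  signed distance 1-Lipschitz across the boundary.\<close>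

lemma opposite_sides:
  assumes "x \<in> \<Omega>" "y \<notin> \<Omega>" shows "\<bar>s x\<bar> + \<bar>s y\<bar> \<le> dist x y"
proof -
  have "closed_segment x y \<inter> \<Gamma> \<noteq> {}"
    by (rule connected_Int_frontier) (use assms in auto)
  then obtain q where q: "q \<in> closed_segment x y" "q \<in> \<Gamma>" by blast
  have "dist x q + dist q y = dist x y"
    using q(1) by (metis between between_mem_segment)
  then show ?thesis using abs_sdist_le[OF q(2), of x] abs_sdist_le[OF q(2), of y] by (simp add: dist_commute)
qed

lemma sdist_Lipschitz: "\<bar>s x - s y\<bar> \<le> dist x y"
proof -
  have a: "\<bar>s x - s y\<bar> \<le> dist x y" if "(x \<in> \<Omega>) = (y \<in> \<Omega>)" for x y
    using setdist_Lipschitz[of x \<Gamma> y] that unfolding sdist_def by (auto simp: abs_minus_commute)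
  have b: "\<bar>s x - s y\<bar> \<le> dist x y" if "x \<in> \<Omega>" "y \<notin> \<Omega>" for x y
    using opposite_sides[OF that] by linarith
  show ?thesis using a b[of x y] b[of y x] by (metis abs_minus_commute dist_commute)
qed

lemma continuous_sdist: "continuous_on S s"
proof -
  have "isCont s x" for x unfolding continuous_at_eps_delta
    by (metis sdist_Lipschitz dist_real_def le_less_trans)
  then show ?thesis by (simp add: continuous_at_imp_continuous_on)
qed

lemma closure_sdist: "closure \<Omega> = {x. s x \<le> 0}"
  using clos_eq sdist_neg_iff sdist_zero_iff by (auto simp: order_le_less)

text \<open>A boundary point lies in the closure of the domain, which excludes
  \<open>\<psi> > 0\<close>. Conversely, the gradient does not vanish, so moving from a zero of
  \<open>\<psi>\<close> against the gradient enters the domain and the zero lies in its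
  closure.\<close>

lemma chart_bdry:
  assumes p: "p \<in> \<Gamma>" and psi: "C2_on (ball p r) \<psi>" "\<forall>x\<in>ball p r. grad \<psi> x \<noteq> 0"
    "\<Omega> \<inter> ball p r = {x\<in>ball p r. \<psi> x < 0}" and x: "x \<in> ball p r"
  shows "x \<in> \<Gamma> \<longleftrightarrow> \<psi> x = 0"
proof
  have psi3: "y \<in> \<Omega> \<longleftrightarrow> \<psi> y < 0" if "y \<in> ball p r" for y using psi(3) that by blast
  have C1: "C1_on (ball p r) \<psi>" using C2_on_C1(1)[OF open_ball psi(1)] .
  have cont: "continuous_on (ball p r) \<psi>" using C1_on_continuous[OF C1 open_ball] .
  {
    assume "x \<in> \<Gamma>"
    then have "x \<notin> \<Omega>" "x \<in> closure \<Omega>" using clos_eq by auto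
    then have "\<psi> x \<ge> 0" using psi3[OF x] by simp
    moreover have "\<not> \<psi> x > 0"
    proof
      assume pos: "\<psi> x > 0"
      have "open (ball p r \<inter> \<psi> -` {0<..})"
        using continuous_open_preimage[OF cont open_ball open_greaterThan] .
      then have "ball p r \<inter> \<psi> -` {0<..} \<inter> \<Omega> \<noteq> {}"
        using \<open>x \<in> closure \<Omega>\<close> x pos open_Int_closure_eq_empty by fastforce
      then obtain y where "y \<in> ball p r" "\<psi> y > 0" "y \<in> \<Omega>" by auto
      then show False using psi3[of y] by simp
    qed
    ultimately show "\<psi> x = 0" by simp
  }
  assume 0: "\<psi> x = 0"
  define g where "g = grad \<psi> x"
  have g: "g \<noteq> 0" using psi(2) x by (simp add: g_def)
  have "DERIV (\<lambda>t. \<psi> (x + t *\<^sub>R (- g))) 0 :> - (g \<bullet> g)"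
    using GDERIV_line[OF C1_on_GDERIV[OF C1 open_ball x], of "- g"] by (simp add: g_def)
  from DERIV_neg_dec_right[OF this] obtain d where d: "d > 0" "\<And>h. 0 < h \<Longrightarrow> h < d \<Longrightarrow> \<psi> (x + h *\<^sub>R (- g)) < 0"
    using g 0 by auto
  have "x \<in> closure \<Omega>" unfolding closure_approachable
  proof (intro allI impI)
    fix e :: real assume e: "e > 0"
    obtain e' where e': "e' > 0" "ball x e' \<subseteq> ball p r" using x open_ball openE by blast
    define h where "h = min (d / 2) (min e e' / (2 * norm g))"
    have h: "0 < h" "h < d" using d e e' g by (auto simp: h_def)
    have "h * norm g \<le> min e e' / (2 * norm g) * norm g" by (intro mult_right_mono) (auto simp: h_def)
    also have "\<dots> = min e e' / 2" using g by simp
    also have "\<dots> < min e e'"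
    proof -
      have "m / 2 < m" if "0 < m" for m :: real using that by simp
      then show ?thesis using e e' by (meson min_less_iff_conj)
    qed
    finally have "dist (x + h *\<^sub>R (- g)) x < min e e'" using h by (simp add: dist_norm)
    moreover from this have "x + h *\<^sub>R (- g) \<in> ball p r"
      by (intro subsetD[OF e'(2)]) (simp add: dist_commute)
    then have "x + h *\<^sub>R (- g) \<in> \<Omega>" using d(2)[OF h] psi3 by blast
    ultimately show "\<exists>y\<in>\<Omega>. dist y x < e" by (intro bexI[of _ "x + h *\<^sub>R (- g)"]) simp_all
  qed
  moreover have "x \<notin> \<Omega>" using psi3[OF x] 0 by simp
  ultimately show "x \<in> \<Gamma>" using clos_eq by auto
qed

text \<open>A half-space inside another one has the same normal. Testing with
  \<open>e *\<^sub>R w - \<tau>\<close>, where \<open>\<tau>\<close> is the part of \<open>g\<close>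
  orthogonal to \<open>w\<close>, forces \<open>\<tau> = 0\<close>.\<close>

lemma sphere_normal:
  fixes g w :: "real^'n"
  assumes "\<And>d. d \<bullet> w > 0 \<Longrightarrow> g \<bullet> d \<ge> 0" "g \<noteq> 0" "w \<noteq> 0"
  shows "\<exists>a>0. w = a *\<^sub>R g"
proof -
  define a where "a = (g \<bullet> w) / (w \<bullet> w)"
  define \<tau> where "\<tau> = g - a *\<^sub>R w"
  have ww: "w \<bullet> w > 0" using assms by simp
  have tw: "\<tau> \<bullet> w = 0" using ww by (simp add: \<tau>_def a_def inner_diff_left)
  have gt: "g \<bullet> \<tau> = \<tau> \<bullet> \<tau>" using tw by (simp add: \<tau>_def inner_diff_left inner_diff_right inner_commute)
  have "\<tau> = 0"
  proof (rule ccontr)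
    assume "\<tau> \<noteq> 0"
    then have tt: "\<tau> \<bullet> \<tau> > 0" by simp
    \<comment> \<open>Small enough that \<open>e * (g \<bullet> w)\<close> is at most half of
      \<open>\<tau> \<bullet> \<tau>\<close>; the added 1 keeps the denominator positive.\<close>
    define e where "e = (\<tau> \<bullet> \<tau>) / (2 * (\<bar>g \<bullet> w\<bar> + 1))"
    have e: "e > 0" using tt by (simp add: e_def add_nonneg_pos)
    have "(e *\<^sub>R w - \<tau>) \<bullet> w > 0" using e ww tw by (simp add: inner_diff_left)
    from assms(1)[OF this] have "e * (g \<bullet> w) \<ge> \<tau> \<bullet> \<tau>" using gt by (simp add: inner_diff_right)
    moreover have "e * (g \<bullet> w) \<le> e * (\<bar>g \<bullet> w\<bar> + 1)" using e by simp
    moreover have half: "y / (2 * c) * c = y / 2" if "c \<noteq> 0" for y c :: real using that by simp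
    have "e * (\<bar>g \<bullet> w\<bar> + 1) = (\<tau> \<bullet> \<tau>) / 2" unfolding e_def by (rule half) linarith
    ultimately show False using tt by linarith
  qed
  then have g: "g = a *\<^sub>R w" by (simp add: \<tau>_def)
  have "a \<ge> 0" using assms(1)[of w] ww by (simp add: a_def)
  moreover have "a \<noteq> 0" using g assms(2) by auto
  ultimately show ?thesis using g by (intro exI[of _ "1 / a"]) simp
qed

text \<open>The ball of radius \<open>\<bar>s x\<bar>\<close> about \<open>x\<close> does not cross
  the boundary, so \<open>\<psi>\<close> has one sign in it. Every direction with
  \<open>d \<bullet> w > 0\<close> points from \<open>q\<close> into this ball, hence
  \<open>\<sigma> * \<psi>\<close> cannot decrease along it, and \<open>sphere_normal\<close> makes
  \<open>x - q\<close> parallel to the gradient. The multiplier \<open>l\<close> carries the sign of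
  \<open>s x\<close>.\<close>

lemma nearest_normal:
  assumes p: "p \<in> \<Gamma>" and psi: "C2_on (ball p r) \<psi>" "\<forall>x\<in>ball p r. grad \<psi> x \<noteq> 0"
    "\<Omega> \<inter> ball p r = {x\<in>ball p r. \<psi> x < 0}"
    and q: "q \<in> \<Gamma>" "q \<in> ball p r" and near: "dist x q = \<bar>s x\<bar>"
  shows "\<exists>l. x = q + l *\<^sub>R grad \<psi> q \<and> s x = l * norm (grad \<psi> q)"
proof (cases "x = q")
  case True
  then show ?thesis using near by (intro exI[of _ 0]) auto
next
  case False
  define w where "w = x - q"
  have w: "w \<noteq> 0" "norm w = \<bar>s x\<bar>" using False near by (auto simp: w_def dist_norm)
  define \<sigma> where "\<sigma> = sgn (s x)"
  define g where "g = grad \<psi> q"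
  have sig: "s x \<noteq> 0" "\<sigma> = 1 \<or> \<sigma> = -1" using w by (auto simp: \<sigma>_def sgn_if)
  have psi3: "y \<in> \<Omega> \<longleftrightarrow> \<psi> y < 0" if "y \<in> ball p r" for y using psi(3) that by blast
  have C1: "C1_on (ball p r) \<psi>" using C2_on_C1(1)[OF open_ball psi(1)] .
  have side: "\<sigma> * \<psi> y \<ge> 0" if y: "y \<in> ball p r" "dist x y < norm w" for y
  proof -
    have "(x \<in> \<Omega>) = (y \<in> \<Omega>)"
    proof (rule ccontr)
      assume "(x \<in> \<Omega>) \<noteq> (y \<in> \<Omega>)"
      then have "\<bar>s x\<bar> + \<bar>s y\<bar> \<le> dist x y"
        using opposite_sides[of x y] opposite_sides[of y x] by (auto simp: dist_commute)
      then show False using y w by linarith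
    qed
    then have "s x < 0 \<longleftrightarrow> \<psi> y < 0" using psi3[OF y(1)] sdist_neg_iff[of x] by simp
    then show ?thesis using sig(1) by (cases "s x < 0") (simp_all add: \<sigma>_def)
  qed
  have "(\<sigma> *\<^sub>R g) \<bullet> d \<ge> 0" if d: "d \<bullet> w > 0" for d
  proof (rule ccontr)
    assume neg: "\<not> (\<sigma> *\<^sub>R g) \<bullet> d \<ge> 0"
    have "DERIV (\<lambda>t. \<psi> (q + t *\<^sub>R d)) 0 :> g \<bullet> d"
      using GDERIV_line[OF C1_on_GDERIV[OF C1 open_ball q(2)], of d] by (simp add: g_def)
    then have "DERIV (\<lambda>t. \<sigma> * \<psi> (q + t *\<^sub>R d)) 0 :> \<sigma> * (g \<bullet> d)" by (rule DERIV_cmult)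
    moreover have "\<sigma> * (g \<bullet> d) < 0" using neg by simp
    ultimately obtain h0 where h0: "h0 > 0" "\<forall>h>0. h < h0 \<longrightarrow> \<sigma> * \<psi> (q + (0 + h) *\<^sub>R d) < \<sigma> * \<psi> (q + 0 *\<^sub>R d)"
      using DERIV_neg_dec_right by blast
    have pq: "\<psi> q = 0" using chart_bdry[OF p psi q(2)] q(1) by simp
    obtain e where e: "e > 0" "ball q e \<subseteq> ball p r" using q(2) open_ball openE by blast
    have dn: "d \<noteq> 0" using d by auto
    \<comment> \<open>The three bounds preserve the decrease of \<open>\<sigma> * \<psi>\<close>,
      membership in the chart, and \<open>h * (d \<bullet> d) \<le> d \<bullet> w\<close>; the last
      one puts \<open>q + h *\<^sub>R d\<close> strictly inside the ball about \<open>x\<close>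
      through \<open>q\<close>.\<close>
    define h where "h = min (h0 / 2) (min (e / (2 * norm d)) (d \<bullet> w / (d \<bullet> d)))"
    have h: "0 < h" "h < h0" using h0 e dn d by (auto simp: h_def)
    have "h * norm d \<le> e / (2 * norm d) * norm d" by (intro mult_right_mono) (auto simp: h_def)
    also have "\<dots> = e / 2" using dn by simp
    finally have in1: "q + h *\<^sub>R d \<in> ball p r" using e h by (intro subsetD[OF e(2)]) (auto simp: dist_norm)
    have hd: "h * (d \<bullet> d) \<le> d \<bullet> w"
    proof -
      have "h * (d \<bullet> d) \<le> d \<bullet> w / (d \<bullet> d) * (d \<bullet> d)" by (intro mult_right_mono) (auto simp: h_def)
      then show ?thesis using dn by simp
    qed
    have "(norm (w - h *\<^sub>R d))\<^sup>2 = w \<bullet> w - 2 * h * (d \<bullet> w) + h * (h * (d \<bullet> d))"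
      unfolding power2_norm_eq_inner by (simp add: inner_diff_left inner_diff_right inner_commute algebra_simps)
    also have "\<dots> \<le> w \<bullet> w - 2 * h * (d \<bullet> w) + h * (d \<bullet> w)" using hd h by simp
    also have "\<dots> < w \<bullet> w" using h d by simp
    finally have "(norm (w - h *\<^sub>R d))\<^sup>2 < (norm w)\<^sup>2" by (simp add: power2_norm_eq_inner)
    then have "norm (w - h *\<^sub>R d) < norm w" by (rule power2_less_imp_less) simp
    then have "dist x (q + h *\<^sub>R d) < norm w" by (simp add: dist_norm w_def algebra_simps)
    from side[OF in1 this] h0(2) h pq show False by auto
  qed
  moreover have "\<sigma> *\<^sub>R g \<noteq> 0" using psi(2) q(2) sig by (auto simp: g_def)
  ultimately obtain a where a: "a > 0" "w = a *\<^sub>R (\<sigma> *\<^sub>R g)" using sphere_normal w(1) by blast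
  have "s x = \<sigma> * norm w" using w(2) by (simp add: \<sigma>_def sgn_mult_abs mult.commute abs_mult_sgn)
  also have "norm w = a * norm g" using a sig by auto
  finally show ?thesis using a(2) by (intro exI[of _ "a * \<sigma>"]) (auto simp: g_def w_def algebra_simps)
qed

end

lemma has_derivative_GDERIV:
  fixes f :: "real^'n \<Rightarrow> real"
  assumes "(f has_derivative f') (at x)"
  shows "GDERIV f x :> (\<chi> i. f' (axis i 1))"
proof -
  have l: "linear f'" using assms has_derivative_linear by blast
  have "f' h = (\<chi> i. f' (axis i 1)) \<bullet> h" for h
  proof -
    have "f' h = f' (\<Sum>i\<in>UNIV. h $ i *\<^sub>R axis i 1)" by (simp add: sum_axis_eq)
    also have "\<dots> = (\<Sum>i\<in>UNIV. h $ i * f' (axis i 1))"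
      using l by (simp add: linear_sum linear_cmul)
    finally show ?thesis by (simp add: inner_vec_def mult.commute)
  qed
  then have "f' = (\<lambda>h. (\<chi> i. f' (axis i 1)) \<bullet> h)" by blast
  then show ?thesis using assms unfolding GDERIV_has_derivative by simp
qed

lemma grad_has_derivative:
  fixes f :: "real^'n \<Rightarrow> real"
  assumes "C2_on U f" "open U" "x \<in> U"
  shows "(grad f has_derivative (\<lambda>h. \<chi> j. grad (pd f j) x \<bullet> h)) (at x)"
proof -
  have "((\<lambda>x. grad f x $ k) has_derivative (\<lambda>h. grad (pd f k) x \<bullet> h)) (at x)" for k
    using C1_on_GDERIV[OF C2_on_C1(2)[OF assms(2,1)] assms(2,3)]
    unfolding GDERIV_has_derivative by (simp add: grad_def[of f])
  then show ?thesis
    by (subst has_derivative_componentwise_within) (auto simp: Basis_vec_def inner_axis)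
qed

context C2_domain
begin

text \<open>The nearest point \<open>q\<close> of \<open>x\<close> solves \<open>x = q + l *\<^sub>R grad \<psi> q\<close>, \<open>\<psi> q = 0\<close>, a system that the inverse
  function theorem solves for \<open>(q, l)\<close>.\<close>

lemma projection_chart:
  assumes p: "p \<in> \<Gamma>" and r: "r > 0" and psi: "C2_on (ball p r) \<psi>" "\<forall>x\<in>ball p r. grad \<psi> x \<noteq> 0"
    "\<Omega> \<inter> ball p r = {x\<in>ball p r. \<psi> x < 0}"
  obtains \<delta> \<pi> where "\<delta> > 0" "\<delta> \<le> r" "\<And>k. C1_on (ball p \<delta>) (\<lambda>x. \<pi> x $ k)"
    "\<And>x q. x \<in> ball p \<delta> \<Longrightarrow> q \<in> \<Gamma> \<Longrightarrow> dist x q = \<bar>s x\<bar> \<Longrightarrow> q = \<pi> x \<and> q \<in> ball p r"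
proof -
  let ?U = "ball p r \<times> (UNIV :: real set)"
  have C: "C1_on (ball p r) \<psi>" "\<And>k. C1_on (ball p r) (pd \<psi> k)" using C2_on_C1[OF open_ball psi(1)] by auto
  have gc: "continuous_on (ball p r) (grad \<psi>)" "\<And>k. continuous_on (ball p r) (grad (pd \<psi> k))"
    using C C1_on_grad_continuous by auto
  define T where "T z = (fst z + snd z *\<^sub>R grad \<psi> (fst z), \<psi> (fst z))" for z
  define H where "H q h = (\<chi> j. grad (pd \<psi> j) q \<bullet> h)" for q h
  define F where "F z w = (fst w + (snd z *\<^sub>R H (fst z) (fst w) + snd w *\<^sub>R grad \<psi> (fst z)), grad \<psi> (fst z) \<bullet> fst w)" for z w :: "(real^'n) \<times> real"
  have oU: "open ?U" by (intro open_Times) auto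
  have dT: "(T has_derivative F z) (at z)" if z: "z \<in> ?U" for z
  proof -
    have zz: "fst z \<in> ball p r" using z by auto
    have 1: "((\<lambda>z. grad \<psi> (fst z)) has_derivative (\<lambda>w. H (fst z) (fst w))) (at z)"
      using has_derivative_compose[OF has_derivative_fst[OF has_derivative_ident] grad_has_derivative[OF psi(1) open_ball zz]]
      unfolding H_def by simp
    have "(\<psi> has_derivative (\<lambda>h. grad \<psi> (fst z) \<bullet> h)) (at (fst z))"
      using C1_on_GDERIV[OF C(1) open_ball zz] unfolding GDERIV_has_derivative .
    then have 2: "((\<lambda>z. \<psi> (fst z)) has_derivative (\<lambda>w. grad \<psi> (fst z) \<bullet> fst w)) (at z)"
      by (rule has_derivative_compose[OF has_derivative_fst[OF has_derivative_ident]])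
    show ?thesis unfolding T_def[abs_def] F_def[abs_def]
      by (intro has_derivative_Pair has_derivative_add has_derivative_fst has_derivative_ident 2
         has_derivative_eq_rhs[OF has_derivative_scaleR[OF has_derivative_snd[OF has_derivative_ident] 1]]) auto
  qed
  have bl: "bounded_linear (F z)" if "z \<in> ?U" for z using dT[OF that] has_derivative_bounded_linear by blast
  define T' where "T' z = Blinfun (F z)" for z
  have T': "blinfun_apply (T' z) = F z" if "z \<in> ?U" for z
    unfolding T'_def using bounded_linear_Blinfun_apply[OF bl[OF that]] .
  have contT': "continuous_on ?U T'"
  proof (rule continuous_on_blinfun_componentwise)
    fix w :: "(real^'n) \<times> real"
    have "continuous_on ?U (\<lambda>z. F z w)"
      unfolding F_def H_def
      by (intro continuous_on_Pair continuous_on_add continuous_on_scaleR continuous_on_inner continuous_on_vec_lambda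
         continuous_on_compose2[OF gc(1)] continuous_on_compose2[OF gc(2)] continuous_intros) auto
    then show "continuous_on ?U (\<lambda>z. blinfun_apply (T' z) w)"
      by (subst continuous_on_cong[OF refl]) (auto simp: T')
  qed
  define g where "g = grad \<psi> p"
  have g: "g \<noteq> 0" using psi(2) r by (auto simp: g_def)
  have p0: "(p, 0) \<in> ?U" using r by auto
  \<comment> \<open>At \<open>(p, 0)\<close> the Hessian term drops out and the derivative maps
    \<open>(a, m)\<close> to \<open>(a + m *\<^sub>R g, g \<bullet> a)\<close>; pairing the first
    component with \<open>g\<close> recovers \<open>m\<close>.\<close>
  define inv0 where "inv0 w = (fst w - ((g \<bullet> fst w - snd w) / (g \<bullet> g)) *\<^sub>R g, (g \<bullet> fst w - snd w) / (g \<bullet> g))" for w :: "(real^'n) \<times> real"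
  have "linear inv0"
    by (rule linearI) (auto simp: inv0_def inner_add_right algebra_simps add_divide_distrib diff_divide_distrib scaleR_add_left)
  then have "bounded_linear inv0" using linear_conv_bounded_linear by blast
  then have inv0: "blinfun_apply (Blinfun inv0) = inv0" by (rule bounded_linear_Blinfun_apply)
  have invid: "Blinfun inv0 o\<^sub>L T' (p, 0) = id_blinfun"
  proof (rule blinfun_eqI)
    fix w :: "(real^'n) \<times> real"
    have "inv0 (F (p, 0) w) = w"
      using g by (simp add: inv0_def F_def g_def[symmetric] inner_add_right)
    then show "blinfun_apply (Blinfun inv0 o\<^sub>L T' (p, 0)) w = blinfun_apply id_blinfun w"
      by (simp add: inv0 T'[OF p0])
  qed
  have T0: "T (p, 0) = (p, 0)"
    using chart_bdry[OF p psi, of p] p r by (simp add: T_def)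
  obtain U' V G G' where U': "open U'" "U' \<subseteq> ?U" "(p, 0) \<in> U'" and V: "open V" "(p, 0) \<in> V"
    and hom: "homeomorphism U' V T G" and dG: "\<And>y. y \<in> V \<Longrightarrow> (G has_derivative (G' y)) (at y)"
    and G': "\<And>y. y \<in> V \<Longrightarrow> G' y = inv (blinfun_apply (T' (G y)))"
    and bij: "\<And>y. y \<in> V \<Longrightarrow> bij (blinfun_apply (T' (G y)))"
    using inverse_function_theorem[OF oU _ contT' p0 invid, of T] dT T' T0 by (metis (no_types, lifting))
  define \<pi> where "\<pi> x = fst (G (x, 0))" for x
  define W where "W = (\<lambda>x. (x, 0::real)) -` V"
  have oW: "open W" unfolding W_def by (rule continuous_open_vimage) (auto intro!: continuous_intros V)
  have pW: "p \<in> W" using V by (simp add: W_def)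
  have GV: "continuous_on V G" "G ` V \<subseteq> U'" using hom by (auto simp: homeomorphism_def)
  have G'c: "continuous_on V (\<lambda>y. G' y w)" for w
  proof -
    have "continuous_on V (\<lambda>y. inv (blinfun_apply (T' (G y))) w)"
      by (rule continuous_on_inv_blinfun[OF _ bij])
         (rule continuous_on_compose2[OF contT' GV(1)], use GV(2) U'(2) in auto)
    then show ?thesis by (subst continuous_on_cong[OF refl]) (auto simp: G')
  qed
  have piC1: "C1_on W (\<lambda>x. \<pi> x $ k)" for k
  proof (rule C1_onI[OF oW])
    fix x assume "x \<in> W"
    then have "(x, 0) \<in> V" by (simp add: W_def)
    have "((\<lambda>x. (x, 0::real)) has_derivative (\<lambda>h. (h, 0))) (at x)"
      by (intro has_derivative_Pair has_derivative_ident has_derivative_const)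
    from has_derivative_compose[OF this dG[OF \<open>(x, 0) \<in> V\<close>]]
    have "((\<lambda>x. G (x, 0)) has_derivative (\<lambda>h. G' (x, 0) (h, 0))) (at x)" .
    then have "((\<lambda>x. \<pi> x $ k) has_derivative (\<lambda>h. fst (G' (x, 0) (h, 0)) $ k)) (at x)"
      unfolding \<pi>_def by (intro bounded_linear.has_derivative[OF bounded_linear_vec_nth] has_derivative_fst)
    then show "GDERIV (\<lambda>x. \<pi> x $ k) x :> (\<chi> i. fst (G' (x, 0) (axis i 1, 0)) $ k)"
      by (rule has_derivative_GDERIV)
  next
    show "continuous_on W (\<lambda>x. \<chi> i. fst (G' (x, 0) (axis i 1, 0)) $ k)"
      by (intro continuous_on_vec_lambda continuous_on_component continuous_on_fst continuous_on_compose2[OF G'c] continuous_intros)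
         (auto simp: W_def)
  qed
  obtain A B where AB: "open A" "open B" "(p, 0) \<in> A \<times> B" "A \<times> B \<subseteq> U'"
    by (rule open_prod_elim[OF U'(1,3)])
  have "p \<in> ball p r" using r by simp
  then have "isCont (grad \<psi>) p" using gc(1) continuous_on_eq_continuous_at[OF open_ball] by blast
  moreover have "norm g / 2 > 0" using g by simp
  ultimately obtain \<rho>2 where \<rho>2: "\<rho>2 > 0" "\<And>q. dist q p < \<rho>2 \<Longrightarrow> dist (grad \<psi> q) g < norm g / 2"
    unfolding continuous_at_eps_delta g_def by blast
  obtain a where a: "a > 0" "ball p a \<subseteq> A" using AB openE by blast
  obtain b where b: "b > 0" "ball 0 b \<subseteq> B" using AB openE by blast
  obtain w where w: "w > 0" "ball p w \<subseteq> W" using oW pW openE by blast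
  \<comment> \<open>Every nearest point is then within \<open>2 * \<delta>\<close> of
    \<open>p\<close> and its parameter is below \<open>b\<close> in absolute value, so
    \<open>(q, l)\<close> lies in \<open>U'\<close>, where \<open>G\<close> inverts
    \<open>T\<close>; this identifies the nearest point as the value of
    \<open>\<pi>\<close>.\<close>
  define \<delta> where "\<delta> = min (min (a / 2) (b * norm g / 4)) (min w (min (\<rho>2 / 2) (r / 2)))"
  have d: "\<delta> > 0" "2 * \<delta> \<le> a" "\<delta> \<le> b * norm g / 4" "\<delta> \<le> w" "2 * \<delta> \<le> \<rho>2" "2 * \<delta> \<le> r"
    using a b w \<rho>2 r g by (auto simp: \<delta>_def min_def)
  show ?thesis
  proof (rule that[of \<delta> \<pi>])
    show "\<delta> > 0" "\<delta> \<le> r" using d by auto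
    show "C1_on (ball p \<delta>) (\<lambda>x. \<pi> x $ k)" for k
      by (rule C1_on_subset[OF piC1]) (use w d in auto)
  next
    fix x q assume x: "x \<in> ball p \<delta>" and q: "q \<in> \<Gamma>" "dist x q = \<bar>s x\<bar>"
    have xq: "dist x q < \<delta>" using abs_sdist_le[OF p, of x] x q by (simp add: dist_commute)
    have pq: "dist p q < 2 * \<delta>" using dist_triangle[of p q x] x xq by (simp add: dist_commute)
    have qb: "q \<in> ball p r" using pq d by simp
    obtain l where l: "x = q + l *\<^sub>R grad \<psi> q" "s x = l * norm (grad \<psi> q)"
      using nearest_normal[OF p psi q(1) qb q(2)] by blast
    have ng: "norm (grad \<psi> q) > norm g / 2"
    proof -
      have "dist (grad \<psi> q) g < norm g / 2" using \<rho>2(2)[of q] pq d by (simp add: dist_commute)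
      moreover have "norm g \<le> norm (grad \<psi> q) + dist (grad \<psi> q) g"
        by (metis dist_commute dist_norm norm_triangle_sub)
      ultimately show ?thesis by linarith
    qed
    have "\<bar>l\<bar> * norm (grad \<psi> q) < \<delta>" using xq q l(2) by (simp add: abs_mult)
    moreover have "\<bar>l\<bar> * (norm g / 2) \<le> \<bar>l\<bar> * norm (grad \<psi> q)" using ng by (intro mult_left_mono) auto
    ultimately have "\<bar>l\<bar> * (norm g / 2) < b * norm g / 4" using d by linarith
    then have "\<bar>l\<bar> * norm g < b * norm g" using b g by (simp add: field_simps)
    then have "\<bar>l\<bar> < b" by (rule mult_right_less_imp_less) simp
    then have "l \<in> B" using b by (intro subsetD[OF b(2)]) (simp add: dist_norm)
    moreover have "q \<in> A" using a pq d by (intro subsetD[OF a(2)]) simp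
    ultimately have "(q, l) \<in> U'" using AB by auto
    then have "G (T (q, l)) = (q, l)" using hom by (simp add: homeomorphism_def)
    moreover have "T (q, l) = (x, 0)" using l(1) chart_bdry[OF p psi qb] q(1) by (simp add: T_def)
    ultimately show "q = \<pi> x \<and> q \<in> ball p r" using qb by (simp add: \<pi>_def)
  qed
qed

text \<open>The projection \<open>\<pi>\<close> and the unit normal \<open>n\<close> are only C^1,
  so the formula \<open>s x = (x - \<pi> x) \<bullet> n x\<close> by itself shows only that
  \<open>s\<close> is C^1. Differentiating it, the terms with derivatives of \<open>n\<close> and of
  \<open>\<pi>\<close> vanish, since \<open>n\<close> has constant length and \<open>\<pi>\<close>
  moves within the boundary. What remains is \<open>grad s = n\<close>, and one more derivative is
  available.\<close>

lemma sdist_C2_local: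
  assumes p: "p \<in> \<Gamma>"
  shows "\<exists>\<delta>>0. C2_on (ball p \<delta>) s \<and> (\<forall>x\<in>ball p \<delta>. norm (grad s x) = 1) \<and>
    (\<forall>x\<in>ball p \<delta>. \<forall>q\<in>\<Gamma>. dist x q = \<bar>s x\<bar> \<longrightarrow> x = q + s x *\<^sub>R grad s q \<and> grad s x = grad s q)"
proof -
  from chart[OF p] obtain r \<psi> where r: "r > 0" and psi: "C2_on (ball p r) \<psi>" "\<forall>x\<in>ball p r. grad \<psi> x \<noteq> 0"
    "\<Omega> \<inter> ball p r = {x\<in>ball p r. \<psi> x < 0}" by blast
  obtain \<delta> \<pi> where d: "\<delta> > 0" "\<delta> \<le> r" and piC: "\<And>k. C1_on (ball p \<delta>) (\<lambda>x. \<pi> x $ k)"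
    and pi: "\<And>x q. x \<in> ball p \<delta> \<Longrightarrow> q \<in> \<Gamma> \<Longrightarrow> dist x q = \<bar>s x\<bar> \<Longrightarrow> q = \<pi> x \<and> q \<in> ball p r"
    by (rule projection_chart[OF p r psi]) blast
  let ?B = "ball p \<delta>"
  have oB: "open ?B" by simp
  have piB: "\<pi> x \<in> \<Gamma>" "\<pi> x \<in> ball p r" "dist x (\<pi> x) = \<bar>s x\<bar>" if "x \<in> ?B" for x
    using nearest_exists[of x] pi[OF that] by auto
  have C: "C1_on (ball p r) \<psi>" "\<And>k. C1_on (ball p r) (pd \<psi> k)" using C2_on_C1[OF open_ball psi(1)] by auto
  define R where "R x = (\<Sum>j\<in>UNIV. pd \<psi> j x * pd \<psi> j x)" for x
  have RN: "R x = (norm (grad \<psi> x))\<^sup>2" for x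
    unfolding power2_norm_eq_inner by (simp add: R_def inner_vec_def grad_def)
  have Rpos: "R x > 0" if "x \<in> ball p r" for x using psi(2) that by (simp add: RN)
  define n where "n k x = R (\<pi> x) powr (-1/2) * pd \<psi> k (\<pi> x)" for k x
  have sub: "\<pi> ` ?B \<subseteq> ball p r" using piB(2) by auto
  have RC: "C1_on ?B (\<lambda>x. R (\<pi> x))"
  proof (rule C1_on_compose(1)[OF open_ball oB _ piC sub])
    show "C1_on (ball p r) R" unfolding R_def[abs_def]
      by (intro C1_on_sum C1_on_mult C open_ball) auto
  qed
  have nC: "C1_on ?B (n k)" for k
    unfolding n_def[abs_def]
  proof (rule C1_on_mult[OF oB])
    show "C1_on ?B (\<lambda>x. pd \<psi> k (\<pi> x))" by (rule C1_on_compose(1)[OF open_ball oB C(2) piC sub])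
    show "C1_on ?B (\<lambda>x. R (\<pi> x) powr (-1/2))"
    proof (rule C1_on_real_compose[OF oB RC, where T="{0<..}" and \<phi>'="\<lambda>t. (-1/2) * t powr (-1/2 - 1)"])
      fix t :: real assume "t \<in> {0<..}"
      then show "DERIV (\<lambda>t. t powr (-1/2)) t :> (-1/2) * t powr (-1/2 - 1)"
        by (intro has_real_derivative_powr) auto
    next
      show "continuous_on {0<..} (\<lambda>t::real. (-1/2) * t powr (-1/2 - 1))"
        by (intro continuous_intros) auto
      show "(\<lambda>x. R (\<pi> x)) ` ?B \<subseteq> {0<..}" using Rpos piB(2) by auto
    qed
  qed
  have powr: "R (\<pi> x) powr (-1/2) = 1 / norm (grad \<psi> (\<pi> x))" if "x \<in> ?B" for x
  proof -
    have "(-1/2::real) = -(1/2)" by simp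
    then have "R (\<pi> x) powr (-1/2) = inverse (R (\<pi> x) powr (1/2))" by (simp only: powr_minus)
    also have "R (\<pi> x) powr (1/2) = sqrt (R (\<pi> x))"
      using Rpos[OF piB(2)[OF that]] by (simp add: powr_half_sqrt)
    finally show ?thesis by (simp add: RN inverse_eq_divide)
  qed
  have nn: "(\<chi> k. n k x) = (1 / norm (grad \<psi> (\<pi> x))) *\<^sub>R grad \<psi> (\<pi> x)" if "x \<in> ?B" for x
    using powr[OF that] by (simp add: n_def grad_def vec_eq_iff)
  have nsq: "(\<Sum>k\<in>UNIV. n k x * n k x) = 1" if x: "x \<in> ?B" for x
  proof -
    have "(\<Sum>k\<in>UNIV. n k x * n k x) = (\<chi> k. n k x) \<bullet> (\<chi> k. n k x)" by (simp add: inner_vec_def)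
    also have "\<dots> = 1" unfolding nn[OF x] using psi(2) piB(2)[OF x] by (simp add: dot_square_norm power2_eq_square)
    finally show ?thesis .
  qed
  have xpi: "x - \<pi> x = s x *\<^sub>R (\<chi> k. n k x)" if x: "x \<in> ?B" for x
  proof -
    obtain l where l: "x = \<pi> x + l *\<^sub>R grad \<psi> (\<pi> x)" "s x = l * norm (grad \<psi> (\<pi> x))"
      using nearest_normal[OF p psi piB[OF x]] by blast
    have "grad \<psi> (\<pi> x) \<noteq> 0" using psi(2) piB(2)[OF x] by blast
    then have "s x *\<^sub>R (\<chi> k. n k x) = l *\<^sub>R grad \<psi> (\<pi> x)" unfolding nn[OF x] l(2) by simp
    then show ?thesis using l(1) by (metis add_diff_cancel_left')
  qed
  have seq: "s x = (\<Sum>k\<in>UNIV. (x $ k - \<pi> x $ k) * n k x)" if x: "x \<in> ?B" for x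
  proof -
    have "(\<Sum>k\<in>UNIV. (x $ k - \<pi> x $ k) * n k x) = (x - \<pi> x) \<bullet> (\<chi> k. n k x)" by (simp add: inner_vec_def)
    also have "\<dots> = s x * ((\<chi> k. n k x) \<bullet> (\<chi> k. n k x))" unfolding xpi[OF x] by simp
    also have "\<dots> = s x" using nsq[OF x] by (simp add: inner_vec_def)
    finally show ?thesis by simp
  qed
  have nder: "(\<Sum>k\<in>UNIV. n k x * pd (n k) i x) = 0" if x: "x \<in> ?B" for x i
  proof -
    have "pd (\<lambda>x. \<Sum>k\<in>UNIV. n k x * n k x) i x = pd (\<lambda>x. 1) i x"
      by (rule C1_on_cong_imp(2)[OF oB _ _ x]) (auto simp: nsq)
    moreover have "pd (\<lambda>x. \<Sum>k\<in>UNIV. n k x * n k x) i x = (\<Sum>k\<in>UNIV. n k x * pd (n k) i x + pd (n k) i x * n k x)"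
      using pd_sum[of UNIV "\<lambda>k x. n k x * n k x" i x] pd_mult[OF C1_on_pd_exists[OF nC x] C1_on_pd_exists[OF nC x]] by simp
    moreover have "(\<Sum>k\<in>UNIV. n k x * pd (n k) i x + pd (n k) i x * n k x) = 2 * (\<Sum>k\<in>UNIV. n k x * pd (n k) i x)"
      by (simp add: sum_distrib_left mult.commute)
    ultimately show ?thesis by simp
  qed
  have pider: "(\<Sum>k\<in>UNIV. pd (\<lambda>x. \<pi> x $ k) i x * n k x) = 0" if x: "x \<in> ?B" for x i
  proof -
    have "(\<Sum>k\<in>UNIV. pd \<psi> k (\<pi> x) * pd (\<lambda>x. \<pi> x $ k) i x) = pd (\<lambda>x. \<psi> (\<pi> x)) i x"
      by (rule C1_on_compose(2)[OF open_ball oB C(1) piC sub x, symmetric])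
    also have "\<dots> = pd (\<lambda>x. 0) i x"
    proof (rule C1_on_cong_imp(2)[OF oB _ _ x])
      fix y assume "y \<in> ?B"
      then show "0 = \<psi> (\<pi> y)" using chart_bdry[OF p psi piB(2)] piB(1) by simp
    qed auto
    finally have z: "(\<Sum>k\<in>UNIV. pd \<psi> k (\<pi> x) * pd (\<lambda>x. \<pi> x $ k) i x) = 0" by simp
    have "(\<Sum>k\<in>UNIV. pd (\<lambda>x. \<pi> x $ k) i x * n k x) = R (\<pi> x) powr (-1/2) * (\<Sum>k\<in>UNIV. pd \<psi> k (\<pi> x) * pd (\<lambda>x. \<pi> x $ k) i x)"
      by (simp add: n_def sum_distrib_left mult_ac)
    then show ?thesis using z by simp
  qed
  have dC: "C1_on ?B (\<lambda>x. x $ k - \<pi> x $ k)" for k by (intro C1_on_diff piC) auto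
  have dp: "pd (\<lambda>x. x $ k - \<pi> x $ k) i x = (if i = k then 1 else 0) - pd (\<lambda>x. \<pi> x $ k) i x" if "x \<in> ?B" for k i x
    using pd_diff(2)[OF C1_on_pd_exists[OF C1_on_coord(1) that] C1_on_pd_exists[OF piC that]] by simp
  let ?S = "\<lambda>x. \<Sum>k\<in>UNIV. (x $ k - \<pi> x $ k) * n k x"
  have SC: "C1_on ?B ?S" by (intro C1_on_sum C1_on_mult dC nC) auto
  have Sp: "pd ?S i x = n i x" if x: "x \<in> ?B" for i x
  proof -
    have "pd ?S i x = (\<Sum>k\<in>UNIV. (x $ k - \<pi> x $ k) * pd (n k) i x + pd (\<lambda>x. x $ k - \<pi> x $ k) i x * n k x)"
      using pd_sum[of UNIV "\<lambda>k x. (x $ k - \<pi> x $ k) * n k x" i x]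
        pd_mult[OF C1_on_pd_exists[OF dC x] C1_on_pd_exists[OF nC x]] by simp
    also have "\<dots> = (\<Sum>k\<in>UNIV. (s x * (n k x * pd (n k) i x) - pd (\<lambda>x. \<pi> x $ k) i x * n k x) + (if i = k then n k x else 0))"
    proof (rule sum.cong[OF refl])
      fix k
      have "x $ k - \<pi> x $ k = s x * n k x" using xpi[OF x] by (simp add: vec_eq_iff)
      then show "(x $ k - \<pi> x $ k) * pd (n k) i x + pd (\<lambda>x. x $ k - \<pi> x $ k) i x * n k x =
        (s x * (n k x * pd (n k) i x) - pd (\<lambda>x. \<pi> x $ k) i x * n k x) + (if i = k then n k x else 0)"
        unfolding dp[OF x] by (simp add: algebra_simps)
    qed
    also have "\<dots> = s x * (\<Sum>k\<in>UNIV. n k x * pd (n k) i x) - (\<Sum>k\<in>UNIV. pd (\<lambda>x. \<pi> x $ k) i x * n k x) + n i x"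
      by (simp add: sum.distrib sum_subtractf sum_distrib_left)
    finally show ?thesis using nder[OF x] pider[OF x] by simp
  qed
  have sC: "C1_on ?B s" "\<And>x i. x \<in> ?B \<Longrightarrow> pd s i x = n i x"
    using C1_on_cong_imp[OF oB SC seq[symmetric]] Sp by auto
  have sC2: "C2_on ?B s" by (rule C2_on_intro[OF oB sC(1) nC sC(2)])
  have gs: "grad s x = (\<chi> k. n k x)" if "x \<in> ?B" for x using sC(2)[OF that] by (simp add: grad_def)
  have norm1: "norm (grad s x) = 1" if x: "x \<in> ?B" for x
    unfolding gs[OF x] norm_eq_sqrt_inner using nsq[OF x] by (simp add: inner_vec_def)
  \<comment> \<open>The radius is halved so that the foot \<open>q\<close> of \<open>x\<close> lies
    in \<open>?B\<close> too, where the formula for the gradient applies to both points.\<close>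
  have near: "x = q + s x *\<^sub>R grad s q \<and> grad s x = grad s q"
    if x: "x \<in> ball p (\<delta> / 2)" and q: "q \<in> \<Gamma>" "dist x q = \<bar>s x\<bar>" for x q
  proof -
    have xB: "x \<in> ?B" using x d by auto
    have "dist x q \<le> dist x p" using abs_sdist_le[OF p, of x] q by simp
    then have "dist p q < \<delta>" using dist_triangle[of p q x] x by (simp add: dist_commute)
    then have qB: "q \<in> ?B" by simp
    have q1: "q = \<pi> x" using pi[OF xB q] by simp
    have "\<bar>s q\<bar> = 0" using q(1) sdist_zero_iff by simp
    then have q2: "q = \<pi> q" using pi[OF qB q(1)] by simp
    have "grad s x = grad s q" unfolding gs[OF xB] gs[OF qB] nn[OF xB] nn[OF qB] using q1 q2 by simp
    moreover have "x = q + s x *\<^sub>R grad s x" using xpi[OF xB] q1 unfolding gs[OF xB] by (metis add.commute diff_add_cancel)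
    ultimately show ?thesis by simp
  qed
  show ?thesis
    by (intro exI[of _ "\<delta> / 2"] conjI ballI impI C2_on_subset[OF sC2] norm1 near; use d in auto)
qed

text \<open>Compactness of the boundary makes the local radii uniform: \<open>\<delta>\<close> is
  its distance to the complement of the union of the local balls.\<close>

lemma tubular_neighbourhood:
  obtains \<delta> where "\<delta> > 0" "C2_on {x. \<bar>s x\<bar> < \<delta>} s" "\<And>x. \<bar>s x\<bar> < \<delta> \<Longrightarrow> norm (grad s x) = 1"
    "\<And>x q. \<bar>s x\<bar> < \<delta> \<Longrightarrow> q \<in> \<Gamma> \<Longrightarrow> dist x q = \<bar>s x\<bar> \<Longrightarrow> x = q + s x *\<^sub>R grad s q \<and> grad s x = grad s q"
proof -
  obtain D where D: "\<And>p. p \<in> \<Gamma> \<Longrightarrow> D p > 0 \<and> C2_on (ball p (D p)) s \<and> (\<forall>x\<in>ball p (D p). norm (grad s x) = 1) \<and>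
    (\<forall>x\<in>ball p (D p). \<forall>q\<in>\<Gamma>. dist x q = \<bar>s x\<bar> \<longrightarrow> x = q + s x *\<^sub>R grad s q \<and> grad s x = grad s q)"
    using sdist_C2_local by metis
  define W where "W = (\<Union>p\<in>\<Gamma>. ball p (D p))"
  have W: "open W" "\<Gamma> \<subseteq> W" using D by (auto simp: W_def)
  obtain \<delta> where d: "\<delta> > 0" "{x. \<bar>s x\<bar> < \<delta>} \<subseteq> W"
  proof (cases "- W = {}")
    case True
    then show ?thesis using that[of 1] by auto
  next
    case False
    have pos: "setdist \<Gamma> (- W) > 0"
      using W False bdry_nonempty compact_bdry by (subst setdist_gt_0_compact_closed) auto
    show ?thesis
    proof (rule that[OF pos], rule subsetI)
      fix x assume x: "x \<in> {x. \<bar>s x\<bar> < setdist \<Gamma> (- W)}"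
      obtain q where q: "q \<in> \<Gamma>" "dist x q = \<bar>s x\<bar>" using nearest_exists by blast
      show "x \<in> W"
      proof (rule ccontr)
        assume "x \<notin> W"
        then have "setdist \<Gamma> (- W) \<le> dist q x" using q by (intro setdist_le_dist) auto
        then show False using x q by (simp add: dist_commute)
      qed
    qed
  qed
  show ?thesis
  proof (rule that[OF d(1)])
    show "C2_on {x. \<bar>s x\<bar> < \<delta>} s"
    proof (rule C2_on_local)
      fix x assume "x \<in> {x. \<bar>s x\<bar> < \<delta>}"
      then obtain p where "p \<in> \<Gamma>" "x \<in> ball p (D p)" using d(2) by (auto simp: W_def)
      then show "\<exists>V. open V \<and> x \<in> V \<and> C2_on V s" using D open_ball by blast
    qed
  next
    fix x assume x: "\<bar>s x\<bar> < \<delta>"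
    then obtain p where p: "p \<in> \<Gamma>" "x \<in> ball p (D p)" using d(2) by (auto simp: W_def)
    then show "norm (grad s x) = 1" using D by blast
    show "\<And>q. q \<in> \<Gamma> \<Longrightarrow> dist x q = \<bar>s x\<bar> \<Longrightarrow> x = q + s x *\<^sub>R grad s q \<and> grad s x = grad s q"
      using D p by blast
  qed
qed

end

subsection \<open>The divergence identity for the torsion function\<close>

lemma C2_on_quad:
  fixes z :: "real^'n"
  shows "C2_on UNIV (\<lambda>x. (norm (x - z))\<^sup>2 / 2)" "pd (\<lambda>x. (norm (x - z))\<^sup>2 / 2) i x = x $ i - z $ i"
    "pd (pd (\<lambda>x. (norm (x - z))\<^sup>2 / 2) i) j x = (if i = j then 1 else 0)"
proof -
  have d: "GDERIV (\<lambda>x. (norm (x - z))\<^sup>2 / 2) x :> x - z" for x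
  proof -
    have "((\<lambda>x. ((x - z) \<bullet> (x - z)) / 2) has_derivative (\<lambda>h. (x - z) \<bullet> h)) (at x)"
      by (auto intro!: derivative_eq_intros simp: inner_commute)
    then show ?thesis unfolding GDERIV_has_derivative power2_norm_eq_inner .
  qed
  have p: "pd (\<lambda>x. (norm (x - z))\<^sup>2 / 2) i = (\<lambda>x. x $ i - z $ i)" for i
    by (rule ext) (simp add: GDERIV_pd(2)[OF d])
  have c: "C1_on UNIV (\<lambda>x::real^'n. x $ i - z $ i)" for i by (intro C1_on_diff) auto
  have "C1_on UNIV (\<lambda>x. (norm (x - z))\<^sup>2 / 2)"
    by (rule C1_onI[OF open_UNIV d]) (intro continuous_intros)
  then show "C2_on UNIV (\<lambda>x. (norm (x - z))\<^sup>2 / 2)"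
    unfolding C2_on_iff p using c by blast
  show "pd (\<lambda>x. (norm (x - z))\<^sup>2 / 2) i x = x $ i - z $ i" unfolding p ..
  show "pd (pd (\<lambda>x. (norm (x - z))\<^sup>2 / 2) i) j x = (if i = j then 1 else 0)"
    unfolding p by (auto simp: pd_diff(2)[OF C1_on_pd_exists[OF C1_on_coord(1) UNIV_I] C1_on_pd_exists[OF C1_on_const(1) UNIV_I]])
qed

text \<open>On the boundary the value of \<open>grad u\<close> would depend on the values of
  \<open>u\<close> outside the closure, which are arbitrary; \<open>G\<close> is the continuous
  extension that stands for the gradient there.\<close>

locale torsion = C2_domain \<Omega> for \<Omega> :: "(real^'n) set" +
  fixes u :: "real^'n \<Rightarrow> real" and G :: "real^'n \<Rightarrow> real^'n"
  assumes cont_u: "continuous_on (closure \<Omega>) u" and C2_u: "C2_on \<Omega> u"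
    and lap_u: "\<And>x. x \<in> \<Omega> \<Longrightarrow> lap u x = real CARD('n)" and u_bdry: "\<And>x. x \<in> frontier \<Omega> \<Longrightarrow> u x = 0"
    and cont_G: "continuous_on (closure \<Omega>) G" and G_grad: "\<And>x. x \<in> \<Omega> \<Longrightarrow> G x = grad u x"
begin

lemma harmonic_part:
  fixes z :: "real^'n"
  defines "h \<equiv> \<lambda>x. (norm (x - z))\<^sup>2 / 2 - u x"
  shows "C2_on \<Omega> h" "\<And>x. x \<in> \<Omega> \<Longrightarrow> lap h x = 0" "\<And>x i. x \<in> \<Omega> \<Longrightarrow> pd h i x = x $ i - z $ i - pd u i x"
    "\<And>x i j. x \<in> \<Omega> \<Longrightarrow> pd (pd h i) j x = (if i = j then 1 else 0) - pd (pd u i) j x"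
proof -
  have q: "C2_on \<Omega> (\<lambda>x. (norm (x - z))\<^sup>2 / 2)" using C2_on_subset[OF C2_on_quad(1)] by blast
  have m: "C2_on \<Omega> (\<lambda>x. (-1) * u x)" "\<And>x i. x \<in> \<Omega> \<Longrightarrow> pd (\<lambda>x. (-1) * u x) i x = (-1) * pd u i x"
    "\<And>x i j. x \<in> \<Omega> \<Longrightarrow> pd (pd (\<lambda>x. (-1) * u x) i) j x = (-1) * pd (pd u i) j x"
    by (fact C2_on_cmult[OF open_dom C2_u])+
  have h: "h = (\<lambda>x. (norm (x - z))\<^sup>2 / 2 + (-1) * u x)" by (simp add: h_def)
  note a = C2_on_add[OF open_dom q m(1)]
  show "C2_on \<Omega> h" unfolding h by (rule a)
  show "\<And>x i. x \<in> \<Omega> \<Longrightarrow> pd h i x = x $ i - z $ i - pd u i x"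
    unfolding h using a(2) m(2) by (simp add: C2_on_quad(2))
  show pp: "\<And>x i j. x \<in> \<Omega> \<Longrightarrow> pd (pd h i) j x = (if i = j then 1 else 0) - pd (pd u i) j x"
    unfolding h using a(3) m(3) by (simp add: C2_on_quad(3))
  show "lap h x = 0" if "x \<in> \<Omega>" for x
  proof -
    have "lap h x = (\<Sum>i\<in>(UNIV::'n set). 1) - lap u x"
      unfolding lap_def pp[OF that] by (simp add: sum_subtractf)
    then show ?thesis using lap_u[OF that] by simp
  qed
qed

text \<open>\<open>u\<close> differs from a harmonic function by a quadratic polynomial, so the
  extra derivative and the symmetry come from \<open>harmonic_pd\<close>.\<close>

lemma pd_u:
  shows "C2_on \<Omega> (pd u i)" "\<And>x. x \<in> \<Omega> \<Longrightarrow> lap (pd u i) x = 0"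
    "\<And>x. x \<in> \<Omega> \<Longrightarrow> pd (pd u i) j x = pd (pd u j) i x"
proof -
  define h where "h x = (norm (x - (0::real^'n)))\<^sup>2 / 2 - u x" for x
  have h: "C2_on \<Omega> h" "\<And>x. x \<in> \<Omega> \<Longrightarrow> lap h x = 0" "\<And>x i. x \<in> \<Omega> \<Longrightarrow> pd h i x = x $ i - pd u i x"
    "\<And>x i j. x \<in> \<Omega> \<Longrightarrow> pd (pd h i) j x = (if i = j then 1 else 0) - pd (pd u i) j x"
    using harmonic_part[where z=0] unfolding h_def[abs_def] by (simp_all only: zero_index diff_zero)
  note hp = harmonic_pd[OF open_dom h(1,2)]
  show sym: "\<And>x. x \<in> \<Omega> \<Longrightarrow> pd (pd u i) j x = pd (pd u j) i x"
    subgoal for x using hp(3)[of x i j] h(4)[of x i j] h(4)[of x j i] by (cases "i = j") auto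
    done
  have m: "C2_on \<Omega> (\<lambda>x. (-1) * pd h k x)" "\<And>x i. x \<in> \<Omega> \<Longrightarrow> pd (\<lambda>x. (-1) * pd h k x) i x = (-1) * pd (pd h k) i x"
    "\<And>x i j. x \<in> \<Omega> \<Longrightarrow> pd (pd (\<lambda>x. (-1) * pd h k x) i) j x = (-1) * pd (pd (pd h k) i) j x" for k i
    by (rule C2_on_cmult[OF open_dom hp(1)]; assumption?)+
  note a = C2_on_add[OF open_dom C2_on_coord[OF open_dom] m(1)]
  have e: "x $ i + (-1) * pd h i x = pd u i x" if "x \<in> \<Omega>" for x i using h(3)[OF that] by simp
  note ce = C2_on_cong_imp[OF open_dom a(1) e]
  show "C2_on \<Omega> (pd u i)" by (rule ce(1))
  show "lap (pd u i) x = 0" if x: "x \<in> \<Omega>" for x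
  proof -
    have "pd (pd (pd u i) j) j x = - pd (pd (pd h i) j) j x" for j
    proof -
      have "pd (\<lambda>x::real^'n. x $ i) j = (\<lambda>x. if j = i then 1 else 0)" by (rule ext) simp
      then have "pd (pd (\<lambda>x::real^'n. x $ i) j) j x = 0" by simp
      then show ?thesis using ce(2)[OF _ x, of i j j] a(3)[OF x, of i i j j] m(3)[OF x] by simp
    qed
    then have "lap (pd u i) x = - lap (pd h i) x" unfolding lap_def by (simp add: sum_negf)
    then show ?thesis using hp(2)[OF _ x] by simp
  qed
qed

text \<open>Component \<open>j\<close> of \<open>\<phi> D^2u grad u - |grad u|^2 grad \<phi> + (grad
  \<phi> . grad u) grad u - \<phi> grad u\<close>. The middle two terms form a Rellich-type field,
  weighted so that every product of \<open>grad \<phi>\<close> with the Hessian of \<open>u\<close>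
  cancels in the divergence.\<close>

definition flux :: "(real^'n \<Rightarrow> real) \<Rightarrow> 'n \<Rightarrow> real^'n \<Rightarrow> real" where
  "flux \<phi> j x = \<phi> x * (\<Sum>i\<in>UNIV. pd u i x * pd (pd u i) j x) - pd \<phi> j x * (\<Sum>i\<in>UNIV. pd u i x * pd u i x)
     + (\<Sum>i\<in>UNIV. pd \<phi> i x * pd u i x) * pd u j x - \<phi> x * pd u j x"

lemma torsion_divergence:
  assumes phi: "C2_on \<Omega> \<phi>" and x: "x \<in> \<Omega>"
  shows "C1_on \<Omega> (flux \<phi> j)"
    "(\<Sum>j\<in>UNIV. pd (flux \<phi> j) j x) = \<phi> x * ((\<Sum>i\<in>UNIV. \<Sum>j\<in>UNIV. (pd (pd u i) j x)\<^sup>2) - real CARD('n))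
      - (lap \<phi> x * (norm (grad u x))\<^sup>2 - (\<Sum>i\<in>UNIV. \<Sum>j\<in>UNIV. pd (pd \<phi> i) j x * pd u i x * pd u j x)
          - (real CARD('n) - 1) * (grad \<phi> x \<bullet> grad u x))"
proof -
  note o = open_dom
  note f = C2_on_C1[OF o phi]
  note c = C2_on_C1[OF o C2_u]
  have c2: "C1_on \<Omega> (pd (pd u i) j)" for i j using C2_on_C1(2)[OF o pd_u(1)] .
  have Z1: "C1_on \<Omega> (\<lambda>x. \<phi> x * (\<Sum>i\<in>UNIV. pd u i x * pd (pd u i) j x))"
    and Z2: "C1_on \<Omega> (\<lambda>x. pd \<phi> j x * (\<Sum>i\<in>UNIV. pd u i x * pd u i x))"
    and Z3: "C1_on \<Omega> (\<lambda>x. (\<Sum>i\<in>UNIV. pd \<phi> i x * pd u i x) * pd u j x)"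
    and Z4: "C1_on \<Omega> (\<lambda>x. \<phi> x * pd u j x)" for j
    by (intro C1_on_mult C1_on_sum o f c c2; simp)+
  show "C1_on \<Omega> (flux \<phi> j)" for j unfolding flux_def[abs_def] by (intro C1_on_add C1_on_diff o Z1 Z2 Z3 Z4)
  have e: "pd_exists \<phi> j x" "pd_exists (pd \<phi> i) j x" "pd_exists (pd u i) j x" "pd_exists (pd (pd u i) k) j x" for i j k
    using f c c2 x C1_on_pd_exists by blast+
  have s1: "pd_exists (\<lambda>x. \<Sum>i\<in>UNIV. pd u i x * pd (pd u i) k x) j x"
    "pd (\<lambda>x. \<Sum>i\<in>UNIV. pd u i x * pd (pd u i) k x) j x = (\<Sum>i\<in>UNIV. pd u i x * pd (pd (pd u i) k) j x + pd (pd u i) j x * pd (pd u i) k x)" for j k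
    using pd_sum[OF finite, of UNIV "\<lambda>i x. pd u i x * pd (pd u i) k x" j x] pd_mult[OF e(3,4)] by auto
  have s2: "pd_exists (\<lambda>x. \<Sum>i\<in>UNIV. pd u i x * pd u i x) j x"
    "pd (\<lambda>x. \<Sum>i\<in>UNIV. pd u i x * pd u i x) j x = (\<Sum>i\<in>UNIV. pd u i x * pd (pd u i) j x + pd (pd u i) j x * pd u i x)" for j
    using pd_sum[OF finite, of UNIV "\<lambda>i x. pd u i x * pd u i x" j x] pd_mult[OF e(3,3)] by auto
  have s3: "pd_exists (\<lambda>x. \<Sum>i\<in>UNIV. pd \<phi> i x * pd u i x) j x"
    "pd (\<lambda>x. \<Sum>i\<in>UNIV. pd \<phi> i x * pd u i x) j x = (\<Sum>i\<in>UNIV. pd \<phi> i x * pd (pd u i) j x + pd (pd \<phi> i) j x * pd u i x)" for j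
    using pd_sum[OF finite, of UNIV "\<lambda>i x. pd \<phi> i x * pd u i x" j x] pd_mult[OF e(2,3)] by auto
  define V where "V i = pd u i x" for i
  define H where "H i j = pd (pd u i) j x" for i j
  define T where "T i j = pd (pd (pd u i) j) j x" for i j
  define F where "F i = pd \<phi> i x" for i
  define P where "P i j = pd (pd \<phi> i) j x" for i j
  have sym: "H i j = H j i" for i j unfolding H_def by (rule pd_u(3)[OF x])
  have trH: "(\<Sum>j\<in>UNIV. H j j) = real CARD('n)" using lap_u[OF x] unfolding lap_def H_def .
  have trT: "(\<Sum>j\<in>UNIV. T i j) = 0" for i using pd_u(2)[OF x, of i] unfolding lap_def T_def .
  have pz1: "pd_exists (\<lambda>x. \<phi> x * (\<Sum>i\<in>UNIV. pd u i x * pd (pd u i) j x)) j x"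
    "pd (\<lambda>x. \<phi> x * (\<Sum>i\<in>UNIV. pd u i x * pd (pd u i) j x)) j x
      = \<phi> x * (\<Sum>i\<in>UNIV. V i * T i j + H i j * H i j) + F j * (\<Sum>i\<in>UNIV. V i * H i j)" for j
    using pd_mult[OF e(1) s1(1), of j j] s1(2) by (simp_all add: V_def T_def H_def F_def)
  have pz2: "pd_exists (\<lambda>x. pd \<phi> j x * (\<Sum>i\<in>UNIV. pd u i x * pd u i x)) j x"
    "pd (\<lambda>x. pd \<phi> j x * (\<Sum>i\<in>UNIV. pd u i x * pd u i x)) j x
      = F j * (\<Sum>i\<in>UNIV. V i * H i j + H i j * V i) + P j j * (\<Sum>i\<in>UNIV. V i * V i)" for j
    using pd_mult[OF e(2) s2(1), of j j] s2(2) by (simp_all add: V_def P_def H_def F_def)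
  have pz3: "pd_exists (\<lambda>x. (\<Sum>i\<in>UNIV. pd \<phi> i x * pd u i x) * pd u j x) j x"
    "pd (\<lambda>x. (\<Sum>i\<in>UNIV. pd \<phi> i x * pd u i x) * pd u j x) j x
      = (\<Sum>i\<in>UNIV. F i * V i) * H j j + (\<Sum>i\<in>UNIV. F i * H i j + P i j * V i) * V j" for j
    using pd_mult[OF s3(1) e(3), of j j] s3(2) by (simp_all add: V_def P_def H_def F_def)
  have pz4: "pd_exists (\<lambda>x. \<phi> x * pd u j x) j x" "pd (\<lambda>x. \<phi> x * pd u j x) j x = \<phi> x * H j j + F j * V j" for j
    using pd_mult[OF e(1,3), of j j] by (simp_all add: V_def H_def F_def)
  have pZ: "pd (flux \<phi> j) j x = (\<phi> x * (\<Sum>i\<in>UNIV. V i * T i j + H i j * H i j) + F j * (\<Sum>i\<in>UNIV. V i * H i j))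
     - (F j * (\<Sum>i\<in>UNIV. V i * H i j + H i j * V i) + P j j * (\<Sum>i\<in>UNIV. V i * V i))
     + ((\<Sum>i\<in>UNIV. F i * V i) * H j j + (\<Sum>i\<in>UNIV. F i * H i j + P i j * V i) * V j) - (\<phi> x * H j j + F j * V j)" for j
    unfolding flux_def[abs_def]
    using pd_diff[OF pz1(1) pz2(1), of j] pd_add[OF pd_diff(1)[OF pz1(1) pz2(1)] pz3(1), of j]
      pd_diff[OF pd_add(1)[OF pd_diff(1)[OF pz1(1) pz2(1)] pz3(1)] pz4(1), of j] pz1(2) pz2(2) pz3(2) pz4(2)
    by simp
  \<comment> \<open>\<open>a\<close> is \<open>grad \<phi> . D^2u grad u\<close>; it occurs with
    weights 1, -2 and 1 in the first three fields and so disappears.\<close>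
  define a where "a = (\<Sum>j\<in>UNIV. F j * (\<Sum>i\<in>UNIV. V i * H i j))"
  have 1: "(\<Sum>j\<in>UNIV. \<phi> x * (\<Sum>i\<in>UNIV. V i * T i j + H i j * H i j)) = \<phi> x * (\<Sum>i\<in>UNIV. \<Sum>j\<in>UNIV. (H i j)\<^sup>2)"
  proof -
    have "(\<Sum>j\<in>UNIV. \<Sum>i\<in>UNIV. V i * T i j) = (\<Sum>i\<in>UNIV. V i * (\<Sum>j\<in>UNIV. T i j))"
      by (subst sum.swap) (simp add: sum_distrib_left)
    then have "(\<Sum>j\<in>UNIV. \<Sum>i\<in>UNIV. V i * T i j) = 0" using trT by simp
    moreover have "(\<Sum>j\<in>UNIV. \<Sum>i\<in>UNIV. H i j * H i j) = (\<Sum>i\<in>UNIV. \<Sum>j\<in>UNIV. (H i j)\<^sup>2)"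
      by (subst sum.swap) (simp add: power2_eq_square)
    ultimately show ?thesis by (simp only: sum_distrib_left[symmetric] sum.distrib) simp
  qed
  have 2: "(\<Sum>j\<in>UNIV. F j * (\<Sum>i\<in>UNIV. V i * H i j + H i j * V i)) = 2 * a"
    unfolding a_def sum_distrib_left by (simp add: algebra_simps sum.distrib sum_distrib_left)
  have 3: "(\<Sum>j\<in>UNIV. (\<Sum>i\<in>UNIV. F i * H i j + P i j * V i) * V j) = a + (\<Sum>i\<in>UNIV. \<Sum>j\<in>UNIV. P i j * V i * V j)"
  proof -
    have "(\<Sum>j\<in>UNIV. (\<Sum>i\<in>UNIV. F i * H i j + P i j * V i) * V j)
      = (\<Sum>j\<in>UNIV. \<Sum>i\<in>UNIV. F i * (V j * H j i)) + (\<Sum>j\<in>UNIV. \<Sum>i\<in>UNIV. P i j * V i * V j)"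
      by (simp add: sum_distrib_right sum_distrib_left sum.distrib distrib_right distrib_left sym mult_ac)
    also have "(\<Sum>j\<in>UNIV. \<Sum>i\<in>UNIV. F i * (V j * H j i)) = a"
      unfolding a_def sum_distrib_left by (rule sum.swap)
    also have "(\<Sum>j\<in>UNIV. \<Sum>i\<in>UNIV. P i j * V i * V j) = (\<Sum>i\<in>UNIV. \<Sum>j\<in>UNIV. P i j * V i * V j)" by (rule sum.swap)
    finally show ?thesis .
  qed
  have 4: "(norm (grad u x))\<^sup>2 = (\<Sum>i\<in>UNIV. V i * V i)" "grad \<phi> x \<bullet> grad u x = (\<Sum>i\<in>UNIV. F i * V i)"
    unfolding power2_norm_eq_inner by (simp_all add: inner_vec_def grad_def V_def F_def)
  have "(\<Sum>j\<in>UNIV. pd (flux \<phi> j) j x) = (\<Sum>j\<in>UNIV. \<phi> x * (\<Sum>i\<in>UNIV. V i * T i j + H i j * H i j)) + a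
     - ((\<Sum>j\<in>UNIV. F j * (\<Sum>i\<in>UNIV. V i * H i j + H i j * V i)) + (\<Sum>j\<in>UNIV. P j j) * (\<Sum>i\<in>UNIV. V i * V i))
     + ((\<Sum>i\<in>UNIV. F i * V i) * (\<Sum>j\<in>UNIV. H j j) + (\<Sum>j\<in>UNIV. (\<Sum>i\<in>UNIV. F i * H i j + P i j * V i) * V j))
     - (\<phi> x * (\<Sum>j\<in>UNIV. H j j) + (\<Sum>j\<in>UNIV. F j * V j))"
    unfolding pZ a_def by (simp only: sum.distrib sum_subtractf sum_distrib_left[symmetric] sum_distrib_right[symmetric])
  also have "\<dots> = \<phi> x * ((\<Sum>i\<in>UNIV. \<Sum>j\<in>UNIV. (H i j)\<^sup>2) - real CARD('n))
      - ((\<Sum>j\<in>UNIV. P j j) * (\<Sum>i\<in>UNIV. V i * V i) - (\<Sum>i\<in>UNIV. \<Sum>j\<in>UNIV. P i j * V i * V j)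
          - (real CARD('n) - 1) * (\<Sum>i\<in>UNIV. F i * V i))"
    unfolding 1 2 3 trH by (simp add: algebra_simps)
  finally show "(\<Sum>j\<in>UNIV. pd (flux \<phi> j) j x) = \<phi> x * ((\<Sum>i\<in>UNIV. \<Sum>j\<in>UNIV. (pd (pd u i) j x)\<^sup>2) - real CARD('n))
      - (lap \<phi> x * (norm (grad u x))\<^sup>2 - (\<Sum>i\<in>UNIV. \<Sum>j\<in>UNIV. pd (pd \<phi> i) j x * pd u i x * pd u j x)
          - (real CARD('n) - 1) * (grad \<phi> x \<bullet> grad u x))"
    unfolding 4 lap_def H_def P_def V_def F_def .
qed

text \<open>The flux vanishes off \<open>K\<close>, so its divergence integrates to 0. One side then
  contains \<open>\<phi>\<close> undifferentiated, the other only derivatives of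
  \<open>\<phi>\<close>, which for a cut-off live in a boundary strip.\<close>

lemma torsion_identity:
  assumes phi: "C2_on UNIV \<phi>" and K: "compact K" "K \<subseteq> \<Omega>" and z: "\<And>x. x \<notin> K \<Longrightarrow> \<phi> x = 0"
  defines "A \<equiv> \<lambda>x. \<phi> x * ((\<Sum>i\<in>UNIV. \<Sum>j\<in>UNIV. (pd (pd u i) j x)\<^sup>2) - real CARD('n))"
    and "B \<equiv> \<lambda>x. lap \<phi> x * (norm (grad u x))\<^sup>2 - (\<Sum>i\<in>UNIV. \<Sum>j\<in>UNIV. pd (pd \<phi> i) j x * pd u i x * pd u j x)
          - (real CARD('n) - 1) * (grad \<phi> x \<bullet> grad u x)"
  shows "integrable lborel A" "integrable lborel B" "integral\<^sup>L lborel A = integral\<^sup>L lborel B"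
proof -
  note o = open_dom
  have phiO: "C2_on \<Omega> \<phi>" using C2_on_subset[OF phi] by blast
  have cK: "closed K" using K compact_imp_closed by blast
  have f: "C1_on UNIV \<phi>" "C1_on UNIV (pd \<phi> i)" for i using phi by (auto simp: C2_on_iff)
  have z1: "pd \<phi> i x = 0" if "x \<notin> K" for x i using C1_on_extend(2)[OF open_UNIV cK _ f(1) z that] by simp
  have z2: "pd (pd \<phi> i) j x = 0" if "x \<notin> K" for x i j using C1_on_extend(2)[OF open_UNIV cK _ f(2) z1 that] by simp
  define Z where "Z = flux \<phi>"
  note td = torsion_divergence[OF phiO, folded Z_def]
  have ZC: "C1_on \<Omega> (Z j)" for j
    using td(1) nonempty_dom by (metis ex_in_conv)
  have Zz: "Z j x = 0" if "x \<notin> K" for j x using z[OF that] z1[OF that] by (simp add: Z_def flux_def)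
  note ip = integral_pd_zero_on[OF o K ZC Zz]
  have c: "C1_on \<Omega> u" "\<And>i. C1_on \<Omega> (pd u i)" using C2_on_C1[OF o C2_u] by auto
  have cu: "continuous_on K (pd u i)" "continuous_on K (pd (pd u i) j)" for i j
    using c C1_on_pd_continuous K(2) continuous_on_subset by blast+
  have cf: "continuous_on K \<phi>" "continuous_on K (pd \<phi> i)" "continuous_on K (pd (pd \<phi> i) j)" for i j
    using f C1_on_pd_continuous C1_on_continuous[OF f(1)] continuous_on_subset by blast+
  show iA: "integrable lborel A"
    by (rule continuous_compact_support_integrable[OF _ K(1)])
       (auto simp: A_def z intro!: continuous_intros cu cf)
  show iB: "integrable lborel B"
  proof (rule continuous_compact_support_integrable[OF _ K(1)])
    show "continuous_on K B"
      unfolding B_def lap_def power2_norm_eq_inner inner_vec_def grad_def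
      by (auto intro!: continuous_intros cu cf)
    fix x assume "x \<notin> K"
    then show "B x = 0" by (simp add: B_def lap_def inner_vec_def grad_def z1 z2)
  qed
  have "(\<Sum>j\<in>UNIV. pd (Z j) j x) = A x - B x" for x
  proof (cases "x \<in> \<Omega>")
    case True
    then show ?thesis unfolding A_def B_def
      by (intro td(2))
  next
    case False
    then have nK: "x \<notin> K" using K by blast
    have "pd (Z j) j x = 0" for j
      using C1_on_extend(2)[OF o cK K(2) ZC Zz nK] .
    then show ?thesis using nK by (simp add: A_def B_def z z1 z2 lap_def inner_vec_def grad_def)
  qed
  then have "integral\<^sup>L lborel (\<lambda>x. A x - B x) = integral\<^sup>L lborel (\<lambda>x. \<Sum>j\<in>UNIV. pd (Z j) j x)" by simp
  also have "\<dots> = 0" using ip by simp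
  finally show "integral\<^sup>L lborel A = integral\<^sup>L lborel B" using iA iB by simp
qed

end

subsection \<open>Volume of thin boundary strips\<close>

lemma DERIV_max0_shift:
  fixes c :: real
  shows "DERIV (\<lambda>t. max 0 (t - c) ^ Suc (Suc m)) t :> real (Suc (Suc m)) * max 0 (t - c) ^ Suc m"
proof -
  have d: "DERIV (\<lambda>t. t - c) t :> 1" by (auto intro!: derivative_eq_intros)
  from DERIV_chain2[OF DERIV_max0_power d] show ?thesis by (simp only: mult_1_right)
qed

context C2_domain
begin

lemma sdist_line_in:
  assumes "x \<in> \<Omega>" "dist x y < \<bar>s x\<bar>" shows "y \<in> \<Omega>"
  using opposite_sides[OF assms(1), of y] assms(2) by force

lemma compact_strip: "compact {x. \<bar>s x\<bar> \<le> \<rho>}" "compact {x. - \<rho> \<le> s x \<and> s x \<le> 0}" "compact {x. s x \<le> - \<rho>}" if "\<rho> \<ge> 0"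
proof -
  have c: "closed {x. \<bar>s x\<bar> \<le> \<rho>}"
    by (intro closed_Collect_le continuous_intros continuous_sdist)
  obtain B where B: "\<And>q. q \<in> \<Gamma> \<Longrightarrow> norm q \<le> B" using compact_imp_bounded[OF compact_bdry] unfolding bounded_iff by blast
  have "norm x \<le> B + \<rho>" if "\<bar>s x\<bar> \<le> \<rho>" for x
  proof -
    obtain q where "q \<in> \<Gamma>" "dist x q = \<bar>s x\<bar>" using nearest_exists by blast
    then show ?thesis using B[of q] that norm_triangle_ineq2[of x q] by (simp add: dist_norm)
  qed
  then have "bounded {x. \<bar>s x\<bar> \<le> \<rho>}" unfolding bounded_iff by blast
  then show k: "compact {x. \<bar>s x\<bar> \<le> \<rho>}" using c compact_eq_bounded_closed by blast
  have c2: "closed {x. - \<rho> \<le> s x \<and> s x \<le> 0}"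
    by (intro closed_Collect_conj closed_Collect_le continuous_intros continuous_sdist)
  have e2: "{x. - \<rho> \<le> s x \<and> s x \<le> 0} = {x. \<bar>s x\<bar> \<le> \<rho>} \<inter> {x. - \<rho> \<le> s x \<and> s x \<le> 0}" using that by auto
  show "compact {x. - \<rho> \<le> s x \<and> s x \<le> 0}" by (subst e2) (rule compact_Int_closed[OF k c2])
  have e3: "{x. s x \<le> - \<rho>} = closure \<Omega> \<inter> {x. s x \<le> - \<rho>}" unfolding closure_sdist using that by auto
  have c3: "closed {x. s x \<le> - \<rho>}"
    by (intro closed_Collect_le continuous_intros continuous_sdist)
  show "compact {x. s x \<le> - \<rho>}" by (subst e3) (rule compact_Int_closed[OF compact_clos c3])
qed

text \<open>The compactly supported field \<open>k (s x) *\<^sub>R grad s x\<close> is tested, with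
  \<open>k\<close> an arctangent of width \<open>\<epsilon>\<close> times a fixed cut-off. Its
  divergence integrates to 0, is of size \<open>1 / \<epsilon>\<close> on the strip and otherwise
  bounded independently of \<open>\<epsilon>\<close>. The constant may depend on the domain: it only
  multiplies errors that are sent to 0 or serves to show finiteness.\<close>

lemma strip_measure:
  obtains C \<epsilon>\<^sub>0 where "C > 0" "\<epsilon>\<^sub>0 > 0" "\<And>\<epsilon>. 0 < \<epsilon> \<Longrightarrow> \<epsilon> \<le> \<epsilon>\<^sub>0 \<Longrightarrow> measure lborel {x. \<bar>s x\<bar> \<le> \<epsilon>} \<le> C * \<epsilon>"
proof -
  obtain \<delta> where d: "\<delta> > 0" "C2_on {x. \<bar>s x\<bar> < \<delta>} s" "\<And>x. \<bar>s x\<bar> < \<delta> \<Longrightarrow> norm (grad s x) = 1"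
    using tubular_neighbourhood by metis
  let ?U = "{x. \<bar>s x\<bar> < \<delta>}"
  have oU: "open ?U" by (intro open_Collect_less continuous_intros continuous_sdist)
  define \<rho> where "\<rho> = \<delta> / 2"
  have r: "\<rho> > 0" "\<rho> < \<delta>" using d by (auto simp: \<rho>_def)
  let ?K = "{x. \<bar>s x\<bar> \<le> \<rho>}"
  have K: "compact ?K" "?K \<subseteq> ?U" using compact_strip(1)[of \<rho>] r by auto
  have sC: "C1_on ?U s" "\<And>i. C1_on ?U (pd s i)" using C2_on_C1[OF oU d(2)] by auto
  have lapc: "continuous_on ?K (lap s)"
  proof -
    have "continuous_on ?U (lap s)" unfolding lap_def[abs_def]
      by (intro continuous_on_sum C1_on_pd_continuous sC)
    then show ?thesis using K continuous_on_subset by blast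
  qed
  then obtain L where L: "\<And>x. x \<in> ?K \<Longrightarrow> \<bar>lap s x\<bar> \<le> L"
    using compact_imp_bounded[OF compact_continuous_image[OF lapc K(1)]] unfolding bounded_iff by auto
  define b where "b t = max 0 (\<rho>\<^sup>2 - t\<^sup>2) ^ 2" for t :: real
  define b' where "b' t = - 4 * t * max 0 (\<rho>\<^sup>2 - t\<^sup>2)" for t :: real
  have db: "DERIV b t :> b' t" for t
  proof -
    have "DERIV (\<lambda>t. \<rho>\<^sup>2 - t\<^sup>2) t :> - 2 * t" by (auto intro!: derivative_eq_intros)
    from DERIV_chain2[OF DERIV_max0_power[of 0] this]
    show ?thesis unfolding b_def[abs_def] b'_def by (simp add: numeral_2_eq_2 mult_ac)
  qed
  \<comment> \<open>Bound for the terms of the divergence that do not blow up: \<open>2\<close> for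
    the arctangent, \<open>4 * \<rho> ^ 3\<close> for \<open>b'\<close>, and
    \<open>\<rho> ^ 4 * \<bar>L\<bar>\<close> for \<open>b\<close> times the Laplacian of
    \<open>s\<close>.\<close>
  define C1 where "C1 = 2 * (4 * \<rho> ^ 3 + \<rho> ^ 4 * \<bar>L\<bar>)"
  \<comment> \<open>On the strip \<open>\<epsilon> \<le> \<rho> / 2\<close> gives
    \<open>b \<ge> (3 * \<rho>\<^sup>2 / 4)\<^sup>2\<close> and the derivative of the arctangent is
    at least \<open>1 / (2 * \<epsilon>)\<close>; together
    \<open>9 * \<rho> ^ 4 / (32 * \<epsilon>)\<close>. The added 1 makes \<open>C\<close>
    positive.\<close>
  define C where "C = 32 * C1 * measure lborel ?K / (9 * \<rho> ^ 4) + 1"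
  have C1: "C1 \<ge> 0" using r by (simp add: C1_def)
  have bound: "measure lborel {x. \<bar>s x\<bar> \<le> \<epsilon>} \<le> C * \<epsilon>" if e: "0 < \<epsilon>" "\<epsilon> \<le> \<rho> / 2" for \<epsilon>
  proof -
    define k where "k t = arctan (t / \<epsilon>) * b t" for t
    define k' where "k' t = (1 / (1 + (t / \<epsilon>)\<^sup>2)) / \<epsilon> * b t + arctan (t / \<epsilon>) * b' t" for t
    have dk: "DERIV k t :> k' t" for t
      unfolding k_def[abs_def] k'_def using e
      by (auto intro!: derivative_eq_intros db simp: inverse_eq_divide)
    have ck: "continuous_on UNIV k'"
      unfolding k'_def b_def b'_def using e
      by (intro continuous_intros) (auto simp: add_nonneg_eq_0_iff)
    let ?Z = "\<lambda>j x. k (s x) * pd s j x"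
    have kC: "C1_on ?U (\<lambda>x. k (s x))"
      by (rule C1_on_real_compose[OF oU sC(1) dk ck]) auto
    have ZC: "C1_on ?U (?Z j)" for j by (intro C1_on_mult oU kC sC)
    have k0: "k t = 0" "k' t = 0" if "\<bar>t\<bar> \<ge> \<rho>" for t
    proof -
      have "\<rho>\<^sup>2 \<le> t\<^sup>2" using that r by (metis abs_le_square_iff abs_of_pos)
      then show "k t = 0" "k' t = 0" by (simp_all add: k_def k'_def b_def b'_def)
    qed
    have Z0: "?Z j x = 0" if "x \<notin> ?K" for j x using that k0 by simp
    note ip = integral_pd_zero_on[OF oU K ZC Z0]
    let ?D = "\<lambda>x. \<Sum>j\<in>UNIV. pd (?Z j) j x"
    have D: "?D x = k' (s x) + k (s x) * lap s x" if x: "x \<in> ?K" for x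
    proof -
      have xU: "x \<in> ?U" using x K by blast
      have "pd (?Z j) j x = k (s x) * pd (pd s j) j x + k' (s x) * pd s j x * pd s j x" for j
        using pd_mult(2)[OF C1_on_pd_exists[OF kC xU] C1_on_pd_exists[OF sC(2) xU]]
          pd_real_compose(2)[OF C1_on_pd_exists[OF sC(1) xU] dk] by simp
      then have "?D x = k (s x) * lap s x + k' (s x) * (\<Sum>j\<in>UNIV. pd s j x * pd s j x)"
        by (simp add: sum.distrib lap_def sum_distrib_left mult.assoc)
      also have "(\<Sum>j\<in>UNIV. pd s j x * pd s j x) = (norm (grad s x))\<^sup>2"
        unfolding power2_norm_eq_inner by (simp add: inner_vec_def grad_def)
      finally show ?thesis using d(3)[of x] xU by simp
    qed
    have D0: "?D x = 0" if "x \<notin> ?K" for x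
      using C1_on_extend(2)[OF oU compact_imp_closed[OF K(1)] K(2) ZC Z0 that] by simp
    let ?S = "{x. \<bar>s x\<bar> \<le> \<epsilon>}"
    have SK: "?S \<subseteq> ?K" using e r by auto
    have low: "(9 * \<rho> ^ 4 / (32 * \<epsilon>)) * indicator ?S x - C1 * indicator ?K x \<le> ?D x" for x
    proof (cases "x \<in> ?K")
      case False
      then show ?thesis using SK D0[OF False] by (auto simp: indicator_def)
    next
      case True
      let ?t = "s x"
      have t: "\<bar>?t\<bar> \<le> \<rho>" using True by simp
      have t2: "?t\<^sup>2 \<le> \<rho>\<^sup>2" using t r by (metis abs_le_square_iff abs_of_pos)
      have bb: "0 \<le> b ?t" "b ?t \<le> \<rho> ^ 4"
      proof -
        have "(\<rho>\<^sup>2 - ?t\<^sup>2)\<^sup>2 \<le> (\<rho>\<^sup>2)\<^sup>2" using t2 by (intro power_mono) auto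
        then show "b ?t \<le> \<rho> ^ 4" "0 \<le> b ?t" using t2 by (simp_all add: b_def)
      qed
      have bb': "\<bar>b' ?t\<bar> \<le> 4 * \<rho> ^ 3"
      proof -
        have "\<bar>b' ?t\<bar> = 4 * (\<bar>?t\<bar> * (\<rho>\<^sup>2 - ?t\<^sup>2))" using t2 by (simp add: b'_def abs_mult)
        also have "\<dots> \<le> 4 * (\<rho> * \<rho>\<^sup>2)" using t t2 r by (intro mult_left_mono mult_mono) auto
        finally show ?thesis by (simp add: power3_eq_cube power2_eq_square)
      qed
      have at: "\<bar>arctan (?t / \<epsilon>)\<bar> \<le> 2"
        using arctan_bounded[of "?t / \<epsilon>"] pi_less_4 by linarith
      have 1: "\<bar>arctan (?t / \<epsilon>) * b' ?t\<bar> \<le> 2 * (4 * \<rho> ^ 3)"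
        unfolding abs_mult using at bb' by (intro mult_mono) auto
      have "\<bar>lap s x\<bar> \<le> \<bar>L\<bar>" using L[OF True] by simp
      then have "b ?t * \<bar>lap s x\<bar> \<le> \<rho> ^ 4 * \<bar>L\<bar>" using bb by (intro mult_mono) auto
      then have 2: "\<bar>k ?t * lap s x\<bar> \<le> 2 * (\<rho> ^ 4 * \<bar>L\<bar>)"
      proof -
        assume le: "b ?t * \<bar>lap s x\<bar> \<le> \<rho> ^ 4 * \<bar>L\<bar>"
        have "\<bar>arctan (?t / \<epsilon>)\<bar> * (b ?t * \<bar>lap s x\<bar>) \<le> 2 * (\<rho> ^ 4 * \<bar>L\<bar>)"
          by (rule mult_mono[OF at le]) (use bb in auto)
        then show ?thesis unfolding k_def abs_mult using bb by (simp add: mult.assoc)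
      qed
      have 3: "(9 * \<rho> ^ 4 / (32 * \<epsilon>)) * indicator ?S x \<le> (1 / (1 + (?t / \<epsilon>)\<^sup>2)) / \<epsilon> * b ?t"
      proof (cases "x \<in> ?S")
        case False
        then show ?thesis using bb e by (simp add: add_nonneg_nonneg)
      next
        case True
        then have te: "\<bar>?t\<bar> \<le> \<epsilon>" by simp
        have "(?t / \<epsilon>)\<^sup>2 \<le> 1\<^sup>2" using te e by (intro power2_le_iff_abs_le[THEN iffD2]) (auto simp: abs_divide)
        then have a1: "1 / (1 + (?t / \<epsilon>)\<^sup>2) \<ge> 1 / 2" by (intro divide_left_mono) (auto simp: add_pos_nonneg)
        have "?t\<^sup>2 \<le> (\<rho> / 2)\<^sup>2" using te e by (intro power2_le_iff_abs_le[THEN iffD2]) auto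
        then have "3 * \<rho>\<^sup>2 / 4 \<le> \<rho>\<^sup>2 - ?t\<^sup>2" by (simp add: power_divide)
        then have "(3 * \<rho>\<^sup>2 / 4)\<^sup>2 \<le> (\<rho>\<^sup>2 - ?t\<^sup>2)\<^sup>2" by (intro power_mono) auto
        then have a2: "9 * \<rho> ^ 4 / 16 \<le> b ?t" using t2 by (simp add: b_def power_divide power_mult_distrib)
        have "(1 / 2) * (9 * \<rho> ^ 4 / 16) \<le> (1 / (1 + (?t / \<epsilon>)\<^sup>2)) * b ?t"
          using a1 a2 by (intro mult_mono) auto
        then have "(1 / 2) * (9 * \<rho> ^ 4 / 16) / \<epsilon> \<le> (1 / (1 + (?t / \<epsilon>)\<^sup>2)) * b ?t / \<epsilon>"
          using e by (intro divide_right_mono) auto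
        then show ?thesis using True by simp
      qed
      have "C1 = 2 * (4 * \<rho> ^ 3) + 2 * (\<rho> ^ 4 * \<bar>L\<bar>)" by (simp add: C1_def)
      moreover have "?D x = (1 / (1 + (?t / \<epsilon>)\<^sup>2)) / \<epsilon> * b ?t + arctan (?t / \<epsilon>) * b' ?t + k ?t * lap s x"
        unfolding D[OF True] k'_def ..
      moreover have "indicator ?K x = (1::real)" using True by simp
      ultimately show ?thesis using 1 2 3 by (simp only: mult_1_right)
    qed
    have cS: "compact ?S" using compact_strip(1)[of \<epsilon>] e by simp
    have mS: "?S \<in> sets lborel" "?K \<in> sets lborel" "emeasure lborel ?S < \<infinity>" "emeasure lborel ?K < \<infinity>"
      using borel_compact[OF cS] borel_compact[OF K(1)] emeasure_bounded_finite[OF compact_imp_bounded[OF cS]]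
        emeasure_bounded_finite[OF compact_imp_bounded[OF K(1)]] by simp_all
    have i: "integrable lborel (\<lambda>x. (9 * \<rho> ^ 4 / (32 * \<epsilon>)) * indicator ?S x - C1 * indicator ?K x)"
      using mS by (intro Bochner_Integration.integrable_diff integrable_mult_right integrable_real_indicator) auto
    have "integral\<^sup>L lborel (\<lambda>x. (9 * \<rho> ^ 4 / (32 * \<epsilon>)) * indicator ?S x - C1 * indicator ?K x) \<le> integral\<^sup>L lborel ?D"
      by (rule integral_mono[OF i _ low]) (use ip in auto)
    also have "\<dots> = 0" using ip by simp
    also have "integral\<^sup>L lborel (\<lambda>x. (9 * \<rho> ^ 4 / (32 * \<epsilon>)) * indicator ?S x - C1 * indicator ?K x)
       = (9 * \<rho> ^ 4 / (32 * \<epsilon>)) * measure lborel ?S - C1 * measure lborel ?K"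
      using mS by (subst Bochner_Integration.integral_diff) (auto intro!: integrable_mult_right integrable_real_indicator)
    finally have "(9 * \<rho> ^ 4 / (32 * \<epsilon>)) * measure lborel ?S \<le> C1 * measure lborel ?K" by simp
    then have "measure lborel ?S \<le> 32 * C1 * measure lborel ?K / (9 * \<rho> ^ 4) * \<epsilon>"
      using e r by (simp add: field_simps)
    also have "\<dots> \<le> C * \<epsilon>" using e by (intro mult_right_mono) (auto simp: C_def)
    finally show ?thesis .
  qed
  have "C > 0" using C1 r by (auto simp: C_def intro!: add_nonneg_pos divide_nonneg_nonneg mult_nonneg_nonneg)
  then show ?thesis using that[of C "\<rho> / 2"] bound r by simp
qed

end

subsection \<open>The cut-off function\<close>

text \<open>\<open>ramp2\<close> is the hat function on \<open>[0, 2]\<close> with peak 1 at 1;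
  \<open>ramp1\<close> and \<open>ramp\<close> are its first and second antiderivatives, written
  with truncated powers so that they can be differentiated without a case split.\<close>

definition "ramp x = (max 0 (x - 0) ^ 3 - 2 * max 0 (x - 1) ^ 3 + max 0 (x - 2) ^ 3) / (6::real)"
definition "ramp1 x = (max 0 (x - 0) ^ 2 - 2 * max 0 (x - 1) ^ 2 + max 0 (x - 2) ^ 2) / (2::real)"
definition "ramp2 x = max 0 (x - 0) - 2 * max 0 (x - 1) + max 0 (x - 2 :: real)"

lemma ramp_DERIV: "DERIV ramp x :> ramp1 x" "DERIV ramp1 x :> ramp2 x"
proof -
  have 1: "DERIV (\<lambda>t. max 0 (t - c) ^ 3) x :> 3 * max 0 (x - c) ^ 2" for c :: real
    using DERIV_max0_shift[of c 1 x] by (simp add: numeral_eq_Suc)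
  have 2: "DERIV (\<lambda>t. max 0 (t - c) ^ 2) x :> 2 * max 0 (x - c)" for c :: real
    using DERIV_max0_shift[of c 0 x] by (simp add: numeral_eq_Suc)
  show "DERIV ramp x :> ramp1 x" unfolding ramp_def[abs_def] ramp1_def
    by (rule DERIV_cong[OF DERIV_cdivide[OF DERIV_add[OF DERIV_diff[OF 1 DERIV_cmult[OF 1]] 1]]]) simp
  show "DERIV ramp1 x :> ramp2 x" unfolding ramp1_def[abs_def] ramp2_def
    by (rule DERIV_cong[OF DERIV_cdivide[OF DERIV_add[OF DERIV_diff[OF 2 DERIV_cmult[OF 2]] 2]]]) simp
qed

lemma ramp2_bounds: "0 \<le> ramp2 x" "ramp2 x \<le> 1" "x \<le> 0 \<Longrightarrow> ramp2 x = 0" "2 \<le> x \<Longrightarrow> ramp2 x = 0"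
  by (auto simp: ramp2_def max_def)

lemma ramp1_bounds: "x \<le> 0 \<Longrightarrow> ramp1 x = 0" "2 \<le> x \<Longrightarrow> ramp1 x = 1" "x \<le> y \<Longrightarrow> ramp1 x \<le> ramp1 y"
  "0 \<le> ramp1 x" "ramp1 x \<le> 1"
proof -
  show 0: "x \<le> 0 \<Longrightarrow> ramp1 x = 0" for x by (simp add: ramp1_def)
  show 2: "2 \<le> x \<Longrightarrow> ramp1 x = 1" for x by (simp add: ramp1_def power2_eq_square algebra_simps)
  show m: "x \<le> y \<Longrightarrow> ramp1 x \<le> ramp1 y" for x y
    using DERIV_nonneg_imp_nondecreasing[of x y ramp1] ramp_DERIV(2) ramp2_bounds(1) by blast
  show "0 \<le> ramp1 x" using m[of "min x 0" x] 0[of "min x 0"] by simp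
  show "ramp1 x \<le> 1" using m[of x "max x 2"] 2[of "max x 2"] by simp
qed

lemma ramp_bounds: "x \<le> 0 \<Longrightarrow> ramp x = 0" "2 \<le> x \<Longrightarrow> ramp x = x - 1" "x \<le> y \<Longrightarrow> ramp x \<le> ramp y"
proof -
  show "x \<le> 0 \<Longrightarrow> ramp x = 0" by (simp add: ramp_def)
  show "2 \<le> x \<Longrightarrow> ramp x = x - 1" by (simp add: ramp_def power3_eq_cube algebra_simps) (simp add: field_simps)
  show "x \<le> y \<Longrightarrow> ramp x \<le> ramp y"
    using DERIV_nonneg_imp_nondecreasing[of x y ramp] ramp_DERIV(1) ramp1_bounds(4) by blast
qed

text \<open>\<open>\<eta>\<close> is concave except on the thin layer next to \<open>0\<close>, where \<open>\<eta>''\<close> may be as large as \<open>1 / (\<epsilon> * \<delta>)\<close>.\<close>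

lemma cutoff_exists:
  assumes e: "0 < \<epsilon>" "\<epsilon> \<le> \<delta>"
  obtains \<eta> \<eta>' \<eta>'' :: "real \<Rightarrow> real" where "\<And>t. DERIV \<eta> t :> \<eta>' t" "\<And>t. DERIV \<eta>' t :> \<eta>'' t" "continuous_on UNIV \<eta>''"
    "\<And>t. - \<epsilon> \<le> t \<Longrightarrow> \<eta> t = 0" "\<And>t. t \<le> - (\<delta> + 2 * \<epsilon>) \<Longrightarrow> \<eta> t = 1 - \<epsilon> / \<delta>" "\<And>t. \<eta> t \<ge> 0"
    "\<And>t. \<eta>' t \<le> 0" "\<And>t. \<eta>' t \<ge> - 1 / \<delta>" "\<And>t. - \<epsilon> \<le> t \<Longrightarrow> \<eta>' t = 0" "\<And>t. t \<le> - (\<delta> + 2 * \<epsilon>) \<Longrightarrow> \<eta>' t = 0"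
    "\<And>t. \<eta>'' t \<le> 1 / (\<epsilon> * \<delta>)" "\<And>t. t \<le> - (3 * \<epsilon>) \<Longrightarrow> \<eta>'' t \<le> 0" "\<And>t. - \<epsilon> \<le> t \<Longrightarrow> \<eta>'' t = 0"
    "\<And>t. t \<le> - (\<delta> + 2 * \<epsilon>) \<Longrightarrow> \<eta>'' t = 0"
proof -
  define a where "a t = (- t - \<epsilon>) / \<epsilon>" for t
  define b where "b t = (- t - \<delta>) / \<epsilon>" for t
  have d: "\<delta> > 0" using e by simp
  have da: "DERIV a t :> - (1 / \<epsilon>)" "DERIV b t :> - (1 / \<epsilon>)" for t
    unfolding a_def[abs_def] b_def[abs_def] using e by (auto intro!: derivative_eq_intros)
  have ab: "b t \<le> a t" for t using e by (simp add: a_def b_def divide_right_mono)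
  have a0: "a t \<le> 0" "b t \<le> 0" if "- \<epsilon> \<le> t" for t
    using that e by (auto simp: a_def b_def divide_le_0_iff)
  have a2: "a t \<ge> 2" if "t \<le> - (3 * \<epsilon>)" for t using that e by (simp add: a_def pos_le_divide_eq)
  have b2: "b t \<ge> 2" "a t \<ge> 2" if "t \<le> - (\<delta> + 2 * \<epsilon>)" for t using that e by (simp_all add: a_def b_def pos_le_divide_eq)
  \<comment> \<open>Two ramps, one starting at \<open>- \<epsilon>\<close> and one at
    \<open>- \<delta>\<close>: their difference has slope \<open>- 1 / \<delta>\<close> in between
    and levels off at \<open>\<epsilon> / \<delta> * (a t - b t) = 1 - \<epsilon> /
    \<delta>\<close>.\<close>
  define \<eta> where "\<eta> t = \<epsilon> / \<delta> * (ramp (a t) - ramp (b t))" for t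
  define \<eta>' where "\<eta>' t = - 1 / \<delta> * (ramp1 (a t) - ramp1 (b t))" for t
  define \<eta>'' where "\<eta>'' t = 1 / (\<epsilon> * \<delta>) * (ramp2 (a t) - ramp2 (b t))" for t
  show ?thesis
  proof (rule that[of \<eta> \<eta>' \<eta>''])
    fix t
    have "DERIV (\<lambda>t. \<epsilon> / \<delta> * (ramp (a t) - ramp (b t))) t :> \<epsilon> / \<delta> * (ramp1 (a t) * (- (1 / \<epsilon>)) - ramp1 (b t) * (- (1 / \<epsilon>)))"
      by (intro DERIV_cmult DERIV_diff DERIV_chain2[OF ramp_DERIV(1)] da)
    then show "DERIV \<eta> t :> \<eta>' t" unfolding \<eta>_def[abs_def]
      by (rule DERIV_cong) (use e d in \<open>simp add: \<eta>'_def field_simps\<close>)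
    have "DERIV (\<lambda>t. - 1 / \<delta> * (ramp1 (a t) - ramp1 (b t))) t :> - 1 / \<delta> * (ramp2 (a t) * (- (1 / \<epsilon>)) - ramp2 (b t) * (- (1 / \<epsilon>)))"
      by (intro DERIV_cmult DERIV_diff DERIV_chain2[OF ramp_DERIV(2)] da)
    then show "DERIV \<eta>' t :> \<eta>'' t" unfolding \<eta>'_def[abs_def]
      by (rule DERIV_cong) (use e d in \<open>simp add: \<eta>''_def field_simps\<close>)
    show "\<eta> t \<ge> 0" using ramp_bounds(3)[OF ab] e d by (simp add: \<eta>_def)
    show "\<eta>' t \<le> 0" using ramp1_bounds(3)[OF ab] d by (simp add: \<eta>'_def divide_le_0_iff)
    show "\<eta>' t \<ge> - 1 / \<delta>" using ramp1_bounds(4)[of "b t"] ramp1_bounds(5)[of "a t"] d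
      by (simp add: \<eta>'_def divide_right_mono)
    have "ramp2 (a t) - ramp2 (b t) \<le> 1" using ramp2_bounds(1)[of "b t"] ramp2_bounds(2)[of "a t"] by simp
    then show "\<eta>'' t \<le> 1 / (\<epsilon> * \<delta>)" unfolding \<eta>''_def using e d by (intro mult_left_le) auto
    show "\<eta>'' t \<le> 0" if "t \<le> - (3 * \<epsilon>)"
      using ramp2_bounds(4)[OF a2[OF that]] ramp2_bounds(1)[of "b t"] e d by (simp add: \<eta>''_def)
    show "\<eta>' t = 0" "\<eta>'' t = 0" "\<eta> t = 1 - \<epsilon> / \<delta>" if "t \<le> - (\<delta> + 2 * \<epsilon>)"
      using b2[OF that] e d
      by (simp_all add: \<eta>'_def \<eta>''_def \<eta>_def ramp1_bounds ramp2_bounds ramp_bounds)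
        (simp add: a_def b_def field_simps)
    show "\<eta> t = 0" "\<eta>' t = 0" "\<eta>'' t = 0" if "- \<epsilon> \<le> t"
      using a0[OF that] by (simp_all add: \<eta>_def \<eta>'_def \<eta>''_def ramp1_bounds ramp2_bounds ramp_bounds)
  next
    show "continuous_on UNIV \<eta>''" unfolding \<eta>''_def ramp2_def a_def b_def using e
      by (intro continuous_intros) auto
  qed
qed

subsection \<open>The interior Hessian is controlled by a boundary layer\<close>

context C2_domain
begin

text \<open>Fixing one width by \<open>SOME\<close> lets later statements mention it instead of
  obtaining it each time.\<close>

definition tube :: real where
  "tube = (SOME \<delta>. \<delta> > 0 \<and> C2_on {x. \<bar>s x\<bar> < \<delta>} s \<and> (\<forall>x. \<bar>s x\<bar> < \<delta> \<longrightarrow> norm (grad s x) = 1) \<and>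
    (\<forall>x q. \<bar>s x\<bar> < \<delta> \<longrightarrow> q \<in> \<Gamma> \<longrightarrow> dist x q = \<bar>s x\<bar> \<longrightarrow> x = q + s x *\<^sub>R grad s q \<and> grad s x = grad s q))"

lemma tube: "tube > 0" "C2_on {x. \<bar>s x\<bar> < tube} s" "\<bar>s x\<bar> < tube \<Longrightarrow> norm (grad s x) = 1"
  "\<bar>s x\<bar> < tube \<Longrightarrow> q \<in> \<Gamma> \<Longrightarrow> dist x q = \<bar>s x\<bar> \<Longrightarrow> x = q + s x *\<^sub>R grad s q \<and> grad s x = grad s q"
proof -
  have "\<exists>\<delta>. \<delta> > 0 \<and> C2_on {x. \<bar>s x\<bar> < \<delta>} s \<and> (\<forall>x. \<bar>s x\<bar> < \<delta> \<longrightarrow> norm (grad s x) = 1) \<and>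
    (\<forall>x q. \<bar>s x\<bar> < \<delta> \<longrightarrow> q \<in> \<Gamma> \<longrightarrow> dist x q = \<bar>s x\<bar> \<longrightarrow> x = q + s x *\<^sub>R grad s q \<and> grad s x = grad s q)"
    by (rule tubular_neighbourhood) blast
  from someI_ex[OF this, folded tube_def]
  show "tube > 0" "C2_on {x. \<bar>s x\<bar> < tube} s" "\<bar>s x\<bar> < tube \<Longrightarrow> norm (grad s x) = 1"
    "\<bar>s x\<bar> < tube \<Longrightarrow> q \<in> \<Gamma> \<Longrightarrow> dist x q = \<bar>s x\<bar> \<Longrightarrow> x = q + s x *\<^sub>R grad s q \<and> grad s x = grad s q"
    by blast+
qed

lemma open_tube: "open {x. \<bar>s x\<bar> < tube}"
  by (intro open_Collect_less continuous_intros continuous_sdist)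

lemma sdist_tube: "C1_on {x. \<bar>s x\<bar> < tube} s" "C1_on {x. \<bar>s x\<bar> < tube} (pd s i)"
  using C2_on_C1[OF open_tube tube(2)] by auto

lemma bdry_tube: "p \<in> \<Gamma> \<Longrightarrow> \<bar>s p\<bar> < tube"
  using sdist_zero_iff[of p] tube(1) by simp

text \<open>The derivative of the constant squared length of \<open>grad s\<close>: the normal lies
  in the kernel of the Hessian of the distance.\<close>

lemma hess_sdist_normal:
  assumes x: "\<bar>s x\<bar> < tube"
  shows "(\<Sum>k\<in>UNIV. pd s k x * pd (pd s k) j x) = 0"
proof -
  let ?U = "{x. \<bar>s x\<bar> < tube}"
  have xU: "x \<in> ?U" using x by simp
  have "pd (\<lambda>x. \<Sum>k\<in>UNIV. pd s k x * pd s k x) j x = pd (\<lambda>x. 1) j x"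
  proof (rule C1_on_cong_imp(2)[OF open_tube _ _ xU])
    fix y assume "y \<in> ?U"
    then have "(norm (grad s y))\<^sup>2 = 1" using tube(3) by simp
    then show "1 = (\<Sum>k\<in>UNIV. pd s k y * pd s k y)"
      unfolding power2_norm_eq_inner by (simp add: inner_vec_def grad_def)
  qed simp
  moreover have "pd (\<lambda>x. \<Sum>k\<in>UNIV. pd s k x * pd s k x) j x = (\<Sum>k\<in>UNIV. pd s k x * pd (pd s k) j x + pd (pd s k) j x * pd s k x)"
    using pd_sum[of UNIV "\<lambda>k x. pd s k x * pd s k x" j x] pd_mult[OF C1_on_pd_exists[OF sdist_tube(2) xU] C1_on_pd_exists[OF sdist_tube(2) xU]] by simp
  moreover have "(\<Sum>k\<in>UNIV. pd s k x * pd (pd s k) j x + pd (pd s k) j x * pd s k x) = 2 * (\<Sum>k\<in>UNIV. pd s k x * pd (pd s k) j x)"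
    by (simp add: sum_distrib_left mult.commute)
  ultimately show ?thesis by simp
qed

end

context torsion
begin

definition gmax :: real where "gmax = (SUP x\<in>closure \<Omega>. norm (G x))"

lemma norm_G_le: "x \<in> closure \<Omega> \<Longrightarrow> norm (G x) \<le> gmax"
proof -
  assume x: "x \<in> closure \<Omega>"
  have "compact ((\<lambda>x. norm (G x)) ` closure \<Omega>)"
    by (intro compact_continuous_image continuous_intros cont_G compact_clos)
  then have "bdd_above ((\<lambda>x. norm (G x)) ` closure \<Omega>)"
    by (intro bounded_imp_bdd_above compact_imp_bounded)
  then show ?thesis unfolding gmax_def using x by (rule cSUP_upper2) simp
qed

lemma gmax_nonneg: "gmax \<ge> 0"
  using norm_G_le[of "SOME x. x \<in> \<Omega>"] nonempty_dom clos_eq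
  by (metis UnCI ex_in_conv norm_ge_zero norm_G_le order_trans)

text \<open>The mean value theorem uses derivatives only at inner parameters, so both endpoints may
  lie on the boundary.\<close>

lemma u_segment:
  assumes xy: "x \<in> closure \<Omega>" "y \<in> closure \<Omega>" and seg: "\<And>t. 0 < t \<Longrightarrow> t < 1 \<Longrightarrow> x + t *\<^sub>R (y - x) \<in> \<Omega>"
  shows "\<exists>t. 0 < t \<and> t < 1 \<and> u y - u x = G (x + t *\<^sub>R (y - x)) \<bullet> (y - x)"
proof -
  let ?f = "\<lambda>t. u (x + t *\<^sub>R (y - x))"
  have d: "DERIV ?f t :> G (x + t *\<^sub>R (y - x)) \<bullet> (y - x)" if t: "0 < t" "t < 1" for t
  proof -
    have in': "x + t *\<^sub>R (y - x) \<in> \<Omega>" using seg t by blast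
    have "DERIV (\<lambda>r. u ((x + t *\<^sub>R (y - x)) + r *\<^sub>R (y - x))) 0 :> grad u (x + t *\<^sub>R (y - x)) \<bullet> (y - x)"
      by (rule GDERIV_line[OF C1_on_GDERIV[OF C2_on_C1(1)[OF open_dom C2_u] open_dom in']])
    then have "DERIV (\<lambda>r. u ((x + t *\<^sub>R (y - x)) + r *\<^sub>R (y - x))) (t - t) :> G (x + t *\<^sub>R (y - x)) \<bullet> (y - x)"
      using G_grad[OF in'] by simp
    moreover have "DERIV (\<lambda>r. r - t) t :> 1" by (auto intro!: derivative_eq_intros)
    ultimately have "DERIV (\<lambda>r. u ((x + t *\<^sub>R (y - x)) + (r - t) *\<^sub>R (y - x))) t :> G (x + t *\<^sub>R (y - x)) \<bullet> (y - x) * 1"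
      by (rule DERIV_chain2)
    moreover have "(x + t *\<^sub>R (y - x)) + (r - t) *\<^sub>R (y - x) = x + r *\<^sub>R (y - x)" for r
      by (simp add: scaleR_left_diff_distrib)
    ultimately show ?thesis by simp
  qed
  have "x + t *\<^sub>R (y - x) \<in> closure \<Omega>" if "0 \<le> t" "t \<le> 1" for t
    using seg[of t] that xy closure_subset by (cases "t = 0 \<or> t = 1") auto
  then have "continuous_on {0..1} ?f"
    by (intro continuous_on_compose2[OF cont_u] continuous_intros) auto
  from MVT[OF zero_less_one this] d
  obtain l z where z: "0 < z" "z < 1" "DERIV ?f z :> l" "?f 1 - ?f 0 = (1 - 0) * l"
    using real_differentiable_def by blast
  then have "l = G (x + z *\<^sub>R (y - x)) \<bullet> (y - x)" using d[OF z(1,2)] DERIV_unique by blast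
  then show ?thesis using z by (intro exI[of _ z]) simp
qed

text \<open>The segment to the nearest boundary point stays in the domain until its end, where
  \<open>u\<close> vanishes.\<close>

lemma u_bound:
  assumes x: "x \<in> closure \<Omega>"
  shows "\<bar>u x\<bar> \<le> gmax * \<bar>s x\<bar>"
proof (cases "x \<in> \<Omega>")
  case False
  then have "x \<in> \<Gamma>" using x clos_eq by auto
  then show ?thesis using u_bdry gmax_nonneg by simp
next
  case True
  obtain q where q: "q \<in> \<Gamma>" "dist x q = \<bar>s x\<bar>" using nearest_exists by blast
  have in': "x + t *\<^sub>R (q - x) \<in> \<Omega>" if t: "0 < t" "t < 1" for t
  proof (rule sdist_line_in[OF True])
    have "\<bar>s x\<bar> > 0" using True sdist_neg_iff[of x] by simp
    then have "t * \<bar>s x\<bar> < \<bar>s x\<bar>" using t by simp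
    then show "dist x (x + t *\<^sub>R (q - x)) < \<bar>s x\<bar>" using t q(2) by (simp add: dist_norm norm_minus_commute)
  qed
  have qc: "q \<in> closure \<Omega>" using q clos_eq by auto
  obtain t where t: "0 < t" "t < 1" "u q - u x = G (x + t *\<^sub>R (q - x)) \<bullet> (q - x)"
    using u_segment[OF x qc in'] by blast
  have "\<bar>u x\<bar> = \<bar>G (x + t *\<^sub>R (q - x)) \<bullet> (q - x)\<bar>" using t(3) u_bdry[OF q(1)] by simp
  also have "\<dots> \<le> norm (G (x + t *\<^sub>R (q - x))) * norm (q - x)" by (rule Cauchy_Schwarz_ineq2)
  also have "\<dots> \<le> gmax * norm (q - x)"
    using in'[OF t(1,2)] closure_subset by (intro mult_right_mono norm_G_le) auto
  finally show ?thesis using q(2) by (simp add: dist_norm norm_minus_commute)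
qed

text \<open>Curves inside the boundary are avoided. From \<open>p\<close> one moves in the direction
  of the tangential part \<open>\<tau>\<close> of \<open>G p\<close>, tilted inwards by a small
  \<open>a\<close>. The depth then grows only at a rate of order \<open>a\<close>, so
  \<open>u_bound\<close> and the mean value theorem keep \<open>G\<close> in that direction of order
  \<open>a\<close>. Continuity of \<open>G\<close> at \<open>p\<close> and
  \<open>a \<rightarrow> 0\<close> give \<open>\<tau> = 0\<close>.\<close>

lemma G_normal:
  assumes p: "p \<in> \<Gamma>"
  shows "G p = (G p \<bullet> grad s p) *\<^sub>R grad s p"
proof -
  define \<nu> where "\<nu> = grad s p"
  define \<tau> where "\<tau> = G p - (G p \<bullet> \<nu>) *\<^sub>R \<nu>"
  have nn: "norm \<nu> = 1" unfolding \<nu>_def by (rule tube(3)[OF bdry_tube[OF p]])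
  then have nn': "\<nu> \<bullet> \<nu> = 1" by (simp add: dot_square_norm)
  have tn: "\<tau> \<bullet> \<nu> = 0" "G p \<bullet> \<tau> = \<tau> \<bullet> \<tau>"
    by (simp_all add: \<tau>_def inner_diff_left inner_diff_right nn' inner_commute)
  have pin: "p \<in> {x. \<bar>s x\<bar> < tube}" using bdry_tube[OF p] by simp
  have sp: "s p = 0" using p sdist_zero_iff by simp
  have pc: "p \<in> closure \<Omega>" using p clos_eq by auto
  have est: "\<tau> \<bullet> \<tau> \<le> a * (2 * gmax + \<bar>G p \<bullet> \<nu>\<bar>)" if a: "a > 0" for a
  proof -
    \<comment> \<open>The tilt makes the derivative of \<open>s\<close> along \<open>d\<close> equal
      to \<open>- a < 0\<close>, so short steps from \<open>p\<close> land in the domain.\<close>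
    define d where "d = \<tau> - a *\<^sub>R \<nu>"
    have "\<nu> \<bullet> d = - a" using tn nn' by (simp add: d_def inner_diff_right inner_commute)
    then have D: "DERIV (\<lambda>t. s (p + t *\<^sub>R d)) 0 :> - a"
      using GDERIV_line[OF C1_on_GDERIV[OF sdist_tube(1) open_tube pin], of d] by (simp add: \<nu>_def)
    obtain h1 where h1: "h1 > 0" "\<And>h. 0 < h \<Longrightarrow> h < h1 \<Longrightarrow> s (p + h *\<^sub>R d) < 0"
      using DERIV_neg_dec_right[OF D] a sp by auto
    have "((\<lambda>h. (s (p + (0 + h) *\<^sub>R d) - s (p + 0 *\<^sub>R d)) / h) \<longlongrightarrow> - a) (at 0)"
      using D unfolding DERIV_def .
    then have "\<forall>\<^sub>F h in at 0. s (p + h *\<^sub>R d) / h > - 2 * a"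
      using order_tendstoD(1)[of _ "- a" "at 0" "- 2 * a"] a sp by simp
    then obtain h2 where h2: "h2 > 0" "\<And>h. h \<noteq> 0 \<Longrightarrow> \<bar>h\<bar> < h2 \<Longrightarrow> s (p + h *\<^sub>R d) / h > - 2 * a"
      unfolding eventually_at by (auto simp: dist_real_def)
    have ex: "\<exists>r. 0 < r \<and> r < h \<and> \<bar>G (p + r *\<^sub>R d) \<bullet> d\<bar> \<le> 2 * a * gmax" if h: "0 < h" "h < h1" "h < h2" for h
    proof -
      define y where "y = p + h *\<^sub>R d"
      have yO: "y \<in> \<Omega>" using h1(2)[OF h(1,2)] sdist_neg_iff by (simp add: y_def)
      have seg: "p + t *\<^sub>R (y - p) \<in> \<Omega>" if t: "0 < t" "t < 1" for t
      proof -
        have "t * h < h" using t h by simp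
        then have "t * h < h1" using h(2) by linarith
        moreover have "0 < t * h" using t h by simp
        ultimately have "0 < t * h" "t * h < h1" by blast+
        then have "p + (t * h) *\<^sub>R d \<in> \<Omega>" using h1(2) sdist_neg_iff by blast
        then show ?thesis by (simp add: y_def)
      qed
      have yc: "y \<in> closure \<Omega>" using yO closure_subset by blast
      obtain t where t: "0 < t" "t < 1" "u y - u p = G (p + t *\<^sub>R (y - p)) \<bullet> (y - p)"
        using u_segment[OF pc yc seg] by blast
      have "\<bar>s y\<bar> \<le> 2 * a * h"
      proof -
        have "s y / h > - 2 * a" using h2(2)[of h] h by (simp add: y_def)
        then have "s y > - 2 * a * h" using h by (simp add: pos_less_divide_eq)
        moreover have "s y < 0" using yO sdist_neg_iff by simp
        ultimately show ?thesis by simp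
      qed
      then have "gmax * \<bar>s y\<bar> \<le> gmax * (2 * a * h)" using gmax_nonneg by (rule mult_left_mono)
      then have "\<bar>G (p + t *\<^sub>R (y - p)) \<bullet> (y - p)\<bar> \<le> gmax * (2 * a * h)"
        using t(3) u_bdry[OF p] u_bound[OF yc] by simp
      then have "h * \<bar>G (p + (t * h) *\<^sub>R d) \<bullet> d\<bar> \<le> h * (2 * a * gmax)"
        using h by (simp add: y_def abs_mult mult_ac)
      then have "\<bar>G (p + (t * h) *\<^sub>R d) \<bullet> d\<bar> \<le> 2 * a * gmax" using h by simp
      moreover have "0 < t * h" "t * h < h" using t h by auto
      ultimately show ?thesis by blast
    qed
    have "\<bar>G p \<bullet> d\<bar> \<le> 2 * a * gmax"
    proof (rule ccontr)
      assume "\<not> \<bar>G p \<bullet> d\<bar> \<le> 2 * a * gmax"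
      then have e: "\<bar>G p \<bullet> d\<bar> - 2 * a * gmax > 0" by simp
      have "continuous_on (closure \<Omega>) (\<lambda>x. \<bar>G x \<bullet> d\<bar>)" by (intro continuous_intros cont_G)
      then obtain \<rho> where \<rho>: "\<rho> > 0" "\<And>x. x \<in> closure \<Omega> \<Longrightarrow> dist x p < \<rho> \<Longrightarrow>
          dist \<bar>G x \<bullet> d\<bar> \<bar>G p \<bullet> d\<bar> < \<bar>G p \<bullet> d\<bar> - 2 * a * gmax"
        using pc e unfolding continuous_on_iff by metis
      define h where "h = min (h1 / 2) (min (h2 / 2) (\<rho> / (2 * (norm d + 1))))"
      have h: "0 < h" "h < h1" "h < h2" using h1 h2 \<rho> by (auto simp: h_def add_nonneg_pos)
      from ex[OF h] obtain r where r: "0 < r" "r < h" "\<bar>G (p + r *\<^sub>R d) \<bullet> d\<bar> \<le> 2 * a * gmax" by blast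
      have "r * norm d \<le> h * (norm d + 1)" using r by (intro mult_mono) auto
      also have "\<dots> \<le> \<rho> / (2 * (norm d + 1)) * (norm d + 1)" by (intro mult_right_mono) (auto simp: h_def)
      also have "\<dots> = \<rho> / 2"
      proof -
        have "c \<noteq> 0 \<Longrightarrow> \<rho> / (2 * c) * c = \<rho> / 2" for c :: real by simp
        then show ?thesis by (metis add_nonneg_pos less_numeral_extra(1,3) norm_ge_zero)
      qed
      finally have "dist (p + r *\<^sub>R d) p < \<rho>" using r \<rho> by (simp add: dist_norm)
      moreover have "p + r *\<^sub>R d \<in> closure \<Omega>" using h1(2)[of r] r h closure_sdist by auto
      ultimately have "dist \<bar>G (p + r *\<^sub>R d) \<bullet> d\<bar> \<bar>G p \<bullet> d\<bar> < \<bar>G p \<bullet> d\<bar> - 2 * a * gmax" using \<rho>(2) by blast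
      then show False using r(3) by (simp add: dist_real_def)
    qed
    moreover have "G p \<bullet> d = \<tau> \<bullet> \<tau> - a * (G p \<bullet> \<nu>)" using tn by (simp add: d_def inner_diff_right)
    moreover have "a * (G p \<bullet> \<nu>) \<le> a * \<bar>G p \<bullet> \<nu>\<bar>" using a by simp
    ultimately show ?thesis by (simp add: algebra_simps)
  qed
  have "\<tau> \<bullet> \<tau> \<le> 0"
  proof (rule ccontr)
    assume "\<not> \<tau> \<bullet> \<tau> \<le> 0"
    define B where "B = 2 * gmax + \<bar>G p \<bullet> \<nu>\<bar> + 1"
    have B: "B > 0" using gmax_nonneg by (simp add: B_def add_nonneg_pos)
    have "\<tau> \<bullet> \<tau> > 0" using \<open>\<not> \<tau> \<bullet> \<tau> \<le> 0\<close> by linarith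
    then have "(\<tau> \<bullet> \<tau>) / (2 * B) > 0" using B by simp
    from est[OF this] have "\<tau> \<bullet> \<tau> \<le> (\<tau> \<bullet> \<tau>) / (2 * B) * (B - 1)" by (simp add: B_def)
    also have "\<dots> \<le> (\<tau> \<bullet> \<tau>) / (2 * B) * B" using \<open>\<tau> \<bullet> \<tau> > 0\<close> B by (intro mult_left_mono) auto
    also have "\<dots> = (\<tau> \<bullet> \<tau>) / 2" using B by simp
    finally show False using \<open>\<tau> \<bullet> \<tau> > 0\<close> by simp
  qed
  then have "\<tau> = 0" by (meson inner_gt_zero_iff not_le)
  then show ?thesis by (simp add: \<tau>_def \<nu>_def)
qed

text \<open>On \<open>\<Gamma>\<close>, where \<open>G = u\<^sub>\<nu> *\<^sub>R \<nu>\<close>, this is \<open>(N - 1) * u\<^sub>\<nu> * (1 - H * u\<^sub>\<nu>)\<close>, which is at most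
  \<open>(N - 1) * max 0 (1 / H - u\<^sub>\<nu>)\<close>.\<close>

definition bflux :: "real^'n \<Rightarrow> real" where
  "bflux x = (real CARD('n) - 1) * (G x \<bullet> grad s x)
     + (\<Sum>i\<in>UNIV. \<Sum>j\<in>UNIV. pd (pd s i) j x * G x $ i * G x $ j) - (norm (G x))\<^sup>2 * lap s x"

lemma bflux_bdry:
  assumes p: "p \<in> \<Gamma>" and H: "mean_curv \<Omega> p > 0" and N: "CARD('n) \<ge> 2"
  shows "bflux p \<le> (real CARD('n) - 1) * \<bar>G p \<bullet> outer_normal \<Omega> p - 1 / mean_curv \<Omega> p\<bar>"
proof -
  define a where "a = G p \<bullet> grad s p"
  define m where "m = mean_curv \<Omega> p"
  define N' where "N' = real CARD('n) - 1"
  have N': "N' > 0" using N by (simp add: N'_def)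
  have Gp: "G p = a *\<^sub>R grad s p" unfolding a_def by (rule G_normal[OF p])
  have nn: "norm (grad s p) = 1" by (rule tube(3)[OF bdry_tube[OF p]])
  have "(\<Sum>i\<in>UNIV. \<Sum>j\<in>UNIV. pd (pd s i) j p * G p $ i * G p $ j)
      = (\<Sum>j\<in>UNIV. \<Sum>i\<in>UNIV. pd (pd s i) j p * G p $ i * G p $ j)" by (rule sum.swap)
  also have "\<dots> = (\<Sum>j\<in>UNIV. a\<^sup>2 * pd s j p * (\<Sum>i\<in>UNIV. pd s i p * pd (pd s i) j p))"
    unfolding Gp by (simp add: sum_distrib_left grad_def power2_eq_square mult_ac)
  also have "\<dots> = 0" using hess_sdist_normal[OF bdry_tube[OF p]] by simp
  finally have 1: "(\<Sum>i\<in>UNIV. \<Sum>j\<in>UNIV. pd (pd s i) j p * G p $ i * G p $ j) = 0" .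
  have lap: "lap s p = N' * m" using N' by (simp add: m_def mean_curv_def N'_def)
  have ng: "(norm (G p))\<^sup>2 = a\<^sup>2" unfolding Gp using nn by simp
  have "bflux p = N' * (a - a\<^sup>2 * m)"
    unfolding bflux_def 1 lap ng a_def[symmetric] N'_def[symmetric] by (simp add: algebra_simps)
  moreover have "a - a\<^sup>2 * m \<le> \<bar>a - 1 / m\<bar>"
  proof -
    have m: "m > 0" using H by (simp add: m_def)
    \<comment> \<open>In terms of the deficit \<open>1 / m - a\<close> the expression is the deficit
      minus a square weighted by the mean curvature; its sign is where positive curvature
      enters.\<close>
    have "a - a\<^sup>2 * m = (1 / m - a) - m * (1 / m - a)\<^sup>2"
      using m by (simp add: field_simps power2_eq_square)
    also have "\<dots> \<le> 1 / m - a" using m by simp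
    finally show ?thesis by linarith
  qed
  ultimately have "bflux p \<le> N' * \<bar>a - 1 / m\<bar>" using N' by simp
  then show ?thesis by (simp add: N'_def a_def m_def outer_normal_def)
qed

lemma strip_subset:
  assumes "\<rho> < tube" "0 \<le> \<rho>"
  shows "{x. - \<rho> \<le> s x \<and> s x \<le> 0} \<subseteq> {x. \<bar>s x\<bar> < tube}" "{x. - \<rho> \<le> s x \<and> s x \<le> 0} \<subseteq> closure \<Omega>"
  using assms closure_sdist tube(1) by auto

lemma continuous_strip:
  assumes "\<rho> < tube" "0 \<le> \<rho>"
  shows "continuous_on {x. - \<rho> \<le> s x \<and> s x \<le> 0} bflux"
    "continuous_on {x. - \<rho> \<le> s x \<and> s x \<le> 0} (\<lambda>x. (norm (G x))\<^sup>2 - (G x \<bullet> grad s x)\<^sup>2)"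
proof -
  let ?S = "{x. - \<rho> \<le> s x \<and> s x \<le> 0}"
  have c1: "continuous_on ?S (pd (pd s i) j)" "continuous_on ?S (grad s)" "continuous_on ?S G" for i j
    using continuous_on_subset[OF C1_on_pd_continuous[OF sdist_tube(2)] strip_subset(1)[OF assms]]
      continuous_on_subset[OF C1_on_grad_continuous[OF sdist_tube(1)] strip_subset(1)[OF assms]]
      continuous_on_subset[OF cont_G strip_subset(2)[OF assms]] by auto
  show "continuous_on ?S bflux" unfolding bflux_def[abs_def] lap_def
    by (intro continuous_intros c1)
  show "continuous_on ?S (\<lambda>x. (norm (G x))\<^sup>2 - (G x \<bullet> grad s x)\<^sup>2)"
    by (intro continuous_intros c1)
qed

definition defect :: "real^'n \<Rightarrow> real" where
  "defect x = (\<Sum>i\<in>UNIV. \<Sum>j\<in>UNIV. (pd (pd u i) j x)\<^sup>2) - real CARD('n)"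

lemma defect_eq:
  fixes z :: "real^'n"
  assumes x: "x \<in> \<Omega>"
  shows "defect x = (\<Sum>i\<in>UNIV. \<Sum>j\<in>UNIV. (pd (pd (\<lambda>x. (norm (x - z))\<^sup>2 / 2 - u x) i) j x)\<^sup>2)"
proof -
  have "(\<Sum>i\<in>UNIV. \<Sum>j\<in>UNIV. (pd (pd (\<lambda>x. (norm (x - z))\<^sup>2 / 2 - u x) i) j x)\<^sup>2)
    = (\<Sum>i\<in>UNIV. \<Sum>j\<in>UNIV. (pd (pd u i) j x)\<^sup>2 + (if i = j then 1 - 2 * pd (pd u i) j x else 0))"
    unfolding harmonic_part(4)[OF x] by (intro sum.cong refl) (auto simp: power2_eq_square algebra_simps)
  also have "\<dots> = (\<Sum>i\<in>UNIV. \<Sum>j\<in>UNIV. (pd (pd u i) j x)\<^sup>2) + (\<Sum>i\<in>UNIV. 1 - 2 * pd (pd u i) i x)"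
    by (simp add: sum.distrib)
  also have "(\<Sum>i\<in>UNIV. 1 - 2 * pd (pd u i) i x) = real CARD('n) - 2 * lap u x"
    by (simp add: sum_subtractf lap_def sum_distrib_left)
  finally show ?thesis using lap_u[OF x] by (simp add: defect_def)
qed

lemma defect_nonneg: "x \<in> \<Omega> \<Longrightarrow> defect x \<ge> 0"
  unfolding defect_eq[of x 0] by (intro sum_nonneg) auto

lemma continuous_defect: "continuous_on \<Omega> defect"
  unfolding defect_def[abs_def]
  by (intro continuous_intros C1_on_pd_continuous C2_on_C1(2)[OF open_dom C2_u])

end

context torsion
begin

text \<open>\<open>s\<close> is C^2 only near the boundary. Where
  \<open>\<bar>s x\<bar> \<ge> tube\<close> the composition is locally constant, with value 0
  outside and \<open>c\<close> deep inside, and the two descriptions agree on open sets that cover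
  the space.\<close>

lemma cutoff_derivs:
  assumes ph: "\<And>t. DERIV \<eta> t :> \<eta>' t" "\<And>t. DERIV \<eta>' t :> \<eta>'' t" "continuous_on UNIV \<eta>''"
    and z: "\<And>t. - \<epsilon> \<le> t \<Longrightarrow> \<eta> t = 0" and e: "0 < \<epsilon>" and c: "\<And>t. t \<le> - \<rho> \<Longrightarrow> \<eta> t = c" and r: "\<rho> < tube"
  shows "C2_on UNIV (\<lambda>x. \<eta> (s x))"
    "\<bar>s x\<bar> < tube \<Longrightarrow> pd (\<lambda>x. \<eta> (s x)) i x = \<eta>' (s x) * pd s i x"
    "\<bar>s x\<bar> < tube \<Longrightarrow> pd (pd (\<lambda>x. \<eta> (s x)) i) j x = \<eta>'' (s x) * pd s j x * pd s i x + \<eta>' (s x) * pd (pd s i) j x"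
    "tube \<le> \<bar>s x\<bar> \<Longrightarrow> pd (\<lambda>x. \<eta> (s x)) i x = 0 \<and> pd (pd (\<lambda>x. \<eta> (s x)) i) j x = 0"
proof -
  let ?f = "\<lambda>x. \<eta> (s x)"
  let ?U = "{x. \<bar>s x\<bar> < tube}"
  note rc = C2_on_real_compose[OF open_tube tube(2) ph(1,2,3), simplified]
  show "\<bar>s x\<bar> < tube \<Longrightarrow> pd ?f i x = \<eta>' (s x) * pd s i x"
    "\<bar>s x\<bar> < tube \<Longrightarrow> pd (pd ?f i) j x = \<eta>'' (s x) * pd s j x * pd s i x + \<eta>' (s x) * pd (pd s i) j x"
    using rc by auto
  have far: "\<exists>V k. open V \<and> x \<in> V \<and> (\<forall>y\<in>V. ?f y = k)" if x: "tube \<le> \<bar>s x\<bar>" for x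
  proof (cases "s x < 0")
    case True
    then have "x \<in> {y. s y < - \<rho>}" using x r by auto
    moreover have "open {y. s y < - \<rho>}" by (intro open_Collect_less continuous_intros continuous_sdist)
    moreover have "\<forall>y\<in>{y. s y < - \<rho>}. ?f y = c" using c by simp
    ultimately show ?thesis by blast
  next
    case False
    then have "x \<in> {y. - \<epsilon> < s y}" using e by simp
    moreover have "open {y. - \<epsilon> < s y}" by (intro open_Collect_less continuous_intros continuous_sdist)
    moreover have "\<forall>y\<in>{y. - \<epsilon> < s y}. ?f y = 0" using z by simp
    ultimately show ?thesis by blast
  qed
  have farC: "\<exists>V. open V \<and> x \<in> V \<and> C2_on V ?f \<and> pd ?f i x = 0 \<and> pd (pd ?f i) j x = 0" if x: "tube \<le> \<bar>s x\<bar>" for x i j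
  proof -
    obtain V k where V: "open V" "x \<in> V" "\<And>y. y \<in> V \<Longrightarrow> k = ?f y" using far[OF x] by metis
    have c0: "pd (\<lambda>y::real^'n. k) i = (\<lambda>y. 0)" for i by (rule ext) simp
    have "pd ?f i x = 0" using C1_on_cong_imp(2)[OF V(1) C1_on_const(1) V(3) V(2)] by simp
    moreover have "pd (pd ?f i) j x = pd (pd (\<lambda>y. k) i) j x"
      by (rule C2_on_cong_imp(2)[OF V(1) C2_on_const[OF V(1)] V(3) V(2)])
    then have "pd (pd ?f i) j x = 0" unfolding c0 C1_on_const(2) .
    moreover have "C2_on V ?f" by (rule C2_on_cong_imp(1)[OF V(1) C2_on_const[OF V(1)] V(3)])
    ultimately show ?thesis using V(1,2) by blast
  qed
  show "tube \<le> \<bar>s x\<bar> \<Longrightarrow> pd ?f i x = 0 \<and> pd (pd ?f i) j x = 0" using farC by blast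
  show "C2_on UNIV ?f"
  proof (rule C2_on_local)
    fix x
    show "\<exists>V. open V \<and> x \<in> V \<and> C2_on V ?f"
    proof (cases "\<bar>s x\<bar> < tube")
      case True
      then show ?thesis using open_tube rc(1) by blast
    next
      case False
      then show ?thesis using farC[of x] by force
    qed
  qed
qed

text \<open>The tangential part of \<open>G\<close> vanishes on the boundary by
  \<open>G_normal\<close>; uniform continuity on the compact strip carries this to nearby
  points.\<close>

lemma tangential_small:
  assumes "\<rho> < tube" "0 < \<rho>" "\<kappa> > 0"
  shows "\<exists>d>0. \<forall>x. - \<rho> \<le> s x \<longrightarrow> s x \<le> 0 \<longrightarrow> \<bar>s x\<bar> < d \<longrightarrow> (norm (G x))\<^sup>2 - (G x \<bullet> grad s x)\<^sup>2 < \<kappa>"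
proof -
  let ?S = "{x. - \<rho> \<le> s x \<and> s x \<le> 0}"
  let ?T = "\<lambda>x. (norm (G x))\<^sup>2 - (G x \<bullet> grad s x)\<^sup>2"
  have cS: "compact ?S" using compact_strip(2)[of \<rho>] assms by simp
  define T where "T = ?T"
  define S where "S = ?S"
  have uc: "uniformly_continuous_on S T"
    unfolding S_def T_def using compact_uniformly_continuous[OF continuous_strip(2) cS] assms by simp
  obtain d where d0: "d > 0" "\<And>x y. x \<in> S \<Longrightarrow> y \<in> S \<Longrightarrow> dist y x < d \<Longrightarrow> dist (T y) (T x) < \<kappa>"
    using uniformly_continuous_onE[OF uc assms(3)] by metis
  have d: "d > 0" "\<And>x y. x \<in> ?S \<Longrightarrow> y \<in> ?S \<Longrightarrow> dist y x < d \<Longrightarrow> dist (?T y) (?T x) < \<kappa>"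
    using d0 unfolding S_def T_def by blast+
  have "?T x < \<kappa>" if x: "x \<in> ?S" "\<bar>s x\<bar> < d" for x
  proof -
    obtain q where q: "q \<in> \<Gamma>" "dist x q = \<bar>s x\<bar>" using nearest_exists by blast
    have "q \<in> ?S" using q(1) sdist_zero_iff[of q] assms by simp
    then have "dist (?T x) (?T q) < \<kappa>" using d(2) x q by simp
    moreover have "?T q = 0"
    proof -
      have "norm (G q) = \<bar>G q \<bullet> grad s q\<bar>"
        using G_normal[OF q(1)] tube(3)[OF bdry_tube[OF q(1)]] by (metis mult_1_right norm_scaleR real_norm_def)
      then show ?thesis by simp
    qed
    ultimately show ?thesis by (simp add: dist_real_def)
  qed
  then show ?thesis using d(1) by (intro exI[of _ d]) auto
qed

text \<open>For \<open>\<phi> = \<eta> \<circ> s\<close> the second derivatives of \<open>\<phi>\<close> contribute \<open>\<eta>'' * (\<bar>G\<bar>\<^sup>2 - (G \<bullet> grad s)\<^sup>2)\<close>: nonpositive where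
  \<open>\<eta>\<close> is concave, and small in the thin layer because \<open>G\<close> is normal on \<open>\<Gamma>\<close>.\<close>

lemma interior_defect_approx:
  assumes d: "0 < \<delta>" "3 * \<delta> < tube" and K: "compact K" "K \<subseteq> {x. s x \<le> - (3 * \<delta>)}" and tau: "0 < \<tau>" "\<tau> < 1"
  shows "(1 - \<tau>) * integral\<^sup>L lborel (\<lambda>x. indicator K x * defect x)
    \<le> (1 / \<delta>) * integral\<^sup>L lborel (\<lambda>x. indicator {x. - (3 * \<delta>) \<le> s x \<and> s x \<le> 0} x * max 0 (bflux x)) + \<tau>"
proof -
  let ?S = "{x. - (3 * \<delta>) \<le> s x \<and> s x \<le> 0}"
  have d3: "0 \<le> 3 * \<delta>" "0 < 3 * \<delta>" using d by auto
  have cS: "compact ?S" using compact_strip(2)[OF d3(1)] .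
  have cb: "continuous_on ?S bflux" using continuous_strip(1)[OF d(2) d3(1)] .
  have KO: "K \<subseteq> \<Omega>" using K(2) sdist_neg_iff d by force
  obtain C \<epsilon>\<^sub>0 where C: "C > 0" "\<epsilon>\<^sub>0 > 0" "\<And>\<epsilon>. 0 < \<epsilon> \<Longrightarrow> \<epsilon> \<le> \<epsilon>\<^sub>0 \<Longrightarrow> measure lborel {x. \<bar>s x\<bar> \<le> \<epsilon>} \<le> C * \<epsilon>"
    using strip_measure by metis
  \<comment> \<open>The thin layer has measure at most \<open>C * (3 * \<epsilon>)\<close> and
    contributes at most \<open>\<kappa> / (\<epsilon> * \<delta>)\<close> per unit of volume; this
    choice makes the product exactly \<open>\<tau>\<close>, whatever \<open>\<epsilon>\<close>
    is.\<close>
  define \<kappa> where "\<kappa> = \<tau> * \<delta> / (3 * C)"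
  have k: "\<kappa> > 0" using tau d C by (simp add: \<kappa>_def)
  obtain d' where d': "d' > 0" "\<And>x. - (3 * \<delta>) \<le> s x \<Longrightarrow> s x \<le> 0 \<Longrightarrow> \<bar>s x\<bar> < d' \<Longrightarrow> (norm (G x))\<^sup>2 - (G x \<bullet> grad s x)\<^sup>2 < \<kappa>"
    using tangential_small[OF d(2) d3(2) k] by blast
  \<comment> \<open>The first bound keeps the plateau \<open>1 - \<epsilon> / \<delta>\<close> above
    \<open>1 - \<tau>\<close>; the others make \<open>strip_measure\<close> and the smallness of the
    tangential part available at depth \<open>3 * \<epsilon>\<close>.\<close>
  define \<epsilon> where "\<epsilon> = min (\<tau> * \<delta>) (min (\<epsilon>\<^sub>0 / 3) (d' / 6))"
  have e: "0 < \<epsilon>" "\<epsilon> \<le> \<tau> * \<delta>" "3 * \<epsilon> \<le> \<epsilon>\<^sub>0" "3 * \<epsilon> < d'" using tau d C d' by (auto simp: \<epsilon>_def)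
  have "\<tau> * \<delta> \<le> 1 * \<delta>" using tau d by (intro mult_right_mono) auto
  then have ed: "\<epsilon> \<le> \<delta>" using e(2) by linarith
  obtain \<eta> \<eta>' \<eta>'' :: "real \<Rightarrow> real" where eta: "\<And>t. DERIV \<eta> t :> \<eta>' t" "\<And>t. DERIV \<eta>' t :> \<eta>'' t" "continuous_on UNIV \<eta>''"
    "\<And>t. - \<epsilon> \<le> t \<Longrightarrow> \<eta> t = 0" "\<And>t. t \<le> - (\<delta> + 2 * \<epsilon>) \<Longrightarrow> \<eta> t = 1 - \<epsilon> / \<delta>" "\<And>t. \<eta> t \<ge> 0"
    "\<And>t. \<eta>' t \<le> 0" "\<And>t. \<eta>' t \<ge> - 1 / \<delta>" "\<And>t. - \<epsilon> \<le> t \<Longrightarrow> \<eta>' t = 0" "\<And>t. t \<le> - (\<delta> + 2 * \<epsilon>) \<Longrightarrow> \<eta>' t = 0"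
    "\<And>t. \<eta>'' t \<le> 1 / (\<epsilon> * \<delta>)" "\<And>t. t \<le> - (3 * \<epsilon>) \<Longrightarrow> \<eta>'' t \<le> 0" "\<And>t. - \<epsilon> \<le> t \<Longrightarrow> \<eta>'' t = 0"
    "\<And>t. t \<le> - (\<delta> + 2 * \<epsilon>) \<Longrightarrow> \<eta>'' t = 0"
    apply (rule cutoff_exists[OF e(1) ed])
    subgoal for \<eta> \<eta>' \<eta>'' by (rule that[of \<eta> \<eta>' \<eta>'']; blast)
    done
  define \<phi> where "\<phi> x = \<eta> (s x)" for x
  have dt: "\<delta> + 2 * \<epsilon> < tube" using ed d by simp
  note cd = cutoff_derivs[OF eta(1,2,3,4) e(1) eta(5) dt, folded \<phi>_def[abs_def], simplified]
  let ?K' = "{x. s x \<le> - \<epsilon>}"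
  have K': "compact ?K'" "?K' \<subseteq> \<Omega>" using compact_strip(3)[of \<epsilon>] e sdist_neg_iff by force+
  have z: "\<phi> x = 0" if "x \<notin> ?K'" for x using that eta(4) by (simp add: \<phi>_def)
  define A where "A x = \<phi> x * defect x" for x
  define B where "B x = lap \<phi> x * (norm (grad u x))\<^sup>2 - (\<Sum>i\<in>UNIV. \<Sum>j\<in>UNIV. pd (pd \<phi> i) j x * pd u i x * pd u j x)
          - (real CARD('n) - 1) * (grad \<phi> x \<bullet> grad u x)" for x
  have AB: "integrable lborel A" "integrable lborel B" "integral\<^sup>L lborel A = integral\<^sup>L lborel B"
    using torsion_identity[OF cd(1) K' z] unfolding A_def[abs_def] B_def[abs_def] defect_def by auto
  have iK: "integrable lborel (\<lambda>x. indicator K x * defect x)"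
    using borel_integrable_compact[OF K(1) continuous_on_subset[OF continuous_defect KO]] by simp
  have A_low: "(1 - \<tau>) * (indicator K x * defect x) \<le> A x" for x
  proof (cases "x \<in> K")
    case True
    then have "s x \<le> - (\<delta> + 2 * \<epsilon>)" using K(2) ed by force
    then have "\<phi> x = 1 - \<epsilon> / \<delta>" using eta(5) by (simp add: \<phi>_def)
    moreover have "\<epsilon> / \<delta> \<le> \<tau>" using e(2) d by (simp add: pos_divide_le_eq)
    ultimately have "(1 - \<tau>) * defect x \<le> \<phi> x * defect x"
      using defect_nonneg True KO by (intro mult_right_mono) auto
    then show ?thesis using True by (simp add: A_def)
  next
    case False
    have "A x \<ge> 0"
    proof (cases "x \<in> \<Omega>")
      case True
      then show ?thesis unfolding A_def \<phi>_def using eta(6) defect_nonneg by simp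
    next
      case False
      then have "\<phi> x = 0" using K'(2) by (intro z) blast
      then show ?thesis by (simp add: A_def)
    qed
    then show ?thesis using False by simp
  qed
  let ?E = "{x. \<bar>s x\<bar> \<le> 3 * \<epsilon>}"
  let ?R = "\<lambda>x. \<kappa> / (\<epsilon> * \<delta>) * indicator ?E x + (1 / \<delta>) * (indicator ?S x * max 0 (bflux x))"
  have cE: "compact ?E" using compact_strip(1)[of "3 * \<epsilon>"] e by simp
  have B_up: "B x \<le> ?R x" for x
  proof -
    have Rn: "?R x \<ge> 0" using k e d by (auto simp: indicator_def)
    show ?thesis
    proof (cases "\<bar>s x\<bar> < tube")
      case False
      then have "B x = 0" using cd(4)[of x] by (simp add: B_def lap_def grad_def inner_vec_def)
      then show ?thesis using Rn by simp
    next
      case True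
      let ?g = "grad u x"
      have nn: "norm (grad s x) = 1" using tube(3)[OF True] .
      have gs: "grad s x \<bullet> grad s x = 1" using nn by (simp add: dot_square_norm)
      have l1: "lap \<phi> x = \<eta>'' (s x) + \<eta>' (s x) * lap s x"
      proof -
        have "lap \<phi> x = \<eta>'' (s x) * (grad s x \<bullet> grad s x) + \<eta>' (s x) * lap s x"
          unfolding lap_def inner_vec_def using cd(3)[OF True] by (simp add: sum.distrib sum_distrib_left grad_def mult.assoc)
        then show ?thesis using gs by simp
      qed
      have l2: "(\<Sum>i\<in>UNIV. \<Sum>j\<in>UNIV. pd (pd \<phi> i) j x * pd u i x * pd u j x)
        = \<eta>'' (s x) * (?g \<bullet> grad s x)\<^sup>2 + \<eta>' (s x) * (\<Sum>i\<in>UNIV. \<Sum>j\<in>UNIV. pd (pd s i) j x * ?g $ i * ?g $ j)"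
      proof -
        have "(?g \<bullet> grad s x)\<^sup>2 = (\<Sum>i\<in>UNIV. \<Sum>j\<in>UNIV. (pd u i x * pd s i x) * (pd u j x * pd s j x))"
          unfolding power2_eq_square inner_vec_def by (simp add: sum_product grad_def)
        then show ?thesis using cd(3)[OF True] by (simp add: sum_distrib_left sum.distrib[symmetric] grad_def algebra_simps)
      qed
      have l3: "grad \<phi> x \<bullet> ?g = \<eta>' (s x) * (?g \<bullet> grad s x)"
        unfolding inner_vec_def using cd(2)[OF True] by (simp add: sum_distrib_left grad_def mult_ac)
      \<comment> \<open>Sorted by \<open>\<eta>''\<close> and \<open>\<eta>'\<close>: the second
        bracket is \<open>bflux\<close> with \<open>grad u\<close> for \<open>G\<close>, and
        \<open>- \<eta>'\<close> lies between 0 and \<open>1 / \<delta>\<close>, which produces the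
        average over the strip.\<close>
      have Bx: "B x = \<eta>'' (s x) * ((norm ?g)\<^sup>2 - (?g \<bullet> grad s x)\<^sup>2) + (- \<eta>' (s x)) *
         ((real CARD('n) - 1) * (?g \<bullet> grad s x) + (\<Sum>i\<in>UNIV. \<Sum>j\<in>UNIV. pd (pd s i) j x * ?g $ i * ?g $ j) - (norm ?g)\<^sup>2 * lap s x)"
        unfolding B_def l1 l2 l3 by (simp add: algebra_simps)
      show ?thesis
      proof (cases "- \<epsilon> \<le> s x \<or> s x \<le> - (\<delta> + 2 * \<epsilon>)")
        case True
        then have "\<eta>' (s x) = 0" "\<eta>'' (s x) = 0" using eta(9,10,13,14) by blast+
        then show ?thesis using Rn unfolding Bx by simp
      next
        case False
        then have sx: "s x < - \<epsilon>" "- (\<delta> + 2 * \<epsilon>) < s x" by auto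
        have xS: "- (3 * \<delta>) \<le> s x" "s x \<le> 0" using sx ed e by auto
        have "x \<in> \<Omega>" using sx e sdist_neg_iff[of x] by simp
        then have Gx: "?g = G x" by (simp add: G_grad)
        have T0: "0 \<le> (norm (G x))\<^sup>2 - (G x \<bullet> grad s x)\<^sup>2"
        proof -
          have "\<bar>G x \<bullet> grad s x\<bar> \<le> norm (G x)" using Cauchy_Schwarz_ineq2[of "G x" "grad s x"] nn by simp
          then have "\<bar>G x \<bullet> grad s x\<bar>\<^sup>2 \<le> (norm (G x))\<^sup>2" by (intro power_mono) auto
          then show ?thesis by simp
        qed
        have p1: "\<eta>'' (s x) * ((norm (G x))\<^sup>2 - (G x \<bullet> grad s x)\<^sup>2) \<le> \<kappa> / (\<epsilon> * \<delta>) * indicator ?E x"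
        proof (cases "s x \<le> - (3 * \<epsilon>)")
          case True
          then have "\<eta>'' (s x) * ((norm (G x))\<^sup>2 - (G x \<bullet> grad s x)\<^sup>2) \<le> 0"
            using T0 eta(12) by (simp add: mult_nonpos_nonneg)
          also have "0 \<le> \<kappa> / (\<epsilon> * \<delta>) * indicator ?E x" using k e d by (simp add: indicator_def)
          finally show ?thesis .
        next
          case False
          then have E: "\<bar>s x\<bar> \<le> 3 * \<epsilon>" using xS by simp
          then have "(norm (G x))\<^sup>2 - (G x \<bullet> grad s x)\<^sup>2 < \<kappa>" using d'(2)[OF xS] e by simp
          then have "\<eta>'' (s x) * ((norm (G x))\<^sup>2 - (G x \<bullet> grad s x)\<^sup>2) \<le> 1 / (\<epsilon> * \<delta>) * \<kappa>"
            using T0 eta(11) e d by (intro mult_mono) auto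
          then show ?thesis using E by simp
        qed
        have "(- \<eta>' (s x)) * bflux x \<le> (- \<eta>' (s x)) * max 0 (bflux x)"
          using eta(7) by (intro mult_left_mono) auto
        also have "\<dots> \<le> (1 / \<delta>) * max 0 (bflux x)" using eta(8)[of "s x"] by (intro mult_right_mono) auto
        finally have p2: "(- \<eta>' (s x)) * bflux x \<le> (1 / \<delta>) * (indicator ?S x * max 0 (bflux x))" using xS by simp
        have "B x = \<eta>'' (s x) * ((norm (G x))\<^sup>2 - (G x \<bullet> grad s x)\<^sup>2) + (- \<eta>' (s x)) * bflux x"
          unfolding Bx Gx bflux_def ..
        then show ?thesis using p1 p2 by linarith
      qed
    qed
  qed
  have iS: "integrable lborel (\<lambda>x. indicator ?S x * max 0 (bflux x))"
  proof -
    have "continuous_on ?S (\<lambda>x. max 0 (bflux x))" by (intro continuous_intros cb)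
    from borel_integrable_compact[OF cS this] show ?thesis by simp
  qed
  have iE: "integrable lborel (\<lambda>x. indicator ?E x :: real)"
    using borel_compact[OF cE] emeasure_bounded_finite[OF compact_imp_bounded[OF cE]] by (intro integrable_real_indicator) auto
  have "(1 - \<tau>) * integral\<^sup>L lborel (\<lambda>x. indicator K x * defect x) = integral\<^sup>L lborel (\<lambda>x. (1 - \<tau>) * (indicator K x * defect x))"
    by simp
  also have "\<dots> \<le> integral\<^sup>L lborel A"
    by (rule integral_mono) (use iK AB(1) A_low in auto)
  also have "\<dots> = integral\<^sup>L lborel B" by (rule AB(3))
  also have "\<dots> \<le> integral\<^sup>L lborel ?R"
    by (rule integral_mono[OF AB(2)]) (use iE iS B_up in auto)
  also have "\<dots> = \<kappa> / (\<epsilon> * \<delta>) * measure lborel ?E + (1 / \<delta>) * integral\<^sup>L lborel (\<lambda>x. indicator ?S x * max 0 (bflux x))"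
    using iE iS by simp
  also have "\<kappa> / (\<epsilon> * \<delta>) * measure lborel ?E \<le> \<kappa> / (\<epsilon> * \<delta>) * (C * (3 * \<epsilon>))"
    using C(3)[of "3 * \<epsilon>"] e k d by (intro mult_left_mono) auto
  also have "\<kappa> / (\<epsilon> * \<delta>) * (C * (3 * \<epsilon>)) = \<tau>" using e d C by (simp add: \<kappa>_def field_simps)
  finally show ?thesis by simp
qed

lemma interior_defect_le:
  assumes d: "0 < \<delta>" "3 * \<delta> < tube" and K: "compact K" "K \<subseteq> {x. s x \<le> - (3 * \<delta>)}"
  shows "integral\<^sup>L lborel (\<lambda>x. indicator K x * defect x)
    \<le> (1 / \<delta>) * integral\<^sup>L lborel (\<lambda>x. indicator {x. - (3 * \<delta>) \<le> s x \<and> s x \<le> 0} x * max 0 (bflux x))" (is "?I \<le> ?R")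
proof (rule ccontr)
  assume n: "\<not> ?I \<le> ?R"
  define D where "D = ?I - ?R"
  have D: "D > 0" using n by (simp add: D_def)
  \<comment> \<open>So small that \<open>\<tau> * (?I + 1)\<close> is at most half of the assumed
    gap \<open>D\<close>.\<close>
  define \<tau> where "\<tau> = min (1/2) (D / (2 * (\<bar>?I\<bar> + 1)))"
  have p: "\<bar>?I\<bar> + 1 > 0" by linarith
  have t: "0 < \<tau>" "\<tau> < 1" using D p by (auto simp: \<tau>_def)
  have "(1 - \<tau>) * ?I \<le> ?R + \<tau>" by (rule interior_defect_approx[OF d K t])
  then have "D \<le> \<tau> * (?I + 1)" by (simp add: D_def algebra_simps)
  also have "\<dots> \<le> \<tau> * (\<bar>?I\<bar> + 1)" using t by (intro mult_left_mono) auto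
  also have "\<dots> \<le> D / (2 * (\<bar>?I\<bar> + 1)) * (\<bar>?I\<bar> + 1)" using p by (intro mult_right_mono) (auto simp: \<tau>_def)
  also have "\<dots> = D / 2"
  proof -
    have half: "D / (2 * c) * c = D / 2" if "c > 0" for c :: real using that by simp
    show ?thesis by (rule half[OF p])
  qed
  finally show False using D by simp
qed

end

subsection \<open>Boundary layers and Hausdorff measure\<close>

text \<open>Balls of radius \<open>3 * d\<close> at spacing \<open>d\<close> along a normal segment
  of length \<open>\<delta>\<close>: at most \<open>2 * \<delta> / d\<close> of them, hence a volume
  of order \<open>\<delta>\<close> times the power \<open>N - 1\<close> of \<open>d\<close>. A point
  within \<open>2 * d\<close> of the segment is within \<open>3 * d\<close> of a grid point.\<close>

lemma segment_cover:
  fixes p \<nu> :: "real^'n"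
  assumes nu: "norm \<nu> = 1" and d: "0 < d" "d \<le> \<delta>"
  defines "Z \<equiv> \<Union>j\<le>nat \<lfloor>\<delta> / d\<rfloor>. cball (p - (real j * d) *\<^sub>R \<nu>) (3 * d)"
  shows "Z \<in> sets lborel"
    "emeasure lborel Z \<le> ennreal (2 * unit_ball_vol (real CARD('n)) * 3 ^ CARD('n) * \<delta> * d powr (real CARD('n) - 1))"
    "0 \<le> \<tau> \<Longrightarrow> \<tau> \<le> \<delta> \<Longrightarrow> dist x (p - \<tau> *\<^sub>R \<nu>) \<le> 2 * d \<Longrightarrow> x \<in> Z"
proof -
  let ?J = "nat \<lfloor>\<delta> / d\<rfloor>"
  show "Z \<in> sets lborel" unfolding Z_def by (intro sets.countable_UN) auto
  have dd: "\<delta> / d \<ge> 1" using d by simp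
  have J: "real ?J \<le> \<delta> / d" using dd by (simp add: of_nat_nat)
  let ?v = "unit_ball_vol (real CARD('n))"
  have "emeasure lborel Z \<le> (\<Sum>j\<in>{..?J}. emeasure lborel (cball (p - (real j * d) *\<^sub>R \<nu>) (3 * d)))"
    unfolding Z_def by (rule emeasure_subadditive_finite) auto
  also have "\<dots> = (\<Sum>j\<in>{..?J}. ennreal (?v * (3 * d) ^ CARD('n)))"
    using d by (simp add: emeasure_cball)
  also have "\<dots> = ennreal (real (?J + 1) * (?v * (3 * d) ^ CARD('n)))"
    using d by (subst sum_ennreal) (auto simp only: sum_constant card_atMost Suc_eq_plus1 intro!: mult_nonneg_nonneg unit_ball_vol_nonneg zero_le_power)
  also have "\<dots> \<le> ennreal (2 * ?v * 3 ^ CARD('n) * \<delta> * d powr (real CARD('n) - 1))"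
  proof (rule ennreal_leI)
    have "real (?J + 1) = real ?J + 1" by simp
    then have "real (?J + 1) \<le> 2 * (\<delta> / d)" using J dd by linarith
    then have "real (?J + 1) * (?v * (3 * d) ^ CARD('n)) \<le> 2 * (\<delta> / d) * (?v * (3 * d) ^ CARD('n))"
      using d by (intro mult_right_mono) auto
    also have "\<dots> = 2 * ?v * 3 ^ CARD('n) * \<delta> * d powr (real CARD('n) - 1)"
    proof -
      have pw: "(3 * d) ^ CARD('n) = 3 ^ CARD('n) * (d powr (real CARD('n) - 1) * d)"
        using d powr_add[of d "real CARD('n) - 1" 1] by (simp add: power_mult_distrib powr_realpow)
      show ?thesis unfolding pw using d by simp
    qed
    finally show "real (?J + 1) * (?v * (3 * d) ^ CARD('n)) \<le> 2 * ?v * 3 ^ CARD('n) * \<delta> * d powr (real CARD('n) - 1)" .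
  qed
  finally show "emeasure lborel Z \<le> ennreal (2 * ?v * 3 ^ CARD('n) * \<delta> * d powr (real CARD('n) - 1))" .
  assume t: "0 \<le> \<tau>" "\<tau> \<le> \<delta>" and x: "dist x (p - \<tau> *\<^sub>R \<nu>) \<le> 2 * d"
  define j where "j = nat \<lfloor>\<tau> / d\<rfloor>"
  have jr: "real j = of_int \<lfloor>\<tau> / d\<rfloor>" using t d by (simp add: j_def)
  have jJ: "j \<le> ?J" unfolding j_def using t d by (intro nat_mono floor_mono divide_right_mono) auto
  have "real j \<le> \<tau> / d" "\<tau> / d < real j + 1" unfolding jr by linarith+
  then have "real j * d \<le> \<tau>" "\<tau> < (real j + 1) * d" using d by (simp_all add: pos_le_divide_eq pos_divide_less_eq)
  then have jd: "\<bar>\<tau> - real j * d\<bar> \<le> d" by (simp add: algebra_simps)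
  have "dist (p - \<tau> *\<^sub>R \<nu>) (p - (real j * d) *\<^sub>R \<nu>) = norm ((real j * d - \<tau>) *\<^sub>R \<nu>)"
    by (simp add: dist_norm scaleR_left_diff_distrib algebra_simps)
  also have "\<dots> \<le> d" using jd nu by (simp add: abs_minus_commute)
  finally have "dist x (p - (real j * d) *\<^sub>R \<nu>) \<le> 3 * d"
    using x dist_triangle[of x "p - (real j * d) *\<^sub>R \<nu>" "p - \<tau> *\<^sub>R \<nu>"] by simp
  then show "x \<in> Z" unfolding Z_def using jJ by (auto simp: dist_commute)
qed

text \<open>Deals with covering sets of diameter 0, which have no weight in the Hausdorff sum: the
  strip points above such a set lie on one segment, a null set in dimension at least two.\<close>

lemma segment_null:
  fixes p \<nu> :: "real^'n"
  assumes nu: "norm \<nu> = 1" and d: "0 < \<delta>" and N: "CARD('n) \<ge> 2"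
  defines "Z \<equiv> (\<lambda>\<tau>. p - \<tau> *\<^sub>R \<nu>) ` {0..\<delta>}"
  shows "Z \<in> sets lborel" "emeasure lborel Z = 0"
proof -
  have "compact Z" unfolding Z_def by (intro compact_continuous_image continuous_intros) auto
  then show m: "Z \<in> sets lborel" by (simp add: borel_compact)
  have "negligible Z" unfolding Z_def
    by (rule negligible_differentiable_image_lowdim) (use N in \<open>auto intro!: derivative_intros\<close>)
  then show "emeasure lborel Z = 0"
    using m null_sets_completion_iff[OF m] unfolding negligible_iff_null_sets by (simp add: null_setsD1)
qed

text \<open>The volume factor of \<open>segment_cover\<close> divided by the normalising factor of
  the Hausdorff measure; the power of 2 converts diameters into the half-diameters used
  there.\<close>

definition tube_const :: "'n::finite itself \<Rightarrow> real" where
  "tube_const _ = 2 * unit_ball_vol (real CARD('n)) * 3 ^ CARD('n) * 2 powr (real CARD('n) - 1)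
     / (pi powr ((real CARD('n) - 1) / 2) / Gamma ((real CARD('n) - 1) / 2 + 1))"

lemma hausdorff_weight_pos:
  assumes "(n::real) > 0" shows "pi powr (n / 2) / Gamma (n / 2 + 1) > 0"
  using assms by (intro divide_pos_pos Gamma_real_pos) auto

lemma tube_const_pos:
  assumes "CARD('n::finite) \<ge> 2" shows "tube_const TYPE('n) > 0"
  unfolding tube_const_def using assms
  by (intro divide_pos_pos[OF _ hausdorff_weight_pos] mult_pos_pos) auto

lemma tube_const_weight:
  fixes d \<delta> :: real
  assumes N: "CARD('n::finite) \<ge> 2" and d: "d \<ge> 0"
  shows "2 * unit_ball_vol (real CARD('n)) * 3 ^ CARD('n) * \<delta> * d powr (real CARD('n) - 1)
    = (tube_const TYPE('n) * \<delta>) * (pi powr ((real CARD('n) - 1) / 2) / Gamma ((real CARD('n) - 1) / 2 + 1) * (d / 2) powr (real CARD('n) - 1))"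
proof -
  let ?n = "real CARD('n) - 1"
  define w where "w = pi powr (?n / 2) / Gamma (?n / 2 + 1)"
  have w: "w > 0" unfolding w_def by (rule hausdorff_weight_pos) (use N in simp)
  have p: "d powr ?n = 2 powr ?n * (d / 2) powr ?n"
    using d by (simp add: powr_mult[symmetric])
  show ?thesis
    unfolding tube_const_def w_def[symmetric] p using w by simp
qed

context C2_domain
begin

text \<open>The segment between two close boundary points leaves the boundary but stays in a compact
  strip, where the second derivatives of \<open>s\<close> are bounded.\<close>

lemma normal_Lipschitz:
  obtains L d where "L > 0" "d > 0" "\<And>p q. p \<in> \<Gamma> \<Longrightarrow> q \<in> \<Gamma> \<Longrightarrow> dist p q < d \<Longrightarrow> norm (grad s p - grad s q) \<le> L * dist p q"
proof -
  let ?K = "{x. \<bar>s x\<bar> \<le> tube / 2}"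
  have K: "compact ?K" "?K \<subseteq> {x. \<bar>s x\<bar> < tube}" using compact_strip(1)[of "tube / 2"] tube(1) by auto
  have "\<exists>B. \<forall>x\<in>?K. norm (grad (pd s i) x) \<le> B" for i
  proof -
    have "continuous_on ?K (grad (pd s i))"
      using C1_on_grad_continuous[OF sdist_tube(2)] K continuous_on_subset by blast
    from compact_imp_bounded[OF compact_continuous_image[OF this K(1)]]
    show ?thesis unfolding bounded_iff by auto
  qed
  then obtain B where B: "\<And>i x. x \<in> ?K \<Longrightarrow> norm (grad (pd s i) x) \<le> B i" by metis
  define L where "L = (\<Sum>i\<in>UNIV. \<bar>B i\<bar>) + 1"
  have L: "L > 0" by (simp add: L_def add_nonneg_pos sum_nonneg)
  have main: "norm (grad s p - grad s q) \<le> L * dist p q"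
    if pq: "p \<in> \<Gamma>" "q \<in> \<Gamma>" "dist p q < tube / 2" for p q
  proof -
    have comp: "\<bar>(grad s p - grad s q) $ i\<bar> \<le> \<bar>B i\<bar> * dist p q" for i
    proof -
      let ?x = "\<lambda>t. q + t *\<^sub>R (p - q)"
      have inK: "?x t \<in> ?K" if "0 \<le> t" "t \<le> 1" for t
      proof -
        have "\<bar>s (?x t)\<bar> \<le> dist (?x t) q" by (rule abs_sdist_le[OF pq(2)])
        also have "\<dots> = t * dist p q" using that by (simp add: dist_norm)
        also have "\<dots> \<le> 1 * dist p q" using that by (intro mult_right_mono) auto
        finally show ?thesis using pq(3) by simp
      qed
      have D: "DERIV (\<lambda>t. pd s i (?x t)) t :> grad (pd s i) (?x t) \<bullet> (p - q)" if t: "0 \<le> t" "t \<le> 1" for t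
      proof -
        have xt: "?x t \<in> {x. \<bar>s x\<bar> < tube}" using inK[OF t] K(2) by blast
        have "DERIV (\<lambda>r. pd s i (?x t + r *\<^sub>R (p - q))) (t - t) :> grad (pd s i) (?x t) \<bullet> (p - q)"
          using GDERIV_line[OF C1_on_GDERIV[OF sdist_tube(2) open_tube xt]] by simp
        moreover have "DERIV (\<lambda>r. r - t) t :> 1" by (auto intro!: derivative_eq_intros)
        ultimately have "DERIV (\<lambda>r. pd s i (?x t + (r - t) *\<^sub>R (p - q))) t :> grad (pd s i) (?x t) \<bullet> (p - q) * 1"
          by (rule DERIV_chain2)
        moreover have "?x t + (r - t) *\<^sub>R (p - q) = ?x r" for r by (simp add: scaleR_left_diff_distrib)
        ultimately show ?thesis by simp
      qed
      obtain z where z: "0 < z" "z < 1" "pd s i (?x 1) - pd s i (?x 0) = (1 - 0) * (grad (pd s i) (?x z) \<bullet> (p - q))"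
        using MVT2[OF zero_less_one, of "\<lambda>t. pd s i (?x t)" "\<lambda>t. grad (pd s i) (?x t) \<bullet> (p - q)", OF D] by blast
      have "\<bar>grad (pd s i) (?x z) \<bullet> (p - q)\<bar> \<le> norm (grad (pd s i) (?x z)) * norm (p - q)" by (rule Cauchy_Schwarz_ineq2)
      also have "\<dots> \<le> \<bar>B i\<bar> * norm (p - q)" using B[OF inK[of z], of i] z by (intro mult_right_mono) auto
      finally show ?thesis using z(3) by (simp add: grad_def dist_norm)
    qed
    have "norm (grad s p - grad s q) \<le> (\<Sum>i\<in>UNIV. \<bar>(grad s p - grad s q) $ i\<bar>)" by (rule norm_le_l1_cart)
    also have "\<dots> \<le> (\<Sum>i\<in>UNIV. \<bar>B i\<bar> * dist p q)" by (intro sum_mono comp)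
    also have "\<dots> \<le> L * dist p q" by (simp add: L_def sum_distrib_right[symmetric] distrib_right)
    finally show ?thesis .
  qed
  show ?thesis by (rule that[OF L, of "tube / 2"]) (use main tube(1) in auto)
qed

text \<open>The normal turns by at most \<open>L * D n\<close> over a covering set of diameter
  \<open>D n\<close>, so for \<open>\<delta> < 1 / L\<close> the strip points above that set stay
  within \<open>2 * D n\<close> of one normal segment. \<open>segment_cover\<close> then bounds
  their volume by \<open>tube_const * \<delta>\<close> times the weight of the set in the Hausdorff
  sum.\<close>

lemma tube_measure:
  assumes N: "CARD('n) \<ge> 2"
  obtains \<delta>\<^sub>1 where "\<delta>\<^sub>1 > 0" "\<And>\<delta> A E. 0 < \<delta> \<Longrightarrow> \<delta> < \<delta>\<^sub>1 \<Longrightarrow> A \<subseteq> \<Gamma> \<Longrightarrow> E \<in> sets lborel \<Longrightarrow>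
     (\<And>x. x \<in> E \<Longrightarrow> - \<delta> \<le> s x \<and> s x \<le> 0 \<and> (\<exists>q\<in>A. dist x q = \<bar>s x\<bar>)) \<Longrightarrow>
     emeasure lborel E / ennreal (tube_const TYPE('n) * \<delta>) \<le> hausdorff (real CARD('n) - 1) A"
proof -
  obtain L d where L: "L > 0" and d: "d > 0"
    and Lip: "\<And>p q. p \<in> \<Gamma> \<Longrightarrow> q \<in> \<Gamma> \<Longrightarrow> dist p q < d \<Longrightarrow> norm (grad s p - grad s q) \<le> L * dist p q"
    using normal_Lipschitz by metis
  let ?n = "real CARD('n) - 1"
  let ?w = "pi powr (?n / 2) / Gamma (?n / 2 + 1)"
  have w: "?w > 0" by (rule hausdorff_weight_pos) (use N in simp)
  have tc: "tube_const TYPE('n) > 0" by (rule tube_const_pos[OF N])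
  have main: "emeasure lborel E / ennreal (tube_const TYPE('n) * \<delta>) \<le> hausdorff ?n A"
    if dl: "0 < \<delta>" "\<delta> < min tube (1 / L)" and A: "A \<subseteq> \<Gamma>" and E: "E \<in> sets lborel"
      and Ep: "\<And>x. x \<in> E \<Longrightarrow> - \<delta> \<le> s x \<and> s x \<le> 0 \<and> (\<exists>q\<in>A. dist x q = \<bar>s x\<bar>)" for \<delta> A E
  proof -
    \<comment> \<open>The mesh must be below \<open>d\<close> for the Lipschitz bound on normals and
      at most \<open>\<delta>\<close> for \<open>segment_cover\<close>.\<close>
    define \<eta> where "\<eta> = min \<delta> (d / 2)"
    have eta: "\<eta> > 0" "\<eta> \<le> \<delta>" "\<eta> < d" using dl d by (auto simp: \<eta>_def)
    have cover: "emeasure lborel E / ennreal (tube_const TYPE('n) * \<delta>) \<le> (\<Sum>n. ennreal (?w * (diameter (C n) / 2) powr ?n))"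
      if C: "A \<subseteq> (\<Union>n. C n)" "\<And>n. bounded (C n) \<and> diameter (C n) \<le> \<eta>" for C :: "nat \<Rightarrow> (real^'n) set"
    proof -
      define D where "D n = diameter (C n)" for n
      have D: "0 \<le> D n" "D n \<le> \<eta>" for n using C(2) by (auto simp: D_def diameter_ge_0)
      \<comment> \<open>Each covering set gets one measurable set that catches all points of
        \<open>E\<close> whose foot lies in it: the empty set, a single normal segment, or a chain
        of balls along one.\<close>
      have "\<exists>W. W \<in> sets lborel \<and> emeasure lborel W \<le> ennreal ((tube_const TYPE('n) * \<delta>) * (?w * (D n / 2) powr ?n)) \<and>
          (\<forall>x\<in>E. (\<exists>q\<in>A \<inter> C n. dist x q = \<bar>s x\<bar>) \<longrightarrow> x \<in> W)" for n
      proof (cases "A \<inter> C n = {}")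
        case True
        then show ?thesis by (intro exI[of _ "{}"]) auto
      next
        case False
        then obtain p where p: "p \<in> A" "p \<in> C n" by blast
        then have pG: "p \<in> \<Gamma>" using A by blast
        define \<nu> where "\<nu> = grad s p"
        have nu: "norm \<nu> = 1" unfolding \<nu>_def by (rule tube(3)[OF bdry_tube[OF pG]])
        have near: "dist x (p - (- s x) *\<^sub>R \<nu>) \<le> 2 * D n"
          if x: "x \<in> E" and q: "q \<in> A" "q \<in> C n" "dist x q = \<bar>s x\<bar>" for x q
        proof -
          have qG: "q \<in> \<Gamma>" using q A by blast
          have sx: "- \<delta> \<le> s x" "s x \<le> 0" using Ep[OF x] by auto
          have qp: "dist q p \<le> D n" unfolding D_def using C(2) p q by (intro diameter_bounded_bound) auto
          have "x = q + s x *\<^sub>R grad s q" using tube(4)[of x q] sx dl qG q(3) by auto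
          then have "x - (p - (- s x) *\<^sub>R \<nu>) = (q - p) + s x *\<^sub>R (grad s q - \<nu>)"
            by (simp add: algebra_simps)
          then have "dist x (p - (- s x) *\<^sub>R \<nu>) \<le> norm (q - p) + norm (s x *\<^sub>R (grad s q - \<nu>))"
            by (simp only: dist_norm norm_triangle_ineq)
          also have "\<dots> = dist q p + \<bar>s x\<bar> * norm (grad s q - \<nu>)" by (simp add: dist_norm)
          also have "\<dots> \<le> D n + \<delta> * (L * D n)"
          proof -
            have "norm (grad s q - \<nu>) \<le> L * dist q p" unfolding \<nu>_def
              using Lip[OF qG pG] qp D(2)[of n] eta by linarith
            also have "\<dots> \<le> L * D n" using qp L by (intro mult_left_mono) auto
            finally have "\<bar>s x\<bar> * norm (grad s q - \<nu>) \<le> \<delta> * (L * D n)"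
              using sx dl by (intro mult_mono) auto
            then show ?thesis using qp by simp
          qed
          also have "\<delta> * (L * D n) = (\<delta> * L) * D n" by simp
          also have "\<dots> \<le> 1 * D n" using dl L D(1) by (intro mult_right_mono) (auto simp: pos_less_divide_eq less_imp_le)
          finally show ?thesis by simp
        qed
        show ?thesis
        proof (cases "D n = 0")
          case True
          let ?W = "(\<lambda>\<tau>. p - \<tau> *\<^sub>R \<nu>) ` {0..\<delta>}"
          have "x \<in> ?W" if x: "x \<in> E" and q: "q \<in> A \<inter> C n" "dist x q = \<bar>s x\<bar>" for x q
          proof -
            have "dist x (p - (- s x) *\<^sub>R \<nu>) \<le> 0" using near[OF x, of q] q True by auto
            then have "x = p - (- s x) *\<^sub>R \<nu>" by simp
            moreover have "- s x \<in> {0..\<delta>}" using Ep[OF x] by auto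
            ultimately show ?thesis by (rule image_eqI)
          qed
          then show ?thesis using segment_null[OF nu dl(1) N, where p=p] by (intro exI[of _ ?W]) auto
        next
          case False
          then have Dp: "0 < D n" "D n \<le> \<delta>" using D[of n] eta by auto
          let ?Z = "\<Union>j\<le>nat \<lfloor>\<delta> / D n\<rfloor>. cball (p - (real j * D n) *\<^sub>R \<nu>) (3 * D n)"
          note sc = segment_cover[OF nu Dp, where p=p]
          have "x \<in> ?Z" if x: "x \<in> E" and q: "q \<in> A \<inter> C n" "dist x q = \<bar>s x\<bar>" for x q
            by (rule sc(3)[where \<tau>="- s x"]) (use Ep[OF x] near[OF x, of q] q in auto)
          then show ?thesis using sc(1,2) tube_const_weight[OF N D(1), of \<delta> n] by (intro exI[of _ ?Z]) auto
        qed
      qed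
      then obtain W where W: "\<And>n. W n \<in> sets lborel" "\<And>n. emeasure lborel (W n) \<le> ennreal ((tube_const TYPE('n) * \<delta>) * (?w * (D n / 2) powr ?n))"
        "\<And>n x q. x \<in> E \<Longrightarrow> q \<in> A \<inter> C n \<Longrightarrow> dist x q = \<bar>s x\<bar> \<Longrightarrow> x \<in> W n" by metis
      have "E \<subseteq> (\<Union>n. W n)"
      proof
        fix x assume x: "x \<in> E"
        then obtain q where q: "q \<in> A" "dist x q = \<bar>s x\<bar>" using Ep by blast
        then obtain n where "q \<in> C n" using C(1) by blast
        then show "x \<in> (\<Union>n. W n)" using W(3)[OF x, of q n] q by blast
      qed
      then have "emeasure lborel E \<le> emeasure lborel (\<Union>n. W n)" by (rule emeasure_mono) (use W(1) in blast)
      also have "\<dots> \<le> (\<Sum>n. emeasure lborel (W n))" by (rule emeasure_subadditive_countably) (use W(1) in blast)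
      also have "\<dots> \<le> (\<Sum>n. ennreal ((tube_const TYPE('n) * \<delta>) * (?w * (D n / 2) powr ?n)))"
        by (intro suminf_le W(2)) auto
      also have "\<dots> = (\<Sum>n. ennreal (tube_const TYPE('n) * \<delta>) * ennreal (?w * (D n / 2) powr ?n))"
        by (intro suminf_cong ennreal_mult mult_nonneg_nonneg less_imp_le[OF w] less_imp_le[OF tc] less_imp_le[OF dl(1)] powr_ge_zero)
      also have "\<dots> = ennreal (tube_const TYPE('n) * \<delta>) * (\<Sum>n. ennreal (?w * (D n / 2) powr ?n))"
        by (rule ennreal_suminf_cmult)
      finally show ?thesis unfolding D_def
        using tc dl by (intro divide_le_posI_ennreal) auto
    qed
    have "emeasure lborel E / ennreal (tube_const TYPE('n) * \<delta>) \<le>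
      (INF C\<in>{C :: nat \<Rightarrow> (real^'n) set. A \<subseteq> (\<Union>n. C n) \<and> (\<forall>n. bounded (C n) \<and> diameter (C n) \<le> \<eta>)}.
        (\<Sum>n. ennreal (?w * (diameter (C n) / 2) powr ?n)))"
      by (rule INF_greatest) (use cover in blast)
    also have "\<dots> \<le> hausdorff ?n A" unfolding hausdorff_def
      by (rule SUP_upper) (use eta in simp)
    finally show ?thesis .
  qed
  show ?thesis
  proof (rule that[of "min tube (1 / L)"])
    show "min tube (1 / L) > 0" using tube(1) L by simp
  next
    fix \<delta> A E
    assume "0 < \<delta>" "\<delta> < min tube (1 / L)" "A \<subseteq> \<Gamma>" "E \<in> sets lborel"
      "\<And>x. x \<in> E \<Longrightarrow> - \<delta> \<le> s x \<and> s x \<le> 0 \<and> (\<exists>q\<in>A. dist x q = \<bar>s x\<bar>)"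
    then show "emeasure lborel E / ennreal (tube_const TYPE('n) * \<delta>) \<le> hausdorff ?n A" by (rule main)
  qed
qed

end

text \<open>Fubini on the region below the graph. It brings volume integrals into the shape of
  \<open>L1_bdry\<close>, which is built from superlevel sets.\<close>

lemma nn_integral_layer_cake:
  fixes f :: "'a::euclidean_space \<Rightarrow> real"
  assumes f: "f \<in> borel_measurable borel"
  shows "(\<integral>\<^sup>+ x. ennreal (f x) \<partial>lborel) = (\<integral>\<^sup>+ t\<in>{0<..}. emeasure lborel {x. t < f x} \<partial>lborel)"
proof -
  let ?h = "\<lambda>x t. indicator {z. 0 < snd z \<and> snd z < f (fst z)} (x, t) :: ennreal"
  have ms: "{z :: 'a \<times> real. 0 < snd z \<and> snd z < f (fst z)} \<in> sets (lborel \<Otimes>\<^sub>M lborel)"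
  proof -
    have "{z \<in> space (lborel \<Otimes>\<^sub>M lborel). 0 < snd z \<and> snd z < f (fst z)} \<in> sets (lborel \<Otimes>\<^sub>M (lborel :: real measure))"
      using f by measurable
    then show ?thesis by (simp add: space_pair_measure)
  qed
  have m: "(\<lambda>(x, t). ?h x t) \<in> borel_measurable (lborel \<Otimes>\<^sub>M lborel)"
    using borel_measurable_indicator[OF ms] by (simp only: case_prod_eta)
  have "(\<integral>\<^sup>+ x. ennreal (f x) \<partial>lborel) = (\<integral>\<^sup>+ x. (\<integral>\<^sup>+ t. ?h x t \<partial>lborel) \<partial>lborel)"
  proof (rule nn_integral_cong)
    fix x
    have "(\<integral>\<^sup>+ t. ?h x t \<partial>lborel) = (\<integral>\<^sup>+ t. indicator {0<..<f x} t \<partial>lborel)"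
      by (intro nn_integral_cong) (auto simp: indicator_def)
    also have "\<dots> = ennreal (f x)" by (cases "0 \<le> f x") (auto simp: ennreal_neg)
    finally show "ennreal (f x) = (\<integral>\<^sup>+ t. ?h x t \<partial>lborel)" by simp
  qed
  also have "\<dots> = (\<integral>\<^sup>+ t. (\<integral>\<^sup>+ x. ?h x t \<partial>lborel) \<partial>lborel)"
    by (rule lborel_pair.Fubini'[OF m, symmetric])
  also have "\<dots> = (\<integral>\<^sup>+ t\<in>{0<..}. emeasure lborel {x. t < f x} \<partial>lborel)"
  proof (rule nn_integral_cong)
    fix t :: real
    have "{x. t < f x} \<in> sets lborel" using f by measurable
    moreover have "?h x t = indicator {x. t < f x} x * indicator {0<..} t" for x by (auto simp: indicator_def)
    ultimately show "(\<integral>\<^sup>+ x. ?h x t \<partial>lborel) = emeasure lborel {x. t < f x} * indicator {0<..} t"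
      by (simp add: nn_integral_multc)
  qed
  finally show ?thesis .
qed

text \<open>\<open>N - 1\<close> comes from the boundary value of \<open>bflux\<close>; the 3 arises
  because a strip of depth \<open>3 * \<delta>\<close> is averaged with the factor
  \<open>1 / \<delta>\<close>.\<close>

definition defect_const :: "'n::finite itself \<Rightarrow> real" where
  "defect_const _ = 3 * (real CARD('n) - 1) * tube_const TYPE('n)"

abbreviation dirichlet :: "(real^'n) set \<Rightarrow> (real^'n \<Rightarrow> real) \<Rightarrow> ennreal" where
  "dirichlet U v \<equiv> \<integral>\<^sup>+ x\<in>U. ennreal ((norm (grad v x))\<^sup>2) \<partial>lebesgue"

lemma measurable_on_open:
  fixes f :: "real^'n \<Rightarrow> real"
  assumes "open U" "continuous_on U f"
  shows "(\<lambda>x. ennreal (f x) * indicator U x) \<in> borel_measurable lborel"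
proof -
  have "(\<lambda>x. indicator U x *\<^sub>R f x) \<in> borel_measurable borel"
    using assms by (intro borel_measurable_continuous_on_indicator) auto
  then have "(\<lambda>x. ennreal (indicator U x *\<^sub>R f x)) \<in> borel_measurable lborel" by measurable
  moreover have "(\<lambda>x. ennreal (indicator U x *\<^sub>R f x)) = (\<lambda>x. ennreal (f x) * indicator U x)"
    by (auto simp: fun_eq_iff indicator_def)
  ultimately show ?thesis by (simp only:)
qed

lemma defect_const_pos: "CARD('n::finite) \<ge> 2 \<Longrightarrow> defect_const TYPE('n) > 0"
  using tube_const_pos[where 'n='n] by (simp add: defect_const_def)

lemma L1_bdry_nonneg: "L1_bdry \<Omega> g \<ge> 0"
  by (simp add: L1_bdry_def)

lemma hausdorff_mono: "A \<subseteq> B \<Longrightarrow> hausdorff n A \<le> hausdorff n B"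
  unfolding hausdorff_def
  by (intro SUP_mono' INF_superset_mono) auto

section \<open>Finite surface measure and the bound for the Hessian on the whole domain\<close>

context C2_domain
begin

text \<open>Packing: balls of radius \<open>\<epsilon> / 2\<close> about separated boundary points
  are disjoint and lie in the strip of width \<open>\<epsilon>\<close>, whose volume is of order
  \<open>\<epsilon>\<close>.\<close>

lemma separated_card:
  obtains C \<epsilon>\<^sub>0 where "C > 0" "\<epsilon>\<^sub>0 > 0" "\<And>\<epsilon> F. 0 < \<epsilon> \<Longrightarrow> \<epsilon> \<le> \<epsilon>\<^sub>0 \<Longrightarrow> F \<subseteq> \<Gamma> \<Longrightarrow> finite F \<Longrightarrow>
    (\<And>p q. p \<in> F \<Longrightarrow> q \<in> F \<Longrightarrow> p \<noteq> q \<Longrightarrow> dist p q \<ge> \<epsilon>) \<Longrightarrow> real (card F) * \<epsilon> powr (real CARD('n) - 1) \<le> C"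
proof -
  obtain C \<epsilon>\<^sub>0 where C: "C > 0" "\<epsilon>\<^sub>0 > 0" "\<And>\<epsilon>. 0 < \<epsilon> \<Longrightarrow> \<epsilon> \<le> \<epsilon>\<^sub>0 \<Longrightarrow> measure lborel {x. \<bar>s x\<bar> \<le> \<epsilon>} \<le> C * \<epsilon>"
    using strip_measure by metis
  let ?v = "unit_ball_vol (real CARD('n))"
  have v: "?v > 0" by simp
  let ?C = "C * 2 ^ CARD('n) / ?v"
  show ?thesis
  proof (rule that[of ?C \<epsilon>\<^sub>0])
    show "?C > 0" "\<epsilon>\<^sub>0 > 0" using C v by auto
  next
    fix \<epsilon> F
    assume e: "0 < \<epsilon>" "\<epsilon> \<le> \<epsilon>\<^sub>0" and F: "F \<subseteq> \<Gamma>" "finite F"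
      and sep: "\<And>p q. p \<in> F \<Longrightarrow> q \<in> F \<Longrightarrow> p \<noteq> q \<Longrightarrow> dist p q \<ge> \<epsilon>"
    let ?S = "{x. \<bar>s x\<bar> \<le> \<epsilon>}"
    have cS: "compact ?S" using compact_strip(1)[of \<epsilon>] e by simp
    have sub: "(\<Union>p\<in>F. ball p (\<epsilon> / 2)) \<subseteq> ?S"
    proof
      fix x assume "x \<in> (\<Union>p\<in>F. ball p (\<epsilon> / 2))"
      then obtain p where "p \<in> F" "dist p x < \<epsilon> / 2" by auto
      then show "x \<in> ?S" using abs_sdist_le[of p x] F e by (auto simp: dist_commute)
    qed
    have disj: "disjoint_family_on (\<lambda>p. ball p (\<epsilon> / 2)) F"
      unfolding disjoint_family_on_def
    proof (intro ballI impI)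
      fix p q assume pq: "p \<in> F" "q \<in> F" "p \<noteq> q"
      have "dist p q < \<epsilon>" if "x \<in> ball p (\<epsilon> / 2)" "x \<in> ball q (\<epsilon> / 2)" for x
        using that dist_triangle[of p q x] by (simp add: dist_commute)
      then show "ball p (\<epsilon> / 2) \<inter> ball q (\<epsilon> / 2) = {}" using sep[OF pq] by force
    qed
    have mb: "measure lborel (ball p (\<epsilon> / 2)) = ?v * (\<epsilon> / 2) ^ CARD('n)" for p :: "real^'n"
      using content_ball[of "\<epsilon> / 2" p] e by simp
    have "real (card F) * (?v * (\<epsilon> / 2) ^ CARD('n)) = (\<Sum>p\<in>F. measure lborel (ball p (\<epsilon> / 2)))"
      unfolding mb by simp
    also have "\<dots> = measure lborel (\<Union>p\<in>F. ball p (\<epsilon> / 2))"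
      by (rule measure_finite_Union[symmetric, OF F(2) _ disj])
         (use emeasure_lborel_ball_finite in \<open>auto simp: less_top\<close>)
    also have "\<dots> \<le> measure lborel ?S"
      by (rule measure_mono_fmeasurable[OF sub])
         (use cS emeasure_bounded_finite[OF compact_imp_bounded[OF cS]] in \<open>auto simp: fmeasurable_def borel_compact intro!: borel_open open_UN\<close>)
    also have "\<dots> \<le> C * \<epsilon>" by (rule C(3)[OF e])
    finally have 1: "real (card F) * (?v * (\<epsilon> / 2) ^ CARD('n)) \<le> C * \<epsilon>" .
    have pw: "\<epsilon> ^ CARD('n) = \<epsilon> powr (real CARD('n) - 1) * \<epsilon>"
      using e powr_add[of \<epsilon> "real CARD('n) - 1" 1] by (simp add: powr_realpow)
    have "(real (card F) * \<epsilon> powr (real CARD('n) - 1)) * (?v * \<epsilon> / 2 ^ CARD('n)) \<le> C * \<epsilon>"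
      using 1 unfolding power_divide pw by (simp add: mult_ac)
    then show "real (card F) * \<epsilon> powr (real CARD('n) - 1) \<le> ?C"
      using e v by (simp add: field_simps)
  qed
qed

text \<open>A largest \<open>\<epsilon>\<close>-separated subset of the boundary is an
  \<open>\<epsilon>\<close>-net, and \<open>separated_card\<close> bounds its size; the balls of
  radius \<open>\<epsilon>\<close> about it form a cover whose Hausdorff sum is bounded uniformly in
  \<open>\<epsilon>\<close>.\<close>

lemma hausdorff_bdry_finite:
  assumes N: "CARD('n) \<ge> 2"
  shows "hausdorff (real CARD('n) - 1) \<Gamma> < \<infinity>"
proof -
  obtain C \<epsilon>\<^sub>0 where C: "C > 0" "\<epsilon>\<^sub>0 > 0" and card: "\<And>\<epsilon> F. 0 < \<epsilon> \<Longrightarrow> \<epsilon> \<le> \<epsilon>\<^sub>0 \<Longrightarrow> F \<subseteq> \<Gamma> \<Longrightarrow> finite F \<Longrightarrow>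
    (\<And>p q. p \<in> F \<Longrightarrow> q \<in> F \<Longrightarrow> p \<noteq> q \<Longrightarrow> dist p q \<ge> \<epsilon>) \<Longrightarrow> real (card F) * \<epsilon> powr (real CARD('n) - 1) \<le> C"
    using separated_card by metis
  let ?n = "real CARD('n) - 1"
  let ?w = "pi powr (?n / 2) / Gamma (?n / 2 + 1)"
  have w: "?w > 0" by (rule hausdorff_weight_pos) (use N in simp)
  have "(INF C\<in>{C :: nat \<Rightarrow> (real^'n) set. \<Gamma> \<subseteq> (\<Union>n. C n) \<and> (\<forall>n. bounded (C n) \<and> diameter (C n) \<le> \<delta>)}.
        (\<Sum>n. ennreal (?w * (diameter (C n) / 2) powr ?n))) \<le> ennreal (?w * C)" if d: "\<delta> > 0" for \<delta>
  proof -
    define \<epsilon> where "\<epsilon> = min \<epsilon>\<^sub>0 (\<delta> / 2)"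
    have e: "0 < \<epsilon>" "\<epsilon> \<le> \<epsilon>\<^sub>0" "2 * \<epsilon> \<le> \<delta>" using C d by (auto simp: \<epsilon>_def)
    define Fs where "Fs = {F. F \<subseteq> \<Gamma> \<and> finite F \<and> (\<forall>p\<in>F. \<forall>q\<in>F. p \<noteq> q \<longrightarrow> dist p q \<ge> \<epsilon>)}"
    have bd: "card F \<le> nat \<lceil>C / \<epsilon> powr ?n\<rceil>" if "F \<in> Fs" for F
    proof -
      have "real (card F) * \<epsilon> powr ?n \<le> C" using that card[OF e(1,2), of F] by (auto simp: Fs_def)
      then have "real (card F) \<le> C / \<epsilon> powr ?n" using e by (simp add: pos_le_divide_eq)
      then show ?thesis by linarith
    qed
    have "{} \<in> Fs" by (simp add: Fs_def)
    \<comment> \<open>A separated set of greatest size exists because \<open>bd\<close> bounds all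
      sizes.\<close>
    then obtain F where F: "F \<in> Fs" "\<And>F'. F' \<in> Fs \<Longrightarrow> card F' \<le> card F"
      using ex_has_greatest_nat[of "\<lambda>F. F \<in> Fs" "{}" card "Suc (nat \<lceil>C / \<epsilon> powr ?n\<rceil>)"] bd less_Suc_eq_le by blast
    have FF: "F \<subseteq> \<Gamma>" "finite F" using F(1) by (auto simp: Fs_def)
    have net: "\<exists>q\<in>F. dist p q < \<epsilon>" if p: "p \<in> \<Gamma>" for p
    proof (rule ccontr)
      assume n: "\<not> (\<exists>q\<in>F. dist p q < \<epsilon>)"
      then have far: "\<And>q. q \<in> F \<Longrightarrow> \<epsilon> \<le> dist p q" by (simp add: not_less)
      have "insert p F \<in> Fs" unfolding Fs_def mem_Collect_eq
      proof (intro conjI ballI impI)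
        show "insert p F \<subseteq> \<Gamma>" "finite (insert p F)" using FF p by auto
        fix a b assume ab: "a \<in> insert p F" "b \<in> insert p F" "a \<noteq> b"
        then show "\<epsilon> \<le> dist a b"
          using far[of a] far[of b] F(1) unfolding Fs_def by (cases "a = p"; cases "b = p") (auto simp: dist_commute)
      qed
      moreover have "p \<notin> F" using n e by auto
      ultimately show False using F(2)[of "insert p F"] FF by simp
    qed
    obtain f where f: "F = f ` {i::nat. i < card F}"
    proof -
      obtain m and f :: "nat \<Rightarrow> real^'n" where mf: "F = f ` {i. i < m}" "inj_on f {i. i < m}"
        using finite_imp_nat_seg_image_inj_on[OF FF(2)] by blast
      then have "card F = m" by (simp add: card_image)
      then show thesis using that mf(1) by blast
    qed
    define Cs where "Cs i = (if i < card F then cball (f i) \<epsilon> else {})" for i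
    have 1: "\<Gamma> \<subseteq> (\<Union>n. Cs n)"
    proof
      fix p assume "p \<in> \<Gamma>"
      then obtain q where "q \<in> F" "dist p q < \<epsilon>" using net by blast
      moreover then obtain i where "i < card F" "q = f i" using f by auto
      ultimately have "p \<in> Cs i" by (simp add: Cs_def dist_commute)
      then show "p \<in> (\<Union>n. Cs n)" by blast
    qed
    have dC: "diameter (Cs i) = (if i < card F then 2 * \<epsilon> else 0)" for i
      using e by (simp add: Cs_def diameter_cball)
    have "(INF C\<in>{C :: nat \<Rightarrow> (real^'n) set. \<Gamma> \<subseteq> (\<Union>n. C n) \<and> (\<forall>n. bounded (C n) \<and> diameter (C n) \<le> \<delta>)}.
        (\<Sum>n. ennreal (?w * (diameter (C n) / 2) powr ?n))) \<le> (\<Sum>n. ennreal (?w * (diameter (Cs n) / 2) powr ?n))"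
      by (rule INF_lower) (use 1 dC e d in \<open>auto simp: Cs_def\<close>)
    also have "\<dots> = (\<Sum>n\<in>{..<card F}. ennreal (?w * (diameter (Cs n) / 2) powr ?n))"
      by (rule suminf_finite) (auto simp: dC)
    also have "\<dots> = (\<Sum>n\<in>{..<card F}. ennreal (?w * \<epsilon> powr ?n))"
      by (rule sum.cong) (auto simp: dC)
    also have "\<dots> = ennreal (\<Sum>n\<in>{..<card F}. ?w * \<epsilon> powr ?n)"
      by (rule sum_ennreal) (intro mult_nonneg_nonneg less_imp_le[OF w] powr_ge_zero)
    also have "\<dots> = ennreal (?w * (real (card F) * \<epsilon> powr ?n))" by (simp add: mult_ac)
    also have "\<dots> \<le> ennreal (?w * C)"
      using card[OF e(1,2) FF] F(1) less_imp_le[OF w] by (intro ennreal_leI mult_left_mono) (auto simp: Fs_def)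
    finally show ?thesis .
  qed
  then have "hausdorff ?n \<Gamma> \<le> ennreal (?w * C)" unfolding hausdorff_def by (intro SUP_least) auto
  also have "\<dots> < \<infinity>" by simp
  finally show ?thesis .
qed

lemma continuous_bdry: "continuous_on \<Gamma> (grad s)" "continuous_on \<Gamma> (lap s)"
proof -
  have sub: "\<Gamma> \<subseteq> {x. \<bar>s x\<bar> < tube}" using bdry_tube by blast
  show "continuous_on \<Gamma> (grad s)" using C1_on_grad_continuous[OF sdist_tube(1)] sub continuous_on_subset by blast
  have "continuous_on {x. \<bar>s x\<bar> < tube} (lap s)" unfolding lap_def[abs_def]
    by (intro continuous_on_sum C1_on_pd_continuous[OF sdist_tube(2)])
  then show "continuous_on \<Gamma> (lap s)" using sub continuous_on_subset by blast
qed

end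

context torsion
begin

abbreviation "deficit p \<equiv> G p \<bullet> outer_normal \<Omega> p - 1 / mean_curv \<Omega> p"

abbreviation "total_deficit \<equiv> L1_bdry \<Omega> (\<lambda>x. deficit x)"

text \<open>\<open>L1_bdry\<close> passes through \<open>enn2real\<close>, which sends infinity to
  0, so finiteness is required before \<open>total_deficit\<close> can bound anything from above.
  The deficit is continuous on the compact boundary, and its superlevel sets are empty beyond its
  maximum.\<close>

lemma deficit_integral_finite:
  assumes N: "CARD('n) \<ge> 2" and H: "\<And>p. p \<in> \<Gamma> \<Longrightarrow> mean_curv \<Omega> p > 0"
  shows "(\<integral>\<^sup>+ t\<in>{0<..}. hausdorff (real CARD('n) - 1) {x\<in>\<Gamma>. \<bar>deficit x\<bar> > t} \<partial>lborel) < \<infinity>"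
proof -
  have mc: "continuous_on \<Gamma> (mean_curv \<Omega>)"
    unfolding mean_curv_def[abs_def] using N by (intro continuous_intros continuous_bdry) auto
  have "continuous_on \<Gamma> G" using cont_G clos_eq continuous_on_subset by blast
  then have "continuous_on \<Gamma> (\<lambda>x. deficit x)"
    unfolding outer_normal_def using H by (intro continuous_intros continuous_bdry mc) force+
  from compact_imp_bounded[OF compact_continuous_image[OF this compact_bdry]]
  obtain B where B: "\<And>x. x \<in> \<Gamma> \<Longrightarrow> \<bar>deficit x\<bar> \<le> B" unfolding bounded_iff by auto
  let ?h = "hausdorff (real CARD('n) - 1) \<Gamma>"
  have "(\<integral>\<^sup>+ t\<in>{0<..}. hausdorff (real CARD('n) - 1) {x\<in>\<Gamma>. \<bar>deficit x\<bar> > t} \<partial>lborel)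
     \<le> (\<integral>\<^sup>+ t. ?h * indicator {0..\<bar>B\<bar>} t \<partial>lborel)"
  proof (rule nn_integral_mono)
    fix t :: real
    show "hausdorff (real CARD('n) - 1) {x\<in>\<Gamma>. \<bar>deficit x\<bar> > t} * indicator {0<..} t \<le> ?h * indicator {0..\<bar>B\<bar>} t"
    proof (cases "0 < t \<and> t \<le> \<bar>B\<bar>")
      case True
      then show ?thesis using hausdorff_mono[of "{x\<in>\<Gamma>. \<bar>deficit x\<bar> > t}" \<Gamma>] by auto
    next
      case False
      have h0: "hausdorff (real CARD('n) - 1) ({} :: (real^'n) set) = 0"
      proof -
        have "(INF C\<in>{C :: nat \<Rightarrow> (real^'n) set. {} \<subseteq> (\<Union>n. C n) \<and> (\<forall>n. bounded (C n) \<and> diameter (C n) \<le> \<delta>)}.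
          (\<Sum>n. ennreal (pi powr ((real CARD('n) - 1) / 2) / Gamma ((real CARD('n) - 1) / 2 + 1) * (diameter (C n) / 2) powr (real CARD('n) - 1)))) \<le> 0"
          if "\<delta> > 0" for \<delta>
          by (rule INF_lower2[of "\<lambda>_. {}"]) (use that in auto)
        then have "hausdorff (real CARD('n) - 1) ({} :: (real^'n) set) \<le> 0" unfolding hausdorff_def
          by (intro SUP_least) auto
        then show ?thesis by simp
      qed
      show ?thesis
      proof (cases "t \<le> 0")
        case True then show ?thesis by simp
      next
        case f: False
        then have e: "{x\<in>\<Gamma>. \<bar>deficit x\<bar> > t} = {}" using False B by force
        show ?thesis unfolding e h0 by simp
      qed
    qed
  qed
  also have "\<dots> = ?h * ennreal \<bar>B\<bar>" by (subst nn_integral_cmult) auto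
  also have "\<dots> < \<infinity>" using hausdorff_bdry_finite[OF N] by (simp add: ennreal_mult_less_top)
  finally show ?thesis .
qed

text \<open>In a thin strip \<open>bflux\<close> differs by less than \<open>\<tau>\<close> from its
  value at the foot of the point. A superlevel set of \<open>bflux - \<tau>\<close> therefore lies
  above a superlevel set of the deficit, \<open>tube_measure\<close> compares the two, and
  integration over the level gives the \<open>L1_bdry\<close> norm.\<close>

lemma bflux_strip_integral:
  assumes N: "CARD('n) \<ge> 2" and H: "\<And>p. p \<in> \<Gamma> \<Longrightarrow> mean_curv \<Omega> p > 0" and tau: "\<tau> > 0"
  shows "\<exists>\<delta>\<^sub>2>0. \<forall>\<delta>. 0 < \<delta> \<longrightarrow> \<delta> < \<delta>\<^sub>2 \<longrightarrow>
    integral\<^sup>L lborel (\<lambda>x. indicator {x. - \<delta> \<le> s x \<and> s x \<le> 0} x * max 0 (bflux x))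
     \<le> \<tau> * measure lborel {x. \<bar>s x\<bar> \<le> \<delta>} + (real CARD('n) - 1) * tube_const TYPE('n) * \<delta> * total_deficit"
proof -
  obtain \<delta>\<^sub>1 where d1: "\<delta>\<^sub>1 > 0" and tm: "\<And>\<delta> A E. 0 < \<delta> \<Longrightarrow> \<delta> < \<delta>\<^sub>1 \<Longrightarrow> A \<subseteq> \<Gamma> \<Longrightarrow> E \<in> sets lborel \<Longrightarrow>
     (\<And>x. x \<in> E \<Longrightarrow> - \<delta> \<le> s x \<and> s x \<le> 0 \<and> (\<exists>q\<in>A. dist x q = \<bar>s x\<bar>)) \<Longrightarrow>
     emeasure lborel E / ennreal (tube_const TYPE('n) * \<delta>) \<le> hausdorff (real CARD('n) - 1) A"
    using tube_measure[OF N] by metis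
  let ?\<rho> = "tube / 2"
  have rho: "?\<rho> < tube" "0 \<le> ?\<rho>" using tube(1) by auto
  define S where "S \<delta> = {x. - \<delta> \<le> s x \<and> s x \<le> 0}" for \<delta>
  have cS: "compact (S \<delta>)" if "0 \<le> \<delta>" for \<delta> unfolding S_def by (rule compact_strip(2)[OF that])
  have cb: "continuous_on (S ?\<rho>) bflux" unfolding S_def by (rule continuous_strip(1)[OF rho])
  have uc: "uniformly_continuous_on (S ?\<rho>) bflux" by (rule compact_uniformly_continuous[OF cb cS[OF rho(2)]])
  obtain d where d: "d > 0" "\<And>x y. x \<in> S ?\<rho> \<Longrightarrow> y \<in> S ?\<rho> \<Longrightarrow> dist y x < d \<Longrightarrow> dist (bflux y) (bflux x) < \<tau>"
    using uniformly_continuous_onE[OF uc tau] by metis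
  define n1 where "n1 = real CARD('n) - 1"
  have n1: "n1 > 0" using N by (simp add: n1_def)
  have tc: "tube_const TYPE('n) > 0" by (rule tube_const_pos[OF N])
  let ?D = "total_deficit"
  have D: "ennreal ?D = (\<integral>\<^sup>+ t\<in>{0<..}. hausdorff n1 {x\<in>\<Gamma>. \<bar>deficit x\<bar> > t} \<partial>lborel)"
    using deficit_integral_finite[OF N H] unfolding L1_bdry_def n1_def by (simp add: less_top)
  have main: "integral\<^sup>L lborel (\<lambda>x. indicator (S \<delta>) x * max 0 (bflux x))
     \<le> \<tau> * measure lborel {x. \<bar>s x\<bar> \<le> \<delta>} + n1 * tube_const TYPE('n) * \<delta> * ?D"
    if dl: "0 < \<delta>" "\<delta> < min \<delta>\<^sub>1 (min ?\<rho> d)" for \<delta>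
  proof -
    have cSd: "compact (S \<delta>)" using cS dl by simp
    have Ssub: "S \<delta> \<subseteq> S ?\<rho>" using dl by (auto simp: S_def)
    have Sm: "S \<delta> \<in> sets borel" using cSd by (rule borel_compact)
    have cbd: "continuous_on (S \<delta>) bflux" using cb Ssub continuous_on_subset by blast
    \<comment> \<open>Subtracting \<open>\<tau>\<close> absorbs the oscillation between a point and
      its foot; dividing by \<open>n1\<close> makes the levels of \<open>f\<close> match those of
      the deficit without a factor.\<close>
    define f where "f x = indicator (S \<delta>) x * (max 0 (bflux x - \<tau>) / n1)" for x
    have "continuous_on (S \<delta>) (\<lambda>x. max 0 (bflux x - \<tau>) / n1)" using n1 by (intro continuous_intros cbd) auto
    from borel_integrable_compact[OF cSd this] have fi: "integrable lborel f" unfolding f_def by simp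
    then have fm: "f \<in> borel_measurable borel" using borel_measurable_integrable by fastforce
    have f0: "f x \<ge> 0" for x using n1 by (simp add: f_def indicator_def)
    let ?T = "tube_const TYPE('n) * \<delta>"
    have T: "?T > 0" using tc dl by simp
    have lev: "emeasure lborel {x. t < f x} / ennreal ?T \<le> hausdorff n1 {x\<in>\<Gamma>. \<bar>deficit x\<bar> > t}" if t: "t > 0" for t
      unfolding n1_def
    proof (rule tm)
      show "0 < \<delta>" "\<delta> < \<delta>\<^sub>1" using dl by auto
      show "{x \<in> \<Gamma>. \<bar>deficit x\<bar> > t} \<subseteq> \<Gamma>" by blast
      show "{x. t < f x} \<in> sets lborel" using fm by measurable
      fix x assume "x \<in> {x. t < f x}"
      then have tf: "t < f x" by simp
      have xS: "x \<in> S \<delta>"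
      proof (rule ccontr)
        assume "x \<notin> S \<delta>"
        then have "f x = 0" by (simp add: f_def)
        then show False using tf t by simp
      qed
      have "t < max 0 (bflux x - \<tau>) / n1" using xS tf by (simp add: f_def)
      then have "t * n1 < max 0 (bflux x - \<tau>)" using n1 by (simp add: pos_less_divide_eq)
      moreover have "t * n1 > 0" using t n1 by simp
      ultimately have b: "t * n1 + \<tau> < bflux x" by (auto simp: max_def split: if_splits)
      obtain q where q: "q \<in> \<Gamma>" "dist x q = \<bar>s x\<bar>" using nearest_exists by blast
      have "q \<in> S ?\<rho>" using q(1) sdist_zero_iff[of q] rho by (simp add: S_def)
      moreover have "dist x q < d" using xS q(2) dl by (auto simp: S_def)
      ultimately have "dist (bflux x) (bflux q) < \<tau>" using d(2) xS Ssub by blast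
      then have "t * n1 < bflux q" using b by (simp add: dist_real_def)
      also have "\<dots> \<le> n1 * \<bar>deficit q\<bar>" using bflux_bdry[OF q(1) H[OF q(1)] N] by (simp add: n1_def)
      finally have "t < \<bar>deficit q\<bar>" using n1 by (simp add: mult.commute)
      then show "- \<delta> \<le> s x \<and> s x \<le> 0 \<and> (\<exists>q\<in>{x \<in> \<Gamma>. \<bar>deficit x\<bar> > t}. dist x q = \<bar>s x\<bar>)"
        using xS q by (auto simp: S_def)
    qed
    have "ennreal (integral\<^sup>L lborel f) = (\<integral>\<^sup>+ x. ennreal (f x) \<partial>lborel)"
      by (rule nn_integral_eq_integral[symmetric, OF fi]) (simp add: f0)
    also have "\<dots> = (\<integral>\<^sup>+ t\<in>{0<..}. emeasure lborel {x. t < f x} \<partial>lborel)" by (rule nn_integral_layer_cake[OF fm])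
    also have "\<dots> = (\<integral>\<^sup>+ t. ennreal ?T * (emeasure lborel {x. t < f x} / ennreal ?T * indicator {0<..} t) \<partial>lborel)"
    proof (rule nn_integral_cong)
      fix t
      have "ennreal ?T * (emeasure lborel {x. t < f x} / ennreal ?T) = emeasure lborel {x. t < f x}"
      proof -
        have "ennreal ?T \<noteq> 0" using T by (simp only: ennreal_eq_0_iff not_le)
        from mult_divide_eq_ennreal[OF this ennreal_neq_top] show ?thesis
          by (simp only: ennreal_times_divide mult.commute[of "ennreal ?T"])
      qed
      then show "emeasure lborel {x. t < f x} * indicator {0<..} t = ennreal ?T * (emeasure lborel {x. t < f x} / ennreal ?T * indicator {0<..} t)"
        by (metis mult.assoc)
    qed
    also have "\<dots> = ennreal ?T * (\<integral>\<^sup>+ t. emeasure lborel {x. t < f x} / ennreal ?T * indicator {0<..} t \<partial>lborel)"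
    proof (rule nn_integral_cmult)
      have "{z \<in> space (lborel \<Otimes>\<^sub>M lborel). fst z < f (snd z)} \<in> sets ((lborel :: real measure) \<Otimes>\<^sub>M lborel)"
        using fm by measurable
      then have "(\<lambda>t. emeasure lborel (Pair t -` {z \<in> space (lborel \<Otimes>\<^sub>M lborel). fst z < f (snd z)})) \<in> borel_measurable (lborel :: real measure)"
        by (rule lborel.measurable_emeasure_Pair)
      then have "(\<lambda>t. emeasure lborel {x. t < f x}) \<in> borel_measurable (lborel :: real measure)"
        by (simp add: space_pair_measure vimage_def)
      then show "(\<lambda>t. emeasure lborel {x. t < f x} / ennreal ?T * indicator {0<..} t) \<in> borel_measurable (lborel :: real measure)"
        by measurable
    qed
    also have "\<dots> \<le> ennreal ?T * (\<integral>\<^sup>+ t. hausdorff n1 {x\<in>\<Gamma>. \<bar>deficit x\<bar> > t} * indicator {0<..} t \<partial>lborel)"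
      using lev by (intro mult_left_mono nn_integral_mono) (auto simp: indicator_def)
    also have "\<dots> = ennreal (?T * ?D)" unfolding D[symmetric] using T
      by (simp add: ennreal_mult L1_bdry_def)
    finally have if': "integral\<^sup>L lborel f \<le> ?T * ?D"
      using T by (subst (asm) ennreal_le_iff) (auto simp: L1_bdry_def)
    let ?E = "{x. \<bar>s x\<bar> \<le> \<delta>}"
    have cE: "compact ?E" using compact_strip(1)[of \<delta>] dl by simp
    have iE: "integrable lborel (\<lambda>x. indicator ?E x :: real)"
      using borel_compact[OF cE] emeasure_bounded_finite[OF compact_imp_bounded[OF cE]] by (intro integrable_real_indicator) auto
    have "continuous_on (S \<delta>) (\<lambda>x. max 0 (bflux x))" by (intro continuous_intros cbd)
    from borel_integrable_compact[OF cSd this] have iS: "integrable lborel (\<lambda>x. indicator (S \<delta>) x * max 0 (bflux x))" by simp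
    have "integral\<^sup>L lborel (\<lambda>x. indicator (S \<delta>) x * max 0 (bflux x)) \<le> integral\<^sup>L lborel (\<lambda>x. \<tau> * indicator ?E x + n1 * f x)"
    proof (rule integral_mono[OF iS])
      show "integrable lborel (\<lambda>x. \<tau> * indicator ?E x + n1 * f x)" using iE fi by simp
      fix x
      show "indicator (S \<delta>) x * max 0 (bflux x) \<le> \<tau> * indicator ?E x + n1 * f x"
      proof (cases "x \<in> S \<delta>")
        case True
        then have "x \<in> ?E" by (auto simp: S_def)
        then show ?thesis using True n1 tau by (auto simp: f_def max_def)
      next
        case False
        then show ?thesis using n1 tau by (simp add: f_def indicator_def)
      qed
    qed
    also have "\<dots> = \<tau> * measure lborel ?E + n1 * integral\<^sup>L lborel f" using iE fi by simp
    also have "\<dots> \<le> \<tau> * measure lborel ?E + n1 * (?T * ?D)" using if' n1 by (intro add_left_mono mult_left_mono) auto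
    finally show ?thesis by (simp add: mult.assoc)
  qed
  show ?thesis
    by (rule exI[of _ "min \<delta>\<^sub>1 (min ?\<rho> d)"]) (use main d1 d tube(1) in \<open>auto simp: S_def n1_def\<close>)
qed

lemma defect_compact_bound:
  assumes N: "CARD('n) \<ge> 2" and H: "\<And>p. p \<in> \<Gamma> \<Longrightarrow> mean_curv \<Omega> p > 0" and K: "compact K" "K \<subseteq> \<Omega>"
  shows "integral\<^sup>L lborel (\<lambda>x. indicator K x * defect x) \<le> defect_const TYPE('n) * total_deficit"
proof (rule field_le_epsilon)
  fix \<tau>' :: real assume t': "\<tau>' > 0"
  obtain C \<epsilon>\<^sub>0 where C: "C > 0" "\<epsilon>\<^sub>0 > 0" "\<And>\<epsilon>. 0 < \<epsilon> \<Longrightarrow> \<epsilon> \<le> \<epsilon>\<^sub>0 \<Longrightarrow> measure lborel {x. \<bar>s x\<bar> \<le> \<epsilon>} \<le> C * \<epsilon>"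
    using strip_measure by metis
  \<comment> \<open>The strip error is
    \<open>(1 / \<delta>) * \<tau> * (C * (3 * \<delta>))\<close>, which this choice makes equal to
    \<open>\<tau>'\<close>.\<close>
  define \<tau> where "\<tau> = \<tau>' / (3 * C)"
  have t: "\<tau> > 0" using t' C by (simp add: \<tau>_def)
  obtain \<delta>\<^sub>2 where d2: "\<delta>\<^sub>2 > 0" "\<And>\<delta>. 0 < \<delta> \<Longrightarrow> \<delta> < \<delta>\<^sub>2 \<Longrightarrow>
    integral\<^sup>L lborel (\<lambda>x. indicator {x. - \<delta> \<le> s x \<and> s x \<le> 0} x * max 0 (bflux x))
     \<le> \<tau> * measure lborel {x. \<bar>s x\<bar> \<le> \<delta>} + (real CARD('n) - 1) * tube_const TYPE('n) * \<delta> * total_deficit"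
    using bflux_strip_integral[OF N H t] by blast
  have "\<exists>\<delta>\<^sub>3>0. \<forall>x\<in>K. s x \<le> - \<delta>\<^sub>3"
  proof (cases "K = {}")
    case False
    obtain x where x: "x \<in> K" "\<And>y. y \<in> K \<Longrightarrow> s y \<le> s x"
      using continuous_attains_sup[OF K(1) False continuous_sdist] by blast
    then show ?thesis using K(2) sdist_neg_iff[of x] by (intro exI[of _ "- s x"]) auto
  qed (auto intro: exI[of _ 1])
  then obtain \<delta>\<^sub>3 where d3: "\<delta>\<^sub>3 > 0" "\<And>x. x \<in> K \<Longrightarrow> s x \<le> - \<delta>\<^sub>3" by blast
  define \<delta> where "\<delta> = min (min \<delta>\<^sub>2 \<delta>\<^sub>3) (min tube \<epsilon>\<^sub>0) / 6"
  have d: "0 < \<delta>" "3 * \<delta> < \<delta>\<^sub>2" "3 * \<delta> < \<delta>\<^sub>3" "3 * \<delta> < tube" "3 * \<delta> \<le> \<epsilon>\<^sub>0"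
    using d2 d3 tube(1) C(2) by (auto simp: \<delta>_def min_def)
  have "K \<subseteq> {x. s x \<le> - (3 * \<delta>)}" using d3(2) d by force
  from interior_defect_le[OF d(1,4) K(1) this]
  have "integral\<^sup>L lborel (\<lambda>x. indicator K x * defect x)
    \<le> (1 / \<delta>) * integral\<^sup>L lborel (\<lambda>x. indicator {x. - (3 * \<delta>) \<le> s x \<and> s x \<le> 0} x * max 0 (bflux x))" .
  also have "\<dots> \<le> (1 / \<delta>) * (\<tau> * measure lborel {x. \<bar>s x\<bar> \<le> 3 * \<delta>} + (real CARD('n) - 1) * tube_const TYPE('n) * (3 * \<delta>) * total_deficit)"
    using d2(2)[of "3 * \<delta>"] d by (intro mult_left_mono) auto
  also have "\<dots> \<le> (1 / \<delta>) * (\<tau> * (C * (3 * \<delta>)) + (real CARD('n) - 1) * tube_const TYPE('n) * (3 * \<delta>) * total_deficit)"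
    using C(3)[of "3 * \<delta>"] d t by (intro mult_left_mono add_right_mono) auto
  also have "\<dots> = defect_const TYPE('n) * total_deficit + \<tau>'"
    using d C by (simp add: \<tau>_def defect_const_def field_simps)
  finally show "integral\<^sup>L lborel (\<lambda>x. indicator K x * defect x) \<le> defect_const TYPE('n) * total_deficit + \<tau>'" .
qed

text \<open>The bound on compact sets does not depend on the set, so monotone convergence along an
  exhaustion suffices.\<close>

lemma defect_bound:
  assumes N: "CARD('n) \<ge> 2" and H: "\<And>p. p \<in> \<Gamma> \<Longrightarrow> mean_curv \<Omega> p > 0"
  shows "(\<integral>\<^sup>+ x\<in>\<Omega>. ennreal (defect x) \<partial>lebesgue) \<le> ennreal (defect_const TYPE('n) * total_deficit)"
proof -
  define K where "K n = {x. s x \<le> - (1 / real (Suc n))}" for n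
  have K: "compact (K n)" "K n \<subseteq> \<Omega>" for n
  proof -
    show "compact (K n)" unfolding K_def by (rule compact_strip(3)) simp
    have "s x < 0" if "x \<in> K n" for x
    proof -
      have "- (1 / real (Suc n)) < 0" by simp
      then show ?thesis using that unfolding K_def by (metis le_less_trans mem_Collect_eq)
    qed
    then show "K n \<subseteq> \<Omega>" using sdist_neg_iff by blast
  qed
  let ?f = "\<lambda>n x. ennreal (indicator (K n) x * defect x)"
  have inc: "incseq ?f"
  proof (rule incseq_SucI, rule le_funI)
    fix n x
    have "K n \<subseteq> K (Suc n)"
    proof -
      have "1 / real (Suc (Suc n)) \<le> 1 / real (Suc n)" by (intro divide_left_mono) auto
      then show ?thesis by (auto simp: K_def)
    qed
    then show "?f n x \<le> ?f (Suc n) x"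
      using defect_nonneg[of x] K(2)[of "Suc n"] by (intro ennreal_leI) (cases "x \<in> K (Suc n)"; auto simp: indicator_def)
  qed
  have i: "integrable lborel (\<lambda>x. indicator (K n) x * defect x)" for n
    using borel_integrable_compact[OF K(1) continuous_on_subset[OF continuous_defect K(2)]] by simp
  have m: "?f n \<in> borel_measurable lborel" for n
    using borel_measurable_integrable[OF i] by measurable
  have sup: "(SUP n. ?f n x) = ennreal (defect x) * indicator \<Omega> x" for x
  proof (cases "x \<in> \<Omega>")
    case True
    then have "- s x > 0" using sdist_neg_iff by simp
    then obtain n where n: "1 / real (Suc n) < - s x" using nat_approx_posE by blast
    then have xK: "x \<in> K n" by (auto simp: K_def)
    show ?thesis
    proof (rule antisym)
      show "(SUP n. ?f n x) \<le> ennreal (defect x) * indicator \<Omega> x"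
        using True defect_nonneg by (intro SUP_least) (auto simp: indicator_def)
      have "ennreal (defect x) * indicator \<Omega> x = ?f n x" using True xK by simp
      also have "\<dots> \<le> (SUP n. ?f n x)" by (rule SUP_upper) simp
      finally show "ennreal (defect x) * indicator \<Omega> x \<le> (SUP n. ?f n x)" .
    qed
  next
    case False
    then have "x \<notin> K n" for n using K(2) by blast
    then show ?thesis using False by simp
  qed
  have "(\<integral>\<^sup>+ x\<in>\<Omega>. ennreal (defect x) \<partial>lebesgue) = (\<integral>\<^sup>+ x. (SUP n. ?f n x) \<partial>lborel)"
    unfolding sup nn_integral_lebesgue_lborel ..
  also have "\<dots> = (SUP n. \<integral>\<^sup>+ x. ?f n x \<partial>lborel)"
    by (rule nn_integral_monotone_convergence_SUP[OF inc m])
  also have "\<dots> \<le> ennreal (defect_const TYPE('n) * total_deficit)"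
  proof (rule SUP_least)
    fix n
    have "indicator (K n) x * defect x \<ge> 0" for x using K(2)[of n] defect_nonneg by (auto simp: indicator_def)
    then have "(\<integral>\<^sup>+ x. ?f n x \<partial>lborel) = ennreal (integral\<^sup>L lborel (\<lambda>x. indicator (K n) x * defect x))"
      by (intro nn_integral_eq_integral i AE_I2)
    also have "\<dots> \<le> ennreal (defect_const TYPE('n) * total_deficit)"
      by (intro ennreal_leI defect_compact_bound[OF N H K])
    finally show "(\<integral>\<^sup>+ x. ?f n x \<partial>lborel) \<le> ennreal (defect_const TYPE('n) * total_deficit)" .
  qed
  finally show ?thesis .
qed

end

subsection \<open>Maximum principle\<close>

text \<open>At a maximum inside \<open>V\<close> the first derivatives vanish, while a positive
  Laplacian leaves one axis with positive second derivative; along that axis \<open>f\<close> would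
  increase strictly.\<close>

lemma strict_subharmonic_max:
  fixes f :: "real^'n \<Rightarrow> real"
  assumes K: "compact K" and cf: "continuous_on K f" and V: "open V" "V \<subseteq> K" and C2: "C2_on V f"
    and lp: "\<And>x. x \<in> V \<Longrightarrow> lap f x > 0" and x: "x \<in> K"
  shows "\<exists>y\<in>K - V. f x \<le> f y"
proof -
  obtain y where y: "y \<in> K" "\<And>w. w \<in> K \<Longrightarrow> f w \<le> f y"
    using continuous_attains_sup[OF K _ cf] x by blast
  have "y \<notin> V"
  proof
    assume yV: "y \<in> V"
    have "\<exists>i. pd (pd f i) i y > 0"
    proof (rule ccontr)
      assume "\<not> (\<exists>i. pd (pd f i) i y > 0)"
      then have "lap f y \<le> 0" unfolding lap_def by (intro sum_nonpos) (simp add: not_less)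
      then show False using lp[OF yV] by simp
    qed
    then obtain i where i: "pd (pd f i) i y > 0" by blast
    let ?p = "\<lambda>t. y + t *\<^sub>R (axis i 1 :: real^'n)"
    obtain e where e: "e > 0" "ball y e \<subseteq> V" using V(1) yV openE by blast
    have pV: "?p t \<in> V" if "\<bar>t\<bar> < e" for t using that by (intro subsetD[OF e(2)]) (simp add: dist_norm)
    note C = C2_on_C1[OF V(1) C2]
    have D1: "DERIV (\<lambda>t. f (?p t)) t :> pd f i (?p t)" if "\<bar>t\<bar> < e" for t
      using pd_segment[of f i y t 1] C1_on_pd_exists[OF C(1) pV[OF that]] by simp
    have "pd f i y = 0"
    proof -
      have D0: "DERIV (\<lambda>t. f (?p t)) 0 :> pd f i y" using D1[of 0] e by simp
      have "f (?p t) \<le> f (?p 0)" if "\<bar>0 - t\<bar> < e" for t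
        using y(2)[of "?p t"] pV[of t] V(2) that by auto
      then show ?thesis using DERIV_local_max[OF D0 e(1)] by blast
    qed
    moreover have "DERIV (\<lambda>t. pd f i (?p t)) 0 :> pd (pd f i) i y"
      by (rule pd_exists_DERIV[OF C1_on_pd_exists[OF C(2) yV]])
    from DERIV_pos_inc_right[OF this i] obtain d where d: "d > 0" "\<forall>h>0. h < d \<longrightarrow> pd f i (?p 0) < pd f i (?p (0 + h))" by blast
    ultimately have pos: "pd f i (?p h) > 0" if "0 < h" "h < d" for h using that by auto
    define h where "h = min d e / 2"
    have h: "0 < h" "h < d" "h < e" using d e by (auto simp: h_def min_def)
    obtain t where t: "0 < t" "t < h" "f (?p h) - f (?p 0) = (h - 0) * pd f i (?p t)"
      using MVT2[OF h(1), of "\<lambda>t. f (?p t)" "\<lambda>t. pd f i (?p t)", OF D1] h(3) by force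
    have "f (?p h) - f y > 0" using t pos[of t] h by simp
    moreover have "f (?p h) \<le> f y" using y(2) pV[of h] h V(2) by auto
    ultimately show False by simp
  qed
  then show ?thesis using y x by blast
qed

lemma local_min_pd:
  fixes f :: "real^'n \<Rightarrow> real"
  assumes V: "open V" "z \<in> V" and C1: "C1_on V f" and m: "\<And>x. x \<in> V \<Longrightarrow> f z \<le> f x"
  shows "pd f i z = 0"
proof -
  obtain e where e: "e > 0" "ball z e \<subseteq> V" using V openE by blast
  have "f (z + 0 *\<^sub>R axis i 1) \<le> f (z + t *\<^sub>R axis i 1)" if "\<bar>0 - t\<bar> < e" for t
    using that by (simp, intro m subsetD[OF e(2)]) (simp add: dist_norm)
  then show ?thesis
    using DERIV_local_min[OF pd_exists_DERIV[OF C1_on_pd_exists[OF C1 V(2)]] e(1)] by blast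
qed

lemma lap_quad: "lap (\<lambda>x::real^'n. (norm (x - z))\<^sup>2 / 2) x = real CARD('n)"
  unfolding lap_def C2_on_quad(3) by simp

context torsion
begin

lemma u_nonpos:
  assumes x: "x \<in> closure \<Omega>" shows "u x \<le> 0"
proof -
  obtain y where y: "y \<in> closure \<Omega> - \<Omega>" "u x \<le> u y"
    using strict_subharmonic_max[OF compact_clos cont_u open_dom closure_subset C2_u _ x] lap_u by auto
  then have "y \<in> \<Gamma>" using clos_eq by auto
  then show ?thesis using y u_bdry by simp
qed

text \<open>\<open>u\<close> is compared with a quarter of the squared distance to \<open>c\<close>.
  That is half of the quadratic with Laplacian \<open>N\<close>, so the difference has Laplacian
  \<open>N / 2\<close> and the strict maximum principle applies; on the sphere it is at most
  \<open>- \<rho>\<^sup>2 / 4\<close>.\<close>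

lemma ball_comparison:
  assumes b: "ball c \<rho> \<subseteq> \<Omega>" and r: "\<rho> > 0"
  shows "u c \<le> - \<rho>\<^sup>2 / 4"
proof -
  let ?q = "\<lambda>x. (norm (x - c))\<^sup>2 / 2"
  let ?f = "\<lambda>x. u x + (- 1 / 2) * ?q x"
  have sub: "cball c \<rho> \<subseteq> closure \<Omega>" using closure_mono[OF b] r by simp
  have qc: "continuous_on S ?q" for S by (intro continuous_intros) auto
  have cf: "continuous_on (cball c \<rho>) ?f"
    by (intro continuous_intros continuous_on_subset[OF cont_u sub]) auto
  have ub: "C2_on (ball c \<rho>) u" using C2_u b C2_on_subset by blast
  have qb: "C2_on (ball c \<rho>) ?q" using C2_on_quad(1) C2_on_subset by blast
  note q2 = C2_on_cmult[OF open_ball qb, where c="- 1 / 2"]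
  note s2 = C2_on_add[OF open_ball ub q2(1)]
  have lp: "lap ?f x = real CARD('n) / 2" if x: "x \<in> ball c \<rho>" for x
  proof -
    have "lap ?f x = lap u x + (- 1 / 2) * lap ?q x"
      unfolding lap_def s2(3)[OF x] q2(3)[OF x] sum.distrib sum_distrib_left ..
    then show ?thesis using lap_u[of x] b x lap_quad[of c x] by auto
  qed
  have cc: "c \<in> cball c \<rho>" using r by simp
  have lp': "lap ?f x > 0" if "x \<in> ball c \<rho>" for x unfolding lp[OF that] by simp
  obtain y where y: "y \<in> cball c \<rho> - ball c \<rho>" "?f c \<le> ?f y"
    using strict_subharmonic_max[OF compact_cball cf open_ball ball_subset_cball s2(1) lp' cc] by blast
  have "norm (y - c) = \<rho>" using y(1) by (auto simp: dist_norm norm_minus_commute)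
  moreover have "u y \<le> 0" using u_nonpos y(1) sub by blast
  ultimately show ?thesis using y(2) by simp
qed

text \<open>By \<open>ball_comparison\<close> the minimum of \<open>u\<close> over the closure is
  negative, so it is not attained on the boundary.\<close>

lemma critical_point: obtains z where "z \<in> \<Omega>" "\<And>i. pd u i z = 0"
proof -
  have ne: "closure \<Omega> \<noteq> {}" using nonempty_dom by simp
  obtain z where z: "z \<in> closure \<Omega>" "\<And>x. x \<in> closure \<Omega> \<Longrightarrow> u z \<le> u x"
    using continuous_attains_inf[OF compact_clos ne cont_u] by blast
  obtain c where c: "c \<in> \<Omega>" using nonempty_dom by blast
  obtain \<rho> where \<rho>: "\<rho> > 0" "ball c \<rho> \<subseteq> \<Omega>" using open_dom c openE by blast
  have "u z \<le> - \<rho>\<^sup>2 / 4" using z(2)[of c] c closure_subset ball_comparison[OF \<rho>(2,1)] by force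
  then have "u z < 0" using \<rho>(1) by (smt (verit) divide_less_0_iff zero_less_power)
  then have "z \<notin> \<Gamma>" using u_bdry by force
  then have zO: "z \<in> \<Omega>" using z clos_eq by auto
  have "pd u i z = 0" for i
    by (rule local_min_pd[OF open_dom zO C2_on_C1(1)[OF open_dom C2_u]]) (use z(2) closure_subset in blast)
  then show ?thesis using that zO by blast
qed

text \<open>Here the 4 of \<open>r \<le> 4 * M\<close> arises: \<open>ball_comparison\<close> gives
  \<open>\<bar>u c\<bar> \<ge> \<rho>\<^sup>2 / 4\<close>, \<open>u_bound\<close> gives
  \<open>\<bar>u c\<bar> \<le> gmax * \<rho>\<close>.\<close>

lemma gmax_ge_radius:
  assumes b: "ball c \<rho> \<subseteq> \<Omega>" and r: "\<rho> > 0" and q: "q \<in> \<Gamma>" "dist c q \<le> \<rho>"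
  shows "\<rho> \<le> 4 * gmax"
proof -
  have c: "c \<in> closure \<Omega>" using b r closure_subset by (metis centre_in_ball subsetD)
  have "\<rho>\<^sup>2 / 4 \<le> \<bar>u c\<bar>" using ball_comparison[OF b r] by linarith
  also have "\<dots> \<le> gmax * \<bar>s c\<bar>" by (rule u_bound[OF c])
  also have "\<dots> \<le> gmax * \<rho>" using abs_sdist_le[OF q(1), of c] q(2) gmax_nonneg by (intro mult_left_mono) auto
  finally have "\<rho> * \<rho> \<le> (4 * gmax) * \<rho>" by (simp add: power2_eq_square)
  then show ?thesis using r by simp
qed

subsection \<open>Radii and the Poincare constant\<close>

lemma rho_attained:
  obtains xe xi where "xe \<in> \<Gamma>" "dist xe z = rho_e \<Omega> z" "xi \<in> \<Gamma>" "dist xi z = rho_i \<Omega> z"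
    "\<And>x. x \<in> \<Gamma> \<Longrightarrow> dist x z \<le> rho_e \<Omega> z" "\<And>x. x \<in> \<Gamma> \<Longrightarrow> rho_i \<Omega> z \<le> dist x z"
proof -
  have cd: "continuous_on \<Gamma> (\<lambda>x. dist x z)" by (intro continuous_intros)
  obtain xe where xe: "xe \<in> \<Gamma>" "\<And>x. x \<in> \<Gamma> \<Longrightarrow> dist x z \<le> dist xe z"
    using continuous_attains_sup[OF compact_bdry bdry_nonempty cd] by blast
  obtain xi where xi: "xi \<in> \<Gamma>" "\<And>x. x \<in> \<Gamma> \<Longrightarrow> dist xi z \<le> dist x z"
    using continuous_attains_inf[OF compact_bdry bdry_nonempty cd] by blast
  have e: "rho_e \<Omega> z = dist xe z" unfolding rho_e_def
    using xe by (intro cSup_eq_maximum) auto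
  have i: "rho_i \<Omega> z = dist xi z" unfolding rho_i_def
    using xi by (intro cInf_eq_minimum) auto
  show ?thesis by (rule that[of xe xi]) (use xe xi e i in auto)
qed

lemma dom_in_ball: "\<Omega> \<subseteq> cball z (rho_e \<Omega> z)"
proof
  fix x assume x: "x \<in> \<Omega>"
  obtain xe xi where r: "xe \<in> \<Gamma>" "dist xe z = rho_e \<Omega> z" "\<And>x. x \<in> \<Gamma> \<Longrightarrow> dist x z \<le> rho_e \<Omega> z"
    by (rule rho_attained[of z]) blast
  let ?q = "\<lambda>x. (norm (x - z))\<^sup>2 / 2"
  have "C2_on \<Omega> ?q" using C2_on_quad(1) C2_on_subset by blast
  moreover have "continuous_on (closure \<Omega>) ?q" by (intro continuous_intros) auto
  moreover have "x \<in> closure \<Omega>" using x closure_subset by blast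
  ultimately obtain y where y: "y \<in> closure \<Omega> - \<Omega>" "?q x \<le> ?q y"
    using strict_subharmonic_max[OF compact_clos _ open_dom closure_subset, of ?q x] lap_quad[of z] by auto
  have "y \<in> \<Gamma>" using y clos_eq by auto
  then have "norm (y - z) \<le> rho_e \<Omega> z" using r(3) by (simp add: dist_norm)
  moreover have "norm (x - z) \<le> norm (y - z)" by (rule power2_le_imp_le) (use y(2) in auto)
  ultimately show "x \<in> cball z (rho_e \<Omega> z)" by (simp add: dist_norm norm_minus_commute)
qed

text \<open>The estimates control \<open>(rho_e - rho_i) * rho_e\<close>; the first claim is what
  exchanges the factor \<open>rho_e\<close> for the power of the volume in the denominators.\<close>

lemma volume_le:
  "measure lebesgue \<Omega> powr (1 / real CARD('n)) \<le> unit_ball_vol (real CARD('n)) powr (1 / real CARD('n)) * rho_e \<Omega> z"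
  "measure lebesgue \<Omega> > 0" "rho_e \<Omega> z \<ge> 0"
proof -
  obtain xe where r: "dist xe z = rho_e \<Omega> z" by (rule rho_attained[of z]) blast
  show re: "rho_e \<Omega> z \<ge> 0" using r by (metis zero_le_dist)
  have "measure lebesgue \<Omega> \<le> measure lebesgue (cball z (rho_e \<Omega> z))"
    using dom_in_ball[of z] open_dom by (intro measure_mono_fmeasurable) (auto intro: lmeasurable_open bounded_dom)
  also have "\<dots> = unit_ball_vol (real CARD('n)) * rho_e \<Omega> z ^ CARD('n)"
    using content_cball[OF re, of z] by (simp add: measure_completion)
  finally have "measure lebesgue \<Omega> powr (1 / real CARD('n)) \<le> (unit_ball_vol (real CARD('n)) * rho_e \<Omega> z ^ CARD('n)) powr (1 / real CARD('n))"
    by (intro powr_mono2) auto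
  also have "\<dots> = unit_ball_vol (real CARD('n)) powr (1 / real CARD('n)) * (rho_e \<Omega> z ^ CARD('n)) powr (1 / real CARD('n))"
    by (rule powr_mult)
  also have "(rho_e \<Omega> z ^ CARD('n)) powr (1 / real CARD('n)) = rho_e \<Omega> z"
  proof (cases "rho_e \<Omega> z = 0")
    case False
    then have "rho_e \<Omega> z > 0" using re by simp
    then show ?thesis by (simp add: powr_realpow[symmetric] powr_powr)
  qed simp
  finally show "measure lebesgue \<Omega> powr (1 / real CARD('n)) \<le> unit_ball_vol (real CARD('n)) powr (1 / real CARD('n)) * rho_e \<Omega> z" .
  have "measure lebesgue \<Omega> \<noteq> 0"
    using open_not_negligible[OF open_dom nonempty_dom] lmeasurable_open[OF bounded_dom open_dom]
    by (simp add: negligible_iff_measure)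
  then show "measure lebesgue \<Omega> > 0" using measure_nonneg[of lebesgue \<Omega>] by linarith
qed

text \<open>A harmonic \<open>v\<close> with positive finite \<open>L\<^sup>2\<close> norm is
  rescaled to norm 1 and becomes a competitor in the definition of \<open>mu0\<close>.\<close>

lemma poincare:
  assumes v: "C2_on \<Omega> v" "\<And>x. x \<in> \<Omega> \<Longrightarrow> lap v x = 0" "v z = 0"
    and fin: "(\<integral>\<^sup>+ x\<in>\<Omega>. ennreal ((v x)\<^sup>2) \<partial>lebesgue) < \<infinity>"
  shows "ennreal (mu0 \<Omega> z) * (\<integral>\<^sup>+ x\<in>\<Omega>. ennreal ((v x)\<^sup>2) \<partial>lebesgue) \<le> dirichlet \<Omega> v"
proof -
  let ?A = "\<integral>\<^sup>+ x\<in>\<Omega>. ennreal ((v x)\<^sup>2) \<partial>lebesgue"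
  let ?B = "dirichlet \<Omega> v"
  show ?thesis
  proof (cases "?A = 0")
    case False
    define a where "a = enn2real ?A"
    have a: "a > 0" "?A = ennreal a" using False fin by (auto simp: a_def enn2real_positive_iff less_top zero_less_iff_neq_zero)
    define c where "c = 1 / sqrt a"
    have c2: "c\<^sup>2 = 1 / a" using a by (simp add: c_def power_divide)
    let ?w = "\<lambda>x. c * v x"
    note cm = C2_on_cmult[OF open_dom v(1), where c=c]
    have lw: "lap ?w x = 0" if "x \<in> \<Omega>" for x
    proof -
      have "lap ?w x = c * lap v x" unfolding lap_def cm(3)[OF that] sum_distrib_left ..
      then show ?thesis using v(2)[OF that] by simp
    qed
    have vm: "(\<lambda>x. ennreal ((v x)\<^sup>2) * indicator \<Omega> x) \<in> borel_measurable lborel"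
      by (intro measurable_on_open[OF open_dom] continuous_intros C1_on_continuous[OF C2_on_C1(1)[OF open_dom v(1)] open_dom])
    have gm: "(\<lambda>x. ennreal ((norm (grad v x))\<^sup>2) * indicator \<Omega> x) \<in> borel_measurable lborel"
      by (intro measurable_on_open[OF open_dom] continuous_intros C1_on_grad_continuous[OF C2_on_C1(1)[OF open_dom v(1)]])
    have em: "ennreal (1 / a * y) = ennreal (1 / a) * ennreal y" if "y \<ge> 0" for y
      using a that by (intro ennreal_mult) auto
    have iw: "(\<integral>\<^sup>+ x\<in>\<Omega>. ennreal ((?w x)\<^sup>2) \<partial>lebesgue) = 1"
    proof -
      have "(\<integral>\<^sup>+ x\<in>\<Omega>. ennreal ((?w x)\<^sup>2) \<partial>lebesgue) = (\<integral>\<^sup>+ x. ennreal (1 / a) * (ennreal ((v x)\<^sup>2) * indicator \<Omega> x) \<partial>lborel)"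
        unfolding nn_integral_lebesgue_lborel power_mult_distrib c2
        by (intro nn_integral_cong) (simp only: em[OF zero_le_power2] mult.assoc)
      also have "\<dots> = ennreal (1 / a) * ?A"
        unfolding nn_integral_lebesgue_lborel by (rule nn_integral_cmult[OF vm])
      also have "\<dots> = 1" using a by (simp add: ennreal_mult[symmetric])
      finally show ?thesis .
    qed
    have gw: "(\<integral>\<^sup>+ x\<in>\<Omega>. ennreal ((norm (grad ?w x))\<^sup>2) \<partial>lebesgue) = ennreal (1 / a) * ?B"
    proof -
      have gx: "(norm (grad ?w x))\<^sup>2 = (1 / a) * (norm (grad v x))\<^sup>2" if "x \<in> \<Omega>" for x
      proof -
        have "grad ?w x = c *\<^sub>R grad v x" using cm(2)[OF that] by (simp add: grad_def vec_eq_iff)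
        then show ?thesis by (simp add: power_mult_distrib c2)
      qed
      have "(\<integral>\<^sup>+ x\<in>\<Omega>. ennreal ((norm (grad ?w x))\<^sup>2) \<partial>lebesgue) = (\<integral>\<^sup>+ x. ennreal (1 / a) * (ennreal ((norm (grad v x))\<^sup>2) * indicator \<Omega> x) \<partial>lborel)"
        unfolding nn_integral_lebesgue_lborel
      proof (intro nn_integral_cong)
        fix x
        show "ennreal ((norm (grad ?w x))\<^sup>2) * indicator \<Omega> x = ennreal (1 / a) * (ennreal ((norm (grad v x))\<^sup>2) * indicator \<Omega> x)"
        proof (cases "x \<in> \<Omega>")
          case True
          then show ?thesis by (simp only: gx em[OF zero_le_power2] mult.assoc)
        qed simp
      qed
      also have "\<dots> = ennreal (1 / a) * ?B"
        unfolding nn_integral_lebesgue_lborel by (rule nn_integral_cmult[OF gm])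
      finally show ?thesis .
    qed
    \<comment> \<open>\<open>mu0\<close> is an \<open>enn2real\<close>, which sends an infinite
      infimum to 0; the inequality in this direction survives that convention.\<close>
    have "ennreal (mu0 \<Omega> z) \<le> (INF v\<in>{v. C2_on \<Omega> v \<and> (\<forall>x\<in>\<Omega>. lap v x = 0)
        \<and> (\<integral>\<^sup>+ x\<in>\<Omega>. ennreal ((v x)\<^sup>2) \<partial>lebesgue) = 1 \<and> v z = 0}.
        dirichlet \<Omega> v)"
      unfolding mu0_def by (simp add: ennreal_enn2real_if)
    also have "\<dots> \<le> ennreal (1 / a) * ?B"
      unfolding gw[symmetric] by (rule INF_lower) (use cm(1) lw iw v(3) in simp)
    finally have "ennreal (mu0 \<Omega> z) * ?A \<le> ennreal (1 / a) * ?B * ennreal a" unfolding a(2) by (rule mult_right_mono) simp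
    also have "\<dots> = ?B * (ennreal (1 / a) * ennreal a)" by (simp add: mult_ac)
    also have "ennreal (1 / a) * ennreal a = 1" using a by (simp add: ennreal_mult[symmetric])
    finally show ?thesis by simp
  qed simp
qed

end

section \<open>Energy of the harmonic part and comparison of the two radii\<close>

context torsion
begin

lemma finite_integral_bounded:
  assumes "\<And>x. x \<in> \<Omega> \<Longrightarrow> \<bar>f x\<bar> \<le> B"
  shows "(\<integral>\<^sup>+ x\<in>\<Omega>. ennreal ((f x)\<^sup>2) \<partial>lebesgue) < \<infinity>"
proof -
  have "(\<integral>\<^sup>+ x\<in>\<Omega>. ennreal ((f x)\<^sup>2) \<partial>lebesgue) \<le> (\<integral>\<^sup>+ x. ennreal (B\<^sup>2) * indicator \<Omega> x \<partial>lborel)"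
    unfolding nn_integral_lebesgue_lborel
  proof (rule nn_integral_mono)
    fix x
    have "(f x)\<^sup>2 \<le> B\<^sup>2" if "x \<in> \<Omega>" using power_mono[OF assms[OF that], of 2] by simp
    then show "ennreal ((f x)\<^sup>2) * indicator \<Omega> x \<le> ennreal (B\<^sup>2) * indicator \<Omega> x"
      by (auto simp: indicator_def intro: ennreal_leI)
  qed
  also have "\<dots> = ennreal (B\<^sup>2) * emeasure lborel \<Omega>" using open_dom by (simp add: nn_integral_cmult_indicator)
  also have "\<dots> < \<infinity>" using emeasure_bounded_finite[OF bounded_dom] by (simp add: ennreal_mult_less_top)
  finally show ?thesis .
qed

lemma energy_chain:
  fixes z :: "real^'n"
  assumes N: "CARD('n) \<ge> 2" and H: "\<And>p. p \<in> \<Gamma> \<Longrightarrow> mean_curv \<Omega> p > 0"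
    and z: "z \<in> \<Omega>" "\<And>i. pd u i z = 0"
  defines "h \<equiv> \<lambda>x. (norm (x - z))\<^sup>2 / 2 - u x"
  obtains a0 a1 where "a0 \<ge> 0" "a1 \<ge> 0" "(\<integral>\<^sup>+ x\<in>\<Omega>. ennreal ((h x - h z)\<^sup>2) \<partial>lebesgue) = ennreal a0"
    "dirichlet \<Omega> h = ennreal a1"
    "mu0 \<Omega> z * a0 \<le> a1" "mu0 \<Omega> z * a1 \<le> defect_const TYPE('n) * total_deficit"
proof -
  note hp = harmonic_part[where z=z, folded h_def]
  have es: "ennreal (\<Sum>i\<in>UNIV. f i) * indicator \<Omega> x = (\<Sum>i\<in>UNIV. ennreal (f i) * indicator \<Omega> x)"
    if "\<And>i. f i \<ge> 0" for f :: "'n \<Rightarrow> real" and x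
    using that by (simp only: sum_ennreal[symmetric] sum_distrib_right)
  have pC: "C2_on \<Omega> (pd h i)" "\<And>x. x \<in> \<Omega> \<Longrightarrow> lap (pd h i) x = 0" for i
    using harmonic_pd(1)[OF open_dom hp(1,2)] harmonic_pd(2)[OF open_dom hp(1,2)] by auto
  let ?\<mu> = "mu0 \<Omega> z"
  have mu: "?\<mu> \<ge> 0" by (simp add: mu0_def)
  have c: "C1_on \<Omega> h" "C1_on \<Omega> (pd h i)" for i using C2_on_C1[OF open_dom hp(1)] by auto
  have pz: "pd h i z = 0" for i using hp(3)[OF z(1)] z(2) by simp
  let ?P = "\<lambda>i. \<integral>\<^sup>+ x\<in>\<Omega>. ennreal ((pd h i x)\<^sup>2) \<partial>lebesgue"
  let ?A1 = "\<integral>\<^sup>+ x\<in>\<Omega>. ennreal ((norm (grad h x))\<^sup>2) \<partial>lebesgue"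
  let ?A0 = "\<integral>\<^sup>+ x\<in>\<Omega>. ennreal ((h x - h z)\<^sup>2) \<partial>lebesgue"
  \<comment> \<open>\<open>poincare\<close> asks for finite \<open>L\<^sup>2\<close> norms; the
    derivatives of \<open>h\<close> are bounded because \<open>G\<close> and the domain are.\<close>
  have Pf: "?P i < \<infinity>" for i
  proof (rule finite_integral_bounded)
    fix x assume x: "x \<in> \<Omega>"
    have "\<bar>pd h i x\<bar> \<le> \<bar>(x - z) $ i\<bar> + \<bar>G x $ i\<bar>"
      using hp(3)[OF x, of i] G_grad[OF x] by (simp add: grad_def)
    also have "\<dots> \<le> norm (x - z) + norm (G x)" by (intro add_mono component_le_norm_cart)
    also have "\<dots> \<le> rho_e \<Omega> z + gmax"
      using dom_in_ball[of z] x norm_G_le[of x] closure_subset by (intro add_mono) (auto simp: dist_norm norm_minus_commute)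
    finally show "\<bar>pd h i x\<bar> \<le> rho_e \<Omega> z + gmax" .
  qed
  have A1: "?A1 = (\<Sum>i\<in>UNIV. ?P i)"
  proof -
    have "?A1 = (\<integral>\<^sup>+ x. (\<Sum>i\<in>UNIV. ennreal ((pd h i x)\<^sup>2) * indicator \<Omega> x) \<partial>lborel)"
      unfolding nn_integral_lebesgue_lborel
    proof (rule nn_integral_cong)
      fix x
      show "ennreal ((norm (grad h x))\<^sup>2) * indicator \<Omega> x = (\<Sum>i\<in>UNIV. ennreal ((pd h i x)\<^sup>2) * indicator \<Omega> x)"
        using es[of "\<lambda>i. (pd h i x)\<^sup>2" x] by (simp only: zero_le_power2 norm_grad_power2)
    qed
    also have "\<dots> = (\<Sum>i\<in>UNIV. \<integral>\<^sup>+ x. ennreal ((pd h i x)\<^sup>2) * indicator \<Omega> x \<partial>lborel)"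
      by (rule nn_integral_sum) (intro measurable_on_open[OF open_dom] continuous_intros C1_on_continuous[OF c(2) open_dom])
    finally show ?thesis unfolding nn_integral_lebesgue_lborel .
  qed
  have A2: "(\<integral>\<^sup>+ x\<in>\<Omega>. ennreal (defect x) \<partial>lebesgue) = (\<Sum>i\<in>UNIV. \<integral>\<^sup>+ x\<in>\<Omega>. ennreal ((norm (grad (pd h i) x))\<^sup>2) \<partial>lebesgue)"
  proof -
    have "(\<integral>\<^sup>+ x\<in>\<Omega>. ennreal (defect x) \<partial>lebesgue) = (\<integral>\<^sup>+ x. (\<Sum>i\<in>UNIV. ennreal ((norm (grad (pd h i) x))\<^sup>2) * indicator \<Omega> x) \<partial>lborel)"
      unfolding nn_integral_lebesgue_lborel
    proof (rule nn_integral_cong)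
      fix x
      have "defect x = (\<Sum>i\<in>UNIV. (norm (grad (pd h i) x))\<^sup>2)" if "x \<in> \<Omega>"
        unfolding defect_eq[OF that, of z] h_def norm_grad_power2 ..
      then show "ennreal (defect x) * indicator \<Omega> x = (\<Sum>i\<in>UNIV. ennreal ((norm (grad (pd h i) x))\<^sup>2) * indicator \<Omega> x)"
        using es[of "\<lambda>i. (norm (grad (pd h i) x))\<^sup>2" x] by (cases "x \<in> \<Omega>") (simp_all only: zero_le_power2 indicator_simps mult_zero_right mult_1_right sum.neutral_const not_False_eq_True)
    qed
    also have "\<dots> = (\<Sum>i\<in>UNIV. \<integral>\<^sup>+ x. ennreal ((norm (grad (pd h i) x))\<^sup>2) * indicator \<Omega> x \<partial>lborel)"
      by (rule nn_integral_sum) (intro measurable_on_open[OF open_dom] continuous_intros C1_on_grad_continuous[OF c(2)])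
    finally show ?thesis unfolding nn_integral_lebesgue_lborel .
  qed
  have fA1: "?A1 < \<infinity>" unfolding A1 using Pf by (simp add: less_top)
  have "ennreal ?\<mu> * ?A1 = (\<Sum>i\<in>UNIV. ennreal ?\<mu> * ?P i)" unfolding A1 by (rule sum_distrib_left)
  also have "\<dots> \<le> (\<Sum>i\<in>UNIV. \<integral>\<^sup>+ x\<in>\<Omega>. ennreal ((norm (grad (pd h i) x))\<^sup>2) \<partial>lebesgue)"
    by (intro sum_mono poincare pC pz Pf)
  also have "\<dots> \<le> ennreal (defect_const TYPE('n) * total_deficit)"
    unfolding A2[symmetric] by (rule defect_bound[OF N H])
  finally have 1: "ennreal ?\<mu> * ?A1 \<le> ennreal (defect_const TYPE('n) * total_deficit)" .
  have hc: "continuous_on (closure \<Omega>) (\<lambda>x. h x - h z)" unfolding h_def by (intro continuous_intros cont_u) auto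
  from compact_imp_bounded[OF compact_continuous_image[OF hc compact_clos]]
  obtain B where B: "\<And>x. x \<in> closure \<Omega> \<Longrightarrow> \<bar>h x - h z\<bar> \<le> B" unfolding bounded_iff by auto
  have fA0: "?A0 < \<infinity>" by (rule finite_integral_bounded[of _ B]) (use B closure_subset in blast)
  let ?v = "\<lambda>x. h x + - h z"
  note va = C2_on_shift[OF open_dom hp(1), where c="- h z"]
  have lv: "lap ?v x = 0" if "x \<in> \<Omega>" for x
    using hp(2)[OF that] unfolding lap_def va(3)[OF that] .
  have gv: "grad ?v x = grad h x" if "x \<in> \<Omega>" for x
    unfolding grad_def va(2)[OF that] ..
  have "ennreal ?\<mu> * (\<integral>\<^sup>+ x\<in>\<Omega>. ennreal ((?v x)\<^sup>2) \<partial>lebesgue) \<le> dirichlet \<Omega> ?v"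
    by (rule poincare[OF va(1) lv]) (use fA0 in auto)
  also have "\<dots> = ?A1" using gv by (intro nn_integral_cong) (auto simp: indicator_def)
  finally have 2: "ennreal ?\<mu> * ?A0 \<le> ?A1" by simp
  have e0: "?A0 = ennreal (enn2real ?A0)" and e1: "?A1 = ennreal (enn2real ?A1)"
    using fA0 fA1 by simp_all
  show ?thesis
  proof (rule that[of "enn2real ?A0" "enn2real ?A1"])
    have "ennreal (?\<mu> * enn2real ?A0) = ennreal ?\<mu> * ?A0" by (subst (2) e0, rule ennreal_mult[OF mu enn2real_nonneg])
    with 2 have "ennreal (?\<mu> * enn2real ?A0) \<le> ennreal (enn2real ?A1)" unfolding e1[symmetric] by (simp only:)
    then show "?\<mu> * enn2real ?A0 \<le> enn2real ?A1" by (simp add: ennreal_le_iff)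
    have kn: "0 \<le> defect_const TYPE('n) * total_deficit"
      by (rule mult_nonneg_nonneg[OF less_imp_le[OF defect_const_pos[OF N]] L1_bdry_nonneg])
    have "ennreal (?\<mu> * enn2real ?A1) = ennreal ?\<mu> * ?A1" by (subst (2) e1, rule ennreal_mult[OF mu enn2real_nonneg])
    with 1 have "ennreal (?\<mu> * enn2real ?A1) \<le> ennreal (defect_const TYPE('n) * total_deficit)" by (simp only:)
    then show "?\<mu> * enn2real ?A1 \<le> defect_const TYPE('n) * total_deficit"
      using kn by (simp add: ennreal_le_iff)
  qed (rule enn2real_nonneg e0 e1)+
qed

lemma interior_sphere_radius_le:
  assumes r: "interior_sphere \<Omega> r"
  shows "r > 0" "r \<le> 4 * gmax" "r \<le> rho_e \<Omega> z"
proof -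
  show rp: "r > 0" using r by (simp add: interior_sphere_def)
  obtain p where p: "p \<in> \<Gamma>" using bdry_nonempty by blast
  obtain c where c: "ball c r \<subseteq> \<Omega>" "cball c r \<inter> \<Gamma> = {p}" using r p by (auto simp: interior_sphere_def)
  have "dist c p \<le> r" using c(2) by auto
  then show "r \<le> 4 * gmax" by (rule gmax_ge_radius[OF c(1) rp p])
  have "ball c r \<subseteq> cball z (rho_e \<Omega> z)" using c(1) dom_in_ball by blast
  then have "dist c z + r \<le> rho_e \<Omega> z" using rp by (simp add: ball_subset_cball_iff)
  then show "r \<le> rho_e \<Omega> z" using zero_le_dist[of c z] by linarith
qed

text \<open>The ball of radius \<open>r\<close> touching the boundary at \<open>p\<close> contains
  the ball of radius \<open>\<sigma>\<close> tangent to it there.\<close>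

lemma inner_point:
  assumes r: "interior_sphere \<Omega> r" and p: "p \<in> \<Gamma>" and sg: "0 < \<sigma>" "\<sigma> \<le> r"
  obtains y where "dist y p = \<sigma>" "ball y \<sigma> \<subseteq> \<Omega>"
proof -
  have rp: "r > 0" using r by (simp add: interior_sphere_def)
  obtain c where c: "ball c r \<subseteq> \<Omega>" "cball c r \<inter> \<Gamma> = {p}" using r p by (auto simp: interior_sphere_def)
  have "dist c p \<le> r" using c(2) by auto
  moreover have "p \<notin> ball c r" using c(1) p clos_eq by blast
  ultimately have cp: "dist c p = r" by simp
  define y where "y = p + (\<sigma> / r) *\<^sub>R (c - p)"
  have yp: "dist y p = \<sigma>" using cp rp sg by (simp add: y_def dist_norm)
  have "y - c = (1 - \<sigma> / r) *\<^sub>R (p - c)" by (simp add: y_def algebra_simps)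
  then have "dist y c = (1 - \<sigma> / r) * r" using cp rp sg by (simp add: dist_norm norm_minus_commute)
  then have "dist y c = r - \<sigma>" using rp by (simp add: left_diff_distrib)
  then have "ball y \<sigma> \<subseteq> ball c r" using sg by (simp add: ball_subset_ball_iff)
  then show ?thesis using that yp c(1) by blast
qed

text \<open>\<open>h\<close> is read off at interior points at distance \<open>\<sigma>\<close> from
  the farthest and the nearest boundary point, where \<open>harmonic_L2_bound\<close> applies. This
  costs \<open>\<sigma>\<close> in each radius and \<open>gmax * \<sigma>\<close> in
  \<open>u\<close>. Radii that differ by less than \<open>4 * \<sigma>\<close> are treated
  directly.\<close>

lemma radius_estimate:
  fixes z :: "real^'n"
  assumes r: "interior_sphere \<Omega> r" and z: "z \<in> \<Omega>" and sg: "0 < \<sigma>" "\<sigma> \<le> r / 8"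
  defines "h \<equiv> \<lambda>x. (norm (x - z))\<^sup>2 / 2 - u x"
  assumes a0: "(\<integral>\<^sup>+ x\<in>\<Omega>. ennreal ((h x - h z)\<^sup>2) \<partial>lebesgue) = ennreal a0" "a0 \<ge> 0"
  shows "(rho_e \<Omega> z - rho_i \<Omega> z) * rho_e \<Omega> z \<le> 32 * gmax * \<sigma>
     + 16 * sqrt (a0 / (bump_mass TYPE('n) * (\<sigma> / (2 * real CARD('n))) ^ CARD('n)))"
proof -
  let ?Q = "sqrt (a0 / (bump_mass TYPE('n) * (\<sigma> / (2 * real CARD('n))) ^ CARD('n)))"
  let ?N = "real CARD('n)"
  have N: "?N \<ge> 1" by (simp add: Suc_leI)
  note rr = interior_sphere_radius_le[OF r]
  obtain xe xi where xe: "xe \<in> \<Gamma>" "dist xe z = rho_e \<Omega> z" and xi: "xi \<in> \<Gamma>" "dist xi z = rho_i \<Omega> z"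
    and min: "\<And>x. x \<in> \<Gamma> \<Longrightarrow> rho_i \<Omega> z \<le> dist x z" and max: "\<And>x. x \<in> \<Gamma> \<Longrightarrow> dist x z \<le> rho_e \<Omega> z"
    by (rule rho_attained[of z]) blast
  define re where "re = rho_e \<Omega> z"
  define ri where "ri = rho_i \<Omega> z"
  have ri0: "ri \<ge> 0" using xi(2) by (metis ri_def zero_le_dist)
  have rei: "ri \<le> re" using max[OF xi(1)] xi(2) by (simp add: re_def ri_def)
  have rre: "r \<le> re" unfolding re_def by (rule rr(3))
  note hp = harmonic_part[where z=z, folded h_def]
  let ?v = "\<lambda>x. h x + - h z"
  note va = C2_on_shift[OF open_dom hp(1), where c="- h z"]
  have lv: "lap ?v x = 0" if "x \<in> \<Omega>" for x
    using hp(2)[OF that] unfolding lap_def va(3)[OF that] .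
  have Q: "\<bar>h y - h z\<bar> \<le> ?Q" if y: "ball y \<sigma> \<subseteq> \<Omega>" for y
  proof -
    \<comment> \<open>\<open>N * ?e = \<sigma> / 2\<close>, so that a closed ball fits into the open
      ball of radius \<open>\<sigma>\<close>.\<close>
    let ?e = "\<sigma> / (2 * ?N)"
    have e: "?e > 0" using sg N by simp
    have cb: "cball y (?N * ?e) \<subseteq> \<Omega>"
    proof -
      have "?N * ?e = \<sigma> / 2" using N by simp
      then show ?thesis using y sg by auto
    qed
    have "?e \<le> ?N * ?e" using mult_right_mono[OF N less_imp_le[OF e]] by (simp only: mult_1)
    then have ce: "cball y ?e \<subseteq> \<Omega>" using cb subset_cball by blast
    have "ennreal (bump_mass TYPE('n) * ?e ^ CARD('n) * (?v y)\<^sup>2) \<le> (\<integral>\<^sup>+ x\<in>cball y ?e. ennreal ((?v x)\<^sup>2) \<partial>lebesgue)"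
      by (rule harmonic_L2_bound[OF open_dom va(1) lv e cb])
    also have "\<dots> \<le> (\<integral>\<^sup>+ x\<in>\<Omega>. ennreal ((h x - h z)\<^sup>2) \<partial>lebesgue)"
      using ce by (intro nn_integral_mono) (auto simp: indicator_def)
    finally have "bump_mass TYPE('n) * ?e ^ CARD('n) * (h y - h z)\<^sup>2 \<le> a0"
      unfolding a0(1) using a0(2) by (simp add: ennreal_le_iff)
    moreover have "bump_mass TYPE('n) * ?e ^ CARD('n) > 0" using bump_mass_pos[where 'n='n] e by simp
    ultimately have "(h y - h z)\<^sup>2 \<le> a0 / (bump_mass TYPE('n) * ?e ^ CARD('n))"
      by (simp add: pos_le_divide_eq mult.commute)
    then show ?thesis using real_le_rsqrt[of "\<bar>h y - h z\<bar>"] by simp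
  qed
  have Q0: "?Q \<ge> 0" using a0(2) bump_mass_pos[where 'n='n] sg by simp
  show ?thesis
  proof (cases "re - ri < 4 * \<sigma>")
    \<comment> \<open>Here \<open>re - ri < 4 * \<sigma> \<le> r / 2 \<le> re / 2\<close>, hence
      \<open>re \<le> 2 * ri\<close>; the ball of radius \<open>ri\<close> about \<open>z\<close>
      lies in the domain and reaches the boundary, which bounds \<open>ri\<close> by
      \<open>4 * gmax\<close>.\<close>
    case True
    have "ri > 0" using True sg rre rr(1) by linarith
    have bz: "ball z ri \<subseteq> \<Omega>"
    proof
      fix y assume "y \<in> ball z ri"
      moreover obtain q where "q \<in> \<Gamma>" "dist z q = \<bar>s z\<bar>" using nearest_exists by blast
      then have "ri \<le> \<bar>s z\<bar>" using min[of q] by (simp add: ri_def dist_commute)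
      ultimately show "y \<in> \<Omega>" using sdist_line_in[OF z, of y] by simp
    qed
    have "ri \<le> 4 * gmax"
      by (rule gmax_ge_radius[OF bz \<open>ri > 0\<close> xi(1)]) (use xi(2) in \<open>simp add: ri_def dist_commute\<close>)
    moreover have "re \<le> 2 * ri" using True sg rre rr(1) by linarith
    ultimately have "re \<le> 8 * gmax" by linarith
    then have "(re - ri) * re \<le> (4 * \<sigma>) * (8 * gmax)"
      using True rei ri0 sg by (intro mult_mono) auto
    then have "(re - ri) * re \<le> 32 * gmax * \<sigma>" by (simp add: mult_ac)
    then show ?thesis using Q0 unfolding re_def ri_def by linarith
  next
    case False
    have sr: "\<sigma> \<le> r" using sg rr(1) by linarith
    obtain ye where ye: "dist ye xe = \<sigma>" "ball ye \<sigma> \<subseteq> \<Omega>" by (rule inner_point[OF r xe(1) sg(1) sr])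
    obtain yi where yi: "dist yi xi = \<sigma>" "ball yi \<sigma> \<subseteq> \<Omega>" by (rule inner_point[OF r xi(1) sg(1) sr])
    have yc: "ye \<in> closure \<Omega>" "yi \<in> closure \<Omega>" using ye(2) yi(2) sg(1) closure_subset by (metis centre_in_ball subsetD)+
    have "re \<le> \<sigma> + norm (ye - z)"
      using dist_triangle[of xe z ye] xe(2) ye(1) by (simp add: re_def dist_commute dist_norm)
    then have "(re - \<sigma>)\<^sup>2 \<le> (norm (ye - z))\<^sup>2" using False ri0 sg by (intro power_mono) auto
    then have 1: "(re - \<sigma>)\<^sup>2 / 2 \<le> h ye" using u_nonpos[OF yc(1)] unfolding h_def by simp
    have "norm (yi - z) \<le> ri + \<sigma>"
      using dist_triangle[of yi z xi] xi(2) yi(1) by (simp add: ri_def dist_norm)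
    then have "(norm (yi - z))\<^sup>2 \<le> (ri + \<sigma>)\<^sup>2" by (intro power_mono) auto
    moreover have "\<bar>u yi\<bar> \<le> gmax * \<sigma>"
      using u_bound[OF yc(2)] abs_sdist_le[OF xi(1), of yi] yi(1) gmax_nonneg
      by (metis mult_left_mono order_trans)
    ultimately have 2: "h yi \<le> (ri + \<sigma>)\<^sup>2 / 2 + gmax * \<sigma>" unfolding h_def by simp
    have "h ye - h yi \<le> 2 * ?Q" using Q[OF ye(2)] Q[OF yi(2)] by linarith
    then have "(re - \<sigma>)\<^sup>2 / 2 - (ri + \<sigma>)\<^sup>2 / 2 \<le> 2 * ?Q + gmax * \<sigma>" using 1 2 by linarith
    moreover have "(re - \<sigma>)\<^sup>2 / 2 - (ri + \<sigma>)\<^sup>2 / 2 = (re - ri - 2 * \<sigma>) * (re + ri) / 2"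
      by (simp add: power2_eq_square field_simps)
    \<comment> \<open>As \<open>re - ri \<ge> 4 * \<sigma>\<close>, subtracting
      \<open>2 * \<sigma>\<close> costs at most half of the difference.\<close>
    moreover have "(re - ri) / 2 * re \<le> (re - ri - 2 * \<sigma>) * (re + ri)"
      using False ri0 rei sg by (intro mult_mono) auto
    ultimately have "(re - ri) * re \<le> 8 * ?Q + 4 * (gmax * \<sigma>)" by linarith
    moreover have "gmax * \<sigma> \<ge> 0" using gmax_nonneg sg by simp
    ultimately show ?thesis using Q0 unfolding re_def ri_def by linarith
  qed
qed

end

subsection \<open>The estimate in large dimension\<close>

text \<open>32 and 16 are the coefficients in \<open>radius_estimate\<close>, and the root is what
  its second term leaves at the optimal scale. \<open>\<kappa>\<close> compares \<open>rho_e\<close>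
  with the volume, \<open>k\<close> is the energy constant, and the 4 stems from
  \<open>r \<le> 4 * M\<close>.\<close>

definition rate_const :: "real \<Rightarrow> real \<Rightarrow> real \<Rightarrow> nat \<Rightarrow> real" where
  "rate_const k b \<kappa> n = (32 + 16 * sqrt ((2 * real n) ^ n / b)) * \<kappa> * (4 * k) powr (1 / (real n + 2))"

text \<open>Arranged so that the optimal scale is at most \<open>r / 8\<close>, as
  \<open>radius_estimate\<close> demands: hence the power of 8. The 4 is again that of
  \<open>r \<le> 4 * M\<close>.\<close>

definition smallness_const :: "real \<Rightarrow> nat \<Rightarrow> real" where
  "smallness_const k n = 1 / (4 * k * 8 ^ (n + 2))"

text \<open>The scale \<open>\<sigma>\<close> balances the two terms of the hypothesis \<open>est\<close>; smallness of \<open>D\<close> makes it admissible.\<close>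
lemma optimise_scale:
  fixes M r \<mu> D V \<kappa> k b re \<Delta> a0 a1 :: real and n :: nat
  assumes pos: "k > 0" "b > 0" "\<kappa> \<ge> 0" "n \<ge> 1" "M > 0" "r > 0" "\<mu> \<ge> 0" "D \<ge> 0" "V > 0" "\<Delta> \<ge> 0"
    and rM: "r \<le> 4 * M" and Vk: "V powr (1 / real n) \<le> \<kappa> * re"
    and a: "a0 \<ge> 0" "\<mu> * a0 \<le> a1" "\<mu> * a1 \<le> k * D"
    and small: "D < smallness_const k n * \<mu>\<^sup>2 * M * r powr (real n + 3)"
    and est: "\<And>\<sigma>. 0 < \<sigma> \<Longrightarrow> \<sigma> \<le> r / 8 \<Longrightarrow> \<Delta> * re \<le> 32 * M * \<sigma> + 16 * sqrt (a0 / (b * (\<sigma> / (2 * real n)) ^ n))"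
  shows "\<Delta> \<le> rate_const k b \<kappa> n * M powr ((real n + 1) / (real n + 2))
      / (\<mu> powr (2 / (real n + 2)) * V powr (1 / real n) * r powr (1 / (real n + 2))) * D powr (1 / (real n + 2))"
proof -
  \<comment> \<open>For \<open>\<mu> = 0\<close> the smallness hypothesis would read
    \<open>D < 0\<close>.\<close>
  have mu: "\<mu> > 0" using small pos(7,8) by (cases "\<mu> = 0") auto
  have m2: "\<mu>\<^sup>2 > 0" using mu by simp
  let ?e = "1 / (real n + 2)"
  have e: "?e > 0" by simp
  let ?c = "sqrt ((2 * real n) ^ n / b)"
  have c0: "?c \<ge> 0" using pos by simp
  have Vp: "V powr (1 / real n) > 0" using pos by simp
  have re: "\<Delta> * V powr (1 / real n) \<le> \<kappa> * (\<Delta> * re)"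
    using mult_left_mono[OF Vk pos(10)] by (simp add: mult_ac)
  define A where "A = k * D / \<mu>\<^sup>2"
  have A0: "A \<ge> 0" using pos by (simp add: A_def)
  have "\<mu>\<^sup>2 * a0 \<le> k * D" using mult_left_mono[OF a(2) pos(7)] a(3) by (simp add: power2_eq_square mult.assoc)
  then have a0A: "a0 \<le> A" unfolding A_def using m2 by (simp add: pos_le_divide_eq mult.commute)
  show ?thesis
  \<comment> \<open>For \<open>D = 0\<close> the optimal scale degenerates to 0, which
    \<open>est\<close> does not admit; there \<open>a0 = 0\<close> and \<open>\<sigma>\<close> is
    sent to 0 instead.\<close>
  proof (cases "D = 0")
    case True
    then have "a0 = 0" using a0A a(1) by (simp add: A_def)
    then have est0: "\<Delta> * re \<le> 32 * M * \<sigma>" if "0 < \<sigma>" "\<sigma> \<le> r / 8" for \<sigma> using est[OF that] by simp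
    have "\<Delta> * re \<le> 0"
    proof (rule field_le_epsilon)
      fix d :: real assume d: "0 < d"
      let ?s = "min (r / 8) (d / (32 * M))"
      have "0 < ?s" "?s \<le> r / 8" "?s \<le> d / (32 * M)" using d pos by auto
      from est0[OF this(1,2)] mult_left_mono[OF this(3), of "32 * M"] pos
      show "\<Delta> * re \<le> 0 + d" by (simp add: mult.assoc)
    qed
    then have "\<kappa> * (\<Delta> * re) \<le> 0" using pos(3) by (simp add: mult_nonneg_nonpos)
    then have "\<Delta> * V powr (1 / real n) \<le> 0" using re by linarith
    then have "\<Delta> \<le> 0" using Vp by (simp add: mult_le_0_iff)
    then show ?thesis using True by simp
  next
    case False
    then have Dp: "D > 0" using pos by simp
    have Ap: "A > 0" using Dp pos m2 by (simp add: A_def)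
    \<comment> \<open>The solution of \<open>M * \<sigma> = sqrt (A / \<sigma> ^ n)\<close>, where
      both error terms have the same order.\<close>
    define \<sigma> where "\<sigma> = (A / M\<^sup>2) powr ?e"
    have sp: "\<sigma> > 0" using Ap pos by (simp add: \<sigma>_def)
    have "\<sigma> powr (real (n + 2)) = (A / M\<^sup>2) powr 1" unfolding \<sigma>_def powr_powr by (simp add: add.commute)
    then have sn: "\<sigma> ^ (n + 2) = A / M\<^sup>2" unfolding powr_realpow[OF sp] using Ap pos by (simp only: powr_one divide_nonneg_nonneg less_imp_le zero_le_power2)
    have sr: "\<sigma> \<le> r / 8"
    proof -
      have rn: "r powr (real n + 3) = r * r ^ (n + 2)"
      proof -
        have "real n + 3 = real (n + 3)" by simp
        then have "r powr (real n + 3) = r ^ (n + 3)" using powr_realpow[OF pos(6)] by (simp only:)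
        also have "\<dots> = r * r ^ (n + 2)" by (simp add: power_add power3_eq_cube power2_eq_square mult_ac)
        finally show ?thesis .
      qed
      have "A \<le> k * (smallness_const k n * \<mu>\<^sup>2 * M * r powr (real n + 3)) / \<mu>\<^sup>2"
        unfolding A_def using small pos(1) by (intro divide_right_mono mult_left_mono) auto
      also have "\<dots> = (M / 4) * (r * (r / 8) ^ (n + 2))"
      proof -
        have "k * (1 / (4 * k * P) * m * M * (r * R)) / m = (M / 4) * (r * (R / P))" if "P > 0" "m > 0" for P R m :: real
          using that pos(1) by (simp add: field_simps)
        from this[of "8 ^ (n + 2)" "\<mu>\<^sup>2" "r ^ (n + 2)"] show ?thesis
          unfolding smallness_const_def rn power_divide using m2 by simp
      qed
      also have "\<dots> \<le> (M / 4) * (4 * M * (r / 8) ^ (n + 2))"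
        using rM pos by (intro mult_left_mono mult_right_mono) auto
      also have "\<dots> = M\<^sup>2 * (r / 8) ^ (n + 2)" by (simp add: power2_eq_square)
      finally have "A / M\<^sup>2 \<le> (r / 8) ^ (n + 2)" using pos by (simp add: divide_le_eq mult.commute)
      then have "\<sigma> ^ (n + 2) \<le> (r / 8) ^ (n + 2)" unfolding sn .
      then have "\<sigma> ^ Suc (n + 1) \<le> (r / 8) ^ Suc (n + 1)" by (simp only: add_Suc_right[symmetric] Suc_1)
      then show ?thesis by (rule power_le_imp_le_base) (use pos in simp)
    qed
    have q: "sqrt (a0 / (b * (\<sigma> / (2 * real n)) ^ n)) \<le> ?c * (M * \<sigma>)"
    proof -
      have "a0 / (b * (\<sigma> / (2 * real n)) ^ n) \<le> A / (b * (\<sigma> / (2 * real n)) ^ n)"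
        using a0A pos sp by (intro divide_right_mono) auto
      also have "A = \<sigma> ^ n * (M * \<sigma>)\<^sup>2" using sn pos by (simp add: power_add power_mult_distrib power2_eq_square field_simps)
      also have "\<sigma> ^ n * (M * \<sigma>)\<^sup>2 / (b * (\<sigma> / (2 * real n)) ^ n) = ((2 * real n) ^ n / b) * (M * \<sigma>)\<^sup>2"
      proof -
        have "S * Y / (b * (S / P)) = (P / b) * Y" if "S > 0" for S Y P :: real using that by simp
        from this[of "\<sigma> ^ n" "(M * \<sigma>)\<^sup>2" "(2 * real n) ^ n"] show ?thesis
          unfolding power_divide using sp by simp
      qed
      finally have "sqrt (a0 / (b * (\<sigma> / (2 * real n)) ^ n)) \<le> sqrt (((2 * real n) ^ n / b) * (M * \<sigma>)\<^sup>2)" by simp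
      also have "\<dots> = ?c * (M * \<sigma>)" using sp pos by (simp only: real_sqrt_mult real_sqrt_abs) simp
      finally show ?thesis .
    qed
    have "\<Delta> * re \<le> (32 + 16 * ?c) * (M * \<sigma>)" using est[OF sp sr] q by (simp add: distrib_right)
    then have "\<kappa> * (\<Delta> * re) \<le> \<kappa> * ((32 + 16 * ?c) * (M * \<sigma>))" using pos(3) by (rule mult_left_mono)
    then have d1: "\<Delta> \<le> (32 + 16 * ?c) * \<kappa> * (M * \<sigma>) / V powr (1 / real n)"
      using re Vp by (simp add: pos_le_divide_eq mult_ac)
    have "\<sigma> = k powr ?e * D powr ?e / (\<mu> powr (2 * ?e) * M powr (2 * ?e))"
    proof -
      have "x\<^sup>2 powr ?e = x powr (2 * ?e)" if "x > 0" for x :: real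
        using powr_powr[of x 2 ?e] that by (simp add: powr_numeral)
      then show ?thesis unfolding \<sigma>_def A_def using mu pos Dp by (simp add: powr_divide powr_mult)
    qed
    moreover have "M = M powr ((real n + 1) * ?e) * M powr ?e"
    proof -
      have "(real n + 1) * ?e + ?e = 1" by (simp add: divide_simps)
      then show ?thesis using pos(5) by (simp add: powr_add[symmetric])
    qed
    moreover have "M powr (2 * ?e) = M powr ?e * M powr ?e" using pos(5) by (simp add: powr_add[symmetric])
    ultimately have "M * \<sigma> = M powr ((real n + 1) * ?e) * (k powr ?e * D powr ?e / (\<mu> powr (2 * ?e) * M powr ?e))"
    proof -
      assume 1: "\<sigma> = k powr ?e * D powr ?e / (\<mu> powr (2 * ?e) * M powr (2 * ?e))"
        and 2: "M = M powr ((real n + 1) * ?e) * M powr ?e" and 3: "M powr (2 * ?e) = M powr ?e * M powr ?e"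
      have "P * E * (X / (Y * (E * E))) = P * (X / (Y * E))" if "E \<noteq> 0" for P E X Y :: real using that by simp
      from this[of "M powr ?e" "M powr ((real n + 1) * ?e)" "k powr ?e * D powr ?e" "\<mu> powr (2 * ?e)"] pos(5)
      show ?thesis unfolding 2[symmetric] 3[symmetric] 1[symmetric] by simp
    qed
    \<comment> \<open>One factor \<open>M powr ?e\<close> of the denominator is weakened to
      \<open>(r / 4) powr ?e\<close>; this yields the power of \<open>r\<close> in the
      claim.\<close>
    also have "\<dots> \<le> M powr ((real n + 1) * ?e) * (k powr ?e * D powr ?e / (\<mu> powr (2 * ?e) * (r / 4) powr ?e))"
    proof (intro mult_left_mono divide_left_mono)
      show "(r / 4) powr ?e \<le> M powr ?e" using rM pos e by (intro powr_mono2) auto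
    qed (use pos mu in auto)
    also have "\<dots> = (4 * k) powr ?e * (M powr ((real n + 1) * ?e) / (\<mu> powr (2 * ?e) * r powr ?e) * D powr ?e)"
      using pos mu by (simp add: powr_divide powr_mult)
    finally have Ms: "M * \<sigma> \<le> (4 * k) powr ?e * (M powr ((real n + 1) * ?e) / (\<mu> powr (2 * ?e) * r powr ?e) * D powr ?e)" .
    have "(32 + 16 * ?c) * \<kappa> * (M * \<sigma>) / V powr (1 / real n)
       \<le> (32 + 16 * ?c) * \<kappa> * ((4 * k) powr ?e * (M powr ((real n + 1) * ?e) / (\<mu> powr (2 * ?e) * r powr ?e) * D powr ?e)) / V powr (1 / real n)"
      using Ms c0 pos by (intro divide_right_mono mult_left_mono) auto
    with d1 show ?thesis unfolding rate_const_def by (simp add: mult_ac)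
  qed
qed

context torsion
begin

lemma large_dim_bound:
  fixes z :: "real^'n"
  assumes N: "CARD('n) \<ge> 2" and H: "\<And>p. p \<in> \<Gamma> \<Longrightarrow> mean_curv \<Omega> p > 0"
    and r: "interior_sphere \<Omega> r" and z: "z \<in> \<Omega>" "\<And>i. pd u i z = 0"
    and small: "total_deficit < smallness_const (defect_const TYPE('n)) CARD('n) * (mu0 \<Omega> z)\<^sup>2 * gmax * r powr (real CARD('n) + 3)"
  shows "rho_e \<Omega> z - rho_i \<Omega> z \<le> rate_const (defect_const TYPE('n)) (bump_mass TYPE('n)) (unit_ball_vol (real CARD('n)) powr (1 / real CARD('n))) CARD('n)
      * gmax powr ((real CARD('n) + 1) / (real CARD('n) + 2))
      / (mu0 \<Omega> z powr (2 / (real CARD('n) + 2)) * measure lebesgue \<Omega> powr (1 / real CARD('n)) * r powr (1 / (real CARD('n) + 2)))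
      * total_deficit powr (1 / (real CARD('n) + 2))"
proof -
  note rr = interior_sphere_radius_le[OF r]
  obtain a0 a1 where a: "a0 \<ge> 0" "a1 \<ge> 0"
    "(\<integral>\<^sup>+ x\<in>\<Omega>. ennreal ((((norm (x - z))\<^sup>2 / 2 - u x) - ((norm (z - z))\<^sup>2 / 2 - u z))\<^sup>2) \<partial>lebesgue) = ennreal a0"
    "mu0 \<Omega> z * a0 \<le> a1" "mu0 \<Omega> z * a1 \<le> defect_const TYPE('n) * total_deficit"
    by (rule energy_chain[OF N H z]) blast+
  obtain xe xi where x: "xe \<in> \<Gamma>" "dist xe z = rho_e \<Omega> z" "dist xi z = rho_i \<Omega> z" "\<And>x. x \<in> \<Gamma> \<Longrightarrow> rho_i \<Omega> z \<le> dist x z"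
    by (rule rho_attained[of z]) blast
  have D0: "total_deficit \<ge> 0" by (rule L1_bdry_nonneg)
  have mu: "mu0 \<Omega> z \<ge> 0" by (simp add: mu0_def)
  have k: "defect_const TYPE('n) > 0" by (rule defect_const_pos[OF N])
  show ?thesis
  proof (rule optimise_scale[where re="rho_e \<Omega> z"])
    fix \<sigma> assume "0 < \<sigma>" "\<sigma> \<le> r / 8"
    from radius_estimate[OF r z(1) this a(3,1)]
    show "(rho_e \<Omega> z - rho_i \<Omega> z) * rho_e \<Omega> z \<le> 32 * gmax * \<sigma> + 16 * sqrt (a0 / (bump_mass TYPE('n) * (\<sigma> / (2 * real CARD('n))) ^ CARD('n)))" .
  next
    show "rho_e \<Omega> z - rho_i \<Omega> z \<ge> 0" using x(4)[OF x(1)] x(2) by simp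
    show "gmax > 0" using rr by linarith
    show "measure lebesgue \<Omega> powr (1 / real CARD('n)) \<le> unit_ball_vol (real CARD('n)) powr (1 / real CARD('n)) * rho_e \<Omega> z"
      "measure lebesgue \<Omega> > 0"
      using volume_le by auto
    show "1 \<le> CARD('n)" using N by simp
  qed (use k bump_mass_pos[where 'n='n] rr mu D0 a small in simp_all)
qed

end

subsection \<open>Positivity of the Poincare constant\<close>

text \<open>\<open>a\<close> bounds the square root of the Dirichlet integral, so that the estimates
  below are linear in \<open>a\<close> with constants independent of \<open>v\<close>.\<close>

definition harm_energy :: "(real^'n) set \<Rightarrow> (real^'n \<Rightarrow> real) \<Rightarrow> real \<Rightarrow> bool" where
  "harm_energy U v a \<longleftrightarrow> C2_on U v \<and> (\<forall>x\<in>U. lap v x = 0) \<and> a \<ge> 0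
     \<and> dirichlet U v \<le> ennreal (a\<^sup>2)"

lemma harmonic_grad_bound:
  fixes v :: "real^'n \<Rightarrow> real"
  assumes U: "open U" and v: "harm_energy U v a" and e: "e > 0" and ball: "cball x (real CARD('n) * e) \<subseteq> U"
  shows "norm (grad v x) \<le> sqrt (real CARD('n) / (bump_mass TYPE('n) * e ^ CARD('n))) * a"
proof -
  let ?b = "bump_mass TYPE('n) * e ^ CARD('n)"
  have b: "?b > 0" using bump_mass_pos[where 'n='n] e by simp
  have C: "C2_on U v" and l: "\<And>x. x \<in> U \<Longrightarrow> lap v x = 0" and a: "a \<ge> 0"
    and E: "dirichlet U v \<le> ennreal (a\<^sup>2)"
    using v by (auto simp: harm_energy_def)
  have "e \<le> real CARD('n) * e" using e by (simp add: mult_le_cancel_right1 Suc_leI)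
  then have ce: "cball x e \<subseteq> U" using ball subset_cball by blast
  have p: "(pd v i x)\<^sup>2 \<le> a\<^sup>2 / ?b" for i
  proof -
    have "ennreal (?b * (pd v i x)\<^sup>2) \<le> (\<integral>\<^sup>+ y\<in>cball x e. ennreal ((pd v i y)\<^sup>2) \<partial>lebesgue)"
      by (rule harmonic_L2_bound[OF U harmonic_pd(1)[OF U C l] harmonic_pd(2)[OF U C l] e ball])
    also have "\<dots> \<le> dirichlet U v"
    proof (rule nn_integral_mono)
      fix y
      have "(pd v i y)\<^sup>2 \<le> (norm (grad v y))\<^sup>2"
        using component_le_norm_cart[of "grad v y" i] by (simp add: grad_def abs_le_square_iff[symmetric])
      then show "ennreal ((pd v i y)\<^sup>2) * indicator (cball x e) y \<le> ennreal ((norm (grad v y))\<^sup>2) * indicator U y"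
        using ce by (auto simp: indicator_def intro: ennreal_leI)
    qed
    also have "\<dots> \<le> ennreal (a\<^sup>2)" by (rule E)
    finally have "?b * (pd v i x)\<^sup>2 \<le> a\<^sup>2" by (simp add: ennreal_le_iff)
    then show ?thesis using b by (simp add: pos_le_divide_eq mult.commute)
  qed
  have "(norm (grad v x))\<^sup>2 = (\<Sum>i\<in>UNIV. (pd v i x)\<^sup>2)" by (rule norm_grad_power2)
  also have "\<dots> \<le> (\<Sum>i\<in>(UNIV::'n set). a\<^sup>2 / ?b)" by (intro sum_mono p)
  also have "\<dots> = (real CARD('n) / ?b) * a\<^sup>2" by simp
  finally have "norm (grad v x) \<le> sqrt ((real CARD('n) / ?b) * a\<^sup>2)" by (rule real_le_rsqrt)
  also have "\<dots> = sqrt (real CARD('n) / ?b) * a" using a by (simp only: real_sqrt_mult real_sqrt_abs abs_of_nonneg)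
  finally show ?thesis .
qed

lemma harmonic_osc_local:
  fixes U :: "(real^'n) set"
  assumes U: "open U" and y: "y \<in> U"
  obtains \<rho> L where "\<rho> > 0" "L \<ge> 0" "ball y \<rho> \<subseteq> U"
    "\<And>v a x. harm_energy U v a \<Longrightarrow> x \<in> ball y \<rho> \<Longrightarrow> \<bar>v x - v y\<bar> \<le> L * a"
proof -
  obtain R where R: "R > 0" "cball y R \<subseteq> U" using U y open_contains_cball by blast
  let ?N = "real CARD('n)"
  have N: "?N > 0" by simp
  let ?e = "R / (2 * ?N)"
  let ?L = "sqrt (?N / (bump_mass TYPE('n) * ?e ^ CARD('n)))"
  have L: "?L \<ge> 0" using bump_mass_pos[where 'n='n] R by simp
  show ?thesis
  proof (rule that[of "R / 2" "?L * (R / 2)"])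
    show b: "ball y (R / 2) \<subseteq> U" using R by auto
    fix v a x assume v: "harm_energy U v a" and x: "x \<in> ball y (R / 2)"
    have a: "a \<ge> 0" and C: "C2_on U v" using v by (auto simp: harm_energy_def)
    have "norm (v x - v y) \<le> (?L * a) * norm (x - y)"
    proof (rule differentiable_bound[of "ball y (R / 2)" v "\<lambda>x h. grad v x \<bullet> h"])
      fix w assume w: "w \<in> ball y (R / 2)"
      show "(v has_derivative (\<lambda>h. grad v w \<bullet> h)) (at w within ball y (R / 2))"
        using C1_on_GDERIV[OF C2_on_C1(1)[OF U C] U subsetD[OF b w]]
        unfolding GDERIV_has_derivative by (rule has_derivative_at_withinI)
      have "cball w (?N * ?e) \<subseteq> cball y R"
      proof
        fix q assume "q \<in> cball w (?N * ?e)"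
        then have "dist w q \<le> R / 2" by simp
        then show "q \<in> cball y R" using w dist_triangle[of y q w] by simp
      qed
      then have g: "norm (grad v w) \<le> ?L * a" using harmonic_grad_bound[OF U v, of ?e w] R N by auto
      show "onorm (\<lambda>h. grad v w \<bullet> h) \<le> ?L * a"
      proof (rule onorm_le)
        fix h show "norm (grad v w \<bullet> h) \<le> ?L * a * norm h"
          using Cauchy_Schwarz_ineq2[of "grad v w" h] mult_right_mono[OF g norm_ge_zero[of h]] by simp
      qed
    qed (use x R in auto)
    also have "\<dots> \<le> (?L * a) * (R / 2)"
      using x L a by (intro mult_left_mono) (auto simp: dist_norm norm_minus_commute)
    finally show "\<bar>v x - v y\<bar> \<le> ?L * (R / 2) * a" by (simp add: mult_ac)
  qed (use R L in auto)
qed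

text \<open>The energy controls only oscillations. The bound on values is carried from
  \<open>z\<close>, where \<open>v\<close> vanishes, through overlapping balls; connectedness takes
  the place of an explicit chain.\<close>

lemma harmonic_bound_point:
  fixes U :: "(real^'n) set"
  assumes U: "open U" "connected U" and z: "z \<in> U" and y: "y \<in> U"
  shows "\<exists>C\<ge>0. \<forall>v a. harm_energy U v a \<longrightarrow> v z = 0 \<longrightarrow> \<bar>v y\<bar> \<le> C * a"
proof -
  define P where "P y \<longleftrightarrow> (\<exists>C\<ge>0. \<forall>v a. harm_energy U v a \<longrightarrow> v z = 0 \<longrightarrow> \<bar>v y\<bar> \<le> C * a)" for y
  have "P y"
  proof (rule connected_induction_simple[OF U(2) z y])
    show "P z" unfolding P_def by (rule exI[of _ 0]) simp
  next
    fix p assume p: "p \<in> U"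
    obtain \<rho> L where r: "\<rho> > 0" "L \<ge> 0" "ball p \<rho> \<subseteq> U"
      and L: "\<And>v a x. harm_energy U v a \<Longrightarrow> x \<in> ball p \<rho> \<Longrightarrow> \<bar>v x - v p\<bar> \<le> L * a"
      by (rule harmonic_osc_local[OF U(1) p]) blast
    have step: "P w" if q: "q \<in> ball p \<rho>" and w: "w \<in> ball p \<rho>" and Pq: "P q" for q w
    proof -
      from Pq obtain C where C: "C \<ge> 0" "\<And>v a. harm_energy U v a \<Longrightarrow> v z = 0 \<Longrightarrow> \<bar>v q\<bar> \<le> C * a"
        unfolding P_def by blast
      \<comment> \<open>Both \<open>q\<close> and \<open>w\<close> are compared with the centre
        \<open>p\<close>, which costs \<open>L * a\<close> twice.\<close>
      have "\<bar>v w\<bar> \<le> (C + 2 * L) * a" if "harm_energy U v a" "v z = 0" for v a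
        using C(2)[OF that] L[OF that(1) q] L[OF that(1) w] unfolding distrib_right by linarith
      then show ?thesis unfolding P_def using C(1) r(2) by (intro exI[of _ "C + 2 * L"] conjI allI impI) simp_all
    qed
    have "openin (top_of_set U) (ball p \<rho>)" using r(3) U(1) by (simp add: openin_open_eq)
    moreover have "p \<in> ball p \<rho>" using r(1) by simp
    ultimately show "\<exists>T. openin (top_of_set U) T \<and> p \<in> T \<and> (\<forall>x\<in>T. \<forall>y\<in>T. P x \<longrightarrow> P y)"
      using step by (intro exI[of _ "ball p \<rho>"] conjI ballI impI)
  qed
  then show ?thesis unfolding P_def .
qed

lemma harmonic_bound_compact:
  fixes U :: "(real^'n) set"
  assumes U: "open U" "connected U" and z: "z \<in> U" and K: "compact K" "K \<subseteq> U"
  obtains C where "C \<ge> 0" "\<And>v a y. harm_energy U v a \<Longrightarrow> v z = 0 \<Longrightarrow> y \<in> K \<Longrightarrow> \<bar>v y\<bar> \<le> C * a"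
proof -
  have "\<exists>\<rho> C. \<rho> > 0 \<and> C \<ge> 0 \<and> (\<forall>v a x. harm_energy U v a \<longrightarrow> v z = 0 \<longrightarrow> x \<in> ball y \<rho> \<longrightarrow> \<bar>v x\<bar> \<le> C * a)"
    if y: "y \<in> K" for y
  proof -
    have yU: "y \<in> U" using y K by blast
    obtain \<rho> L where r: "\<rho> > 0" "L \<ge> 0"
      and L: "\<And>v a x. harm_energy U v a \<Longrightarrow> x \<in> ball y \<rho> \<Longrightarrow> \<bar>v x - v y\<bar> \<le> L * a"
      by (rule harmonic_osc_local[OF U(1) yU]) blast
    obtain C where C: "C \<ge> 0" "\<And>v a. harm_energy U v a \<Longrightarrow> v z = 0 \<Longrightarrow> \<bar>v y\<bar> \<le> C * a"
      using harmonic_bound_point[OF U z yU] by blast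
    have "\<bar>v x\<bar> \<le> (C + L) * a" if "harm_energy U v a" "v z = 0" "x \<in> ball y \<rho>" for v a x
      using C(2)[OF that(1,2)] L[OF that(1,3)] unfolding distrib_right by linarith
    then show ?thesis using add_nonneg_nonneg[OF C(1) r(2)] r(1) by (intro exI[of _ \<rho>] exI[of _ "C + L"] conjI allI impI)
  qed
  then obtain \<rho> C where rC: "\<And>y. y \<in> K \<Longrightarrow> \<rho> y > 0" "\<And>y. y \<in> K \<Longrightarrow> C y \<ge> 0"
    "\<And>y v a x. y \<in> K \<Longrightarrow> harm_energy U v a \<Longrightarrow> v z = 0 \<Longrightarrow> x \<in> ball y (\<rho> y) \<Longrightarrow> \<bar>v x\<bar> \<le> C y * a"
    by metis
  have "K \<subseteq> (\<Union>y\<in>K. ball y (\<rho> y))" using rC(1) by force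
  then obtain F where F: "F \<subseteq> K" "finite F" "K \<subseteq> (\<Union>y\<in>F. ball y (\<rho> y))"
    by (rule compactE_image[OF K(1), rotated 1]) auto
  show ?thesis
  proof (rule that[of "\<Sum>y\<in>F. C y"])
    show "0 \<le> (\<Sum>y\<in>F. C y)" using F rC(2) by (intro sum_nonneg) auto
    fix v a y assume v: "harm_energy U v a" "v z = 0" and y: "y \<in> K"
    have a: "a \<ge> 0" using v by (auto simp: harm_energy_def)
    obtain w where w: "w \<in> F" "y \<in> ball w (\<rho> w)" using F(3) y by blast
    have "\<bar>v y\<bar> \<le> C w * a" using rC(3)[OF _ v w(2)] w(1) F(1) by blast
    also have "C w \<le> (\<Sum>y\<in>F. C y)" using w(1) F rC(2) by (intro member_le_sum) auto
    finally show "\<bar>v y\<bar> \<le> (\<Sum>y\<in>F. C y) * a" using a by (simp add: mult_right_mono)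
  qed
qed

text \<open>Cauchy-Schwarz in the form that the integral of \<open>(\<phi>' - m)\<^sup>2\<close> is
  nonnegative, \<open>m\<close> being the mean slope; it bounds
  \<open>(\<phi> T - \<phi> 0)\<^sup>2\<close> by \<open>T\<close> times the energy.\<close>

lemma square_le_endpoint_energy:
  fixes \<phi> \<phi>' :: "real \<Rightarrow> real"
  assumes T: "T > 0" and d: "\<And>t. t \<in> {0..T} \<Longrightarrow> DERIV \<phi> t :> \<phi>' t" and c: "continuous_on {0..T} \<phi>'"
  shows "(\<phi> 0)\<^sup>2 \<le> 2 * (\<phi> T)\<^sup>2 + 2 * T * integral {0..T} (\<lambda>t. (\<phi>' t)\<^sup>2)"
proof -
  have f: "(\<phi>' has_integral (\<phi> T - \<phi> 0)) {0..T}"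
    using T d by (intro fundamental_theorem_of_calculus)
      (auto simp: has_real_derivative_iff_has_vector_derivative[symmetric] intro: has_field_derivative_at_within)
  define m where "m = (\<phi> T - \<phi> 0) / T"
  have mT: "m * T = \<phi> T - \<phi> 0" using T by (simp add: m_def)
  have q: "((\<lambda>t. (\<phi>' t)\<^sup>2) has_integral integral {0..T} (\<lambda>t. (\<phi>' t)\<^sup>2)) {0..T}"
    by (intro integrable_integral integrable_continuous_real continuous_intros c)
  have k: "((\<lambda>t. m\<^sup>2) has_integral m\<^sup>2 * T) {0..T}" using has_integral_const_real[of "m\<^sup>2" 0 T] T by (simp add: mult.commute)
  have "((\<lambda>t. (\<phi>' t)\<^sup>2 - (2 * m) * \<phi>' t + m\<^sup>2) has_integral
      integral {0..T} (\<lambda>t. (\<phi>' t)\<^sup>2) - (2 * m) * (\<phi> T - \<phi> 0) + m\<^sup>2 * T) {0..T}"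
    by (intro has_integral_add has_integral_diff q k has_integral_mult_right f)
  moreover have "(\<phi>' t)\<^sup>2 - (2 * m) * \<phi>' t + m\<^sup>2 = (\<phi>' t - m)\<^sup>2" for t by (simp add: power2_eq_square algebra_simps)
  ultimately have "0 \<le> integral {0..T} (\<lambda>t. (\<phi>' t)\<^sup>2) - (2 * m) * (\<phi> T - \<phi> 0) + m\<^sup>2 * T"
    by (auto intro: has_integral_nonneg)
  then have "m\<^sup>2 * T \<le> integral {0..T} (\<lambda>t. (\<phi>' t)\<^sup>2)" unfolding mT[symmetric] by (simp add: power2_eq_square mult_ac)
  then have "T * (m\<^sup>2 * T) \<le> T * integral {0..T} (\<lambda>t. (\<phi>' t)\<^sup>2)" using T by (intro mult_left_mono) auto
  then have "(\<phi> T - \<phi> 0)\<^sup>2 \<le> T * integral {0..T} (\<lambda>t. (\<phi>' t)\<^sup>2)" unfolding mT[symmetric] by (simp add: power2_eq_square mult_ac)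
  moreover have "(\<phi> 0)\<^sup>2 \<le> 2 * (\<phi> T)\<^sup>2 + 2 * (\<phi> T - \<phi> 0)\<^sup>2"
  proof -
    have "0 \<le> (2 * \<phi> T - \<phi> 0)\<^sup>2" by simp
    then show ?thesis by (simp add: power2_eq_square algebra_simps)
  qed
  ultimately show ?thesis by linarith
qed

lemma nn_integral_translate:
  fixes q :: "real^'n \<Rightarrow> ennreal"
  assumes [measurable]: "q \<in> borel_measurable borel"
  shows "(\<integral>\<^sup>+ x. q (x - c) \<partial>lborel) = (\<integral>\<^sup>+ x. q x \<partial>lborel)"
proof -
  have "(\<integral>\<^sup>+ x. q x \<partial>lborel) = (\<integral>\<^sup>+ x. q x \<partial>distr lborel borel ((+) (- c)))" by (simp only: lborel_distr_plus)
  also have "\<dots> = (\<integral>\<^sup>+ x. q (- c + x) \<partial>lborel)" by (rule nn_integral_distr) auto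
  finally show ?thesis by simp
qed

section \<open>A Poincare inequality for harmonic functions that vanish at a point\<close>

context C2_domain
begin

text \<open>Along \<open>- e\<close>, with \<open>e\<close> the gradient of the chart function at
  \<open>p\<close>, that function decreases at rate at least \<open>e \<bullet> e / 2\<close> near
  \<open>p\<close>. After time \<open>T\<close> it is at most
  \<open>- T * (e \<bullet> e / 2)\<close>, and this sublevel set is compact in the domain.\<close>

lemma inward_shift:
  assumes p: "p \<in> \<Gamma>"
  obtains \<rho> T e K where "\<rho> > 0" "T > 0" "compact K" "K \<subseteq> \<Omega>"
    "\<And>x t. x \<in> \<Omega> \<inter> ball p \<rho> \<Longrightarrow> 0 \<le> t \<Longrightarrow> t \<le> T \<Longrightarrow> x - t *\<^sub>R e \<in> \<Omega>"
    "\<And>x. x \<in> \<Omega> \<inter> ball p \<rho> \<Longrightarrow> x - T *\<^sub>R e \<in> K"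
proof -
  obtain r \<psi> where r: "r > 0" and C: "C2_on (ball p r) \<psi>" and nz: "\<And>x. x \<in> ball p r \<Longrightarrow> grad \<psi> x \<noteq> 0"
    and dom: "\<Omega> \<inter> ball p r = {x \<in> ball p r. \<psi> x < 0}" using chart[OF p] by blast
  define e where "e = grad \<psi> p"
  have e: "norm e > 0" using nz[of p] r by (simp add: e_def)
  note C1 = C2_on_C1(1)[OF open_ball C]
  have "continuous_on (ball p r) (\<lambda>x. grad \<psi> x \<bullet> e)" by (intro continuous_intros C1_on_grad_continuous[OF C1])
  then have "isCont (\<lambda>x. grad \<psi> x \<bullet> e) p" using r by (simp add: continuous_on_eq_continuous_at)
  then have "\<forall>\<^sub>F x in at p. grad \<psi> x \<bullet> e > e \<bullet> e / 2"
    unfolding isCont_def using e by (intro order_tendstoD(1)[where y="e \<bullet> e"]) (auto simp: e_def)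
  then obtain r0 where r0: "r0 > 0" "\<And>x. x \<noteq> p \<Longrightarrow> dist x p < r0 \<Longrightarrow> grad \<psi> x \<bullet> e > e \<bullet> e / 2"
    unfolding eventually_at by blast
  \<comment> \<open>A third, so that a point of \<open>ball p r1\<close> moved by at most
    \<open>r1\<close> stays in \<open>cball p (2 * r1)\<close>, within the chart and the region of
    the slope bound.\<close>
  define r1 where "r1 = min r r0 / 3"
  have r1: "r1 > 0" "3 * r1 \<le> r" "3 * r1 \<le> r0" using r r0(1) by (auto simp: r1_def)
  have g: "grad \<psi> x \<bullet> e \<ge> e \<bullet> e / 2" if "x \<in> cball p (2 * r1)" for x
  proof (cases "x = p")
    case True then show ?thesis by (simp add: e_def)
  next
    case False
    then show ?thesis using r0(2)[of x] that r1 by (auto simp: dist_commute)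
  qed
  have cb: "cball p (2 * r1) \<subseteq> ball p r" using r1 by auto
  define T where "T = r1 / norm e"
  have T: "T > 0" using r1 e by (simp add: T_def)
  define K where "K = cball p (2 * r1) \<inter> \<psi> -` {..- (T * (e \<bullet> e / 2))}"
  have mem: "x - t *\<^sub>R e \<in> cball p (2 * r1)" if "x \<in> ball p r1" "0 \<le> t" "t \<le> T" for x t
  proof -
    have "t * norm e \<le> r1" using that(3) e by (simp add: T_def pos_le_divide_eq)
    then have "dist x (x - t *\<^sub>R e) \<le> r1" using that(2) by (simp add: dist_norm)
    then show ?thesis using that(1) dist_triangle[of p "x - t *\<^sub>R e" x] by simp
  qed
  have low: "\<psi> (x - t *\<^sub>R e) \<le> \<psi> x - t * (e \<bullet> e / 2)" if x: "x \<in> ball p r1" and t: "0 \<le> t" "t \<le> T" for x t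
  proof -
    have "\<psi> (x - t *\<^sub>R e) + t * (e \<bullet> e / 2) \<le> \<psi> (x - 0 *\<^sub>R e) + 0 * (e \<bullet> e / 2)"
    proof (rule DERIV_nonpos_imp_nonincreasing[OF t(1)])
      fix q assume q: "0 \<le> q" "q \<le> t"
      then have m: "x - q *\<^sub>R e \<in> cball p (2 * r1)" using mem[OF x] t by simp
      have "DERIV (\<lambda>q. \<psi> (x - q *\<^sub>R e)) q :> - (grad \<psi> (x - q *\<^sub>R e) \<bullet> e)"
        by (rule C1_on_DERIV_line[OF C1 open_ball subsetD[OF cb m]])
      then have "DERIV (\<lambda>q. \<psi> (x - q *\<^sub>R e) + q * (e \<bullet> e / 2)) q :> - (grad \<psi> (x - q *\<^sub>R e) \<bullet> e) + e \<bullet> e / 2"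
        by (auto intro!: derivative_eq_intros)
      then show "\<exists>y. DERIV (\<lambda>q. \<psi> (x - q *\<^sub>R e) + q * (e \<bullet> e / 2)) q :> y \<and> y \<le> 0"
        using g[OF m] by (intro exI conjI) auto
    qed
    then show ?thesis by simp
  qed
  show ?thesis
  proof (rule that[of r1 T K e])
    have "continuous_on (cball p (2 * r1)) \<psi>" using C1_on_continuous[OF C1 open_ball] cb by (rule continuous_on_subset)
    then have "closed K" unfolding K_def by (intro continuous_closed_preimage) auto
    then show "compact K" unfolding K_def by (auto simp: compact_eq_bounded_closed intro: bounded_subset[OF bounded_cball])
    show "K \<subseteq> \<Omega>"
    proof
      fix x assume x: "x \<in> K"
      have "T * (e \<bullet> e / 2) > 0" using T e by simp
      then have "\<psi> x < 0" using x by (auto simp: K_def)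
      moreover have "x \<in> ball p r" using x cb by (auto simp: K_def)
      ultimately show "x \<in> \<Omega>" using dom by blast
    qed
    fix x assume x: "x \<in> \<Omega> \<inter> ball p r1"
    then have "x \<in> \<Omega> \<inter> ball p r" using r1 by auto
    then have neg: "\<psi> x < 0" using dom by blast
    show "x - T *\<^sub>R e \<in> K" using mem[of x T] low[of x T] x T neg unfolding K_def by auto
    fix t assume t: "0 \<le> t" "t \<le> T"
    have "\<psi> (x - t *\<^sub>R e) < 0" 
    proof -
      have "t * (e \<bullet> e / 2) \<ge> 0" using t(1) by simp
      moreover have "x \<in> ball p r1" using x by simp
      ultimately show ?thesis using low[OF _ t] neg by fastforce
    qed
    moreover have "x - t *\<^sub>R e \<in> ball p r" using mem[of x t] x t cb by auto
    ultimately show "x - t *\<^sub>R e \<in> \<Omega>" using dom by blast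
  qed (use r1 T in auto)
qed

end

context C2_domain
begin

lemma interior_L2:
  assumes conn: "connected \<Omega>" and z: "z \<in> \<Omega>" and p: "p \<in> \<Omega>"
  shows "\<exists>W C. open W \<and> p \<in> W \<and> C \<ge> 0 \<and> (\<forall>v a. harm_energy \<Omega> v a \<longrightarrow> v z = 0 \<longrightarrow>
     (\<integral>\<^sup>+ x\<in>\<Omega> \<inter> W. ennreal ((v x)\<^sup>2) \<partial>lborel) \<le> ennreal (C * a\<^sup>2))"
proof -
  obtain R where R: "R > 0" "cball p R \<subseteq> \<Omega>" using open_dom p open_contains_cball by blast
  obtain C where C: "C \<ge> 0" "\<And>v a y. harm_energy \<Omega> v a \<Longrightarrow> v z = 0 \<Longrightarrow> y \<in> cball p R \<Longrightarrow> \<bar>v y\<bar> \<le> C * a"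
    by (rule harmonic_bound_compact[OF open_dom conn z compact_cball R(2)]) blast
  let ?m = "measure lborel (ball p R)"
  have "(\<integral>\<^sup>+ x\<in>\<Omega> \<inter> ball p R. ennreal ((v x)\<^sup>2) \<partial>lborel) \<le> ennreal (C\<^sup>2 * ?m * a\<^sup>2)" if v: "harm_energy \<Omega> v a" "v z = 0" for v a
  proof -
    have "(\<integral>\<^sup>+ x\<in>\<Omega> \<inter> ball p R. ennreal ((v x)\<^sup>2) \<partial>lborel) \<le> (\<integral>\<^sup>+ x. ennreal ((C * a)\<^sup>2) * indicator (ball p R) x \<partial>lborel)"
    proof (rule nn_integral_mono)
      fix x
      have "(v x)\<^sup>2 \<le> (C * a)\<^sup>2" if "x \<in> ball p R"
        using power_mono[OF C(2)[OF v, of x], of 2] that by simp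
      then show "ennreal ((v x)\<^sup>2) * indicator (\<Omega> \<inter> ball p R) x \<le> ennreal ((C * a)\<^sup>2) * indicator (ball p R) x"
        by (auto simp: indicator_def intro: ennreal_leI)
    qed
    also have "\<dots> = ennreal ((C * a)\<^sup>2) * emeasure lborel (ball p R)" by (simp add: nn_integral_cmult_indicator)
    also have "emeasure lborel (ball p R) = ennreal ?m"
      using emeasure_bounded_finite[OF bounded_ball, of p R] by (intro emeasure_eq_ennreal_measure) simp
    also have "ennreal ((C * a)\<^sup>2) * ennreal ?m = ennreal (C\<^sup>2 * ?m * a\<^sup>2)"
      by (simp add: ennreal_mult[symmetric] power_mult_distrib mult_ac)
    finally show ?thesis .
  qed
  then show ?thesis using R(1) by (intro exI[of _ "ball p R"] exI[of _ "C\<^sup>2 * ?m"] conjI allI impI) simp_all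
qed

text \<open>Translating inwards by \<open>T *\<^sub>R e\<close> moves the part of \<open>\<Omega>\<close> near \<open>p\<close> into a compact subset of \<open>\<Omega>\<close>, on which
  \<open>v\<close> is controlled by its energy.\<close>

lemma boundary_L2:
  assumes conn: "connected \<Omega>" and z: "z \<in> \<Omega>" and p: "p \<in> \<Gamma>"
  shows "\<exists>W C. open W \<and> p \<in> W \<and> C \<ge> 0 \<and> (\<forall>v a. harm_energy \<Omega> v a \<longrightarrow> v z = 0 \<longrightarrow>
     (\<integral>\<^sup>+ x\<in>\<Omega> \<inter> W. ennreal ((v x)\<^sup>2) \<partial>lborel) \<le> ennreal (C * a\<^sup>2))"
proof -
  obtain \<rho> T e K where r: "\<rho> > 0" and T: "T > 0" and K: "compact K" "K \<subseteq> \<Omega>"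
    and line: "\<And>x t. x \<in> \<Omega> \<inter> ball p \<rho> \<Longrightarrow> 0 \<le> t \<Longrightarrow> t \<le> T \<Longrightarrow> x - t *\<^sub>R e \<in> \<Omega>"
    and inK: "\<And>x. x \<in> \<Omega> \<inter> ball p \<rho> \<Longrightarrow> x - T *\<^sub>R e \<in> K"
    by (rule inward_shift[OF p]) blast
  obtain C where C: "C \<ge> 0" "\<And>v a y. harm_energy \<Omega> v a \<Longrightarrow> v z = 0 \<Longrightarrow> y \<in> K \<Longrightarrow> \<bar>v y\<bar> \<le> C * a"
    by (rule harmonic_bound_compact[OF open_dom conn z K]) blast
  let ?W = "\<Omega> \<inter> ball p \<rho>"
  have Wb: "?W \<in> sets borel" using open_dom by auto
  let ?m = "measure lborel ?W"
  have em: "emeasure lborel ?W = ennreal ?m"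
    using emeasure_bounded_finite[OF bounded_subset[OF bounded_ball, of ?W p \<rho>]] by (intro emeasure_eq_ennreal_measure) auto
  let ?k = "2 * T * (norm e)\<^sup>2"
  have k0: "?k \<ge> 0" using T by simp
  have main: "(\<integral>\<^sup>+ x\<in>?W. ennreal ((v x)\<^sup>2) \<partial>lborel) \<le> ennreal ((2 * C\<^sup>2 * ?m + ?k * T) * a\<^sup>2)"
    if v: "harm_energy \<Omega> v a" "v z = 0" for v a
  proof -
    have Cv: "C2_on \<Omega> v" and a: "a \<ge> 0" and E: "dirichlet \<Omega> v \<le> ennreal (a\<^sup>2)"
      using v(1) by (auto simp: harm_energy_def)
    note C1 = C2_on_C1(1)[OF open_dom Cv]
    define q where "q x = ennreal ((norm (grad v x))\<^sup>2) * indicator \<Omega> x" for x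
    have q[measurable]: "q \<in> borel_measurable borel"
      using measurable_on_open[OF open_dom continuous_on_power[OF continuous_on_norm[OF C1_on_grad_continuous[OF C1]]], of 2]
      by (simp add: q_def[abs_def])
    have qE: "(\<integral>\<^sup>+ x. q x \<partial>lborel) \<le> ennreal (a\<^sup>2)" using E unfolding nn_integral_lebesgue_lborel q_def .
    have pt: "ennreal ((v x)\<^sup>2) \<le> ennreal (2 * (C * a)\<^sup>2) + ennreal ?k * (\<integral>\<^sup>+ t\<in>{0..T}. q (x - t *\<^sub>R e) \<partial>lborel)"
      if x: "x \<in> ?W" for x
    proof -
      let ?g = "\<lambda>t. grad v (x - t *\<^sub>R e)"
      have cg: "continuous_on {0..T} ?g"
        by (rule continuous_on_compose2[OF C1_on_grad_continuous[OF C1]]) (use line[OF x] in \<open>auto intro!: continuous_intros\<close>)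
      have d: "DERIV (\<lambda>t. v (x - t *\<^sub>R e)) t :> - (?g t \<bullet> e)" if t: "t \<in> {0..T}" for t
        by (rule C1_on_DERIV_line[OF C1 open_dom]) (use line[OF x] t in simp)
      have "(v (x - 0 *\<^sub>R e))\<^sup>2 \<le> 2 * (v (x - T *\<^sub>R e))\<^sup>2 + 2 * T * integral {0..T} (\<lambda>t. (- (?g t \<bullet> e))\<^sup>2)"
        by (rule square_le_endpoint_energy[OF T d]) (assumption | intro continuous_intros cg)+
      also have "(v (x - T *\<^sub>R e))\<^sup>2 \<le> (C * a)\<^sup>2" using power_mono[OF C(2)[OF v inK[OF x]], of 2] by simp
      also have "integral {0..T} (\<lambda>t. (- (?g t \<bullet> e))\<^sup>2) \<le> integral {0..T} (\<lambda>t. (norm e)\<^sup>2 * (norm (?g t))\<^sup>2)"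
      proof (rule integral_le)
        fix t
        have "\<bar>?g t \<bullet> e\<bar>\<^sup>2 \<le> (norm (?g t) * norm e)\<^sup>2" by (intro power_mono Cauchy_Schwarz_ineq2) simp
        then show "(- (?g t \<bullet> e))\<^sup>2 \<le> (norm e)\<^sup>2 * (norm (?g t))\<^sup>2" by (simp add: power_mult_distrib mult.commute)
      qed (intro integrable_continuous_real continuous_intros cg)+
      also have "\<dots> = (norm e)\<^sup>2 * integral {0..T} (\<lambda>t. (norm (?g t))\<^sup>2)" by (rule integral_mult_right)
      finally have 1: "(v x)\<^sup>2 \<le> 2 * (C * a)\<^sup>2 + ?k * integral {0..T} (\<lambda>t. (norm (?g t))\<^sup>2)" using T by (simp add: mult_ac)
      let ?I = "integral {0..T} (\<lambda>t. (norm (?g t))\<^sup>2)"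
      have I0: "?I \<ge> 0" by (intro integral_nonneg integrable_continuous_real continuous_intros cg) simp
      have "((\<lambda>t. (norm (?g t))\<^sup>2) has_integral ?I) {0..T}"
        by (intro integrable_integral integrable_continuous_real continuous_intros cg)
      then have "(\<integral>\<^sup>+ t. ennreal ((norm (?g t))\<^sup>2) * indicator {0..T} t \<partial>lborel) = ennreal ?I"
        by (intro nn_integral_has_integral_lebesgue') auto
      moreover have "(\<integral>\<^sup>+ t. ennreal ((norm (?g t))\<^sup>2) * indicator {0..T} t \<partial>lborel) = (\<integral>\<^sup>+ t. q (x - t *\<^sub>R e) * indicator {0..T} t \<partial>lborel)"
        by (rule nn_integral_cong) (use line[OF x] in \<open>auto simp: q_def indicator_def\<close>)
      ultimately have 2: "(\<integral>\<^sup>+ t\<in>{0..T}. q (x - t *\<^sub>R e) \<partial>lborel) = ennreal ?I" by simp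
      have "ennreal ((v x)\<^sup>2) \<le> ennreal (2 * (C * a)\<^sup>2 + ?k * ?I)" using 1 by (rule ennreal_leI)
      also have "\<dots> = ennreal (2 * (C * a)\<^sup>2) + ennreal ?k * ennreal ?I"
        using k0 I0 by (simp only: ennreal_plus ennreal_mult mult_nonneg_nonneg zero_le_power2 zero_le_numeral)
      finally show ?thesis unfolding 2 .
    qed
    let ?Q = "\<lambda>x t. q (x - t *\<^sub>R e) * indicator {0..T} t"
    have mQ: "case_prod ?Q \<in> borel_measurable (lborel \<Otimes>\<^sub>M lborel)" by measurable
    have "(\<integral>\<^sup>+ x\<in>?W. ennreal ((v x)\<^sup>2) \<partial>lborel)
        \<le> (\<integral>\<^sup>+ x. ennreal (2 * (C * a)\<^sup>2) * indicator ?W x + ennreal ?k * (\<integral>\<^sup>+ t. ?Q x t \<partial>lborel) \<partial>lborel)"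
    proof (rule nn_integral_mono)
      fix x
      show "ennreal ((v x)\<^sup>2) * indicator ?W x \<le> ennreal (2 * (C * a)\<^sup>2) * indicator ?W x + ennreal ?k * (\<integral>\<^sup>+ t. ?Q x t \<partial>lborel)"
        using pt[of x] by (cases "x \<in> ?W") simp_all
    qed
    also have "\<dots> = (\<integral>\<^sup>+ x. ennreal (2 * (C * a)\<^sup>2) * indicator ?W x \<partial>lborel) + ennreal ?k * (\<integral>\<^sup>+ x. \<integral>\<^sup>+ t. ?Q x t \<partial>lborel \<partial>lborel)"
      using Wb by (subst nn_integral_add) (auto intro!: nn_integral_cmult)
    \<comment> \<open>After the exchange the inner integral is, for each \<open>t\<close>, that of a
      translate of \<open>q\<close>, so the double integral is at most
      \<open>T * a\<^sup>2\<close>.\<close>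
    also have "(\<integral>\<^sup>+ x. \<integral>\<^sup>+ t. ?Q x t \<partial>lborel \<partial>lborel) = (\<integral>\<^sup>+ t. \<integral>\<^sup>+ x. ?Q x t \<partial>lborel \<partial>lborel)"
      by (rule lborel_pair.Fubini'[symmetric, OF mQ])
    also have "\<dots> = (\<integral>\<^sup>+ t. (\<integral>\<^sup>+ x. q x \<partial>lborel) * indicator {0..T} t \<partial>lborel)"
      by (intro nn_integral_cong) (simp add: nn_integral_multc nn_integral_translate[OF q])
    also have "\<dots> = (\<integral>\<^sup>+ x. q x \<partial>lborel) * ennreal T" using T by (simp add: nn_integral_cmult_indicator)
    also have "\<dots> \<le> ennreal (a\<^sup>2) * ennreal T" by (intro mult_right_mono qE) simp
    also have "(\<integral>\<^sup>+ x. ennreal (2 * (C * a)\<^sup>2) * indicator ?W x \<partial>lborel) = ennreal (2 * (C * a)\<^sup>2) * ennreal ?m"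
      using Wb em by (simp add: nn_integral_cmult_indicator)
    finally have "(\<integral>\<^sup>+ x\<in>?W. ennreal ((v x)\<^sup>2) \<partial>lborel) \<le> ennreal (2 * (C * a)\<^sup>2) * ennreal ?m + ennreal ?k * (ennreal (a\<^sup>2) * ennreal T)"
      by (simp add: add_left_mono mult_left_mono)
    also have "\<dots> = ennreal (2 * (C * a)\<^sup>2 * ?m + ?k * (a\<^sup>2 * T))"
      using T k0 by (simp only: ennreal_plus ennreal_mult mult_nonneg_nonneg zero_le_power2 zero_le_numeral measure_nonneg less_imp_le)
    also have "2 * (C * a)\<^sup>2 * ?m + ?k * (a\<^sup>2 * T) = (2 * C\<^sup>2 * ?m + ?k * T) * a\<^sup>2" by (simp add: power_mult_distrib algebra_simps)
    finally show ?thesis .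
  qed
  have n: "2 * C\<^sup>2 * ?m + ?k * T \<ge> 0" using T k0 by (intro add_nonneg_nonneg mult_nonneg_nonneg) auto
  show ?thesis using r main n
    by (intro exI[of _ "ball p \<rho>"] exI[of _ "2 * C\<^sup>2 * ?m + ?k * T"] conjI allI impI) simp_all
qed

lemma harmonic_poincare_const:
  assumes conn: "connected \<Omega>" and z: "z \<in> \<Omega>"
  obtains C where "C > 0" "\<And>v a. harm_energy \<Omega> v a \<Longrightarrow> v z = 0 \<Longrightarrow> (\<integral>\<^sup>+ x\<in>\<Omega>. ennreal ((v x)\<^sup>2) \<partial>lborel) \<le> ennreal (C * a\<^sup>2)"
proof -
  define good where "good p W C \<longleftrightarrow> open W \<and> p \<in> W \<and> C \<ge> 0 \<and> (\<forall>v a. harm_energy \<Omega> v a \<longrightarrow> v z = 0 \<longrightarrow>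
     (\<integral>\<^sup>+ x\<in>\<Omega> \<inter> W. ennreal ((v x)\<^sup>2) \<partial>lborel) \<le> ennreal (C * a\<^sup>2))" for p W C
  have "\<exists>W C. good p W C" if "p \<in> closure \<Omega>" for p
  proof (cases "p \<in> \<Omega>")
    case True then show ?thesis unfolding good_def by (rule interior_L2[OF conn z])
  next
    case False
    then have "p \<in> \<Gamma>" using that clos_eq by blast
    then show ?thesis unfolding good_def by (rule boundary_L2[OF conn z])
  qed
  then obtain W C where g: "\<And>p. p \<in> closure \<Omega> \<Longrightarrow> good p (W p) (C p)" by metis
  then have W: "\<And>p. p \<in> closure \<Omega> \<Longrightarrow> open (W p)" "\<And>p. p \<in> closure \<Omega> \<Longrightarrow> p \<in> W p"
    "\<And>p. p \<in> closure \<Omega> \<Longrightarrow> C p \<ge> 0" unfolding good_def by simp_all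
  have L: "(\<integral>\<^sup>+ x\<in>\<Omega> \<inter> W p. ennreal ((v x)\<^sup>2) \<partial>lborel) \<le> ennreal (C p * a\<^sup>2)"
    if "p \<in> closure \<Omega>" "harm_energy \<Omega> v a" "v z = 0" for p v a
    using g[OF that(1)] that(2,3) unfolding good_def by simp
  have "closure \<Omega> \<subseteq> (\<Union>p\<in>closure \<Omega>. W p)" using W(2) by blast
  then obtain F where F: "F \<subseteq> closure \<Omega>" "finite F" "closure \<Omega> \<subseteq> (\<Union>p\<in>F. W p)"
    by (rule compactE_image[OF compact_clos W(1), rotated 1]) auto
  have S0: "(\<Sum>p\<in>F. C p) \<ge> 0" using F W(3) by (intro sum_nonneg) auto
  show ?thesis
  proof (rule that[of "1 + (\<Sum>p\<in>F. C p)"])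
    show "1 + (\<Sum>p\<in>F. C p) > 0" using S0 by linarith
    fix v a assume v: "harm_energy \<Omega> v a" "v z = 0"
    have cv: "continuous_on \<Omega> v" using v(1) C2_on_C1(1) C1_on_continuous open_dom unfolding harm_energy_def by blast
    have mv: "(\<lambda>x. ennreal ((v x)\<^sup>2) * indicator (\<Omega> \<inter> W p) x) \<in> borel_measurable lborel" if "p \<in> F" for p
      using measurable_on_open[of "\<Omega> \<inter> W p" "\<lambda>x. (v x)\<^sup>2"] open_dom W(1) that F(1)
      by (auto intro!: continuous_intros continuous_on_subset[OF cv])
    have "(\<integral>\<^sup>+ x\<in>\<Omega>. ennreal ((v x)\<^sup>2) \<partial>lborel) \<le> (\<integral>\<^sup>+ x. (\<Sum>p\<in>F. ennreal ((v x)\<^sup>2) * indicator (\<Omega> \<inter> W p) x) \<partial>lborel)"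
    proof (rule nn_integral_mono)
      fix x
      show "ennreal ((v x)\<^sup>2) * indicator \<Omega> x \<le> (\<Sum>p\<in>F. ennreal ((v x)\<^sup>2) * indicator (\<Omega> \<inter> W p) x)"
      proof (cases "x \<in> \<Omega>")
        case True
        then obtain p where p: "p \<in> F" "x \<in> W p" using F(3) closure_subset by blast
        have "ennreal ((v x)\<^sup>2) * indicator \<Omega> x = ennreal ((v x)\<^sup>2) * indicator (\<Omega> \<inter> W p) x" using True p by simp
        also have "\<dots> \<le> (\<Sum>p\<in>F. ennreal ((v x)\<^sup>2) * indicator (\<Omega> \<inter> W p) x)"
          using F(2) p(1) by (intro member_le_sum) auto
        finally show ?thesis .
      qed simp
    qed
    also have "\<dots> = (\<Sum>p\<in>F. \<integral>\<^sup>+ x\<in>\<Omega> \<inter> W p. ennreal ((v x)\<^sup>2) \<partial>lborel)" by (rule nn_integral_sum) (rule mv)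
    also have "\<dots> \<le> (\<Sum>p\<in>F. ennreal (C p * a\<^sup>2))" using F(1) by (intro sum_mono L v) auto
    also have "\<dots> = ennreal ((\<Sum>p\<in>F. C p) * a\<^sup>2)" unfolding sum_distrib_right using F(1) W(3) by (intro sum_ennreal) auto
    also have "\<dots> \<le> ennreal ((1 + (\<Sum>p\<in>F. C p)) * a\<^sup>2)" by (intro ennreal_leI mult_right_mono) auto
    finally show "(\<integral>\<^sup>+ x\<in>\<Omega>. ennreal ((v x)\<^sup>2) \<partial>lborel) \<le> ennreal ((1 + (\<Sum>p\<in>F. C p)) * a\<^sup>2)" .
  qed
qed

text \<open>An infinite infimum would become 0 under \<open>enn2real\<close>, so a competitor of
  finite energy is exhibited: a normalised coordinate difference.\<close>

lemma mu0_finite_test: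
  assumes z: "z \<in> \<Omega>"
  obtains v where "C2_on \<Omega> v" "\<And>x. x \<in> \<Omega> \<Longrightarrow> lap v x = 0" "(\<integral>\<^sup>+ x\<in>\<Omega>. ennreal ((v x)\<^sup>2) \<partial>lebesgue) = 1" "v z = 0"
    "dirichlet \<Omega> v < \<infinity>"
proof -
  define k :: 'n where "k = undefined"
  define w where "w x = x $ k + - z $ k" for x :: "real^'n"
  have Cw: "C2_on UNIV w" unfolding w_def by (rule C2_on_add(1)[OF open_UNIV C2_on_coord[OF open_UNIV] C2_on_const[OF open_UNIV]])
  have pw: "pd w i = (\<lambda>x. if i = k then 1 else 0)" for i
  proof (rule ext)
    fix x
    have "GDERIV w x :> axis k 1"
      unfolding GDERIV_has_derivative w_def by (auto intro!: derivative_eq_intros simp: cart_eq_inner_axis inner_commute)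
    then show "pd w i x = (if i = k then 1 else 0)" using GDERIV_pd[of w x "axis k 1"] by (auto simp: axis_def)
  qed
  have ppw: "pd (pd w i) j x = 0" for i j x unfolding pw by (simp add: pd_def)
  obtain d where d: "d > 0" "ball z d \<subseteq> \<Omega>" using open_dom z open_contains_ball by blast
  let ?I = "\<integral>\<^sup>+ x\<in>\<Omega>. ennreal ((w x)\<^sup>2) \<partial>lborel"
  \<comment> \<open>On the ball of radius \<open>d / 4\<close> about this point \<open>w\<close> is
    at least \<open>d / 4\<close>, so its \<open>L\<^sup>2\<close> norm is positive and can be
    normalised.\<close>
  let ?y = "z + (d / 2) *\<^sub>R axis k 1"
  have ym: "ball ?y (d / 4) \<subseteq> ball z d"
  proof
    fix x assume "x \<in> ball ?y (d / 4)"
    moreover have "dist z ?y = d / 2" using d(1) by (simp add: dist_norm)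
    ultimately show "x \<in> ball z d" using dist_triangle[of z x ?y] d(1) by simp
  qed
  have "0 < ennreal ((d / 4)\<^sup>2) * emeasure lborel (ball ?y (d / 4))"
  proof -
    have "emeasure lborel (ball ?y (d / 4)) = ennreal (measure lborel (ball ?y (d / 4)))"
      using emeasure_bounded_finite[OF bounded_ball, of ?y "d / 4"] by (intro emeasure_eq_ennreal_measure) simp
    moreover have "measure lborel (ball ?y (d / 4)) > 0" using d(1) by (intro content_ball_pos) simp
    ultimately show ?thesis using d(1) by (simp add: ennreal_zero_less_mult_iff)
  qed
  also have "\<dots> = (\<integral>\<^sup>+ x. ennreal ((d / 4)\<^sup>2) * indicator (ball ?y (d / 4)) x \<partial>lborel)" by (simp add: nn_integral_cmult_indicator)
  also have "\<dots> \<le> ?I"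
  proof (rule nn_integral_mono)
    fix x
    have "(d / 4)\<^sup>2 \<le> (w x)\<^sup>2" if "x \<in> ball ?y (d / 4)"
    proof -
      have "\<bar>(?y - x) $ k\<bar> < d / 4" using component_le_norm_cart[of "?y - x" k] that by (simp add: dist_norm)
      moreover have "(?y - x) $ k = z $ k + d / 2 - x $ k" by simp
      ultimately have "w x \<ge> d / 4" unfolding w_def by linarith
      then show ?thesis using d(1) by (intro power_mono) auto
    qed
    then show "ennreal ((d / 4)\<^sup>2) * indicator (ball ?y (d / 4)) x \<le> ennreal ((w x)\<^sup>2) * indicator \<Omega> x"
      using ym d(2) by (auto simp: indicator_def intro: ennreal_leI)
  qed
  finally have Ipos: "?I > 0" .
  obtain B where B: "\<And>x. x \<in> \<Omega> \<Longrightarrow> norm x \<le> B" using bounded_dom unfolding bounded_iff by blast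
  have "?I \<le> (\<integral>\<^sup>+ x. ennreal ((2 * B)\<^sup>2) * indicator \<Omega> x \<partial>lborel)"
  proof (rule nn_integral_mono)
    fix x
    have "(w x)\<^sup>2 \<le> (2 * B)\<^sup>2" if x: "x \<in> \<Omega>"
    proof -
      have "\<bar>x $ k\<bar> \<le> B" "\<bar>z $ k\<bar> \<le> B" using component_le_norm_cart[of x k] component_le_norm_cart[of z k] B[OF x] B[OF z] by linarith+
      then have "\<bar>w x\<bar> \<le> 2 * B" by (simp add: w_def)
      from power_mono[OF this, of 2] show ?thesis by simp
    qed
    then show "ennreal ((w x)\<^sup>2) * indicator \<Omega> x \<le> ennreal ((2 * B)\<^sup>2) * indicator \<Omega> x"
      by (auto simp: indicator_def intro: ennreal_leI)
  qed
  also have "\<dots> = ennreal ((2 * B)\<^sup>2) * emeasure lborel \<Omega>" using open_dom by (simp add: nn_integral_cmult_indicator)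
  also have "\<dots> < \<infinity>" using emeasure_bounded_finite[OF bounded_dom] by (simp add: ennreal_mult_less_top)
  finally have If: "?I < \<infinity>" .
  define m where "m = enn2real ?I"
  have Im: "?I = ennreal m" using If by (simp add: m_def)
  have m: "m > 0" using Ipos Im by (metis ennreal_less_zero_iff)
  define v where "v x = (1 / sqrt m) * w x" for x
  note cm = C2_on_cmult[OF open_UNIV Cw, where c="1 / sqrt m", folded v_def[abs_def]]
  have gv: "(norm (grad v x))\<^sup>2 = 1 / m" for x
  proof -
    have "grad v x = (1 / sqrt m) *\<^sub>R axis k 1"
      by (simp add: vec_eq_iff grad_def cm(2) pw axis_def)
    then have "norm (grad v x) = 1 / sqrt m" using m by simp
    then show ?thesis using m by (simp add: power_divide)
  qed
  show ?thesis
  proof (rule that[of v])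
    show "C2_on \<Omega> v" by (rule C2_on_subset[OF cm(1)]) simp
    show "lap v x = 0" for x by (simp add: lap_def cm(3) ppw)
    show "v z = 0" by (simp add: v_def w_def)
    have "(\<integral>\<^sup>+ x\<in>\<Omega>. ennreal ((v x)\<^sup>2) \<partial>lborel) = (\<integral>\<^sup>+ x. ennreal (1 / m) * (ennreal ((w x)\<^sup>2) * indicator \<Omega> x) \<partial>lborel)"
    proof (rule nn_integral_cong)
      fix x
      have "(v x)\<^sup>2 = (1 / m) * (w x)\<^sup>2" using m by (simp add: v_def power_divide)
      then have "ennreal ((v x)\<^sup>2) = ennreal (1 / m) * ennreal ((w x)\<^sup>2)" using m by (simp only: ennreal_mult zero_le_power2 divide_nonneg_nonneg zero_le_one less_imp_le)
      then show "ennreal ((v x)\<^sup>2) * indicator \<Omega> x = ennreal (1 / m) * (ennreal ((w x)\<^sup>2) * indicator \<Omega> x)" by (simp only: mult.assoc)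
    qed
    also have "\<dots> = ennreal (1 / m) * ?I"
      using measurable_on_open[OF open_dom, of "\<lambda>x. (w x)\<^sup>2"] continuous_on_subset[OF C1_on_continuous[OF C2_on_C1(1)[OF open_UNIV Cw] open_UNIV], of \<Omega>]
      by (intro nn_integral_cmult) (auto intro!: continuous_intros)
    also have "\<dots> = ennreal ((1 / m) * m)" unfolding Im using m by (simp only: ennreal_mult divide_nonneg_nonneg zero_le_one less_imp_le)
    also have "\<dots> = 1" using m by simp
    finally show "(\<integral>\<^sup>+ x\<in>\<Omega>. ennreal ((v x)\<^sup>2) \<partial>lebesgue) = 1" unfolding nn_integral_lebesgue_lborel .
    have "(\<integral>\<^sup>+ x\<in>\<Omega>. ennreal ((norm (grad v x))\<^sup>2) \<partial>lborel) = ennreal (1 / m) * emeasure lborel \<Omega>"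
      unfolding gv using open_dom by (simp add: nn_integral_cmult_indicator)
    also have "\<dots> < \<infinity>" using emeasure_bounded_finite[OF bounded_dom] by (simp add: ennreal_mult_less_top)
    finally show "dirichlet \<Omega> v < \<infinity>" unfolding nn_integral_lebesgue_lborel .
  qed
qed

text \<open>\<open>enn2real\<close> is 0 both at 0 and at infinity, so both ends are excluded: the
  Poincare constant bounds the infimum below, the test function bounds it above.\<close>

lemma mu0_pos:
  assumes conn: "connected \<Omega>" and z: "z \<in> \<Omega>"
  shows "mu0 \<Omega> z > 0"
proof -
  obtain C where C: "C > 0" "\<And>v a. harm_energy \<Omega> v a \<Longrightarrow> v z = 0 \<Longrightarrow> (\<integral>\<^sup>+ x\<in>\<Omega>. ennreal ((v x)\<^sup>2) \<partial>lborel) \<le> ennreal (C * a\<^sup>2)"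
    by (rule harmonic_poincare_const[OF conn z]) blast
  let ?A = "{v. C2_on \<Omega> v \<and> (\<forall>x\<in>\<Omega>. lap v x = 0) \<and> (\<integral>\<^sup>+ x\<in>\<Omega>. ennreal ((v x)\<^sup>2) \<partial>lebesgue) = 1 \<and> v z = 0}"
  let ?E = "\<lambda>v. dirichlet \<Omega> v"
  have "ennreal (1 / C) \<le> (INF v\<in>?A. ?E v)"
  proof (rule INF_greatest)
    fix v assume v: "v \<in> ?A"
    show "ennreal (1 / C) \<le> ?E v"
    proof (cases "?E v < \<infinity>")
      case True
      define a where "a = sqrt (enn2real (?E v))"
      have Ea: "?E v = ennreal (a\<^sup>2)" using True by (simp add: a_def)
      have he: "harm_energy \<Omega> v a" unfolding harm_energy_def using v Ea by (simp add: a_def)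
      have "(\<integral>\<^sup>+ x\<in>\<Omega>. ennreal ((v x)\<^sup>2) \<partial>lborel) \<le> ennreal (C * a\<^sup>2)" using C(2)[OF he] v by simp
      then have "ennreal 1 \<le> ennreal (C * a\<^sup>2)" using v unfolding nn_integral_lebesgue_lborel by simp
      then have "1 \<le> C * a\<^sup>2" using C(1) by (simp add: ennreal_le_iff del: ennreal_1)
      then show ?thesis unfolding Ea using C(1) by (intro ennreal_leI) (simp add: divide_le_eq mult.commute)
    next
      case False
      then have "?E v = top" by (simp add: not_less top_unique)
      then show ?thesis by simp
    qed
  qed
  moreover have "ennreal (1 / C) > 0" using C(1) by simp
  ultimately have "0 < (INF v\<in>?A. ?E v)" by (rule less_le_trans[rotated])
  moreover obtain v where v: "C2_on \<Omega> v" "\<And>x. x \<in> \<Omega> \<Longrightarrow> lap v x = 0" "(\<integral>\<^sup>+ x\<in>\<Omega>. ennreal ((v x)\<^sup>2) \<partial>lebesgue) = 1" "v z = 0"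
    "?E v < \<infinity>" by (rule mu0_finite_test[OF z]) blast
  have "(INF v\<in>?A. ?E v) \<le> ?E v" by (rule INF_lower) (use v in simp)
  then have "(INF v\<in>?A. ?E v) < \<infinity>" using v(5) by (rule le_less_trans)
  ultimately show ?thesis unfolding mu0_def by (simp add: enn2real_positive_iff)
qed

end

subsection \<open>Deformations into the domain\<close>

text \<open>A change of variables without a Jacobian. \<open>U\<close> is filled up to a null set by
  disjoint balls (Vitali); the preimage of a ball of radius \<open>\<rho>\<close> lies in one of
  radius \<open>4 * \<rho>\<close>, and the preimage of the null set is null because the inverse is
  Lipschitz.\<close>

lemma expansive_preimage_emeasure:
  fixes \<Phi> :: "'a::euclidean_space \<Rightarrow> 'a"
  assumes S: "open S" and c: "continuous_on UNIV \<Phi>" and U: "open U"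
    and ex: "\<And>x y. x \<in> S \<Longrightarrow> y \<in> S \<Longrightarrow> dist x y \<le> 2 * dist (\<Phi> x) (\<Phi> y)"
  shows "emeasure lborel (S \<inter> \<Phi> -` U) \<le> ennreal (4 ^ DIM('a)) * emeasure lborel U"
proof -
  have cm: "\<Phi> \<in> borel_measurable borel" by (rule borel_measurable_continuous_onI[OF c])
  have pre: "S \<inter> \<Phi> -` A \<in> sets borel" if "A \<in> sets borel" for A
  proof (rule sets.Int)
    show "S \<in> sets borel" using S by simp
    show "\<Phi> -` A \<in> sets borel" using measurable_sets[OF cm that] by (simp only: space_borel Int_UNIV_right)
  qed
  define K where "K = {(y, \<rho>). 0 < \<rho> \<and> ball y \<rho> \<subseteq> U}"
  have "\<exists>i. i \<in> K \<and> x \<in> ball (fst i) (snd i) \<and> snd i < d" if xU: "x \<in> U" and d: "0 < d" for x d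
  proof -
    obtain e where e: "e > 0" "ball x e \<subseteq> U" by (rule openE[OF U xU])
    have "ball x (min e (d / 2)) \<subseteq> ball x e" by (rule subset_ball) simp
    then have "(x, min e (d / 2)) \<in> K" using e d by (auto simp: K_def)
    then show ?thesis using e d by (intro exI[of _ "(x, min e (d / 2))"]) auto
  qed
  then obtain C where C: "countable C" "C \<subseteq> K" "pairwise (\<lambda>i j. disjnt (ball (fst i) (snd i)) (ball (fst j) (snd j))) C"
    "negligible (U - (\<Union>i\<in>C. ball (fst i) (snd i)))"
    by (rule Vitali_covering_theorem_balls)
  let ?B = "\<lambda>i. ball (fst i) (snd i)"
  let ?Z = "U - (\<Union>i\<in>C. ?B i)"
  have Zb: "?Z \<in> sets borel" using U C(1) by (intro sets.Diff sets.countable_UN') auto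
  have df: "disjoint_family_on ?B C" using C(3) by (auto simp: disjoint_family_on_def pairwise_def disjnt_def)
  then have df': "disjoint_family_on (\<lambda>i. S \<inter> \<Phi> -` ?B i) C" unfolding disjoint_family_on_def by blast
  have piece: "emeasure lborel (S \<inter> \<Phi> -` ?B i) \<le> ennreal (4 ^ DIM('a)) * emeasure lborel (?B i)" if i: "i \<in> C" for i
  proof (cases "S \<inter> \<Phi> -` ?B i = {}")
    case False
    then obtain x0 where x0: "x0 \<in> S" "\<Phi> x0 \<in> ?B i" by blast
    have r: "snd i > 0" using i C(2) by (auto simp: K_def)
    have "S \<inter> \<Phi> -` ?B i \<subseteq> ball x0 (4 * snd i)"
    proof
      fix x assume x: "x \<in> S \<inter> \<Phi> -` ?B i"
      have "dist (\<Phi> x0) (\<Phi> x) < 2 * snd i" using x x0(2) dist_triangle[of "\<Phi> x0" "\<Phi> x" "fst i"] by (simp add: dist_commute)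
      then show "x \<in> ball x0 (4 * snd i)" using ex[OF x0(1), of x] x by simp
    qed
    then have "emeasure lborel (S \<inter> \<Phi> -` ?B i) \<le> emeasure lborel (ball x0 (4 * snd i))" by (intro emeasure_mono) auto
    also have "\<dots> = ennreal (4 ^ DIM('a)) * emeasure lborel (?B i)"
      using r by (simp add: emeasure_ball ennreal_mult[symmetric] power_mult_distrib mult_ac)
    finally show ?thesis .
  qed simp
  define g where "g = inv_into S \<Phi>"
  have inj: "inj_on \<Phi> S" using ex by (intro inj_onI) fastforce
  have "S \<inter> \<Phi> -` ?Z = g ` (?Z \<inter> \<Phi> ` S)"
    unfolding g_def using inj by (auto simp: image_iff) force
  moreover have "negligible (g ` (?Z \<inter> \<Phi> ` S))"
  proof (rule negligible_locally_Lipschitz_image)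
    show "negligible (?Z \<inter> \<Phi> ` S)" using C(4) by (rule negligible_subset) blast
    fix y assume y: "y \<in> ?Z \<inter> \<Phi> ` S"
    have "norm (g w - g y) \<le> 2 * norm (w - y)" if w: "w \<in> ?Z \<inter> \<Phi> ` S" for w
    proof -
      obtain a b where "a \<in> S" "w = \<Phi> a" "b \<in> S" "y = \<Phi> b" using y w by blast
      then show ?thesis using ex[of a b] inj by (simp add: g_def dist_norm)
    qed
    then show "\<exists>T B. open T \<and> y \<in> T \<and> (\<forall>w\<in>?Z \<inter> \<Phi> ` S \<inter> T. norm (g w - g y) \<le> B * norm (w - y))"
      by (intro exI[of _ UNIV] exI[of _ 2]) simp
  qed simp
  ultimately have "negligible (S \<inter> \<Phi> -` ?Z)" by simp
  then have Z0: "emeasure lborel (S \<inter> \<Phi> -` ?Z) = 0"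
    using pre[OF Zb] by (simp add: negligible_iff_null_sets null_sets_def)
  have mP: "S \<inter> \<Phi> -` ?B i \<in> sets lborel" for i using pre[of "?B i"] by simp
  have mQ: "S \<inter> \<Phi> -` ?Z \<in> sets lborel" using pre[OF Zb] by (simp only: sets_lborel)
  have mU: "(\<Union>i\<in>C. S \<inter> \<Phi> -` ?B i) \<in> sets lborel" by (rule sets.countable_UN'[OF C(1)]) (intro image_subsetI mP)
  have "emeasure lborel (S \<inter> \<Phi> -` U) \<le> emeasure lborel ((\<Union>i\<in>C. S \<inter> \<Phi> -` ?B i) \<union> (S \<inter> \<Phi> -` ?Z))"
    by (rule emeasure_mono[OF _ sets.Un[OF mU mQ]]) blast
  also have "\<dots> \<le> emeasure lborel (\<Union>i\<in>C. S \<inter> \<Phi> -` ?B i) + emeasure lborel (S \<inter> \<Phi> -` ?Z)"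
    by (rule emeasure_subadditive[OF mU mQ])
  also have "\<dots> = (\<integral>\<^sup>+ i. emeasure lborel (S \<inter> \<Phi> -` ?B i) \<partial>count_space C)"
    unfolding Z0 by (simp only: emeasure_UN_countable[OF mP C(1) df'] add_0_right)
  also have "\<dots> \<le> (\<integral>\<^sup>+ i. ennreal (4 ^ DIM('a)) * emeasure lborel (?B i) \<partial>count_space C)"
    by (intro nn_integral_mono piece) simp
  also have "\<dots> = ennreal (4 ^ DIM('a)) * (\<integral>\<^sup>+ i. emeasure lborel (?B i) \<partial>count_space C)" by (rule nn_integral_cmult) simp
  also have "(\<integral>\<^sup>+ i. emeasure lborel (?B i) \<partial>count_space C) = emeasure lborel (\<Union>i\<in>C. ?B i)"
    using C(1) by (subst emeasure_UN_countable[OF _ _ df]) auto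
  also have "\<dots> \<le> emeasure lborel U"
  proof (rule emeasure_mono)
    have "?B i \<subseteq> U" if "i \<in> C" for i using subsetD[OF C(2) that] by (auto simp: K_def)
    then show "(\<Union>i\<in>C. ?B i) \<subseteq> U" by blast
  qed (use U in simp)
  finally show ?thesis by (simp add: mult_left_mono)
qed

text \<open>Layer-cake formula on both sides: the superlevel sets of \<open>F\<close> in
  \<open>S\<close> are open, and those of the composition are their preimages.\<close>

lemma nn_integral_expansive:
  fixes \<Phi> :: "real^'n \<Rightarrow> real^'n"
  assumes S: "open S" and c: "continuous_on UNIV \<Phi>" and F: "continuous_on S F"
    and ex: "\<And>x y. x \<in> S \<Longrightarrow> y \<in> S \<Longrightarrow> dist x y \<le> 2 * dist (\<Phi> x) (\<Phi> y)" and im: "\<And>x. x \<in> S \<Longrightarrow> \<Phi> x \<in> S"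
  shows "(\<integral>\<^sup>+ x\<in>S. ennreal (F (\<Phi> x)) \<partial>lborel) \<le> ennreal (4 ^ CARD('n)) * (\<integral>\<^sup>+ x\<in>S. ennreal (F x) \<partial>lborel)"
proof -
  define f where "f x = indicator S x * F x" for x
  have fm: "f \<in> borel_measurable borel"
    using borel_measurable_continuous_on_indicator[OF _ F] S unfolding f_def[abs_def] by simp
  define g where "g x = indicator S x * f (\<Phi> x)" for x
  have "(\<lambda>x. f (\<Phi> x)) \<in> borel_measurable borel"
    using measurable_compose[OF borel_measurable_continuous_onI[OF c] fm] .
  then have gm: "g \<in> borel_measurable borel"
    unfolding g_def[abs_def] using S by (intro borel_measurable_times borel_measurable_indicator) auto
  have 1: "emeasure lborel {x. t < g x} \<le> ennreal (4 ^ CARD('n)) * emeasure lborel {x. t < f x}" if t: "t > 0" for t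
  proof -
    have f1: "{x. t < f x} = S \<inter> F -` {t<..}" using t by (auto simp: f_def indicator_def split: if_splits)
    have "open (S \<inter> F -` {t<..})" by (rule continuous_open_preimage[OF F S]) auto
    then have "open {x. t < f x}" unfolding f1 .
    from expansive_preimage_emeasure[OF S c this ex]
    have "emeasure lborel (S \<inter> \<Phi> -` {x. t < f x}) \<le> ennreal (4 ^ CARD('n)) * emeasure lborel {x. t < f x}" by simp
    moreover have "{x. t < g x} = S \<inter> \<Phi> -` {x. t < f x}" using t by (auto simp: g_def indicator_def split: if_splits)
    ultimately show ?thesis by simp
  qed
  have "(\<integral>\<^sup>+ x\<in>S. ennreal (F (\<Phi> x)) \<partial>lborel) = (\<integral>\<^sup>+ x. ennreal (g x) \<partial>lborel)"
    using im by (intro nn_integral_cong) (auto simp: g_def f_def indicator_def)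
  also have "\<dots> = (\<integral>\<^sup>+ t\<in>{0<..}. emeasure lborel {x. t < g x} \<partial>lborel)" by (rule nn_integral_layer_cake[OF gm])
  also have "\<dots> \<le> (\<integral>\<^sup>+ t. ennreal (4 ^ CARD('n)) * (emeasure lborel {x. t < f x} * indicator {0<..} t) \<partial>lborel)"
    using 1 by (intro nn_integral_mono) (auto simp: indicator_def)
  also have "\<dots> = ennreal (4 ^ CARD('n)) * (\<integral>\<^sup>+ t\<in>{0<..}. emeasure lborel {x. t < f x} \<partial>lborel)"
  proof (rule nn_integral_cmult)
    let ?R = "{z :: real \<times> (real^'n). fst z < f (snd z)}"
    have "?R \<in> sets (borel \<Otimes>\<^sub>M lborel)"
    proof -
      have "{z \<in> space (borel \<Otimes>\<^sub>M (lborel :: (real^'n) measure)). fst z < f (snd z)} \<in> sets (borel \<Otimes>\<^sub>M lborel)"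
        using fm by measurable
      then show ?thesis by (simp add: space_pair_measure)
    qed
    from lborel.measurable_emeasure_Pair[OF this]
    have "(\<lambda>t. emeasure lborel {x. t < f x}) \<in> borel_measurable borel" by (simp add: vimage_def)
    then show "(\<lambda>t. emeasure lborel {x. t < f x} * indicator {0<..} t) \<in> borel_measurable lborel" by simp
  qed
  also have "(\<integral>\<^sup>+ t\<in>{0<..}. emeasure lborel {x. t < f x} \<partial>lborel) = (\<integral>\<^sup>+ x. ennreal (f x) \<partial>lborel)"
    by (rule nn_integral_layer_cake[OF fm, symmetric])
  also have "\<dots> = (\<integral>\<^sup>+ x\<in>S. ennreal (F x) \<partial>lborel)" by (intro nn_integral_cong) (auto simp: f_def indicator_def)
  finally show ?thesis .
qed

lemma C2_on_polynomial:
  fixes f :: "real^'n \<Rightarrow> real"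
  assumes "real_polynomial_function f"
  shows "C2_on UNIV f"
  using assms
proof induction
  case (linear f)
  have D: "GDERIV f x :> (\<chi> i. f (axis i 1))" for x
    by (rule has_derivative_GDERIV) (rule bounded_linear_imp_has_derivative[OF linear])
  have p: "pd f i x = f (axis i 1)" for i x using GDERIV_pd[OF D] by simp
  show ?case
    by (rule C2_on_intro[OF open_UNIV, where D="\<lambda>i x. f (axis i 1)"])
      (auto intro: C1_onI[OF open_UNIV D] simp: p)
next
  case (const c) show ?case by (rule C2_on_const[OF open_UNIV])
next
  case (add f g) then show ?case by (intro C2_on_add(1)[OF open_UNIV])
next
  case (mult f g) then show ?case by (intro C2_on_mult(1)[OF open_UNIV])
qed

lemma C1_on_component_Lipschitz:
  fixes f :: "real^'n \<Rightarrow> real"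
  assumes C: "C1_on UNIV f" and S: "convex S" and B: "\<And>x i. x \<in> S \<Longrightarrow> \<bar>pd f i x\<bar> \<le> B"
    and xy: "x \<in> S" "y \<in> S"
  shows "\<bar>f x - f y\<bar> \<le> real CARD('n) * B * norm (x - y)"
proof -
  have "norm (f x - f y) \<le> (real CARD('n) * B) * norm (x - y)"
  proof (rule differentiable_bound[OF S _ _ xy])
    fix w assume w: "w \<in> S"
    show "(f has_derivative (\<lambda>h. grad f w \<bullet> h)) (at w within S)"
      using C1_on_GDERIV[OF C open_UNIV UNIV_I] unfolding GDERIV_has_derivative by (rule has_derivative_at_withinI)
    have "norm (grad f w) \<le> (\<Sum>i\<in>UNIV. \<bar>grad f w $ i\<bar>)" by (rule norm_le_l1_cart)
    also have "\<dots> \<le> (\<Sum>i\<in>(UNIV::'n set). B)" by (intro sum_mono) (simp add: grad_def B[OF w])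
    finally have g: "norm (grad f w) \<le> real CARD('n) * B" by simp
    show "onorm (\<lambda>h. grad f w \<bullet> h) \<le> real CARD('n) * B"
    proof (rule onorm_le)
      fix h show "norm (grad f w \<bullet> h) \<le> real CARD('n) * B * norm h"
        using Cauchy_Schwarz_ineq2[of "grad f w" h] mult_right_mono[OF g norm_ge_zero[of h]] by simp
    qed
  qed
  then show ?thesis by simp
qed

context C2_domain
begin

text \<open>\<open>grad s\<close> is only \<open>C\<^sup>1\<close>, so the deformation \<open>x - e *\<^sub>R P x\<close> uses a polynomial approximation \<open>P\<close> of it.\<close>

lemma inward_map:
  assumes eta: "\<eta> > 0"
  obtains \<Phi> :: "real^'n \<Rightarrow> real^'n" where "\<And>k. C2_on UNIV (\<lambda>x. \<Phi> x $ k)" "\<And>x. x \<in> closure \<Omega> \<Longrightarrow> \<Phi> x \<in> \<Omega>"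
    "\<And>x y. x \<in> closure \<Omega> \<Longrightarrow> y \<in> closure \<Omega> \<Longrightarrow> dist x y \<le> 2 * dist (\<Phi> x) (\<Phi> y)"
    "\<And>x k i. x \<in> closure \<Omega> \<Longrightarrow> \<bar>pd (\<lambda>x. \<Phi> x $ k) i x\<bar> \<le> 2"
    "\<And>x k i j. x \<in> closure \<Omega> \<Longrightarrow> \<bar>pd (pd (\<lambda>x. \<Phi> x $ k) i) j x\<bar> \<le> 1"
    "\<And>x. x \<in> closure \<Omega> \<Longrightarrow> dist (\<Phi> x) x < \<eta>"
proof -
  let ?N = "real CARD('n)"
  have N: "?N \<ge> 1" by (simp add: Suc_leI)
  define \<tau> where "\<tau> = tube / 2"
  have t: "\<tau> > 0" "\<tau> < tube" using tube(1) by (auto simp: \<tau>_def)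
  obtain R0 where R0: "\<And>x. x \<in> closure \<Omega> \<Longrightarrow> norm x \<le> R0"
    using compact_imp_bounded[OF compact_clos] unfolding bounded_iff by blast
  define R where "R = R0 + 1"
  let ?X = "cball (0 :: real^'n) R"
  have XR: "closure \<Omega> \<subseteq> ?X" using R0 by (force simp: R_def)
  define K where "K = ?X \<inter> {x. \<bar>s x\<bar> \<le> \<tau>}"
  have "closed {x. \<bar>s x\<bar> \<le> \<tau>}" by (intro closed_Collect_le continuous_intros continuous_sdist)
  then have Kc: "compact K" unfolding K_def by (intro compact_Int_closed) auto
  have Kt: "K \<subseteq> {x. \<bar>s x\<bar> < tube}" using t by (auto simp: K_def)
  \<comment> \<open>Accuracy \<open>1 / (4 * N)\<close> in each component gives \<open>1 / 4\<close>
    for the vector field, well below the unit length of \<open>grad s\<close>.\<close>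
  have "\<exists>g. real_polynomial_function g \<and> (\<forall>x\<in>K. \<bar>pd s k x - g x\<bar> < 1 / (4 * ?N))" for k
  proof -
    have ck: "continuous_on K (pd s k)" by (rule continuous_on_subset[OF C1_on_pd_continuous[OF sdist_tube(1)] Kt])
    have pos: "1 / (4 * ?N) > 0" using N by simp
    show ?thesis
    proof (rule Stone_Weierstrass_real_polynomial_function[OF Kc ck pos])
      fix g assume "real_polynomial_function g" "\<And>x. x \<in> K \<Longrightarrow> \<bar>pd s k x - g x\<bar> < 1 / (4 * ?N)"
      then show ?thesis by (intro exI[of _ g] conjI ballI)
    qed
  qed
  then obtain g where g: "\<And>k. real_polynomial_function (g k)" "\<And>k x. x \<in> K \<Longrightarrow> \<bar>pd s k x - g k x\<bar> < 1 / (4 * ?N)" by metis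
  have gC: "C2_on UNIV (g k)" for k by (rule C2_on_polynomial[OF g(1)])
  note gC1 = C2_on_C1[OF open_UNIV gC]
  define P where "P x = (\<chi> k. g k x)" for x
  have Pa: "norm (grad s x - P x) \<le> 1 / 4" if "x \<in> K" for x
  proof -
    have "norm (grad s x - P x) \<le> (\<Sum>k\<in>UNIV. \<bar>(grad s x - P x) $ k\<bar>)" by (rule norm_le_l1_cart)
    also have "\<dots> \<le> (\<Sum>k\<in>(UNIV::'n set). 1 / (4 * ?N))"
      by (intro sum_mono) (use g(2)[OF that] in \<open>auto simp: grad_def P_def less_imp_le\<close>)
    also have "\<dots> = 1 / 4" using N by simp
    finally show ?thesis .
  qed
  have ex: "\<exists>B\<ge>0. \<forall>x\<in>?X. \<bar>f x\<bar> \<le> B" if "continuous_on UNIV f" for f :: "real^'n \<Rightarrow> real"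
  proof -
    have "compact (f ` ?X)" by (intro compact_continuous_image continuous_on_subset[OF that]) auto
    from compact_imp_bounded[OF this] obtain B where "\<forall>x\<in>?X. \<bar>f x\<bar> \<le> B" unfolding bounded_iff by auto
    then show ?thesis by (intro exI[of _ "max B 0"]) (auto simp: le_max_iff_disj)
  qed
  \<comment> \<open>One continuous function dominates the polynomials and their derivatives up to
    second order, so a single \<open>B\<close> serves them all.\<close>
  let ?F = "\<lambda>x. \<Sum>k\<in>UNIV. (\<bar>g k x\<bar> + (\<Sum>i\<in>UNIV. \<bar>pd (g k) i x\<bar> + (\<Sum>j\<in>UNIV. \<bar>pd (pd (g k) i) j x\<bar>)))"
  have "continuous_on UNIV ?F"
    by (intro continuous_intros C1_on_continuous[OF gC1(1) open_UNIV] C1_on_pd_continuous[OF gC1(1)] C1_on_pd_continuous[OF gC1(2)])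
  from ex[OF this] obtain B where B: "B \<ge> 0" "\<And>x. x \<in> ?X \<Longrightarrow> \<bar>?F x\<bar> \<le> B" by blast
  have Fk: "\<bar>g k x\<bar> + (\<Sum>i\<in>UNIV. \<bar>pd (g k) i x\<bar> + (\<Sum>j\<in>UNIV. \<bar>pd (pd (g k) i) j x\<bar>)) \<le> B" if "x \<in> ?X" for k x
  proof -
    have "\<bar>g k x\<bar> + (\<Sum>i\<in>UNIV. \<bar>pd (g k) i x\<bar> + (\<Sum>j\<in>UNIV. \<bar>pd (pd (g k) i) j x\<bar>)) \<le> ?F x"
      by (rule member_le_sum[where i=k]) (auto intro!: add_nonneg_nonneg sum_nonneg)
    then show ?thesis using B(2)[OF that] by linarith
  qed
  have Fi: "\<bar>pd (g k) i x\<bar> + (\<Sum>j\<in>UNIV. \<bar>pd (pd (g k) i) j x\<bar>) \<le> B" if "x \<in> ?X" for k i x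
  proof -
    have "\<bar>pd (g k) i x\<bar> + (\<Sum>j\<in>UNIV. \<bar>pd (pd (g k) i) j x\<bar>) \<le> (\<Sum>i\<in>UNIV. \<bar>pd (g k) i x\<bar> + (\<Sum>j\<in>UNIV. \<bar>pd (pd (g k) i) j x\<bar>))"
      by (rule member_le_sum[where i=i]) (auto intro!: add_nonneg_nonneg sum_nonneg)
    then show ?thesis using Fk[OF that, of k] by linarith
  qed
  have B0: "\<bar>g k x\<bar> \<le> B" if "x \<in> ?X" for k x
  proof -
    have "(\<Sum>i\<in>UNIV. \<bar>pd (g k) i x\<bar> + (\<Sum>j\<in>UNIV. \<bar>pd (pd (g k) i) j x\<bar>)) \<ge> 0" by (intro add_nonneg_nonneg sum_nonneg) auto
    then show ?thesis using Fk[OF that, of k] by linarith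
  qed
  have B1: "\<bar>pd (g k) i x\<bar> \<le> B" if "x \<in> ?X" for k i x
  proof -
    have "(\<Sum>j\<in>UNIV. \<bar>pd (pd (g k) i) j x\<bar>) \<ge> 0" by (intro sum_nonneg) auto
    then show ?thesis using Fi[OF that, of k i] by linarith
  qed
  have B2: "\<bar>pd (pd (g k) i) j x\<bar> \<le> B" if "x \<in> ?X" for k i j x
  proof -
    have "\<bar>pd (pd (g k) i) j x\<bar> \<le> (\<Sum>j\<in>UNIV. \<bar>pd (pd (g k) i) j x\<bar>)" by (rule member_le_sum[where i=j]) auto
    then show ?thesis using Fi[OF that, of k i] by linarith
  qed
  have PB: "norm (P x) \<le> ?N * B" if "x \<in> ?X" for x
  proof -
    have "norm (P x) \<le> (\<Sum>k\<in>UNIV. \<bar>P x $ k\<bar>)" by (rule norm_le_l1_cart)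
    also have "\<dots> \<le> (\<Sum>k\<in>(UNIV::'n set). B)" by (intro sum_mono) (simp add: P_def B0[OF that])
    finally show ?thesis by simp
  qed
  define L where "L = ?N * (?N * B)"
  have L0: "L \<ge> 0" using B(1) by (simp add: L_def)
  have PL: "norm (P x - P y) \<le> L * norm (x - y)" if "x \<in> ?X" "y \<in> ?X" for x y
  proof -
    have "norm (P x - P y) \<le> (\<Sum>k\<in>UNIV. \<bar>(P x - P y) $ k\<bar>)" by (rule norm_le_l1_cart)
    also have "\<dots> \<le> (\<Sum>k\<in>(UNIV::'n set). ?N * B * norm (x - y))"
    proof (rule sum_mono)
      fix k
      show "\<bar>(P x - P y) $ k\<bar> \<le> ?N * B * norm (x - y)"
        using C1_on_component_Lipschitz[OF gC1(1)[of k] convex_cball B1 that] by (simp add: P_def)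
    qed
    finally show ?thesis by (simp add: L_def)
  qed
  have bL: "B \<le> L" "?N * B \<le> L"
  proof -
    have "1 * B \<le> ?N * B" using N B(1) by (intro mult_right_mono) auto
    moreover have "1 * (?N * B) \<le> ?N * (?N * B)" using N B(1) by (intro mult_right_mono) auto
    ultimately show "B \<le> L" "?N * B \<le> L" unfolding L_def by linarith+
  qed
  define m where "m = min (min (1 / 4) \<eta>) (\<tau> / 2)"
  have m: "m > 0" "m \<le> 1 / 4" "m \<le> \<eta>" "m \<le> \<tau> / 2" using eta t by (auto simp: m_def)
  \<comment> \<open>One factor \<open>L + 1\<close> keeps the displacement \<open>e * L\<close>
    below \<open>m\<close>; the second keeps \<open>e * L * L\<close>, which bounds the change of
    \<open>P\<close> along the path, at most \<open>1 / 4\<close>.\<close>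
  define e where "e = m / ((L + 1) * (L + 1))"
  have L1: "(L + 1) * (L + 1) > 0" "L + 1 \<ge> 1" using L0 by auto
  have ep: "e > 0" using m L1 by (simp add: e_def)
  have eL: "e * (L + 1) \<le> m"
  proof -
    have "e * (L + 1) = m / (L + 1)" using L1 by (simp add: e_def)
    also have "\<dots> \<le> m" using m L1 by (simp add: divide_le_eq mult_le_cancel_left1)
    finally show ?thesis .
  qed
  have eL': "e * L < m" using eL ep by (simp add: algebra_simps)
  have eLL: "e * L * L \<le> 1 / 4"
  proof -
    have "e * L * L \<le> e * (L + 1) * (L + 1)" using L0 ep by (intro mult_mono) auto
    also have "\<dots> = m" using L1 by (simp add: e_def)
    finally show ?thesis using m(2) by linarith
  qed
  define \<Phi> where "\<Phi> x = x - e *\<^sub>R P x" for x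
  have near: "norm (t *\<^sub>R P x) < m" "norm (t *\<^sub>R P x) \<le> e * L" if x: "x \<in> closure \<Omega>" and t: "0 \<le> t" "t \<le> e" for x t
  proof -
    have "norm (P x) \<le> L" using PB[of x] bL XR x by force
    then show "norm (t *\<^sub>R P x) \<le> e * L" using t ep L0 by (simp add: mult_mono)
    then show "norm (t *\<^sub>R P x) < m" using eL' by linarith
  qed
  have k1: "(\<lambda>x. \<Phi> x $ k) = (\<lambda>x. x $ k + (- e) * g k x)" for k by (simp add: \<Phi>_def P_def fun_eq_iff)
  note cg = C2_on_cmult[OF open_UNIV gC, where c="- e"]
  note add = C2_on_add[OF open_UNIV C2_on_coord[OF open_UNIV] cg(1)]
  have d1: "pd (\<lambda>x. \<Phi> x $ k) i x = (if i = k then 1 else 0) - e * pd (g k) i x" for k i x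
    unfolding k1 add(2)[OF UNIV_I] cg(2)[OF UNIV_I] by (simp add: C1_on_coord(2))
  have d2: "pd (pd (\<lambda>x. \<Phi> x $ k) i) j x = - e * pd (pd (g k) i) j x" for k i j x
  proof -
    have "pd (pd (\<lambda>x::real^'n. x $ k) i) j x = 0" by (simp add: C1_on_coord(2)[abs_def] pd_def)
    then show ?thesis unfolding k1 add(3)[OF UNIV_I] cg(3)[OF UNIV_I] by simp
  qed
  show ?thesis
  proof (rule that[of \<Phi>])
    show "C2_on UNIV (\<lambda>x. \<Phi> x $ k)" for k unfolding k1 by (rule add(1))
    fix x assume x: "x \<in> closure \<Omega>"
    have xX: "x \<in> ?X" using XR x by blast
    show "dist (\<Phi> x) x < \<eta>" using near(1)[OF x, of e] ep m by (simp add: \<Phi>_def dist_norm)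
    have eB: "e * \<bar>w\<bar> \<le> 1" if "\<bar>w\<bar> \<le> B" for w
    proof -
      have "e * \<bar>w\<bar> \<le> e * L" using that bL ep by (intro mult_left_mono) auto
      then show ?thesis using eL' m by linarith
    qed
    show "\<bar>pd (\<lambda>x. \<Phi> x $ k) i x\<bar> \<le> 2" for k i
    proof -
      have "\<bar>e * pd (g k) i x\<bar> \<le> 1" using eB[OF B1[OF xX, of k i]] ep by (simp add: abs_mult)
      then show ?thesis unfolding d1 by (cases "i = k") auto
    qed
    show "\<bar>pd (pd (\<lambda>x. \<Phi> x $ k) i) j x\<bar> \<le> 1" for k i j
      using eB[OF B2[OF xX, of k i j]] ep unfolding d2 by (simp add: abs_mult)
    show "dist x y \<le> 2 * dist (\<Phi> x) (\<Phi> y)" if y: "y \<in> closure \<Omega>" for y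
    proof -
      have yX: "y \<in> ?X" using XR y by blast
      have "norm (e *\<^sub>R (P x - P y)) \<le> e * L * norm (x - y)" using PL[OF xX yX] ep by (simp add: mult.assoc)
      also have "\<dots> \<le> (1 / 4) * norm (x - y)" using eL' m by (intro mult_right_mono) auto
      finally have "norm (e *\<^sub>R (P x - P y)) \<le> (1 / 4) * norm (x - y)" .
      moreover have "x - y = (\<Phi> x - \<Phi> y) + e *\<^sub>R (P x - P y)" by (simp add: \<Phi>_def algebra_simps)
      then have "norm (x - y) \<le> norm (\<Phi> x - \<Phi> y) + norm (e *\<^sub>R (P x - P y))" by (metis norm_triangle_ineq)
      moreover have "norm (\<Phi> x - \<Phi> y) \<ge> 0" by simp
      ultimately show ?thesis unfolding dist_norm by linarith
    qed
    have sx: "s x \<le> 0" using x closure_sdist by blast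
    show "\<Phi> x \<in> \<Omega>"
    proof (cases "s x < - (\<tau> / 2)")
      case True
      have "s (\<Phi> x) \<le> s x + dist (\<Phi> x) x" using sdist_Lipschitz[of "\<Phi> x" x] by linarith
      also have "dist (\<Phi> x) x < \<tau> / 2" using near(1)[OF x, of e] ep m by (simp add: \<Phi>_def dist_norm)
      finally show ?thesis using True sdist_neg_iff by force
    next
      case False
      have yK: "x - t *\<^sub>R P x \<in> K" if tt: "0 \<le> t" "t \<le> e" for t
      proof -
        have "\<bar>s (x - t *\<^sub>R P x) - s x\<bar> \<le> norm (t *\<^sub>R P x)" using sdist_Lipschitz[of "x - t *\<^sub>R P x" x] by (simp add: dist_norm)
        then have "\<bar>s (x - t *\<^sub>R P x)\<bar> \<le> \<tau>" using near(1)[OF x tt] m False sx by linarith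
        moreover have "norm (x - t *\<^sub>R P x) \<le> R"
          using norm_triangle_ineq4[of x "t *\<^sub>R P x"] near(1)[OF x tt] m R0[OF x] unfolding R_def by linarith
        ultimately show ?thesis by (simp add: K_def)
      qed
      \<comment> \<open>The slope of \<open>s\<close> along the path is
        \<open>- (grad s ?y \<bullet> P x)\<close>, and that product is at least
        \<open>1 - 1/4 - 1/4\<close>: the losses are the approximation error at \<open>?y\<close>
        and the variation of \<open>P\<close> between \<open>x\<close> and \<open>?y\<close>. The
        strict decrease moves boundary points inside as well.\<close>
      have "s (x - e *\<^sub>R P x) < s (x - 0 *\<^sub>R P x)"
      proof (rule DERIV_neg_imp_decreasing[OF ep])
        fix t assume tt: "0 \<le> t" "t \<le> e"
        let ?y = "x - t *\<^sub>R P x"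
        have yk: "?y \<in> K" by (rule yK[OF tt])
        then have yt: "?y \<in> {x. \<bar>s x\<bar> < tube}" using Kt by blast
        have yX: "?y \<in> ?X" using yk by (simp add: K_def)
        note D = C1_on_DERIV_line[OF sdist_tube(1) open_tube yt]
        have n1: "norm (grad s ?y) = 1" using tube(3) yt by simp
        have "norm (P x - P ?y) \<le> L * norm (t *\<^sub>R P x)" using PL[OF xX yX] by simp
        also have "\<dots> \<le> L * (e * L)" using near(2)[OF x tt] L0 by (rule mult_left_mono)
        also have "\<dots> \<le> 1 / 4" using eLL by (simp add: mult_ac)
        finally have "\<bar>grad s ?y \<bullet> (P x - P ?y)\<bar> \<le> 1 / 4" using Cauchy_Schwarz_ineq2[of "grad s ?y" "P x - P ?y"] n1 by simp
        moreover have "\<bar>grad s ?y \<bullet> (grad s ?y - P ?y)\<bar> \<le> 1 / 4"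
          using Cauchy_Schwarz_ineq2[of "grad s ?y" "grad s ?y - P ?y"] n1 Pa[OF yk] by simp
        moreover have "grad s ?y \<bullet> grad s ?y = 1" using n1 by (simp add: norm_eq_1)
        ultimately have "grad s ?y \<bullet> P x > 0" unfolding inner_diff_right by linarith
        then show "\<exists>y. DERIV (\<lambda>t. s (x - t *\<^sub>R P x)) t :> y \<and> y < 0"
          by (intro exI[of _ "- (grad s ?y \<bullet> P x)"] conjI D) simp
      qed
      then have "s (\<Phi> x) < 0" using sx by (simp add: \<Phi>_def)
      then show ?thesis using sdist_neg_iff by blast
    qed
  qed
qed

end

section \<open>Second-order Sobolev norms under composition\<close>

definition W22_density :: "(real^'n \<Rightarrow> real) \<Rightarrow> real^'n \<Rightarrow> real" where
  "W22_density v x = (v x)\<^sup>2 + (\<Sum>i\<in>UNIV. (pd v i x)\<^sup>2) + (\<Sum>i\<in>UNIV. \<Sum>j\<in>UNIV. (pd (pd v i) j x)\<^sup>2)"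

lemma W22_density_nonneg: "W22_density v x \<ge> 0"
  unfolding W22_density_def by (intro add_nonneg_nonneg sum_nonneg) auto

lemma W22_norm_density: "W22_norm \<Omega> v = sqrt (enn2real (\<integral>\<^sup>+ x\<in>\<Omega>. ennreal (W22_density v x) \<partial>lborel))"
  unfolding W22_norm_def W22_density_def nn_integral_lebesgue_lborel ..

lemma C2_on_compose:
  fixes f :: "real^'n \<Rightarrow> real" and p :: "real^'n \<Rightarrow> real^'n"
  assumes U: "open U" and W: "open W" and f: "C2_on U f" and p: "\<And>k. C2_on W (\<lambda>x. p x $ k)" and im: "p ` W \<subseteq> U"
  shows "C2_on W (\<lambda>x. f (p x))"
    "x \<in> W \<Longrightarrow> pd (\<lambda>x. f (p x)) i x = (\<Sum>k\<in>UNIV. pd f k (p x) * pd (\<lambda>x. p x $ k) i x)"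
    "x \<in> W \<Longrightarrow> pd (pd (\<lambda>x. f (p x)) i) j x = (\<Sum>k\<in>UNIV. pd f k (p x) * pd (pd (\<lambda>x. p x $ k) i) j x
       + (\<Sum>l\<in>UNIV. pd (pd f k) l (p x) * pd (\<lambda>x. p x $ l) j x) * pd (\<lambda>x. p x $ k) i x)"
proof -
  note p1 = C2_on_C1[OF W p]
  note f1 = C2_on_C1[OF U f]
  note c = C1_on_compose[OF U W f1(1) p1(1) im]
  note ck = C1_on_compose[OF U W f1(2) p1(1) im]
  let ?D = "\<lambda>i x. \<Sum>k\<in>UNIV. pd f k (p x) * pd (\<lambda>x. p x $ k) i x"
  show p1': "pd (\<lambda>x. f (p x)) i x = ?D i x" if "x \<in> W" for i x by (rule c(2)[OF that])
  have D: "C1_on W (?D i)" for i by (intro C1_on_sum[OF W] C1_on_mult[OF W] ck(1) p1(2)) auto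
  show "C2_on W (\<lambda>x. f (p x))" by (rule C2_on_intro[OF W c(1) D p1'])
  show "pd (pd (\<lambda>x. f (p x)) i) j x = (\<Sum>k\<in>UNIV. pd f k (p x) * pd (pd (\<lambda>x. p x $ k) i) j x
       + (\<Sum>l\<in>UNIV. pd (pd f k) l (p x) * pd (\<lambda>x. p x $ l) j x) * pd (\<lambda>x. p x $ k) i x)" if x: "x \<in> W"
  proof -
    have "pd (pd (\<lambda>x. f (p x)) i) j x = pd (?D i) j x"
      by (rule C1_on_cong_imp(2)[OF W D _ x]) (simp add: p1')
    also have "\<dots> = (\<Sum>k\<in>UNIV. pd (\<lambda>x. pd f k (p x) * pd (\<lambda>x. p x $ k) i x) j x)"
      by (rule pd_sum[THEN conjunct2]) (simp, intro C1_on_pd_exists[OF C1_on_mult[OF W ck(1) p1(2)] x])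
    also have "\<dots> = (\<Sum>k\<in>UNIV. pd f k (p x) * pd (pd (\<lambda>x. p x $ k) i) j x + pd (\<lambda>x. pd f k (p x)) j x * pd (\<lambda>x. p x $ k) i x)"
      by (intro sum.cong refl pd_mult(2) C1_on_pd_exists[OF ck(1) x] C1_on_pd_exists[OF p1(2) x])
    finally show ?thesis unfolding ck(2)[OF x] .
  qed
qed

text \<open>The chain rule bounds first derivatives by \<open>2 * A\<close> and second ones by
  \<open>A + 4 * B\<close>, with \<open>A\<close> and \<open>B\<close> sums of absolute values.
  Cauchy-Schwarz over the indices gives the coefficients \<open>4 * ?N ^ 2 + 2 * ?N ^ 3\<close> and
  \<open>32 * ?N ^ 4\<close>, which \<open>40 * ?N ^ 4\<close> covers.\<close>

lemma W22_density_compose: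
  fixes f :: "real^'n \<Rightarrow> real" and p :: "real^'n \<Rightarrow> real^'n"
  assumes U: "open U" and W: "open W" and f: "C2_on U f" and p: "\<And>k. C2_on W (\<lambda>x. p x $ k)" and im: "p ` W \<subseteq> U"
    and x: "x \<in> W" and d1: "\<And>k i. \<bar>pd (\<lambda>x. p x $ k) i x\<bar> \<le> 2" and d2: "\<And>k i j. \<bar>pd (pd (\<lambda>x. p x $ k) i) j x\<bar> \<le> 1"
  shows "W22_density (\<lambda>x. f (p x)) x \<le> 40 * real CARD('n) ^ 4 * W22_density f (p x)"
proof -
  let ?N = "real CARD('n)"
  have N: "?N \<ge> 1" by (simp add: Suc_leI)
  note c = C2_on_compose[OF U W f p im]
  define S1 where "S1 = (\<Sum>k\<in>UNIV. (pd f k (p x))\<^sup>2)"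
  define S2 where "S2 = (\<Sum>k\<in>UNIV. \<Sum>l\<in>UNIV. (pd (pd f k) l (p x))\<^sup>2)"
  define A where "A = (\<Sum>k\<in>UNIV. \<bar>pd f k (p x)\<bar>)"
  define B where "B = (\<Sum>k\<in>UNIV. \<Sum>l\<in>UNIV. \<bar>pd (pd f k) l (p x)\<bar>)"
  have S0: "S1 \<ge> 0" "S2 \<ge> 0" unfolding S1_def S2_def by (auto intro!: sum_nonneg)
  have AB: "A \<ge> 0" "B \<ge> 0" unfolding A_def B_def by (auto intro!: sum_nonneg)
  have A2: "A\<^sup>2 \<le> ?N * S1"
    using sum_squared_le_sum_of_squares[of "\<lambda>k. \<bar>pd f k (p x)\<bar>" UNIV] by (simp add: A_def S1_def mult.commute)
  have B2: "B\<^sup>2 \<le> ?N\<^sup>2 * S2"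
  proof -
    have "B\<^sup>2 \<le> (\<Sum>k\<in>UNIV. (\<Sum>l\<in>UNIV. \<bar>pd (pd f k) l (p x)\<bar>)\<^sup>2) * ?N"
      using sum_squared_le_sum_of_squares[of "\<lambda>k. \<Sum>l\<in>UNIV. \<bar>pd (pd f k) l (p x)\<bar>" UNIV] by (simp add: B_def)
    also have "\<dots> \<le> (\<Sum>k\<in>UNIV. (\<Sum>l\<in>UNIV. (pd (pd f k) l (p x))\<^sup>2) * ?N) * ?N"
    proof (intro mult_right_mono sum_mono)
      fix k
      show "(\<Sum>l\<in>UNIV. \<bar>pd (pd f k) l (p x)\<bar>)\<^sup>2 \<le> (\<Sum>l\<in>UNIV. (pd (pd f k) l (p x))\<^sup>2) * ?N"
        using sum_squared_le_sum_of_squares[of "\<lambda>l. \<bar>pd (pd f k) l (p x)\<bar>" UNIV] by simp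
    qed simp
    also have "\<dots> = S2 * ?N * ?N" unfolding S2_def sum_distrib_right[symmetric] ..
    also have "\<dots> = ?N\<^sup>2 * S2" by (simp add: power2_eq_square)
    finally show ?thesis .
  qed
  have 1: "\<bar>pd (\<lambda>x. f (p x)) i x\<bar> \<le> 2 * A" for i
  proof -
    have "\<bar>pd (\<lambda>x. f (p x)) i x\<bar> \<le> (\<Sum>k\<in>UNIV. \<bar>pd f k (p x) * pd (\<lambda>x. p x $ k) i x\<bar>)" unfolding c(2)[OF x] by (rule sum_abs)
    also have "\<dots> \<le> (\<Sum>k\<in>UNIV. \<bar>pd f k (p x)\<bar> * 2)" unfolding abs_mult by (intro sum_mono mult_left_mono d1) auto
    finally show ?thesis by (simp add: A_def sum_distrib_right[symmetric])
  qed
  have 2: "\<bar>pd (pd (\<lambda>x. f (p x)) i) j x\<bar> \<le> A + 4 * B" for i j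
  proof -
    have "\<bar>pd (pd (\<lambda>x. f (p x)) i) j x\<bar> \<le> (\<Sum>k\<in>UNIV. \<bar>pd f k (p x) * pd (pd (\<lambda>x. p x $ k) i) j x
       + (\<Sum>l\<in>UNIV. pd (pd f k) l (p x) * pd (\<lambda>x. p x $ l) j x) * pd (\<lambda>x. p x $ k) i x\<bar>)" unfolding c(3)[OF x] by (rule sum_abs)
    also have "\<dots> \<le> (\<Sum>k\<in>UNIV. \<bar>pd f k (p x)\<bar> + 4 * (\<Sum>l\<in>UNIV. \<bar>pd (pd f k) l (p x)\<bar>))"
    proof (rule sum_mono)
      fix k
      let ?T = "\<Sum>l\<in>UNIV. pd (pd f k) l (p x) * pd (\<lambda>x. p x $ l) j x"
      have "\<bar>?T\<bar> \<le> (\<Sum>l\<in>UNIV. \<bar>pd (pd f k) l (p x) * pd (\<lambda>x. p x $ l) j x\<bar>)" by (rule sum_abs)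
      also have "\<dots> \<le> (\<Sum>l\<in>UNIV. \<bar>pd (pd f k) l (p x)\<bar> * 2)" unfolding abs_mult by (intro sum_mono mult_left_mono d1) auto
      finally have T: "\<bar>?T\<bar> \<le> 2 * (\<Sum>l\<in>UNIV. \<bar>pd (pd f k) l (p x)\<bar>)" by (simp add: sum_distrib_right[symmetric])
      have "\<bar>?T * pd (\<lambda>x. p x $ k) i x\<bar> \<le> (2 * (\<Sum>l\<in>UNIV. \<bar>pd (pd f k) l (p x)\<bar>)) * 2"
        unfolding abs_mult by (intro mult_mono T d1) (auto intro!: sum_nonneg)
      moreover have "\<bar>pd f k (p x) * pd (pd (\<lambda>x. p x $ k) i) j x\<bar> \<le> \<bar>pd f k (p x)\<bar>"
        unfolding abs_mult using mult_left_mono[OF d2[of k i j] abs_ge_zero[of "pd f k (p x)"]] by simp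
      ultimately show "\<bar>pd f k (p x) * pd (pd (\<lambda>x. p x $ k) i) j x + ?T * pd (\<lambda>x. p x $ k) i x\<bar>
          \<le> \<bar>pd f k (p x)\<bar> + 4 * (\<Sum>l\<in>UNIV. \<bar>pd (pd f k) l (p x)\<bar>)" by linarith
    qed
    also have "\<dots> = A + 4 * B" by (simp add: A_def B_def sum.distrib sum_distrib_left[symmetric])
    finally show ?thesis .
  qed
  have q1: "(pd (\<lambda>x. f (p x)) i x)\<^sup>2 \<le> 4 * (?N * S1)" for i
  proof -
    have "(pd (\<lambda>x. f (p x)) i x)\<^sup>2 \<le> (2 * A)\<^sup>2" using power_mono[OF 1[of i], of 2] by simp
    then show ?thesis using A2 by (simp add: power_mult_distrib)
  qed
  have q2: "(pd (pd (\<lambda>x. f (p x)) i) j x)\<^sup>2 \<le> 2 * (?N * S1) + 32 * (?N\<^sup>2 * S2)" for i j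
  proof -
    have "(pd (pd (\<lambda>x. f (p x)) i) j x)\<^sup>2 \<le> (A + 4 * B)\<^sup>2" using power_mono[OF 2[of i j], of 2] by simp
    also have "\<dots> \<le> 2 * A\<^sup>2 + 32 * B\<^sup>2"
    proof -
      have "0 \<le> (A - 4 * B)\<^sup>2" by simp
      then show ?thesis by (simp add: power2_eq_square algebra_simps)
    qed
    finally show ?thesis using A2 B2 by linarith
  qed
  have "W22_density (\<lambda>x. f (p x)) x \<le> (f (p x))\<^sup>2 + (\<Sum>i\<in>(UNIV::'n set). 4 * (?N * S1))
      + (\<Sum>i\<in>(UNIV::'n set). \<Sum>j\<in>(UNIV::'n set). 2 * (?N * S1) + 32 * (?N\<^sup>2 * S2))"
    unfolding W22_density_def by (intro add_mono sum_mono q1 q2 order_refl)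
  also have "\<dots> = (f (p x))\<^sup>2 + (4 * ?N ^ 2 + 2 * ?N ^ 3) * S1 + 32 * ?N ^ 4 * S2"
    by (simp add: algebra_simps power2_eq_square power3_eq_cube power4_eq_xxxx)
  also have "\<dots> \<le> (40 * ?N ^ 4) * (f (p x))\<^sup>2 + (40 * ?N ^ 4) * S1 + (40 * ?N ^ 4) * S2"
  proof -
    have p: "1 \<le> ?N ^ 4" "?N ^ 2 \<le> ?N ^ 4" "?N ^ 3 \<le> ?N ^ 4" using N by (auto intro: power_increasing)
    then have q: "1 \<le> 40 * ?N ^ 4" "4 * ?N ^ 2 + 2 * ?N ^ 3 \<le> 40 * ?N ^ 4" "32 * ?N ^ 4 \<le> 40 * ?N ^ 4" by linarith+
    have "1 * (f (p x))\<^sup>2 \<le> (40 * ?N ^ 4) * (f (p x))\<^sup>2" using q(1) by (rule mult_right_mono) simp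
    moreover have "(4 * ?N ^ 2 + 2 * ?N ^ 3) * S1 \<le> (40 * ?N ^ 4) * S1" using q(2) S0(1) by (rule mult_right_mono)
    moreover have "32 * ?N ^ 4 * S2 \<le> (40 * ?N ^ 4) * S2" using q(3) S0(2) by (rule mult_right_mono)
    ultimately show ?thesis by linarith
  qed
  also have "\<dots> = 40 * ?N ^ 4 * W22_density f (p x)"
    unfolding W22_density_def S1_def[symmetric] S2_def[symmetric] by (simp add: distrib_left)
  finally show ?thesis .
qed

context C2_domain
begin

text \<open>\<open>sobolev_holder_const\<close> speaks about functions that are \<open>C\<^sup>2\<close> across the boundary; the inequality is
  transported to functions of the open set by composing with the maps of \<open>inward_map\<close>.\<close>

lemma sobolev_holder_interior:
  assumes c: "sobolev_holder_const \<Omega> \<gamma> c" and w: "C2_on \<Omega> w" "continuous_on (closure \<Omega>) w"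
    and E: "E \<ge> 0" "(\<integral>\<^sup>+ x\<in>\<Omega>. ennreal (W22_density w x) \<partial>lborel) \<le> ennreal E" and c0: "c \<ge> 0"
    and xy: "x \<in> closure \<Omega>" "y \<in> closure \<Omega>"
  shows "\<bar>w x - w y\<bar> \<le> c * sqrt (4 ^ CARD('n) * (40 * real CARD('n) ^ 4) * E) * dist x y powr \<gamma>"
proof (rule field_le_epsilon)
  fix d :: real assume d: "d > 0"
  let ?N = "real CARD('n)"
  have ev: "\<exists>e>0. \<forall>x'\<in>closure \<Omega>. dist x' x < e \<longrightarrow> \<bar>w x' - w x\<bar> < d / 2" if x: "x \<in> closure \<Omega>" for x
    using bspec[OF iffD1[OF continuous_on_iff w(2)] x, rule_format, of "d / 2"] d by (simp add: dist_real_def)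
  obtain e1 where e1: "e1 > 0" "\<forall>x'\<in>closure \<Omega>. dist x' x < e1 \<longrightarrow> \<bar>w x' - w x\<bar> < d / 2" using ev[OF xy(1)] by blast
  obtain e2 where e2: "e2 > 0" "\<forall>x'\<in>closure \<Omega>. dist x' y < e2 \<longrightarrow> \<bar>w x' - w y\<bar> < d / 2" using ev[OF xy(2)] by blast
  have m: "min e1 e2 > 0" using e1 e2 by simp
  obtain \<Phi> :: "real^'n \<Rightarrow> real^'n" where P: "\<And>k. C2_on UNIV (\<lambda>x. \<Phi> x $ k)" "\<And>x. x \<in> closure \<Omega> \<Longrightarrow> \<Phi> x \<in> \<Omega>"
    "\<And>x y. x \<in> closure \<Omega> \<Longrightarrow> y \<in> closure \<Omega> \<Longrightarrow> dist x y \<le> 2 * dist (\<Phi> x) (\<Phi> y)"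
    "\<And>x k i. x \<in> closure \<Omega> \<Longrightarrow> \<bar>pd (\<lambda>x. \<Phi> x $ k) i x\<bar> \<le> 2"
    "\<And>x k i j. x \<in> closure \<Omega> \<Longrightarrow> \<bar>pd (pd (\<lambda>x. \<Phi> x $ k) i) j x\<bar> \<le> 1"
    "\<And>x. x \<in> closure \<Omega> \<Longrightarrow> dist (\<Phi> x) x < min e1 e2"
    by (rule inward_map[OF m]) blast
  have Pc: "continuous_on UNIV \<Phi>"
  proof -
    have "continuous_on UNIV (\<lambda>x. \<chi> k. \<Phi> x $ k)"
      by (intro continuous_on_vec_lambda C1_on_continuous[OF C2_on_C1(1)[OF open_UNIV P(1)] open_UNIV])
    then show ?thesis by simp
  qed
  define W where "W = \<Phi> -` \<Omega>"
  have W: "open W" unfolding W_def using open_dom Pc by (rule open_vimage)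
  have cW: "closure \<Omega> \<subseteq> W" using P(2) by (auto simp: W_def)
  have PW: "C2_on W (\<lambda>x. \<Phi> x $ k)" for k by (rule C2_on_subset[OF P(1)]) simp
  have im: "\<Phi> ` W \<subseteq> \<Omega>" by (auto simp: W_def)
  \<comment> \<open>The inequality is applied to the composition at the original \<open>x\<close>
    and \<open>y\<close>, so \<open>dist x y\<close> enters undistorted and only the two values
    change, by less than \<open>d / 2\<close> each.\<close>
  let ?v = "\<lambda>x. w (\<Phi> x)"
  have v: "C2_on W ?v" by (rule C2_on_compose(1)[OF open_dom W w(1) PW im])
  have inS: "x \<in> closure \<Omega>" if "x \<in> \<Omega>" for x using that closure_subset by blast
  have cD: "continuous_on \<Omega> (W22_density w)"
    unfolding W22_density_def[abs_def] using C2_on_C1[OF open_dom w(1)]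
    by (intro continuous_intros C1_on_continuous[OF _ open_dom] C1_on_pd_continuous)
  have "(\<integral>\<^sup>+ x\<in>\<Omega>. ennreal (W22_density ?v x) \<partial>lborel) \<le> (\<integral>\<^sup>+ x\<in>\<Omega>. ennreal (40 * ?N ^ 4 * W22_density w (\<Phi> x)) \<partial>lborel)"
  proof (rule nn_integral_mono)
    fix x
    have "W22_density ?v x \<le> 40 * ?N ^ 4 * W22_density w (\<Phi> x)" if "x \<in> \<Omega>"
    proof (rule W22_density_compose[OF open_dom W w(1) PW im])
      show "x \<in> W" using cW inS[OF that] by blast
    qed (rule P(4,5)[OF inS[OF that]])+
    then show "ennreal (W22_density ?v x) * indicator \<Omega> x \<le> ennreal (40 * ?N ^ 4 * W22_density w (\<Phi> x)) * indicator \<Omega> x"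
      by (cases "x \<in> \<Omega>") (simp_all add: ennreal_leI)
  qed
  also have "\<dots> \<le> ennreal (4 ^ CARD('n)) * (\<integral>\<^sup>+ x\<in>\<Omega>. ennreal (40 * ?N ^ 4 * W22_density w x) \<partial>lborel)"
    by (rule nn_integral_expansive[OF open_dom Pc]) (intro continuous_intros cD, rule P(3), (erule inS)+, rule P(2), erule inS)
  also have "(\<integral>\<^sup>+ x\<in>\<Omega>. ennreal (40 * ?N ^ 4 * W22_density w x) \<partial>lborel)
      = (\<integral>\<^sup>+ x. ennreal (40 * ?N ^ 4) * (ennreal (W22_density w x) * indicator \<Omega> x) \<partial>lborel)"
    by (intro nn_integral_cong) (simp add: ennreal_mult W22_density_nonneg mult.assoc)
  also have "\<dots> = ennreal (40 * ?N ^ 4) * (\<integral>\<^sup>+ x\<in>\<Omega>. ennreal (W22_density w x) \<partial>lborel)"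
    using measurable_on_open[OF open_dom cD] by (intro nn_integral_cmult) simp
  also have "ennreal (4 ^ CARD('n)) * (ennreal (40 * ?N ^ 4) * (\<integral>\<^sup>+ x\<in>\<Omega>. ennreal (W22_density w x) \<partial>lborel))
      \<le> ennreal (4 ^ CARD('n)) * (ennreal (40 * ?N ^ 4) * ennreal E)"
    by (intro mult_left_mono E(2)) auto
  also have "\<dots> = ennreal (4 ^ CARD('n) * (40 * ?N ^ 4) * E)" using E(1) by (simp add: ennreal_mult[symmetric] mult.assoc)
  finally have "enn2real (\<integral>\<^sup>+ x\<in>\<Omega>. ennreal (W22_density ?v x) \<partial>lborel) \<le> 4 ^ CARD('n) * (40 * ?N ^ 4) * E"
    using E(1) by (intro enn2real_leI) auto
  then have "W22_norm \<Omega> ?v \<le> sqrt (4 ^ CARD('n) * (40 * ?N ^ 4) * E)"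
    unfolding W22_norm_density by (rule real_sqrt_le_mono)
  then have "c * W22_norm \<Omega> ?v * dist x y powr \<gamma> \<le> c * sqrt (4 ^ CARD('n) * (40 * ?N ^ 4) * E) * dist x y powr \<gamma>"
    using c0 by (intro mult_right_mono mult_left_mono) auto
  moreover have "\<bar>?v x - ?v y\<bar> \<le> c * W22_norm \<Omega> ?v * dist x y powr \<gamma>"
    using c W cW v xy unfolding sobolev_holder_const_def by blast
  moreover have "\<bar>?v x - w x\<bar> < d / 2" "\<bar>?v y - w y\<bar> < d / 2"
    using bspec[OF e1(2) inS[OF P(2)[OF xy(1)]]] bspec[OF e2(2) inS[OF P(2)[OF xy(2)]]] P(6)[OF xy(1)] P(6)[OF xy(2)] by auto
  ultimately show "\<bar>w x - w y\<bar> \<le> c * sqrt (4 ^ CARD('n) * (40 * ?N ^ 4) * E) * dist x y powr \<gamma> + d" by linarith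
qed

text \<open>A negative \<open>c\<close> would force the coordinate functions to be constant.\<close>

lemma sobolev_holder_const_nonneg:
  assumes c: "sobolev_holder_const \<Omega> \<gamma> c"
  shows "c \<ge> 0"
proof (rule ccontr)
  assume n: "\<not> c \<ge> 0"
  obtain z where z: "z \<in> \<Omega>" using nonempty_dom by blast
  obtain d where d: "d > 0" "ball z d \<subseteq> \<Omega>" using open_dom z open_contains_ball by blast
  define k :: 'n where "k = undefined"
  let ?v = "\<lambda>x::real^'n. x $ k"
  let ?y = "z + (d / 2) *\<^sub>R axis k 1"
  have "?y \<in> ball z d" using d by (simp add: dist_norm)
  then have "\<bar>?v ?y - ?v z\<bar> \<le> c * W22_norm \<Omega> ?v * dist ?y z powr \<gamma>"
    using c C2_on_coord[OF open_UNIV, of k] z d closure_subset unfolding sobolev_holder_const_def by blast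
  moreover have "c * W22_norm \<Omega> ?v * dist ?y z powr \<gamma> \<le> 0"
    using n by (intro mult_nonpos_nonneg) (auto simp: W22_norm_def)
  ultimately show False using d by (simp add: axis_def)
qed

end

subsection \<open>The estimate in dimensions two and three\<close>

context torsion
begin

text \<open>The density splits into \<open>(h - h z)\<^sup>2\<close>, the squared gradient and
  \<open>defect\<close>, with integrals at most \<open>?kD / ?\<mu>\<^sup>2\<close>,
  \<open>?kD / ?\<mu>\<close> and \<open>?kD\<close>. This is the origin of the factor
  \<open>(1 + \<mu>) / \<mu>\<close>.\<close>

lemma W22_energy:
  fixes z :: "real^'n"
  assumes N: "CARD('n) \<ge> 2" and H: "\<And>p. p \<in> \<Gamma> \<Longrightarrow> mean_curv \<Omega> p > 0"
    and z: "z \<in> \<Omega>" "\<And>i. pd u i z = 0" and mu: "mu0 \<Omega> z > 0"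
  defines "h \<equiv> \<lambda>x. (norm (x - z))\<^sup>2 / 2 - u x"
  shows "(\<integral>\<^sup>+ x\<in>\<Omega>. ennreal (W22_density (\<lambda>x. h x + - h z) x) \<partial>lborel)
    \<le> ennreal (defect_const TYPE('n) * total_deficit * ((1 + mu0 \<Omega> z) / mu0 \<Omega> z)\<^sup>2)"
proof -
  let ?\<mu> = "mu0 \<Omega> z"
  let ?kD = "defect_const TYPE('n) * total_deficit"
  note hp = harmonic_part[where z=z, folded h_def]
  note C1 = C2_on_C1[OF open_dom hp(1)]
  have D0: "total_deficit \<ge> 0" by (rule L1_bdry_nonneg)
  have k: "defect_const TYPE('n) > 0" by (rule defect_const_pos[OF N])
  obtain a0 a1 where a: "a0 \<ge> 0" "a1 \<ge> 0"
    "(\<integral>\<^sup>+ x\<in>\<Omega>. ennreal ((h x - h z)\<^sup>2) \<partial>lebesgue) = ennreal a0"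
    "dirichlet \<Omega> h = ennreal a1"
    "?\<mu> * a0 \<le> a1" "?\<mu> * a1 \<le> ?kD"
    unfolding h_def by (rule energy_chain[OF N H z]) blast+
  note va = C2_on_shift[OF open_dom hp(1), where c="- h z"]
  have dens: "W22_density (\<lambda>x. h x + - h z) x = (h x - h z)\<^sup>2 + (norm (grad h x))\<^sup>2 + defect x" if x: "x \<in> \<Omega>" for x
  proof -
    have "defect x = (\<Sum>i\<in>UNIV. \<Sum>j\<in>UNIV. (pd (pd h i) j x)\<^sup>2)"
      unfolding defect_eq[OF x, of z] h_def ..
    then show ?thesis unfolding W22_density_def va(2)[OF x] va(3)[OF x] norm_grad_power2 by simp
  qed
  have m: "(\<lambda>x. ennreal (f x) * indicator \<Omega> x) \<in> borel_measurable lborel" if "continuous_on \<Omega> f" for f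
    using measurable_on_open[OF open_dom that] by simp
  have ch: "continuous_on \<Omega> (\<lambda>x. (h x - h z)\<^sup>2)" by (intro continuous_intros C1_on_continuous[OF C1(1) open_dom])
  have cg: "continuous_on \<Omega> (\<lambda>x. (norm (grad h x))\<^sup>2)" by (intro continuous_intros C1_on_grad_continuous[OF C1(1)])
  have "(\<integral>\<^sup>+ x\<in>\<Omega>. ennreal (W22_density (\<lambda>x. h x + - h z) x) \<partial>lborel)
     = (\<integral>\<^sup>+ x. (ennreal ((h x - h z)\<^sup>2) * indicator \<Omega> x + ennreal ((norm (grad h x))\<^sup>2) * indicator \<Omega> x)
         + ennreal (defect x) * indicator \<Omega> x \<partial>lborel)"
  proof (rule nn_integral_cong)
    fix x
    have "ennreal (W22_density (\<lambda>x. h x + - h z) x) = ennreal ((h x - h z)\<^sup>2) + ennreal ((norm (grad h x))\<^sup>2) + ennreal (defect x)"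
      if x: "x \<in> \<Omega>"
      unfolding dens[OF x] using defect_nonneg[OF x] by (simp only: ennreal_plus zero_le_power2 add_nonneg_nonneg)
    then show "ennreal (W22_density (\<lambda>x. h x + - h z) x) * indicator \<Omega> x
      = (ennreal ((h x - h z)\<^sup>2) * indicator \<Omega> x + ennreal ((norm (grad h x))\<^sup>2) * indicator \<Omega> x) + ennreal (defect x) * indicator \<Omega> x"
      by (cases "x \<in> \<Omega>") simp_all
  qed
  also have "\<dots> = ((\<integral>\<^sup>+ x\<in>\<Omega>. ennreal ((h x - h z)\<^sup>2) \<partial>lborel) + (\<integral>\<^sup>+ x\<in>\<Omega>. ennreal ((norm (grad h x))\<^sup>2) \<partial>lborel))
      + (\<integral>\<^sup>+ x\<in>\<Omega>. ennreal (defect x) \<partial>lborel)"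
    by (simp only: nn_integral_add[OF borel_measurable_add[OF m[OF ch] m[OF cg]] m[OF continuous_defect]]
        nn_integral_add[OF m[OF ch] m[OF cg]])
  also have "\<dots> \<le> (ennreal a0 + ennreal a1) + ennreal ?kD"
    using defect_bound[OF N H] unfolding nn_integral_lebesgue_lborel a(3,4)[unfolded nn_integral_lebesgue_lborel]
    by (rule add_left_mono)
  also have "\<dots> = ennreal (a0 + a1 + ?kD)" using a(1,2) D0 k by (simp add: ennreal_plus)
  also have "\<dots> \<le> ennreal (?kD * ((1 + ?\<mu>) / ?\<mu>)\<^sup>2)"
  proof (rule ennreal_leI)
    have 1: "a1 \<le> ?kD / ?\<mu>" using a(6) mu by (simp add: pos_le_divide_eq mult.commute)
    have "a0 \<le> a1 / ?\<mu>" using a(5) mu by (simp add: pos_le_divide_eq mult.commute)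
    also have "\<dots> \<le> ?kD / ?\<mu> / ?\<mu>" using 1 mu by (intro divide_right_mono) auto
    finally have 2: "a0 \<le> ?kD / ?\<mu> / ?\<mu>" .
    have "x * ((1 + m) / m)\<^sup>2 = x / m / m + 2 * (x / m) + x" if "m > 0" for x m :: real
      using that by (simp add: power2_eq_square field_simps)
    from this[OF mu, of ?kD] have "?kD * ((1 + ?\<mu>) / ?\<mu>)\<^sup>2 = ?kD / ?\<mu> / ?\<mu> + 2 * (?kD / ?\<mu>) + ?kD" .
    moreover have "?kD / ?\<mu> \<ge> 0" using D0 k mu by simp
    ultimately show "a0 + a1 + ?kD \<le> ?kD * ((1 + ?\<mu>) / ?\<mu>)\<^sup>2" using 1 2 by linarith
  qed
  finally show ?thesis .
qed

text \<open>On the boundary \<open>h\<close> is half the squared distance to \<open>z\<close>, so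
  its oscillation bounds the difference of the squared radii and hence
  \<open>(re - ri) * re\<close>; this accounts for one factor 2 of the leading 4.\<close>

lemma small_dim_bound:
  fixes z :: "real^'n"
  assumes N: "CARD('n) \<ge> 2" and H: "\<And>p. p \<in> \<Gamma> \<Longrightarrow> mean_curv \<Omega> p > 0"
    and r: "interior_sphere \<Omega> r" and z: "z \<in> \<Omega>" "\<And>i. pd u i z = 0" and mu: "mu0 \<Omega> z > 0"
    and c: "sobolev_holder_const \<Omega> \<gamma> c" and g: "\<gamma> > 0"
  shows "rho_e \<Omega> z - rho_i \<Omega> z
     \<le> (4 * unit_ball_vol (real CARD('n)) powr (1 / real CARD('n)) * sqrt (4 ^ CARD('n) * (40 * real CARD('n) ^ 4) * defect_const TYPE('n)))
       * c * diameter \<Omega> powr \<gamma> / measure lebesgue \<Omega> powr (1 / real CARD('n)) * ((1 + mu0 \<Omega> z) / mu0 \<Omega> z)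
       * sqrt (gmax / r) * total_deficit powr (1 / 2)"
proof -
  let ?\<mu> = "mu0 \<Omega> z"
  let ?D = "total_deficit"
  let ?C = "4 ^ CARD('n) * (40 * real CARD('n) ^ 4)"
  let ?E = "defect_const TYPE('n) * ?D * ((1 + ?\<mu>) / ?\<mu>)\<^sup>2"
  define h where "h = (\<lambda>x. (norm (x - z))\<^sup>2 / 2 - u x)"
  note hp = harmonic_part[where z=z, folded h_def]
  have D0: "?D \<ge> 0" by (rule L1_bdry_nonneg)
  have k: "defect_const TYPE('n) > 0" by (rule defect_const_pos[OF N])
  have E0: "?E \<ge> 0" using D0 k by simp
  note rr = interior_sphere_radius_le[OF r]
  have c0: "c \<ge> 0" by (rule sobolev_holder_const_nonneg[OF c])
  obtain xe xi where x: "xe \<in> \<Gamma>" "dist xe z = rho_e \<Omega> z" "xi \<in> \<Gamma>" "dist xi z = rho_i \<Omega> z"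
    and min: "\<And>x. x \<in> \<Gamma> \<Longrightarrow> rho_i \<Omega> z \<le> dist x z"
    by (rule rho_attained[of z]) blast
  have xc: "xe \<in> closure \<Omega>" "xi \<in> closure \<Omega>" using x clos_eq by blast+
  define re where "re = rho_e \<Omega> z"
  define ri where "ri = rho_i \<Omega> z"
  have ri0: "ri \<ge> 0" using x(4) by (metis ri_def zero_le_dist)
  have rei: "ri \<le> re" using min[OF x(1)] x(2) by (simp add: re_def ri_def)
  have hc: "continuous_on (closure \<Omega>) (\<lambda>x. h x + - h z)" unfolding h_def by (intro continuous_intros cont_u) auto
  let ?Y = "c * sqrt (?C * ?E) * dist xe xi powr \<gamma>"
  have "\<bar>(h xe + - h z) - (h xi + - h z)\<bar> \<le> ?Y"
    by (rule sobolev_holder_interior[OF c C2_on_shift(1)[OF open_dom hp(1)] hc E0 _ c0 xc])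
      (use W22_energy[OF N H z mu] in \<open>simp only: h_def\<close>)
  moreover have "h xe = re\<^sup>2 / 2" "h xi = ri\<^sup>2 / 2" using x u_bdry by (simp_all add: h_def re_def ri_def dist_norm)
  ultimately have "re\<^sup>2 - ri\<^sup>2 \<le> 2 * ?Y" by linarith
  moreover have "(re - ri) * re \<le> re\<^sup>2 - ri\<^sup>2"
    using mult_right_mono[OF rei ri0] by (simp add: power2_eq_square algebra_simps)
  moreover have "?Y \<le> c * sqrt (?C * ?E) * diameter \<Omega> powr \<gamma>"
  proof (intro mult_left_mono powr_mono2)
    show "dist xe xi \<le> diameter \<Omega>"
      using diameter_bounded_bound[OF compact_imp_bounded[OF compact_clos] xc] diameter_closure[OF bounded_dom] by simp
  qed (use g c0 E0 in auto)
  ultimately have 1: "(re - ri) * re \<le> 2 * (c * sqrt (?C * ?E) * diameter \<Omega> powr \<gamma>)" by linarith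
  have sq: "sqrt (?C * ?E) = sqrt (?C * defect_const TYPE('n)) * ?D powr (1 / 2) * ((1 + ?\<mu>) / ?\<mu>)"
  proof -
    have "?C * ?E = (?C * defect_const TYPE('n)) * ?D * ((1 + ?\<mu>) / ?\<mu>)\<^sup>2" by (simp only: mult.assoc)
    then have "sqrt (?C * ?E) = sqrt (?C * defect_const TYPE('n)) * sqrt ?D * \<bar>(1 + ?\<mu>) / ?\<mu>\<bar>"
      by (simp only: real_sqrt_mult real_sqrt_abs)
    then show ?thesis using mu D0 by (simp add: powr_half_sqrt)
  qed
  define Z where "Z = c * sqrt (?C * defect_const TYPE('n)) * ?D powr (1 / 2) * ((1 + ?\<mu>) / ?\<mu>) * diameter \<Omega> powr \<gamma>"
  define K where "K = unit_ball_vol (real CARD('n)) powr (1 / real CARD('n))"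
  define V where "V = measure lebesgue \<Omega> powr (1 / real CARD('n))"
  have V: "V > 0" "V \<le> K * re" unfolding V_def K_def re_def using volume_le(2) by (simp, intro volume_le(1))
  have Z0: "Z \<ge> 0" using c0 k mu by (auto simp: Z_def)
  have K0: "K \<ge> 0" by (simp add: K_def)
  have rZ: "(re - ri) * re \<le> 2 * Z" using 1 unfolding sq Z_def by (simp add: mult_ac)
  \<comment> \<open>The estimate so far has no factor \<open>sqrt (gmax / r)\<close>;
    \<open>r \<le> 4 * gmax\<close> lets it be inserted at the cost of the other factor 2.\<close>
  have half: "1 / 2 \<le> sqrt (gmax / r)"
  proof (rule real_le_rsqrt)
    show "(1 / 2)\<^sup>2 \<le> gmax / r" using rr(1,2) by (simp add: power2_eq_square pos_le_divide_eq)
  qed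
  have "(re - ri) * V \<le> (re - ri) * (K * re)" using V rei by (intro mult_left_mono) auto
  also have "\<dots> = K * ((re - ri) * re)" by simp
  also have "\<dots> \<le> K * (2 * Z)" using rZ K0 by (rule mult_left_mono)
  also have "\<dots> = 4 * K * Z * (1 / 2)" by simp
  also have "\<dots> \<le> 4 * K * Z * sqrt (gmax / r)" using half Z0 K0 by (intro mult_left_mono) auto
  finally have "re - ri \<le> 4 * K * Z * sqrt (gmax / r) / V" using V by (simp add: pos_le_divide_eq)
  then show ?thesis unfolding re_def ri_def Z_def K_def V_def by (simp add: mult_ac)
qed

end

section \<open>Choice of the constants and conclusion\<close>

theorem theorem4p8:
  assumes N2: "CARD('n::finite) \<ge> 2"
  shows "\<exists>k a. k > 0 \<and> a > 0 \<and>
   (\<forall>(\<Omega> :: (real^'n) set) \<alpha> (u :: real^'n \<Rightarrow> real) (G :: real^'n \<Rightarrow> real^'n) r.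
      open \<Omega> \<and> connected \<Omega> \<and> bounded \<Omega> \<and> \<Omega> \<noteq> {} \<and> connected (frontier \<Omega>)
      \<and> 0 < \<alpha> \<and> \<alpha> < 1 \<and> C2alpha_boundary \<alpha> \<Omega>
      \<and> (\<forall>p\<in>frontier \<Omega>. mean_curv \<Omega> p > 0)
      \<and> continuous_on (closure \<Omega>) u \<and> C2_on \<Omega> u
      \<and> (\<forall>x\<in>\<Omega>. lap u x = real CARD('n)) \<and> (\<forall>x\<in>frontier \<Omega>. u x = 0)
      \<and> continuous_on (closure \<Omega>) G \<and> (\<forall>x\<in>\<Omega>. G x = grad u x)
      \<and> interior_sphere \<Omega> r
      \<longrightarrow>
      (let N = real CARD('n);
           M = (SUP x\<in>closure \<Omega>. norm (G x));
           D = L1_bdry \<Omega> (\<lambda>p. G p \<bullet> outer_normal \<Omega> p - 1 / mean_curv \<Omega> p);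
           V = measure lebesgue \<Omega>
       in \<exists>z\<in>\<Omega>. let \<mu> = mu0 \<Omega> z in
         ((CARD('n) = 2 \<or> CARD('n) = 3) \<longrightarrow>
            (\<forall>\<gamma> c. ((CARD('n) = 2 \<and> 0 < \<gamma> \<and> \<gamma> < 1) \<or> (CARD('n) = 3 \<and> \<gamma> = 1/2))
                 \<and> sobolev_holder_const \<Omega> \<gamma> c \<longrightarrow>
               rho_e \<Omega> z - rho_i \<Omega> z
                 \<le> k * c * diameter \<Omega> powr \<gamma> / V powr (1/N) * ((1 + \<mu>) / \<mu>)
                     * sqrt (M / r) * D powr (1/2)))
         \<and> (CARD('n) \<ge> 4 \<longrightarrow>
            D < a * \<mu>\<^sup>2 * M * r powr (N + 3) \<longrightarrow>
            rho_e \<Omega> z - rho_i \<Omega> z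
              \<le> k * M powr ((N + 1) / (N + 2)) / (\<mu> powr (2 / (N + 2)) * V powr (1/N) * r powr (1 / (N + 2)))
                  * D powr (1 / (N + 2)))))"
proof -
  let ?k0 = "defect_const TYPE('n)"
  let ?\<kappa> = "unit_ball_vol (real CARD('n)) powr (1 / real CARD('n))"
  let ?k1 = "4 * ?\<kappa> * sqrt (4 ^ CARD('n) * (40 * real CARD('n) ^ 4) * ?k0)"
  let ?k2 = "rate_const ?k0 (bump_mass TYPE('n)) ?\<kappa> CARD('n)"
  \<comment> \<open>In a fixed dimension only one of the two claims has content, so each may use its
    own constant.\<close>
  define k where "k = (if CARD('n) \<ge> 4 then ?k2 else ?k1)"
  define a where "a = smallness_const ?k0 CARD('n)"
  have k0: "?k0 > 0" using tube_const_pos[OF N2] N2 by (simp add: defect_const_def)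
  have kap: "?\<kappa> > 0"
  proof -
    have "unit_ball_vol (real CARD('n)) > 0" by (rule unit_ball_vol_pos) simp
    then show ?thesis by (metis powr_gt_zero less_irrefl)
  qed
  have "?k1 > 0" using k0 kap by simp
  moreover have "?k2 > 0" unfolding rate_const_def using k0 kap bump_mass_pos[where 'n='n]
    by (intro mult_pos_pos add_pos_nonneg) auto
  ultimately have kp: "k > 0" by (simp add: k_def)
  have ap: "a > 0" using k0 by (simp add: a_def smallness_const_def)
  show ?thesis
  proof (rule exI[of _ k], rule exI[of _ a], intro conjI kp ap allI impI)
    fix \<Omega> :: "(real^'n) set" and \<alpha> :: real and u :: "real^'n \<Rightarrow> real" and G :: "real^'n \<Rightarrow> real^'n" and r :: real
    assume hyp: "open \<Omega> \<and> connected \<Omega> \<and> bounded \<Omega> \<and> \<Omega> \<noteq> {} \<and> connected (frontier \<Omega>)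
      \<and> 0 < \<alpha> \<and> \<alpha> < 1 \<and> C2alpha_boundary \<alpha> \<Omega>
      \<and> (\<forall>p\<in>frontier \<Omega>. mean_curv \<Omega> p > 0)
      \<and> continuous_on (closure \<Omega>) u \<and> C2_on \<Omega> u
      \<and> (\<forall>x\<in>\<Omega>. lap u x = real CARD('n)) \<and> (\<forall>x\<in>frontier \<Omega>. u x = 0)
      \<and> continuous_on (closure \<Omega>) G \<and> (\<forall>x\<in>\<Omega>. G x = grad u x)
      \<and> interior_sphere \<Omega> r"
    interpret torsion \<Omega> u G
    proof
      fix p assume p: "p \<in> frontier \<Omega>"
      have "C2alpha_boundary \<alpha> \<Omega>" using hyp by simp
      from this[unfolded C2alpha_boundary_def, rule_format, OF p]
      show "\<exists>r>0. \<exists>\<psi>. C2_on (ball p r) \<psi> \<and> (\<forall>x\<in>ball p r. grad \<psi> x \<noteq> 0) \<and> \<Omega> \<inter> ball p r = {x\<in>ball p r. \<psi> x < 0}"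
        by blast
    qed (use hyp in simp_all)
    have conn: "connected \<Omega>" and H: "\<And>p. p \<in> frontier \<Omega> \<Longrightarrow> mean_curv \<Omega> p > 0" and r: "interior_sphere \<Omega> r"
      using hyp by simp_all
    obtain z where z: "z \<in> \<Omega>" "\<And>i. pd u i z = 0" by (rule critical_point) blast
    note small = small_dim_bound[OF N2 H r z mu0_pos[OF conn z(1)], unfolded gmax_def]
    note large = large_dim_bound[OF N2 H r z, unfolded gmax_def]
    show "let N = real CARD('n);
           M = (SUP x\<in>closure \<Omega>. norm (G x));
           D = L1_bdry \<Omega> (\<lambda>p. G p \<bullet> outer_normal \<Omega> p - 1 / mean_curv \<Omega> p);
           V = measure lebesgue \<Omega>
       in \<exists>z\<in>\<Omega>. let \<mu> = mu0 \<Omega> z in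
         ((CARD('n) = 2 \<or> CARD('n) = 3) \<longrightarrow>
            (\<forall>\<gamma> c. ((CARD('n) = 2 \<and> 0 < \<gamma> \<and> \<gamma> < 1) \<or> (CARD('n) = 3 \<and> \<gamma> = 1/2))
                 \<and> sobolev_holder_const \<Omega> \<gamma> c \<longrightarrow>
               rho_e \<Omega> z - rho_i \<Omega> z
                 \<le> k * c * diameter \<Omega> powr \<gamma> / V powr (1/N) * ((1 + \<mu>) / \<mu>)
                     * sqrt (M / r) * D powr (1/2)))
         \<and> (CARD('n) \<ge> 4 \<longrightarrow>
            D < a * \<mu>\<^sup>2 * M * r powr (N + 3) \<longrightarrow>
            rho_e \<Omega> z - rho_i \<Omega> z
              \<le> k * M powr ((N + 1) / (N + 2)) / (\<mu> powr (2 / (N + 2)) * V powr (1/N) * r powr (1 / (N + 2)))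
                  * D powr (1 / (N + 2)))"
      unfolding Let_def
    proof (intro bexI[OF _ z(1)] conjI impI allI, goal_cases)
      case (1 \<gamma> c)
      then have "\<gamma> > 0" by auto
      moreover have "k = ?k1" using 1(1) by (auto simp: k_def)
      ultimately show ?case using small[of \<gamma> c] 1(2) by simp
    next
      case 2
      then have "k = ?k2" by (simp add: k_def)
      then show ?case using large 2(2) by (simp add: a_def)
    qed
  qed
qed

end
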